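(* Let $p$ be a prime number and let $\mathbb{F}$ be a finite field of characteristic $p$. For every integer $n \geq 5$, there exist a global function field $k$ over $\mathbb{F}$ and an unramified geometric Galois extension $K/k$ such that $\mathrm{Gal}(K/k) \cong \mathfrak{S}_n$, the symmetric group of degree $n$.
   Context: A global function field over $\mathbb{F}$ is a function field of one variable over the finite field $\mathbb{F}$ (with constant field $\mathbb{F}$). An extension $K/k$ of global function fields is geometric if the constant field of $K$ equals that of $k$ (i.e. no constant field extension occurs). "Unramified" means unramified at every place of $k$. *)

theory Defs
  imports "HOL-Algebra.Algebra"
begin

text \<open>All fields below live inside one ambient field R (the big field K = carrier R).
  Subfields are given as subsets of carrier R.\<close>

definition has_characteristic :: "('a, 'b) ring_scheme \<Rightarrow> nat \<Rightarrow> bool" where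
  "has_characteristic F p \<longleftrightarrow> 0 < p \<and> add_pow F p \<one>\<^bsub>F\<^esub> = \<zero>\<^bsub>F\<^esub>
     \<and> (\<forall>m. 0 < m \<and> m < p \<longrightarrow> add_pow F m \<one>\<^bsub>F\<^esub> \<noteq> \<zero>\<^bsub>F\<^esub>)"

definition constant_field_is :: "('a, 'b) ring_scheme \<Rightarrow> 'a set \<Rightarrow> 'a set \<Rightarrow> bool" where
  "constant_field_is R F0 E \<longleftrightarrow> (\<forall>x\<in>E. \<not> ring.transcendental R F0 x \<longrightarrow> x \<in> F0)"

definition function_field :: "('a, 'b) ring_scheme \<Rightarrow> 'a set \<Rightarrow> 'a set \<Rightarrow> bool" where
  "function_field R F0 E \<longleftrightarrow> subfield E R \<and> subfield F0 R \<and> F0 \<subseteq> E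
     \<and> (\<exists>t\<in>E. ring.transcendental R F0 t
            \<and> ring.finite_dimension R (generate_field R (insert t F0)) E)
     \<and> constant_field_is R F0 E"

definition valuation_ring :: "('a, 'b) ring_scheme \<Rightarrow> 'a set \<Rightarrow> 'a set \<Rightarrow> 'a set \<Rightarrow> bool" where
  "valuation_ring R F0 E V \<longleftrightarrow> subring V R \<and> F0 \<subset> V \<and> V \<subset> E
     \<and> (\<forall>x\<in>E. x \<noteq> \<zero>\<^bsub>R\<^esub> \<longrightarrow> x \<in> V \<or> inv\<^bsub>R\<^esub> x \<in> V)"

definition place_of :: "('a, 'b) ring_scheme \<Rightarrow> 'a set \<Rightarrow> 'a set" where
  "place_of R V = {x \<in> V. x = \<zero>\<^bsub>R\<^esub> \<or> inv\<^bsub>R\<^esub> x \<notin> V}"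

text \<open>Place Q' (with valuation ring V') of the big field lies over the place of V and is
  unramified over it (ramification index 1): some uniformizer of P generates Q.\<close>
definition unramified_at :: "('a, 'b) ring_scheme \<Rightarrow> 'a set \<Rightarrow> 'a set \<Rightarrow> 'a set \<Rightarrow> 'a set \<Rightarrow> bool" where
  "unramified_at R F0 k K V \<longleftrightarrow>
     (\<forall>V'. valuation_ring R F0 K V' \<and> V' \<inter> k = V \<longrightarrow>
        (\<exists>\<pi>\<in>V. place_of R V = {\<pi> \<otimes>\<^bsub>R\<^esub> y | y. y \<in> V}
               \<and> place_of R V' = {\<pi> \<otimes>\<^bsub>R\<^esub> y | y. y \<in> V'}))"

definition unramified_ext :: "('a, 'b) ring_scheme \<Rightarrow> 'a set \<Rightarrow> 'a set \<Rightarrow> 'a set \<Rightarrow> bool" where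
  "unramified_ext R F0 k K \<longleftrightarrow> (\<forall>V. valuation_ring R F0 k V \<longrightarrow> unramified_at R F0 k K V)"

definition Gal :: "('a, 'b) ring_scheme \<Rightarrow> 'a set \<Rightarrow> ('a \<Rightarrow> 'a) monoid" where
  "Gal R k = \<lparr> carrier = {\<sigma>. \<sigma> \<in> ring_iso R R \<and> \<sigma> \<in> extensional (carrier R) \<and> (\<forall>x\<in>k. \<sigma> x = x)},
              Group.monoid.mult = (\<lambda>\<sigma> \<tau>. restrict (\<sigma> \<circ> \<tau>) (carrier R)),
              Group.monoid.one = restrict id (carrier R) \<rparr>"

definition galois_ext :: "('a, 'b) ring_scheme \<Rightarrow> 'a set \<Rightarrow> bool" where
  "galois_ext R k \<longleftrightarrow> field R \<and> subfield k R \<and> ring.finite_dimension R k (carrier R)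
     \<and> {x \<in> carrier R. \<forall>\<sigma>\<in>carrier (Gal R k). \<sigma> x = x} = k"

end

(* Fix a power m > n of p and put A(x) = x^m + x^2 (p odd), A(x) = x^m + x^3 + x^2 (p = 2). In
   characteristic p the only critical point of A is 0, so the roots of A = u are pairwise distinct
   modulo every place where u is a unit. With t transcendental over the finite field and
   s = (1 + t + t^m) / (1 + t + t^p + t^m), the elements t and s have no common zero or pole. Let
   L be the splitting field of (A(X) - t)(A(X) - s) over F(t).

   At a simple zero of t exactly two roots of A = t coincide modulo the place, which yields an
   inertia element acting as a transposition on the roots of A = t and trivially on the roots of
   A = s. At a simple pole of t the differences of the roots force the Galois group to be doubly
   transitive on them. The same holds for s. Hence Gal(L/F(t)) is the full product of two copies of
   the symmetric group of degree m; it is generated by inertia, which acts trivially on constants,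
   so L has no new constants.

   The diagonal copy of the symmetric group of degree n meets every inertia group trivially, as at
   each place one of t, s is a unit. The extension of L over its fixed field is the one sought. *)
theory Submission
  imports Defs
begin

subsection \<open>Discrete valuations\<close>

text \<open>One fact about inertia carries both halves of the argument: a finite group of
  automorphisms with trivial inertia at a discrete valuation fixes an element of value 1
  (\<open>invariant_uniformizer\<close>). Its contrapositive produces the transpositions, because
  over a simple zero of t the colliding roots have half the value of t; applied to the diagonal
  group it is the unramifiedness itself. No completions or residue fields are formed: congruence
  modulo a place is membership of a difference in the maximal ideal.

  The form of s has these reasons. Its numerator and denominator have derivative 1, so their zeros
  are simple. They differ by t^p, so a common zero could only be t = 0, where both are 1. At t =
  infinity both have a pole of order m, so s is a unit at both branch points of t. In A the cubic
  term is present for p = 2 because there x^2 has zero derivative.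

  All fields are realised inside one algebraically closed field carried by the natural numbers, as
  the statement fixes the type \<open>nat ring\<close>; a transcendental element has to be built
  there first.\<close>

lemma (in field) inv_nonzero [simp]:
  assumes "x \<in> carrier R" "x \<noteq> \<zero>"
  shows "inv x \<in> carrier R" "inv x \<noteq> \<zero>" "x \<otimes> inv x = \<one>" "inv x \<otimes> x = \<one>"
proof -
  have u: "x \<in> Units R" using assms field_Units by auto
  show "inv x \<in> carrier R" "x \<otimes> inv x = \<one>" "inv x \<otimes> x = \<one>" using u by auto
  then show "inv x \<noteq> \<zero>" using assms by fastforce
qed

lemma (in field) inv_inv_nonzero [simp]:
  assumes "x \<in> carrier R" "x \<noteq> \<zero>"
  shows "inv (inv x) = x"
  using assms field_Units by (intro Units_inv_inv) auto

lemma (in field) mult_nonzero_iff [simp]: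
  assumes "x \<in> carrier R" "y \<in> carrier R"
  shows "x \<otimes> y = \<zero> \<longleftrightarrow> x = \<zero> \<or> y = \<zero>"
  using assms integral_iff by auto

lemma (in field) inv_mult_nonzero:
  assumes "x \<in> carrier R" "x \<noteq> \<zero>" "y \<in> carrier R" "y \<noteq> \<zero>"
  shows "inv (x \<otimes> y) = inv x \<otimes> inv y"
proof -
  have "(x \<otimes> y) \<otimes> (inv x \<otimes> inv y) = (x \<otimes> inv x) \<otimes> (y \<otimes> inv y)"
    using inv_nonzero(1)[OF assms(1,2)] inv_nonzero(1)[OF assms(3,4)] assms(1,3) by (simp add: m_ac)
  then show ?thesis using assms by (intro comm_inv_char) auto
qed

lemma (in field) pow_nonzero [simp]:
  assumes "x \<in> carrier R" "x \<noteq> \<zero>"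
  shows "x [^] (n::nat) \<noteq> \<zero>"
  using assms by (induct n) auto

lemma (in field) minus_eq_zero_iff [simp]:
  assumes "x \<in> carrier R" "y \<in> carrier R"
  shows "x \<ominus> y = \<zero> \<longleftrightarrow> x = y"
  using assms r_right_minus_eq by auto

text \<open>The valuation is a total integer function whose value at zero is left arbitrary, so
  every law is guarded by nonvanishing. An element of value 1 expresses surjectivity onto the
  integers.\<close>

locale discretely_valued_field = field R for R (structure) +
  fixes v :: "'a \<Rightarrow> int"
  assumes v_mult: "\<lbrakk>x \<in> carrier R; y \<in> carrier R; x \<noteq> \<zero>; y \<noteq> \<zero>\<rbrakk> \<Longrightarrow> v (x \<otimes> y) = v x + v y"
    and v_add: "\<lbrakk>x \<in> carrier R; y \<in> carrier R; x \<noteq> \<zero>; y \<noteq> \<zero>; x \<oplus> y \<noteq> \<zero>\<rbrakk> \<Longrightarrow> min (v x) (v y) \<le> v (x \<oplus> y)"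
    and v_surj: "\<exists>x\<in>carrier R. x \<noteq> \<zero> \<and> v x = 1"
begin

text \<open>The fractional ideals of the valuation: index 0 gives the valuation ring, index 1 its
  maximal ideal, and negative indices serve at poles. Zero is added by hand, which frees sums and
  products from case distinctions.\<close>

definition fil :: "int \<Rightarrow> 'a set" where
  "fil k = {x \<in> carrier R. x = \<zero> \<or> k \<le> v x}"

lemma fil_carrier: "x \<in> fil k \<Longrightarrow> x \<in> carrier R"
  by (simp add: fil_def)

lemma v_one [simp]: "v \<one> = 0"
  using v_mult[of \<one> \<one>] by simp

lemma v_inv:
  assumes "x \<in> carrier R" "x \<noteq> \<zero>"
  shows "v (inv x) = - v x"
  using v_mult[of x "inv x"] assms by simp

lemma v_pow:
  assumes "x \<in> carrier R" "x \<noteq> \<zero>"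
  shows "v (x [^] (n::nat)) = int n * v x"
  using assms by (induct n) (auto simp: v_mult algebra_simps)

lemma v_uminus:
  assumes "x \<in> carrier R" "x \<noteq> \<zero>"
  shows "v (\<ominus> x) = v x"
proof -
  have "v (\<ominus> \<one> \<otimes> \<ominus> \<one>) = v (\<ominus> \<one>) + v (\<ominus> \<one>)"
    by (rule v_mult) auto
  then have "v (\<ominus> \<one>) = 0" by (simp add: l_minus r_minus)
  moreover have "\<ominus> x = \<ominus> \<one> \<otimes> x" using assms by (simp add: l_minus)
  ultimately show ?thesis using assms by (simp add: v_mult)
qed

lemma fil_zero [simp]: "\<zero> \<in> fil k" by (simp add: fil_def)

lemma fil_one [simp]: "\<one> \<in> fil 0" by (simp add: fil_def)

lemma fil_mono: "x \<in> fil k \<Longrightarrow> l \<le> k \<Longrightarrow> x \<in> fil l" by (auto simp: fil_def)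

lemma fil_uminus: "x \<in> fil k \<Longrightarrow> \<ominus> x \<in> fil k" by (auto simp: fil_def v_uminus)

lemma fil_add:
  assumes "x \<in> fil k" "y \<in> fil k"
  shows "x \<oplus> y \<in> fil k"
proof (cases "x = \<zero> \<or> y = \<zero> \<or> x \<oplus> y = \<zero>")
  case False
  then show ?thesis using assms v_add[of x y] by (auto simp: fil_def)
qed (use assms in \<open>auto simp: fil_def\<close>)

lemma fil_diff: "x \<in> fil k \<Longrightarrow> y \<in> fil k \<Longrightarrow> x \<ominus> y \<in> fil k"
  by (simp add: minus_eq fil_add fil_uminus)

lemma fil_mult: "x \<in> fil k \<Longrightarrow> y \<in> fil l \<Longrightarrow> x \<otimes> y \<in> fil (k + l)"
  by (auto simp: fil_def v_mult)

lemma fil_mult0: "x \<in> fil 0 \<Longrightarrow> y \<in> fil l \<Longrightarrow> x \<otimes> y \<in> fil l"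
  "y \<in> fil l \<Longrightarrow> x \<in> fil 0 \<Longrightarrow> y \<otimes> x \<in> fil l"
  using fil_mult[of x 0 y l] fil_mult[of y l x 0] by auto

lemma fil_pow: "x \<in> fil k \<Longrightarrow> x [^] (n::nat) \<in> fil (int n * k)"
proof (induct n)
  case (Suc n)
  then show ?case using fil_mult[of "x [^] n" "int n * k" x k] by (simp add: algebra_simps)
qed simp

lemma fil_pow0: "x \<in> fil 0 \<Longrightarrow> x [^] (n::nat) \<in> fil 0"
  using fil_pow[of x 0 n] by simp

lemma fil_finsum:
  assumes "\<And>i. i \<in> I \<Longrightarrow> f i \<in> fil k"
  shows "finsum R f I \<in> fil k"
proof (cases "finite I")
  case True
  then show ?thesis using assms
  proof (induct I)
    case (insert a I)
    then have "f \<in> I \<rightarrow> carrier R" "f a \<in> carrier R" by (auto intro!: fil_carrier)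
    then show ?case using insert by (simp add: fil_add)
  qed simp
qed (simp add: finsum_infinite)

lemma in_fil_v: "x \<in> carrier R \<Longrightarrow> x \<in> fil (v x)" by (simp add: fil_def)

lemma fil_iff: "x \<in> carrier R \<Longrightarrow> x \<noteq> \<zero> \<Longrightarrow> x \<in> fil k \<longleftrightarrow> k \<le> v x" by (simp add: fil_def)

text \<open>A term of strictly smallest value cannot be cancelled: otherwise \<open>x\<close> =
  (\<open>x\<close> + \<open>y\<close>) - \<open>y\<close> would lie one step deeper in the
  filtration than its value allows.\<close>

lemma v_add_dominant:
  assumes "x \<in> carrier R" "x \<noteq> \<zero>" "y \<in> fil (v x + 1)"
  shows "x \<oplus> y \<noteq> \<zero>" "v (x \<oplus> y) = v x"
proof -
  have y: "y \<in> carrier R" using assms fil_carrier by auto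
  have x: "x = (x \<oplus> y) \<ominus> y" using assms(1) y by algebra
  have fx: "\<not> x \<in> fil (v x + 1)" using assms by (simp add: fil_def)
  have no: "\<not> (x \<oplus> y) \<in> fil (v x + 1)"
  proof
    assume "x \<oplus> y \<in> fil (v x + 1)"
    then have "(x \<oplus> y) \<ominus> y \<in> fil (v x + 1)" using assms(3) fil_diff by blast
    with x fx show False by simp
  qed
  then show nz: "x \<oplus> y \<noteq> \<zero>" by auto
  have "x \<oplus> y \<in> fil (v x)" using assms in_fil_v fil_add fil_mono[of y "v x + 1" "v x"] by simp
  with no nz show "v (x \<oplus> y) = v x" using assms(1) y by (auto simp: fil_def)
qed

lemma v_finprod:
  assumes "finite I" "\<And>i. i \<in> I \<Longrightarrow> f i \<in> carrier R \<and> f i \<noteq> \<zero>"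
  shows "finprod R f I \<noteq> \<zero> \<and> finprod R f I \<in> carrier R \<and> v (finprod R f I) = (\<Sum>i\<in>I. v (f i))"
  using assms
proof (induct I)
  case (insert a I)
  then have "f \<in> I \<rightarrow> carrier R" "f a \<in> carrier R" by auto
  then show ?case using insert by (simp add: v_mult)
qed simp

end

subsection \<open>Automorphism groups and inertia\<close>

lemma (in field) auto_hom:
  assumes "\<gamma> \<in> carrier (Gal R E)"
  shows "\<gamma> \<in> ring_hom R R" "ring_hom_ring R R \<gamma>" "inj_on \<gamma> (carrier R)" "\<gamma> ` carrier R = carrier R"
    "\<gamma> \<in> extensional (carrier R)"
proof -
  show h: "\<gamma> \<in> ring_hom R R" using assms by (simp add: Gal_def ring_iso_def)
  then show "ring_hom_ring R R \<gamma>" by (intro ring_hom_ringI2) (auto simp: ring_axioms)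
  show "inj_on \<gamma> (carrier R)" "\<gamma> ` carrier R = carrier R" "\<gamma> \<in> extensional (carrier R)"
    using assms by (auto simp: Gal_def ring_iso_def bij_betw_def)
qed

lemma (in field) auto_simps:
  assumes "\<gamma> \<in> carrier (Gal R E)"
  shows auto_closed: "\<And>x. x \<in> carrier R \<Longrightarrow> \<gamma> x \<in> carrier R"
    and auto_mult: "\<And>x y. x \<in> carrier R \<Longrightarrow> y \<in> carrier R \<Longrightarrow> \<gamma> (x \<otimes> y) = \<gamma> x \<otimes> \<gamma> y"
    and auto_add: "\<And>x y. x \<in> carrier R \<Longrightarrow> y \<in> carrier R \<Longrightarrow> \<gamma> (x \<oplus> y) = \<gamma> x \<oplus> \<gamma> y"
    and auto_one: "\<gamma> \<one> = \<one>"
    and auto_zero: "\<gamma> \<zero> = \<zero>"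
    and auto_uminus: "\<And>x. x \<in> carrier R \<Longrightarrow> \<gamma> (\<ominus> x) = \<ominus> \<gamma> x"
    and auto_diff: "\<And>x y. x \<in> carrier R \<Longrightarrow> y \<in> carrier R \<Longrightarrow> \<gamma> (x \<ominus> y) = \<gamma> x \<ominus> \<gamma> y"
    and auto_pow: "\<And>x n. x \<in> carrier R \<Longrightarrow> \<gamma> (x [^] (n::nat)) = \<gamma> x [^] n"
    and auto_nonzero: "\<And>x. x \<in> carrier R \<Longrightarrow> \<gamma> x = \<zero> \<longleftrightarrow> x = \<zero>"
    and auto_inv: "\<And>x. x \<in> carrier R \<Longrightarrow> x \<noteq> \<zero> \<Longrightarrow> \<gamma> (inv x) = inv (\<gamma> x)"
proof -
  interpret ring_hom_ring R R \<gamma> using auto_hom(2)[OF assms] .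
  show cl: "\<And>x. x \<in> carrier R \<Longrightarrow> \<gamma> x \<in> carrier R" by simp
  show mu: "\<And>x y. x \<in> carrier R \<Longrightarrow> y \<in> carrier R \<Longrightarrow> \<gamma> (x \<otimes> y) = \<gamma> x \<otimes> \<gamma> y" by simp
  show "\<And>x y. x \<in> carrier R \<Longrightarrow> y \<in> carrier R \<Longrightarrow> \<gamma> (x \<oplus> y) = \<gamma> x \<oplus> \<gamma> y" by simp
  show on: "\<gamma> \<one> = \<one>" by simp
  show ze: "\<gamma> \<zero> = \<zero>" by simp
  show "\<And>x. x \<in> carrier R \<Longrightarrow> \<gamma> (\<ominus> x) = \<ominus> \<gamma> x" by simp
  show "\<And>x y. x \<in> carrier R \<Longrightarrow> y \<in> carrier R \<Longrightarrow> \<gamma> (x \<ominus> y) = \<gamma> x \<ominus> \<gamma> y" by (simp add: minus_eq)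
  show "\<And>x n. x \<in> carrier R \<Longrightarrow> \<gamma> (x [^] (n::nat)) = \<gamma> x [^] n"
  proof -
    fix x n assume "x \<in> carrier R"
    then show "\<gamma> (x [^] (n::nat)) = \<gamma> x [^] n" by (induct n) auto
  qed
  show nz: "\<And>x. x \<in> carrier R \<Longrightarrow> \<gamma> x = \<zero> \<longleftrightarrow> x = \<zero>"
    using ze auto_hom(3)[OF assms] by (metis inj_onD zero_closed)
  fix x assume x: "x \<in> carrier R" "x \<noteq> \<zero>"
  have "\<gamma> x \<otimes> \<gamma> (inv x) = \<one>" using mu[of x "inv x"] x on by simp
  then show "\<gamma> (inv x) = inv (\<gamma> x)" using comm_inv_char[of "\<gamma> x" "\<gamma> (inv x)"] x cl by simp
qed

lemma (in field) auto_eqI: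
  assumes "\<gamma> \<in> carrier (Gal R E)" "\<tau> \<in> carrier (Gal R E')" "\<And>x. x \<in> carrier R \<Longrightarrow> \<gamma> x = \<tau> x"
  shows "\<gamma> = \<tau>"
  using assms auto_hom(5) by (metis extensionalityI)

lemma (in field) Gal_comp:
  assumes "\<gamma> \<in> carrier (Gal R E)" "\<tau> \<in> carrier (Gal R E)"
  shows "restrict (\<gamma> \<circ> \<tau>) (carrier R) \<in> carrier (Gal R E)"
proof -
  have "bij_betw (\<gamma> \<circ> \<tau>) (carrier R) (carrier R)"
    using assms by (auto simp: Gal_def ring_iso_def intro: bij_betw_trans)
  then have b: "bij_betw (restrict (\<gamma> \<circ> \<tau>) (carrier R)) (carrier R) (carrier R)"
    by (subst bij_betw_cong[where g = "\<gamma> \<circ> \<tau>"]) auto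
  have "restrict (\<gamma> \<circ> \<tau>) (carrier R) \<in> ring_hom R R"
    using auto_simps[OF assms(1)] auto_simps[OF assms(2)] by (intro ring_hom_memI) auto
  moreover have "restrict (\<gamma> \<circ> \<tau>) (carrier R) x = x" if "x \<in> E" for x
  proof -
    have "\<gamma> x = x" "\<tau> x = x" using that assms by (auto simp: Gal_def)
    then show ?thesis using auto_hom(5)[OF assms(1)] by (auto simp: restrict_def extensional_def)
  qed
  ultimately show ?thesis using b by (auto simp: Gal_def ring_iso_def)
qed

lemma (in field) Gal_id:
  assumes "E \<subseteq> carrier R"
  shows "restrict id (carrier R) \<in> carrier (Gal R E)"
proof -
  have b: "bij_betw (restrict id (carrier R)) (carrier R) (carrier R)"
    by (subst bij_betw_cong[where g = id]) auto
  have "restrict id (carrier R) \<in> ring_hom R R" by (intro ring_hom_memI) auto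
  then show ?thesis using b assms by (auto simp: Gal_def ring_iso_def)
qed

lemma (in field) Gal_mono: "E \<subseteq> E' \<Longrightarrow> carrier (Gal R E') \<subseteq> carrier (Gal R E)"
  by (auto simp: Gal_def)

lemma (in field) finsum_diff_scaled:
  assumes "finite S" "\<And>i. i \<in> S \<Longrightarrow> f i \<in> carrier R" "\<And>i. i \<in> S \<Longrightarrow> g i \<in> carrier R" "a \<in> carrier R"
  shows "finsum R (\<lambda>i. f i \<ominus> a \<otimes> g i) S = finsum R f S \<ominus> a \<otimes> finsum R g S"
  using assms
proof (induct S)
  case empty
  then show ?case by (simp add: minus_eq)
next
  case (insert x S)
  have c: "f \<in> S \<rightarrow> carrier R" "g \<in> S \<rightarrow> carrier R" "(\<lambda>i. f i \<ominus> a \<otimes> g i) \<in> S \<rightarrow> carrier R"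
    using insert by auto
  then have fc: "finsum R f S \<in> carrier R" "finsum R g S \<in> carrier R" by auto
  have "f x \<in> carrier R" "g x \<in> carrier R" using insert by auto
  then have "(f x \<ominus> a \<otimes> g x) \<oplus> (finsum R f S \<ominus> a \<otimes> finsum R g S)
      = (f x \<oplus> finsum R f S) \<ominus> a \<otimes> (g x \<oplus> finsum R g S)"
    using fc insert(6) by algebra
  then show ?case using insert c by simp
qed

text \<open>The elimination step of Dedekind's independence argument, with the target \<open>0\<close> replaced by a
  submodule \<open>I\<close> and ``nonzero'' by a multiplicative predicate \<open>Q\<close>, so that it also applies
  modulo powers of a maximal ideal.\<close>

lemma (in field) character_elimination:
  fixes Q :: "'a \<Rightarrow> bool"
  assumes "finite S" "\<gamma>\<^sub>0 \<notin> S" "insert \<gamma>\<^sub>0 S \<subseteq> carrier (Gal R E)"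
    and "B \<subseteq> carrier R" and B_mult: "\<And>x y. x \<in> B \<Longrightarrow> y \<in> B \<Longrightarrow> x \<otimes> y \<in> B"
    and I_diff: "\<And>x y. x \<in> I \<Longrightarrow> y \<in> I \<Longrightarrow> x \<ominus> y \<in> I"
    and I_smult: "\<And>\<tau> b x. \<tau> \<in> S \<Longrightarrow> b \<in> B \<Longrightarrow> x \<in> I \<Longrightarrow> \<tau> b \<otimes> x \<in> I"
    and Q: "Q \<one>" "\<And>x y. Q x \<Longrightarrow> Q y \<Longrightarrow> Q (x \<otimes> y)"
    and sep: "\<And>\<gamma>. \<gamma> \<in> S \<Longrightarrow> \<exists>x\<in>B. Q (\<gamma>\<^sub>0 x \<ominus> \<gamma> x)"
    and c: "c \<in> insert \<gamma>\<^sub>0 S \<rightarrow> carrier R"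
    and rel: "\<And>u. u \<in> B \<Longrightarrow> (\<Oplus>\<tau>\<in>insert \<gamma>\<^sub>0 S. c \<tau> \<otimes> \<tau> u) \<in> I"
  shows "\<exists>e\<in>carrier R. Q e \<and> (\<forall>u\<in>B. c \<gamma>\<^sub>0 \<otimes> e \<otimes> \<gamma>\<^sub>0 u \<in> I)"
  using assms(1-3) I_smult sep c rel
proof (induct S arbitrary: c)
  case empty
  have "c \<gamma>\<^sub>0 \<in> carrier R" using empty by auto
  moreover have "c \<gamma>\<^sub>0 \<otimes> \<one> \<otimes> \<gamma>\<^sub>0 u \<in> I" if "u \<in> B" for u
  proof -
    have "\<gamma>\<^sub>0 u \<in> carrier R" using that empty auto_closed assms(4) by auto
    then show ?thesis using empty(6)[OF that] \<open>c \<gamma>\<^sub>0 \<in> carrier R\<close> by simp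
  qed
  ultimately show ?case using Q by blast
next
  case (insert \<gamma> S)
  obtain x where x: "x \<in> B" "Q (\<gamma>\<^sub>0 x \<ominus> \<gamma> x)" using insert(7)[of \<gamma>] by auto
  have xc: "x \<in> carrier R" using x assms(4) by auto
  have gal: "\<tau> \<in> carrier (Gal R E)" if "\<tau> \<in> insert \<gamma>\<^sub>0 (insert \<gamma> S)" for \<tau> using that insert by auto
  have cc: "c \<tau> \<in> carrier R" if "\<tau> \<in> insert \<gamma>\<^sub>0 (insert \<gamma> S)" for \<tau> using that insert by auto
  have sx: "\<gamma> x \<in> carrier R" using gal auto_closed xc by auto
  \<comment> \<open>The relation at \<open>x u\<close> minus \<open>\<gamma> x\<close> times the
    relation at \<open>u\<close> has these coefficients. The one at \<open>\<gamma>\<close>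
    vanishes, so the sum loses one automorphism; the factor
    \<open>\<gamma>\<^sub>0 x - \<gamma> x\<close> picked up at \<open>\<gamma>\<^sub>0\<close>
    satisfies \<open>Q\<close>.\<close>
  define c' where "c' = (\<lambda>\<tau>. c \<tau> \<otimes> (\<tau> x \<ominus> \<gamma> x))"
  have c': "c' \<tau> \<in> carrier R" if "\<tau> \<in> insert \<gamma>\<^sub>0 (insert \<gamma> S)" for \<tau>
    unfolding c'_def using gal[OF that] cc[OF that] sx auto_closed xc by auto
  have "\<exists>e\<in>carrier R. Q e \<and> (\<forall>u\<in>B. c' \<gamma>\<^sub>0 \<otimes> e \<otimes> \<gamma>\<^sub>0 u \<in> I)"
  proof (rule insert(3))
    show "\<gamma>\<^sub>0 \<notin> S" "insert \<gamma>\<^sub>0 S \<subseteq> carrier (Gal R E)" using insert by auto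
    show "\<And>\<tau> b x. \<tau> \<in> S \<Longrightarrow> b \<in> B \<Longrightarrow> x \<in> I \<Longrightarrow> \<tau> b \<otimes> x \<in> I" using insert(6) by auto
    show "\<And>\<gamma>'. \<gamma>' \<in> S \<Longrightarrow> \<exists>x\<in>B. Q (\<gamma>\<^sub>0 x \<ominus> \<gamma>' x)" using insert(7) by auto
    show "c' \<in> insert \<gamma>\<^sub>0 S \<rightarrow> carrier R" using c' by auto
    fix u assume u: "u \<in> B"
    have uc: "u \<in> carrier R" using u assms(4) by auto
    have tu: "\<tau> u \<in> carrier R" "\<tau> x \<in> carrier R" if "\<tau> \<in> insert \<gamma>\<^sub>0 (insert \<gamma> S)" for \<tau>
      using gal[OF that] auto_closed xc uc by auto
    let ?T = "insert \<gamma>\<^sub>0 (insert \<gamma> S)"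
    have fT: "finite ?T" using insert by auto
    have 1: "(\<Oplus>\<tau>\<in>?T. c \<tau> \<otimes> \<tau> (x \<otimes> u)) \<in> I" using insert(9) B_mult x u by auto
    have 2: "\<gamma> x \<otimes> (\<Oplus>\<tau>\<in>?T. c \<tau> \<otimes> \<tau> u) \<in> I" using insert(9)[OF u] insert(6) x by auto
    have "(\<Oplus>\<tau>\<in>?T. c \<tau> \<otimes> \<tau> (x \<otimes> u)) \<ominus> \<gamma> x \<otimes> (\<Oplus>\<tau>\<in>?T. c \<tau> \<otimes> \<tau> u)
       = (\<Oplus>\<tau>\<in>?T. c \<tau> \<otimes> \<tau> (x \<otimes> u) \<ominus> \<gamma> x \<otimes> (c \<tau> \<otimes> \<tau> u))"
    proof (rule finsum_diff_scaled[symmetric, OF fT])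
      fix \<tau> assume t: "\<tau> \<in> ?T"
      show "c \<tau> \<otimes> \<tau> (x \<otimes> u) \<in> carrier R" "c \<tau> \<otimes> \<tau> u \<in> carrier R"
        using cc[OF t] tu[OF t] auto_closed[OF gal[OF t]] xc uc by auto
    qed (rule sx)
    also have "\<dots> = (\<Oplus>\<tau>\<in>?T. c' \<tau> \<otimes> \<tau> u)"
    proof (rule finsum_cong')
      show "(\<lambda>\<tau>. c' \<tau> \<otimes> \<tau> u) \<in> ?T \<rightarrow> carrier R" using c' tu by auto
      fix \<tau> assume t: "\<tau> \<in> ?T"
      have "\<tau> (x \<otimes> u) = \<tau> x \<otimes> \<tau> u" using gal[OF t] auto_mult xc uc by auto
      moreover have "c \<tau> \<otimes> (\<tau> x \<otimes> \<tau> u) \<ominus> \<gamma> x \<otimes> (c \<tau> \<otimes> \<tau> u) = c \<tau> \<otimes> (\<tau> x \<ominus> \<gamma> x) \<otimes> \<tau> u"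
        using cc[OF t] tu[OF t] sx by algebra
      ultimately show "c \<tau> \<otimes> \<tau> (x \<otimes> u) \<ominus> \<gamma> x \<otimes> (c \<tau> \<otimes> \<tau> u) = c' \<tau> \<otimes> \<tau> u" by (simp add: c'_def)
    qed simp
    also have "\<dots> = (\<Oplus>\<tau>\<in>insert \<gamma>\<^sub>0 S. c' \<tau> \<otimes> \<tau> u)"
    proof -
      have T: "?T = insert \<gamma> (insert \<gamma>\<^sub>0 S)" by auto
      have "\<gamma> \<notin> insert \<gamma>\<^sub>0 S" using insert by auto
      moreover have "c' \<gamma> \<otimes> \<gamma> u = \<zero>" unfolding c'_def using cc[of \<gamma>] sx tu[of \<gamma>] by simp
      moreover have "(\<lambda>\<tau>. c' \<tau> \<otimes> \<tau> u) \<in> insert \<gamma>\<^sub>0 S \<rightarrow> carrier R" using c' tu by auto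
      ultimately show ?thesis unfolding T using insert(1) by (subst finsum_insert) auto
    qed
    finally show "(\<Oplus>\<tau>\<in>insert \<gamma>\<^sub>0 S. c' \<tau> \<otimes> \<tau> u) \<in> I" using I_diff[OF 1 2] by simp
  qed
  then obtain e where e: "e \<in> carrier R" "Q e" "\<forall>u\<in>B. c' \<gamma>\<^sub>0 \<otimes> e \<otimes> \<gamma>\<^sub>0 u \<in> I" by auto
  have s0: "\<gamma>\<^sub>0 x \<in> carrier R" "c \<gamma>\<^sub>0 \<in> carrier R" using gal auto_closed xc cc by auto
  let ?e = "(\<gamma>\<^sub>0 x \<ominus> \<gamma> x) \<otimes> e"
  have "c \<gamma>\<^sub>0 \<otimes> ?e = c' \<gamma>\<^sub>0 \<otimes> e" unfolding c'_def using s0 sx e by (simp add: m_assoc)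
  then have "\<forall>u\<in>B. c \<gamma>\<^sub>0 \<otimes> ?e \<otimes> \<gamma>\<^sub>0 u \<in> I" using e by simp
  moreover have "Q ?e" using Q x e by auto
  moreover have "?e \<in> carrier R" using s0 sx e by auto
  ultimately show ?case by blast
qed

locale finite_automorphism_group = field R for R (structure) +
  fixes G :: "('a \<Rightarrow> 'a) set"
  assumes G_finite: "finite G" and G_auto: "G \<subseteq> carrier (Gal R {})"
    and G_id: "restrict id (carrier R) \<in> G"
    and G_comp: "\<lbrakk>\<gamma> \<in> G; \<tau> \<in> G\<rbrakk> \<Longrightarrow> restrict (\<gamma> \<circ> \<tau>) (carrier R) \<in> G"
begin

text \<open>Translation is injective because \<open>\<gamma>\<close> is, and finiteness turns this
  into surjectivity; this is where inverses in \<open>G\<close> come from.\<close>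

lemma G_left_bij:
  assumes "\<gamma> \<in> G"
  shows "bij_betw (\<lambda>\<tau>. restrict (\<gamma> \<circ> \<tau>) (carrier R)) G G"
proof -
  have "inj_on (\<lambda>\<tau>. restrict (\<gamma> \<circ> \<tau>) (carrier R)) G"
  proof (rule inj_onI)
    fix \<tau> \<tau>' assume t: "\<tau> \<in> G" "\<tau>' \<in> G" "restrict (\<gamma> \<circ> \<tau>) (carrier R) = restrict (\<gamma> \<circ> \<tau>') (carrier R)"
    have g: "\<tau> \<in> carrier (Gal R {})" "\<tau>' \<in> carrier (Gal R {})" "\<gamma> \<in> carrier (Gal R {})"
      using t assms G_auto by auto
    show "\<tau> = \<tau>'"
    proof (rule auto_eqI[OF g(1,2)])
      fix x assume x: "x \<in> carrier R"
      have "\<gamma> (\<tau> x) = \<gamma> (\<tau>' x)" using fun_cong[OF t(3), of x] x by simp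
      then show "\<tau> x = \<tau>' x" using auto_hom(3)[OF g(3)] auto_closed[OF g(1)] auto_closed[OF g(2)] x
        by (meson inj_onD)
    qed
  qed
  moreover have "(\<lambda>\<tau>. restrict (\<gamma> \<circ> \<tau>) (carrier R)) ` G \<subseteq> G" using G_comp assms by auto
  ultimately show ?thesis using G_finite by (simp add: bij_betw_def endo_inj_surj)
qed

definition tr :: "'a \<Rightarrow> 'a" where "tr u = (\<Oplus>\<tau>\<in>G. \<tau> u)"

lemma tr_closed: "u \<in> carrier R \<Longrightarrow> tr u \<in> carrier R"
  unfolding tr_def using G_auto auto_closed by (intro finsum_closed) blast

lemma tr_invariant:
  assumes "u \<in> carrier R" "\<gamma> \<in> G"
  shows "\<gamma> (tr u) = tr u"
proof -
  have g: "\<And>\<tau>. \<tau> \<in> G \<Longrightarrow> \<tau> \<in> carrier (Gal R {})" using G_auto by auto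
  have c: "\<And>\<tau>. \<tau> \<in> G \<Longrightarrow> \<tau> u \<in> carrier R" using g auto_closed assms(1) by blast
  interpret h: ring_hom_ring R R \<gamma> using auto_hom(2)[OF g[OF assms(2)]] .
  have "\<gamma> (tr u) = (\<Oplus>\<tau>\<in>G. \<gamma> (\<tau> u))"
    unfolding tr_def using c by (subst h.hom_finsum) (auto simp: comp_def)
  also have "\<dots> = (\<Oplus>\<tau>\<in>G. restrict (\<gamma> \<circ> \<tau>) (carrier R) u)"
    using assms(1) c by (intro finsum_cong') auto
  also have "\<dots> = (\<Oplus>\<tau>\<in>(\<lambda>\<tau>. restrict (\<gamma> \<circ> \<tau>) (carrier R)) ` G. \<tau> u)"
    using G_left_bij[OF assms(2)] c assms(1)
    by (subst finsum_reindex) (auto simp: bij_betw_def)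
  also have "\<dots> = tr u" using G_left_bij[OF assms(2)] by (simp add: tr_def bij_betw_def)
  finally show ?thesis .
qed

text \<open>Artin's lemma: if \<open>\<gamma>\<close> fixes the invariants but \<open>\<gamma> \<notin> G\<close>, then \<open>\<gamma> \<circ> tr = tr\<close> is a
  nontrivial relation between the distinct automorphisms in \<open>\<gamma>G \<union> G\<close>.\<close>

lemma auto_fixing_invariants:
  assumes "\<gamma> \<in> carrier (Gal R {})"
    and "\<And>x. x \<in> carrier R \<Longrightarrow> \<forall>\<tau>\<in>G. \<tau> x = x \<Longrightarrow> \<gamma> x = x"
  shows "\<gamma> \<in> G"
proof (rule ccontr)
  assume n: "\<gamma> \<notin> G"
  let ?id = "restrict id (carrier R)"
  let ?sG = "(\<lambda>\<tau>. restrict (\<gamma> \<circ> \<tau>) (carrier R)) ` G"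
  have g: "\<And>\<tau>. \<tau> \<in> G \<Longrightarrow> \<tau> \<in> carrier (Gal R {})" using G_auto by auto
  have inj: "inj_on (\<lambda>\<tau>. restrict (\<gamma> \<circ> \<tau>) (carrier R)) G"
  proof (rule inj_onI)
    fix \<tau> \<tau>' assume t: "\<tau> \<in> G" "\<tau>' \<in> G" "restrict (\<gamma> \<circ> \<tau>) (carrier R) = restrict (\<gamma> \<circ> \<tau>') (carrier R)"
    show "\<tau> = \<tau>'"
    proof (rule auto_eqI[OF g[OF t(1)] g[OF t(2)]])
      fix x assume x: "x \<in> carrier R"
      have "\<gamma> (\<tau> x) = \<gamma> (\<tau>' x)" using fun_cong[OF t(3), of x] x by simp
      then show "\<tau> x = \<tau>' x"
        using auto_hom(3)[OF assms(1)] auto_closed[OF g[OF t(1)] x] auto_closed[OF g[OF t(2)] x] by (meson inj_onD)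
    qed
  qed
  have sG: "?sG \<subseteq> carrier (Gal R {})" using Gal_comp[OF assms(1)] g by auto
  have disj: "?sG \<inter> G = {}"
  proof (rule ccontr)
    assume "?sG \<inter> G \<noteq> {}"
    then obtain \<tau> where t: "\<tau> \<in> G" "restrict (\<gamma> \<circ> \<tau>) (carrier R) \<in> G" by auto
    obtain \<tau>' where t': "\<tau>' \<in> G" "restrict (\<tau> \<circ> \<tau>') (carrier R) = ?id"
      using G_left_bij[OF t(1)] G_id by (metis (no_types, lifting) bij_betw_imp_surj_on imageE)
    have "\<gamma> = restrict (restrict (\<gamma> \<circ> \<tau>) (carrier R) \<circ> \<tau>') (carrier R)"
    proof (rule auto_eqI[OF assms(1)])
      show "restrict (restrict (\<gamma> \<circ> \<tau>) (carrier R) \<circ> \<tau>') (carrier R) \<in> carrier (Gal R {})"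
        using G_comp[OF t(2) t'(1)] g by auto
      fix x assume x: "x \<in> carrier R"
      have "\<tau> (\<tau>' x) = x" using fun_cong[OF t'(2), of x] x by simp
      then show "\<gamma> x = restrict (restrict (\<gamma> \<circ> \<tau>) (carrier R) \<circ> \<tau>') (carrier R) x"
        using x auto_closed[OF g[OF t'(1)] x] by simp
    qed
    then show False using G_comp[OF t(2) t'(1)] n by simp
  qed
  let ?S = "(G - {?id}) \<union> ?sG"
  \<comment> \<open>With sign 1 on \<open>G\<close> and -1 on the disjoint translate by
    \<open>\<gamma>\<close>, the sum becomes tr u - \<gamma>(tr u), which vanishes by hypothesis.
    Elimination then forces the coefficient at the identity to annihilate a nonzero element,
    although it is 1.\<close>
  define c where "c = (\<lambda>\<tau>. if \<tau> \<in> G then \<one> else \<ominus> \<one>)"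
  have cc: "c \<tau> \<in> carrier R" for \<tau> by (simp add: c_def)
  have ins: "insert ?id ?S = G \<union> ?sG" using G_id by auto
  have "\<exists>e\<in>carrier R. e \<noteq> \<zero> \<and> e \<in> carrier R \<and> (\<forall>u\<in>carrier R. c ?id \<otimes> e \<otimes> ?id u \<in> {\<zero>})"
  proof -
    have "\<exists>e\<in>carrier R. (e \<noteq> \<zero> \<and> e \<in> carrier R) \<and> (\<forall>u\<in>carrier R. c ?id \<otimes> e \<otimes> ?id u \<in> {\<zero>})"
    proof (rule character_elimination[where S = ?S and E = "{}"])
      show "finite ?S" using G_finite by auto
      show "?id \<notin> ?S" using disj G_id by auto
      show "insert ?id ?S \<subseteq> carrier (Gal R {})" using ins sG G_auto by auto
      show "\<exists>x\<in>carrier R. ?id x \<ominus> \<tau> x \<noteq> \<zero> \<and> ?id x \<ominus> \<tau> x \<in> carrier R" if t: "\<tau> \<in> ?S" for \<tau>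
      proof -
        have tg: "\<tau> \<in> carrier (Gal R {})" using t ins sG G_auto by auto
        have "\<tau> \<noteq> ?id" using t disj G_id by auto
        then obtain x where "x \<in> carrier R" "\<tau> x \<noteq> ?id x"
          using auto_eqI[OF tg Gal_id[of "{}"]] by auto
        then show ?thesis using auto_closed[OF tg] by (intro bexI[of _ x]) auto
      qed
      show "c \<in> insert ?id ?S \<rightarrow> carrier R" using cc by auto
      fix u assume u: "u \<in> carrier R"
      have tu: "\<tau> u \<in> carrier R" if "\<tau> \<in> G \<union> ?sG" for \<tau> using that auto_closed u sG G_auto by blast
      have "(\<Oplus>\<tau>\<in>insert ?id ?S. c \<tau> \<otimes> \<tau> u) = (\<Oplus>\<tau>\<in>G. c \<tau> \<otimes> \<tau> u) \<oplus> (\<Oplus>\<tau>\<in>?sG. c \<tau> \<otimes> \<tau> u)"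
        unfolding ins using tu cc disj G_finite by (intro finsum_Un_disjoint) auto
      also have "(\<Oplus>\<tau>\<in>G. c \<tau> \<otimes> \<tau> u) = tr u"
        unfolding tr_def using tu by (intro finsum_cong') (auto simp: c_def)
      also have "(\<Oplus>\<tau>\<in>?sG. c \<tau> \<otimes> \<tau> u) = (\<Oplus>\<tau>\<in>?sG. \<ominus> \<one> \<otimes> \<tau> u)"
        using tu disj by (intro finsum_cong') (auto simp: c_def)
      also have "\<dots> = \<ominus> \<one> \<otimes> (\<Oplus>\<tau>\<in>?sG. \<tau> u)"
        using tu G_finite by (subst finsum_rdistr) auto
      also have "(\<Oplus>\<tau>\<in>?sG. \<tau> u) = (\<Oplus>\<tau>\<in>G. restrict (\<gamma> \<circ> \<tau>) (carrier R) u)"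
        using inj tu by (subst finsum_reindex) auto
      also have "\<dots> = (\<Oplus>\<tau>\<in>G. \<gamma> (\<tau> u))"
        using u auto_closed[OF assms(1)] tu by (intro finsum_cong') auto
      also have "\<dots> = \<gamma> (tr u)"
      proof -
        interpret h: ring_hom_ring R R \<gamma> using auto_hom(2)[OF assms(1)] .
        show ?thesis unfolding tr_def using tu by (subst h.hom_finsum) (auto simp: comp_def)
      qed
      also have "\<gamma> (tr u) = tr u" using assms(2) tr_invariant tr_closed u by auto
      also have "tr u \<oplus> \<ominus> \<one> \<otimes> tr u = \<zero>" using tr_closed[OF u] by (simp add: l_minus r_neg)
      finally show "(\<Oplus>\<tau>\<in>insert ?id ?S. c \<tau> \<otimes> \<tau> u) \<in> {\<zero>}" by (rule ssubst) simp
    next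
      fix \<tau> b x assume "\<tau> \<in> ?S" "b \<in> carrier R" "x \<in> {\<zero>}"
      moreover from this have "\<tau> b \<in> carrier R" using auto_closed sG G_auto by blast
      ultimately show "\<tau> b \<otimes> x \<in> {\<zero>}" by simp
    qed (auto)
    then show ?thesis by blast
  qed
  then obtain e where e: "e \<in> carrier R" "e \<noteq> \<zero>" "c ?id \<otimes> e \<otimes> ?id \<one> \<in> {\<zero>}" by blast
  then show False using G_id by (simp add: c_def)
qed

end

section \<open>Decomposition groups, inertia and invariant uniformizers\<close>

locale valued_automorphism_group =
  discretely_valued_field R v + finite_automorphism_group R G for R (structure) and v G
begin

lemma G_gal: "\<gamma> \<in> G \<Longrightarrow> \<gamma> \<in> carrier (Gal R {})"
  using G_auto by auto

text \<open>If no such \<open>u\<close> existed, \<open>\<gamma>\<close> would send the maximal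
  ideal into the valuation ring. Then units go to units, and the value after applying
  \<open>\<gamma>\<close> is a fixed multiple \<open>e\<close> of the original value. As
  \<open>\<gamma>\<close> is onto, a preimage of the uniformizer gives \<open>e\<close> = 1, so
  \<open>\<gamma>\<close> would preserve \<open>v\<close>.\<close>

lemma conjugate_valuation_separated:
  assumes g: "\<gamma> \<in> carrier (Gal R {})"
    and ne: "\<exists>x\<in>carrier R. x \<noteq> \<zero> \<and> v (\<gamma> x) \<noteq> v x"
  shows "\<exists>u\<in>carrier R. u \<noteq> \<zero> \<and> 0 < v u \<and> v (\<gamma> u) < 0"
proof (rule ccontr)
  assume "\<not> ?thesis"
  then have nn: "0 \<le> v (\<gamma> u)" if "u \<in> carrier R" "u \<noteq> \<zero>" "0 < v u" for u
    using that by force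
  note s = auto_simps[OF g]
  obtain \<pi> where p: "\<pi> \<in> carrier R" "\<pi> \<noteq> \<zero>" "v \<pi> = 1" using v_surj by auto
  define e where "e = v (\<gamma> \<pi>)"
  have e0: "0 \<le> e" using nn p by (simp add: e_def)
  have half: "0 \<le> v (\<gamma> y)" if y: "y \<in> carrier R" "y \<noteq> \<zero>" "v y = 0" for y
  proof (rule ccontr)
    assume "\<not> 0 \<le> v (\<gamma> y)"
    then have neg: "v (\<gamma> y) \<le> -1" by simp
    \<comment> \<open>A power of \<open>y\<close> large enough to outweigh the uniformizer:
      \<open>\<pi> y^k\<close> still has value 1, but its image has value at most \<open>e\<close> -
      (\<open>e\<close> + 1) = -1.\<close>
    obtain k :: nat where k: "int k = e + 1" using e0 by (metis nonneg_int_cases add_nonneg_nonneg zero_le_one)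
    have z: "\<pi> \<otimes> y [^] k \<in> carrier R" "\<pi> \<otimes> y [^] k \<noteq> \<zero>" using p y by auto
    have "v (\<pi> \<otimes> y [^] k) = 1" using p y by (simp add: v_mult v_pow)
    then have "0 \<le> v (\<gamma> (\<pi> \<otimes> y [^] k))" using nn z by simp
    also have "\<dots> = e + (e + 1) * v (\<gamma> y)"
      using p y k by (simp add: s v_mult v_pow e_def)
    also have "\<dots> \<le> e + (e + 1) * (-1)" using neg e0 by (intro add_left_mono mult_left_mono) auto
    finally show False by simp
  qed
  have unit: "v (\<gamma> y) = 0" if y: "y \<in> carrier R" "y \<noteq> \<zero>" "v y = 0" for y
  proof -
    have "0 \<le> v (\<gamma> (inv y))" using half[of "inv y"] y by (simp add: v_inv)
    also have "\<dots> = - v (\<gamma> y)" using y s by (simp add: v_inv)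
    finally show ?thesis using half[OF y] by simp
  qed
  have mul: "v (\<gamma> y) = e * v y" if y: "y \<in> carrier R" "y \<noteq> \<zero>" for y
  proof (cases "0 \<le> v y")
    case True
    obtain n :: nat where n: "v y = int n" using True by (metis nonneg_int_cases)
    let ?q = "inv (\<pi> [^] n)"
    have q: "\<pi> [^] n \<in> carrier R" "\<pi> [^] n \<noteq> \<zero>" using p by auto
    have "v (y \<otimes> ?q) = 0" using y p n q by (simp add: v_mult v_inv v_pow)
    then have "0 = v (\<gamma> (y \<otimes> ?q))" using unit[of "y \<otimes> ?q"] y q by simp
    also have "\<dots> = v (\<gamma> y) - v y * e" using y p n q by (simp add: s v_mult v_inv v_pow e_def)
    finally show ?thesis by (simp add: algebra_simps)
  next
    case False
    obtain n :: nat where n: "v y = - int n" using False by (metis int_cases4 int_nat_eq neg_equal_iff_equal nat_0_le linorder_not_le of_nat_0_le_iff)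
    let ?q = "\<pi> [^] n"
    have q: "?q \<in> carrier R" "?q \<noteq> \<zero>" using p by auto
    have "v (y \<otimes> ?q) = 0" using y p n q by (simp add: v_mult v_pow)
    then have "0 = v (\<gamma> (y \<otimes> ?q))" using unit[of "y \<otimes> ?q"] y q by simp
    also have "\<dots> = v (\<gamma> y) - v y * e" using y p n q by (simp add: s v_mult v_pow e_def)
    finally show ?thesis by (simp add: algebra_simps)
  qed
  obtain z where z: "z \<in> carrier R" "\<gamma> z = \<pi>" using auto_hom(4)[OF g] p by (metis imageE)
  then have "z \<noteq> \<zero>" using p s by auto
  then have "e * v z = 1" using mul[OF z(1)] z p by simp
  then have "e = 1" using e0 zmult_eq_1_iff by auto
  then show False using mul ne by auto
qed

text \<open>Weak approximation in the form needed here, by induction on the set: an element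
  \<open>u\<close> separating \<open>v\<close> from the new conjugate is raised to a high power and
  added to the element \<open>x\<close> found so far.\<close>

lemma separating_element:
  assumes "finite S" "S \<subseteq> carrier (Gal R {})"
    and "\<And>\<gamma>. \<gamma> \<in> S \<Longrightarrow> \<exists>x\<in>carrier R. x \<noteq> \<zero> \<and> v (\<gamma> x) \<noteq> v x"
  shows "\<exists>x\<in>carrier R. x \<noteq> \<zero> \<and> 0 < v x \<and> (\<forall>\<gamma>\<in>S. v (\<gamma> x) < 0)"
  using assms
proof (induct S)
  case empty
  then show ?case using v_surj by force
next
  case (insert \<gamma> S)
  then obtain x where x: "x \<in> carrier R" "x \<noteq> \<zero>" "0 < v x" "\<forall>\<tau>\<in>S. v (\<tau> x) < 0" by auto
  have g: "\<gamma> \<in> carrier (Gal R {})" using insert by auto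
  obtain u where u: "u \<in> carrier R" "u \<noteq> \<zero>" "0 < v u" "v (\<gamma> u) < 0"
    using conjugate_valuation_separated[OF g] insert by auto
  show ?case
  proof (cases "v (\<gamma> x) < 0")
    case True
    then show ?thesis using x by auto
  next
    case False
    \<comment> \<open>Larger than the absolute value of each \<open>v (\<tau> x)\<close> with
      \<open>\<tau>\<close> in \<open>S\<close>, so the power of \<open>u\<close> dominates
      \<open>x\<close> wherever \<open>u\<close> has a pole; at the remaining members of
      \<open>S\<close> the pole of \<open>x\<close> survives.\<close>
    define M where "M = nat (1 + (\<Sum>\<tau>\<in>S. \<bar>v (\<tau> x)\<bar>))"
    have Mpos: "M > 0" unfolding M_def by (simp add: sum_nonneg add_pos_nonneg)
    have M: "\<bar>v (\<tau> x)\<bar> < int M" if "\<tau> \<in> S" for \<tau>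
    proof -
      have "\<bar>v (\<tau> x)\<bar> \<le> (\<Sum>\<tau>\<in>S. \<bar>v (\<tau> x)\<bar>)"
        using insert(1) that by (intro member_le_sum) auto
      then show ?thesis unfolding M_def by (simp add: sum_nonneg)
    qed
    let ?w = "u [^] M"
    let ?y = "x \<oplus> ?w"
    have wc: "?w \<in> carrier R" "?w \<noteq> \<zero>" using u by auto
    have neg: "v (\<tau> ?y) < 0 \<and> ?y \<noteq> \<zero>" if t: "\<tau> \<in> insert \<gamma> S" for \<tau>
    proof -
      have tg: "\<tau> \<in> carrier (Gal R {})" using t insert by auto
      note s = auto_simps[OF tg]
      have tx: "\<tau> x \<in> carrier R" "\<tau> x \<noteq> \<zero>" "\<tau> ?w \<in> carrier R" "\<tau> ?w \<noteq> \<zero>" "\<tau> u \<in> carrier R" "\<tau> u \<noteq> \<zero>"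
        using s x wc u by auto
      have vw: "v (\<tau> ?w) = int M * v (\<tau> u)" using s u tx by (simp add: v_pow)
      have sum: "\<tau> ?y = \<tau> x \<oplus> \<tau> ?w" using s x wc by simp
      have "v (\<tau> x \<oplus> \<tau> ?w) < 0 \<and> \<tau> x \<oplus> \<tau> ?w \<noteq> \<zero>"
      proof (cases "v (\<tau> u) < 0")
        case True
        have "int M * v (\<tau> u) \<le> int M * (-1)" using True by (intro mult_left_mono) auto
        then have "v (\<tau> ?w) < v (\<tau> x) \<and> v (\<tau> ?w) < 0"
          using vw Mpos M[of \<tau>] False t True by auto
        then have "\<tau> x \<in> fil (v (\<tau> ?w) + 1)" "v (\<tau> ?w) < 0" using tx by (auto simp: fil_def)
        then have "\<tau> ?w \<oplus> \<tau> x \<noteq> \<zero>" "v (\<tau> ?w \<oplus> \<tau> x) < 0" using v_add_dominant[of "\<tau> ?w" "\<tau> x"] tx by auto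
        then show ?thesis using tx by (simp add: a_comm)
      next
        case nn: False
        then have tS: "\<tau> \<in> S" using t u by auto
        have "0 \<le> v (\<tau> ?w)" using vw nn by simp
        moreover have "v (\<tau> x) < 0" using x tS by auto
        ultimately have "\<tau> ?w \<in> fil (v (\<tau> x) + 1)" using tx by (auto simp: fil_def)
        then show ?thesis using v_add_dominant[of "\<tau> x" "\<tau> ?w"] tx \<open>v (\<tau> x) < 0\<close> by auto
      qed
      then show ?thesis using sum s x wc by (metis add.m_closed auto_zero[OF tg])
    qed
    have "?y \<noteq> \<zero>" using neg by blast
    moreover have "?y \<in> fil 1"
    proof (rule fil_add)
      have "1 * 1 \<le> int M * v u" using u Mpos by (intro mult_mono) auto
      then show "?w \<in> fil 1" using u by (simp add: fil_def v_pow)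
    qed (use x in \<open>simp add: fil_def\<close>)
    ultimately have "0 < v ?y" by (simp add: fil_def)
    then show ?thesis using neg x wc \<open>?y \<noteq> \<zero>\<close> by (intro bexI[of _ ?y]) auto
  qed
qed

text \<open>The witness is a trace. \<open>B\<close> consists of the elements integral at all
  conjugate places, and \<open>y\<close> has value 1 while all its conjugates lie in the maximal
  ideal, so tr(y u) lies in \<open>fil 1\<close> for every \<open>u\<close> in \<open>B\<close>. If
  all these traces lay in \<open>fil 2\<close>, character elimination modulo \<open>fil 2\<close>
  would put \<open>y e\<close> into \<open>fil 2\<close> for some \<open>e\<close> of value 0. The
  separation that elimination asks for comes from trivial inertia inside the decomposition group and
  from weak approximation outside it.\<close>

theorem invariant_uniformizer:
  assumes inert: "\<And>\<gamma>. \<lbrakk>\<gamma> \<in> G; \<gamma> \<noteq> restrict id (carrier R);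
      \<And>x. x \<in> carrier R \<Longrightarrow> x \<noteq> \<zero> \<Longrightarrow> v (\<gamma> x) = v x\<rbrakk> \<Longrightarrow>
      \<exists>x\<in>carrier R. (\<forall>\<tau>\<in>G. \<tau> x \<in> fil 0) \<and> x \<ominus> \<gamma> x \<notin> fil 1"
  shows "\<exists>y\<in>carrier R. (\<forall>\<gamma>\<in>G. \<gamma> y = y) \<and> y \<noteq> \<zero> \<and> v y = 1"
proof -
  let ?id = "restrict id (carrier R)"
  define D where "D = {\<gamma> \<in> G. \<forall>x\<in>carrier R. x \<noteq> \<zero> \<longrightarrow> v (\<gamma> x) = v x}"
  have "\<exists>x\<in>carrier R. x \<noteq> \<zero> \<and> 0 < v x \<and> (\<forall>\<gamma>\<in>G - D. v (\<gamma> x) < 0)"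
    using G_finite G_auto by (intro separating_element) (auto simp: D_def)
  then obtain x where x: "x \<in> carrier R" "x \<noteq> \<zero>" "0 < v x" "\<And>\<gamma>. \<gamma> \<in> G - D \<Longrightarrow> v (\<gamma> x) < 0" by auto
  \<comment> \<open>\<open>D\<close> is the decomposition group of \<open>v\<close>. The conjugates
    of \<open>z\<close> under \<open>D\<close> are units and all other conjugates have positive
    value, since \<open>x\<close> has positive value along \<open>D\<close> and a pole
    elsewhere.\<close>
  define z where "z = inv (\<one> \<oplus> x)"
  have "x \<in> fil (v \<one> + 1)" using x by (simp add: fil_def)
  then have ox: "\<one> \<oplus> x \<noteq> \<zero>" "v (\<one> \<oplus> x) = 0" using v_add_dominant[of \<one> x] by auto
  have z: "z \<in> carrier R" "z \<noteq> \<zero>" "v z = 0" using ox x by (auto simp: z_def v_inv)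
  have zout: "0 < v (\<gamma> z)" if g: "\<gamma> \<in> G - D" for \<gamma>
  proof -
    have gg: "\<gamma> \<in> carrier (Gal R {})" using g G_gal by auto
    note s = auto_simps[OF gg]
    have gx: "\<gamma> x \<in> carrier R" "\<gamma> x \<noteq> \<zero>" using s x by auto
    have "\<one> \<in> fil (v (\<gamma> x) + 1)" using x(4)[OF g] by (simp add: fil_def)
    then have "v (\<gamma> x \<oplus> \<one>) = v (\<gamma> x)" using v_add_dominant gx by auto
    moreover have "\<gamma> z = inv (\<gamma> x \<oplus> \<one>)" unfolding z_def using s x ox gx by (simp add: a_comm)
    moreover have "\<gamma> x \<oplus> \<one> \<noteq> \<zero>" using \<open>\<one> \<in> fil (v (\<gamma> x) + 1)\<close> v_add_dominant gx by auto
    ultimately show ?thesis using x(4)[OF g] gx by (simp add: v_inv)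
  qed
  have zin: "v (\<gamma> z) = 0" if "\<gamma> \<in> D" for \<gamma> using that z by (auto simp: D_def)
  have gc: "\<gamma> w \<in> carrier R" "\<gamma> w = \<zero> \<longleftrightarrow> w = \<zero>" if "\<gamma> \<in> G" "w \<in> carrier R" for \<gamma> w
    using auto_closed[OF G_gal[OF that(1)]] auto_nonzero[OF G_gal[OF that(1)]] that by auto
  define B where "B = {w \<in> carrier R. \<forall>\<tau>\<in>G. \<tau> w \<in> fil 0}"
  have zB: "z \<in> B"
    using z zin zout gc by (force simp: B_def fil_def)
  obtain \<pi> where p: "\<pi> \<in> carrier R" "\<pi> \<noteq> \<zero>" "v \<pi> = 1" using v_surj by auto
  define M where "M = nat (1 + (\<Sum>\<tau>\<in>G. \<bar>v (\<tau> \<pi>)\<bar>))"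
  have M: "1 - v (\<tau> \<pi>) \<le> int M" if "\<tau> \<in> G" for \<tau>
  proof -
    have "\<bar>v (\<tau> \<pi>)\<bar> \<le> (\<Sum>\<tau>\<in>G. \<bar>v (\<tau> \<pi>)\<bar>)" using G_finite that by (intro member_le_sum) auto
    then show ?thesis unfolding M_def by (simp add: sum_nonneg)
  qed
  \<comment> \<open>The power of \<open>z\<close> leaves the value along \<open>D\<close> at 1 and
    is high enough to make the value of every other conjugate positive.\<close>
  define y where "y = \<pi> \<otimes> z [^] M"
  have y: "y \<in> carrier R" "y \<noteq> \<zero>" "v y = 1" using p z by (auto simp: y_def v_mult v_pow)
  have yt: "\<tau> y \<in> fil 1" if t: "\<tau> \<in> G" for \<tau>
  proof (cases "\<tau> \<in> D")
    case True
    then show ?thesis using y gc t by (auto simp: D_def fil_def)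
  next
    case False
    note s = auto_simps[OF G_gal[OF t]]
    have "int M * 1 \<le> int M * v (\<tau> z)" using zout[of \<tau>] t False by (intro mult_left_mono) auto
    moreover have "v (\<tau> y) = v (\<tau> \<pi>) + int M * v (\<tau> z)"
      unfolding y_def using s p z by (simp add: v_mult v_pow)
    ultimately show ?thesis using M[OF t] gc t y by (simp add: fil_def)
  qed
  have "\<exists>u\<in>B. (\<Oplus>\<tau>\<in>insert ?id (G - {?id}). \<tau> y \<otimes> \<tau> u) \<notin> fil 2"
  proof (rule ccontr)
    assume "\<not> ?thesis"
    then have all: "\<And>u. u \<in> B \<Longrightarrow> (\<Oplus>\<tau>\<in>insert ?id (G - {?id}). \<tau> y \<otimes> \<tau> u) \<in> fil 2" by auto
    have "\<exists>e\<in>carrier R. (e \<in> carrier R \<and> e \<noteq> \<zero> \<and> v e = 0) \<and> (\<forall>u\<in>B. ?id y \<otimes> e \<otimes> ?id u \<in> fil 2)"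
    proof (rule character_elimination[where S = "G - {?id}" and E = "{}"])
      show "finite (G - {?id})" "insert ?id (G - {?id}) \<subseteq> carrier (Gal R {})"
        using G_finite G_auto G_id by auto
      show "B \<subseteq> carrier R" by (auto simp: B_def)
      show "x \<otimes> y \<in> B" if "x \<in> B" "y \<in> B" for x y
        using that fil_mult0 by (auto simp: B_def auto_mult[OF G_gal])
      show "x \<ominus> y \<in> fil 2" if "x \<in> fil 2" "y \<in> fil 2" for x y using that by (rule fil_diff)
      show "\<tau> b \<otimes> x \<in> fil 2" if "\<tau> \<in> G - {?id}" "b \<in> B" "x \<in> fil 2" for \<tau> b x
        using that fil_mult0 by (auto simp: B_def)
      show "\<exists>x\<in>B. ?id x \<ominus> \<gamma> x \<in> carrier R \<and> ?id x \<ominus> \<gamma> x \<noteq> \<zero> \<and> v (?id x \<ominus> \<gamma> x) = 0"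
        if g: "\<gamma> \<in> G - {?id}" for \<gamma>
      proof -
        have "\<exists>x\<in>B. x \<ominus> \<gamma> x \<notin> fil 1"
        proof (cases "\<gamma> \<in> D")
          case True
          then show ?thesis using inert[of \<gamma>] g unfolding B_def D_def by auto
        next
          case False
          \<comment> \<open>Outside \<open>D\<close> the element \<open>z\<close> itself separates:
            it is a unit and its conjugate lies in the maximal ideal.\<close>
          have "\<gamma> z \<in> fil 1" using zout[of \<gamma>] g False gc z by (auto simp: fil_def)
          then have "z \<ominus> \<gamma> z \<notin> fil 1"
            using z fil_add[of "z \<ominus> \<gamma> z" 1 "\<gamma> z"] fil_carrier[of "\<gamma> z"]
            by (metis fil_iff a_minus_def add.m_assoc add.inv_closed l_neg r_zero zero_less_one not_le)
          then show ?thesis using zB by auto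
        qed
        then obtain x where x: "x \<in> B" "x \<ominus> \<gamma> x \<notin> fil 1" by auto
        have xc: "x \<in> carrier R" "\<gamma> x \<in> carrier R" using x g gc by (auto simp: B_def)
        have "?id x \<in> fil 0" "\<gamma> x \<in> fil 0" using x g G_id unfolding B_def by blast+
        then have "x \<ominus> \<gamma> x \<in> fil 0" using fil_diff xc by simp
        then show ?thesis using x xc by (intro bexI[of _ x]) (auto simp: fil_def)
      qed
      show "(\<lambda>\<tau>. \<tau> y) \<in> insert ?id (G - {?id}) \<rightarrow> carrier R" using gc y G_id by auto
      show "\<And>u. u \<in> B \<Longrightarrow> (\<Oplus>\<tau>\<in>insert ?id (G - {?id}). \<tau> y \<otimes> \<tau> u) \<in> fil 2" by (rule all)
    qed (auto simp: v_mult)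
    then obtain e where e: "e \<in> carrier R" "e \<noteq> \<zero>" "v e = 0" "\<forall>u\<in>B. ?id y \<otimes> e \<otimes> ?id u \<in> fil 2" by auto
    have "\<one> \<in> B" by (simp add: B_def auto_one[OF G_gal])
    then have "y \<otimes> e \<in> fil 2" using e y by force
    then show False using y e by (simp add: fil_def v_mult)
  qed
  then obtain u where u: "u \<in> B" "(\<Oplus>\<tau>\<in>insert ?id (G - {?id}). \<tau> y \<otimes> \<tau> u) \<notin> fil 2" by auto
  have uc: "u \<in> carrier R" using u by (simp add: B_def)
  have "insert ?id (G - {?id}) = G" using G_id by auto
  moreover have "(\<Oplus>\<tau>\<in>G. \<tau> y \<otimes> \<tau> u) = tr (y \<otimes> u)"
    unfolding tr_def using y uc gc by (intro finsum_cong') (auto simp: auto_mult[OF G_gal])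
  ultimately have t2: "tr (y \<otimes> u) \<notin> fil 2" using u by simp
  have "tr (y \<otimes> u) \<in> fil 1" unfolding tr_def
  proof (rule fil_finsum)
    fix \<tau> assume t: "\<tau> \<in> G"
    then have "\<tau> u \<in> fil 0" using u by (simp add: B_def)
    then show "\<tau> (y \<otimes> u) \<in> fil 1" using yt[OF t] fil_mult0 y uc by (simp add: auto_mult[OF G_gal[OF t]])
  qed
  with t2 have "tr (y \<otimes> u) \<noteq> \<zero>" "v (tr (y \<otimes> u)) = 1" by (auto simp: fil_def)
  then show ?thesis using tr_invariant tr_closed y uc by (intro bexI[of _ "tr (y \<otimes> u)"]) auto
qed

end

subsection \<open>Valuation rings\<close>

lemma (in field) fractions_subfield:
  assumes "subring A R"
  shows "subfield {a \<otimes> inv b | a b. a \<in> A \<and> b \<in> A \<and> b \<noteq> \<zero>} R" (is "subfield ?Q R")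
proof -
  note A = subringE[OF assms]
  have c: "\<And>a. a \<in> A \<Longrightarrow> a \<in> carrier R" using A(1) by auto
  have add: "a \<otimes> inv b \<oplus> a' \<otimes> inv b' = (a \<otimes> b' \<oplus> a' \<otimes> b) \<otimes> inv (b \<otimes> b')"
    if "a \<in> carrier R" "a' \<in> carrier R" "b \<in> carrier R" "b' \<in> carrier R" "b \<noteq> \<zero>" "b' \<noteq> \<zero>" for a a' b b'
  proof -
    let ?i = "inv b" and ?j = "inv b'"
    have ij: "?i \<in> carrier R" "?j \<in> carrier R" "b \<otimes> ?i = \<one>" "b' \<otimes> ?j = \<one>" using that by auto
    have "(a \<otimes> b' \<oplus> a' \<otimes> b) \<otimes> (?i \<otimes> ?j) = a \<otimes> ?i \<otimes> (b' \<otimes> ?j) \<oplus> a' \<otimes> ?j \<otimes> (b \<otimes> ?i)"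
      using that(1-4) ij(1,2) by algebra
    then show ?thesis using that ij by (simp add: inv_mult_nonzero)
  qed
  show ?thesis
  proof (rule subfieldI')
    show "subring ?Q R"
    proof (rule subringI)
      show "?Q \<subseteq> carrier R" using c by auto
      show "\<one> \<in> ?Q" using A(3) by (intro CollectI exI[of _ \<one>]) auto
      fix x y assume "x \<in> ?Q" "y \<in> ?Q"
      then obtain a b a' b' where ab: "x = a \<otimes> inv b" "a \<in> A" "b \<in> A" "b \<noteq> \<zero>"
        "y = a' \<otimes> inv b'" "a' \<in> A" "b' \<in> A" "b' \<noteq> \<zero>" by auto
      have "\<ominus> x = (\<ominus> a) \<otimes> inv b" using ab c by (simp add: l_minus)
      then show "\<ominus> x \<in> ?Q" using ab A(5) by blast
      have bb: "b \<otimes> b' \<in> A" "b \<otimes> b' \<noteq> \<zero>" using ab A(6) c by auto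
      have "x \<otimes> y = (a \<otimes> a') \<otimes> inv (b \<otimes> b')"
        using ab c inv_nonzero(1)[of b] inv_nonzero(1)[of b'] by (simp add: inv_mult_nonzero m_ac)
      then show "x \<otimes> y \<in> ?Q" using ab A(6) bb by blast
      have "x \<oplus> y = (a \<otimes> b' \<oplus> a' \<otimes> b) \<otimes> inv (b \<otimes> b')"
        using add[of a a' b b'] ab c by simp
      moreover have "a \<otimes> b' \<oplus> a' \<otimes> b \<in> A" using ab by (auto intro!: A(6,7))
      ultimately show "x \<oplus> y \<in> ?Q" using bb by blast
    qed
    fix k assume "k \<in> ?Q - {\<zero>}"
    then obtain a b where ab: "k = a \<otimes> inv b" "a \<in> A" "b \<in> A" "b \<noteq> \<zero>" "k \<noteq> \<zero>" by auto
    then have "a \<noteq> \<zero>" using c by auto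
    then have "inv k = b \<otimes> inv a" using ab c inv_mult_nonzero[of a "inv b"] by (simp add: m_comm)
    then show "inv k \<in> ?Q" using ab \<open>a \<noteq> \<zero>\<close> by blast
  qed
qed

lemma (in field) generate_field_insert_fraction:
  assumes "subfield C R" "g \<in> carrier R" "y \<in> generate_field R (insert g C)"
  shows "\<exists>a\<in>simple_extension C g. \<exists>b\<in>simple_extension C g. b \<noteq> \<zero> \<and> y = a \<otimes> inv b"
proof -
  let ?A = "simple_extension C g"
  have Cc: "C \<subseteq> carrier R" "subring C R" using assms(1) subfieldE by auto
  have A: "subring ?A R" using simple_extension_is_subring Cc assms(2) by auto
  have inc: "insert g C \<subseteq> ?A" using simple_extension_incl[OF Cc(1) assms(2)] simple_extension_mem[OF Cc(2) assms(2)] by auto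
  let ?Q = "{a \<otimes> inv b | a b. a \<in> ?A \<and> b \<in> ?A \<and> b \<noteq> \<zero>}"
  have "insert g C \<subseteq> ?Q"
  proof
    fix x assume "x \<in> insert g C"
    then have "x \<in> ?A" "x \<in> carrier R" using inc Cc(1) assms(2) by auto
    then show "x \<in> ?Q" using subringE(3)[OF A] by (intro CollectI exI[of _ x] exI[of _ \<one>]) auto
  qed
  then have "generate_field R (insert g C) \<subseteq> ?Q"
    using fractions_subfield[OF A] Cc assms(2) by (intro generate_field_min_subfield1) auto
  then have "y \<in> ?Q" using assms(3) by (rule subsetD)
  then show ?thesis by blast
qed

text \<open>A valuation ring before any value function is known: \<open>unit\<close> plays the role
  of value zero, and \<open>place_of R V\<close> that of positive value.\<close>

locale valued_ring = field R for R (structure) +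
  fixes V
  assumes V_subring: "subring V R"
    and V_val: "\<And>x. x \<in> carrier R \<Longrightarrow> x \<noteq> \<zero> \<Longrightarrow> x \<in> V \<or> inv x \<in> V"
begin

lemmas V_ring = subringE[OF V_subring]

lemma V_carrier: "x \<in> V \<Longrightarrow> x \<in> carrier R" using V_ring(1) by auto

definition unit where "unit x \<longleftrightarrow> x \<in> V \<and> x \<noteq> \<zero> \<and> inv x \<in> V"

lemma unit_carrier: "unit x \<Longrightarrow> x \<in> carrier R" "unit x \<Longrightarrow> x \<noteq> \<zero>" using V_carrier by (auto simp: unit_def)

lemma unit_one [simp]: "unit \<one>" using V_ring(3) by (simp add: unit_def)

lemma unit_mult: "unit x \<Longrightarrow> unit y \<Longrightarrow> unit (x \<otimes> y)"
  using V_ring(6) V_carrier by (auto simp: unit_def inv_mult_nonzero)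

lemma unit_inv: "unit x \<Longrightarrow> unit (inv x)" using V_carrier by (auto simp: unit_def)

lemma unit_pow: "unit x \<Longrightarrow> unit (x [^] (n::nat))"
  by (induct n) (auto intro: unit_mult)

lemma place_carrier: "x \<in> place_of R V \<Longrightarrow> x \<in> carrier R" "x \<in> place_of R V \<Longrightarrow> x \<in> V"
  using V_carrier by (auto simp: place_of_def)

lemma place_or_unit: "x \<in> V \<Longrightarrow> x \<in> place_of R V \<or> unit x"
  by (auto simp: place_of_def unit_def)

lemma place_not_unit: "x \<in> place_of R V \<Longrightarrow> \<not> unit x"
  by (auto simp: place_of_def unit_def)

lemma not_V_inv: "x \<in> carrier R \<Longrightarrow> x \<notin> V \<Longrightarrow> inv x \<in> place_of R V"
  using V_val[of x] V_ring(2) inv_inv_nonzero[of x] by (cases "x = \<zero>") (auto simp: place_of_def)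

lemma place_mult:
  assumes "x \<in> V" "y \<in> place_of R V"
  shows "x \<otimes> y \<in> place_of R V" "y \<otimes> x \<in> place_of R V"
proof -
  have c: "x \<in> carrier R" "y \<in> carrier R" "y \<in> V" using assms V_carrier place_carrier by auto
  have "\<not> unit (x \<otimes> y)"
  proof
    assume u: "unit (x \<otimes> y)"
    then have nz: "x \<noteq> \<zero>" "y \<noteq> \<zero>" using c unit_carrier(2)[OF u] by auto
    have "inv y = x \<otimes> inv (x \<otimes> y)" using c nz by (simp add: inv_mult_nonzero m_assoc[symmetric])
    then have "inv y \<in> V" using u assms V_ring(6) by (auto simp: unit_def)
    then show False using assms nz by (auto simp: place_of_def)
  qed
  then show "x \<otimes> y \<in> place_of R V" using place_or_unit[of "x \<otimes> y"] V_ring(6) assms c by auto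
  then show "y \<otimes> x \<in> place_of R V" using c by (simp add: m_comm)
qed

lemma place_zero [simp]: "\<zero> \<in> place_of R V" using V_ring(2) by (simp add: place_of_def)

lemma place_add:
  assumes "x \<in> place_of R V" "y \<in> place_of R V"
  shows "x \<oplus> y \<in> place_of R V"
proof (cases "x = \<zero> \<or> y = \<zero>")
  case True
  then show ?thesis using assms place_carrier by auto
next
  case False
  have c: "x \<in> carrier R" "y \<in> carrier R" using assms place_carrier by auto
  have *: "a \<oplus> b \<in> place_of R V" if ab: "a \<in> carrier R" "b \<in> place_of R V" "b \<noteq> \<zero>" "a \<otimes> inv b \<in> V" for a b
  proof -
    have bc: "b \<in> carrier R" using ab place_carrier by auto
    have "a \<oplus> b = (a \<otimes> inv b \<oplus> \<one>) \<otimes> b" using ab bc by (simp add: l_distr m_assoc)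
    moreover have "a \<otimes> inv b \<oplus> \<one> \<in> V" using ab V_ring(3,7) by auto
    ultimately show ?thesis using place_mult ab by simp
  qed
  have "x \<otimes> inv y \<in> V \<or> inv (x \<otimes> inv y) \<in> V" using V_val[of "x \<otimes> inv y"] c False by auto
  moreover have "inv (x \<otimes> inv y) = y \<otimes> inv x" using c False by (simp add: inv_mult_nonzero m_comm)
  ultimately show ?thesis
    using *[of x y] *[of y x] c False assms by (auto simp: a_comm)
qed

lemma unit_add_place:
  assumes "unit x" "y \<in> place_of R V"
  shows "unit (x \<oplus> y)"
proof (rule ccontr)
  assume n: "\<not> unit (x \<oplus> y)"
  have c: "x \<in> carrier R" "y \<in> carrier R" using assms unit_carrier place_carrier by auto
  have "x \<oplus> y \<in> V" using assms place_carrier V_ring(7) by (auto simp: unit_def)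
  then have "x \<oplus> y \<in> place_of R V" using n place_or_unit by auto
  moreover have "\<ominus> y \<in> place_of R V"
    using place_mult(1)[of "\<ominus> \<one>" y] assms V_ring(3,5) c by (simp add: l_minus)
  ultimately have "(x \<oplus> y) \<oplus> \<ominus> y \<in> place_of R V" by (rule place_add)
  moreover have "(x \<oplus> y) \<oplus> \<ominus> y = x" using c by algebra
  ultimately show False using assms(1) place_not_unit by auto
qed

lemma place_pow:
  assumes "x \<in> place_of R V" "0 < n"
  shows "x [^] (n::nat) \<in> place_of R V"
proof -
  obtain k where n: "n = Suc k" using assms(2) gr0_implies_Suc by blast
  have "x [^] k \<in> V" for k :: nat using assms place_carrier V_ring(3,6) by (induct k) auto
  then show ?thesis using place_mult(1) assms(1) n by simp
qed

text \<open>Valuation rings are integrally closed, here for coefficients in a field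
  \<open>E\<close>: if \<open>x\<close> were outside \<open>V\<close>, its inverse \<open>y\<close>
  would lie in \<open>V\<close>, and \<open>E[y]\<close>, a field because \<open>y\<close> is
  algebraic, would contain \<open>x\<close> and lie in \<open>V\<close>.\<close>

lemma algebraic_in_V:
  assumes "subfield E R" "E \<subseteq> V" "x \<in> carrier R" "algebraic E x"
  shows "x \<in> V"
proof (rule ccontr)
  assume n: "x \<notin> V"
  then have nz: "x \<noteq> \<zero>" using V_ring(2) by auto
  let ?y = "inv x"
  have y: "?y \<in> carrier R" "?y \<noteq> \<zero>" "?y \<in> V" using assms nz V_val n by auto
  have "algebraic E ?y"
    using subfield_m_inv(1)[OF subfield_of_algebraics[OF assms(1)], of x] assms nz by (auto simp: over_def)
  then have sf: "subfield (simple_extension E ?y) R"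
    using simple_extension_is_subfield[OF assms(1) y(1)] by (simp add: over_def)
  have "?y \<in> simple_extension E ?y" using simple_extension_mem subfieldE(1)[OF assms(1)] y by auto
  then have "inv ?y \<in> simple_extension E ?y" using subfield_m_inv(1)[OF sf, of ?y] y by auto
  moreover have "simple_extension E ?y \<subseteq> V"
    using simple_extension_subring_incl[OF V_subring assms(2) y(3)] .
  ultimately show False using n nz assms(3) by auto
qed

lemma algebraic_unit:
  assumes "subfield E R" "E \<subseteq> V" "x \<in> carrier R" "algebraic E x" "x \<noteq> \<zero>"
  shows "unit x"
proof -
  have "algebraic E (inv x)"
    using subfield_m_inv(1)[OF subfield_of_algebraics[OF assms(1)], of x] assms by (auto simp: over_def)
  then show ?thesis using algebraic_in_V[OF assms(1,2)] assms by (auto simp: unit_def)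
qed

lemma field_unit: "subfield E R \<Longrightarrow> E \<subseteq> V \<Longrightarrow> x \<in> E \<Longrightarrow> x \<noteq> \<zero> \<Longrightarrow> unit x"
  using subfield_m_inv(1)[of E x] by (auto simp: unit_def)

text \<open>Nonzero constants are units and \<open>g\<close> is a non-unit, so the lowest nonzero
  coefficient decides the value. In Horner form: either the constant term is nonzero and the element
  is a unit, or a factor \<open>g\<close> splits off.\<close>

lemma polynomial_in_place_element:
  assumes "subfield C R" "C \<subseteq> V" "g \<in> place_of R V" "g \<noteq> \<zero>"
    and "a \<in> simple_extension C g" "a \<noteq> \<zero>"
  shows "\<exists>j u. unit u \<and> a = g [^] (j::nat) \<otimes> u"
  using assms(5,6)
proof (induct a rule: simple_extension.induct)
  case (lin k1 k2)
  have gc: "g \<in> carrier R" "g \<in> V" using assms(3) place_carrier by auto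
  have AV: "simple_extension C g \<subseteq> V" using simple_extension_subring_incl[OF V_subring assms(2) gc(2)] .
  have k: "k1 \<in> V" "k1 \<in> carrier R" "k2 \<in> V" "k2 \<in> carrier R" using lin AV assms(2) V_carrier by auto
  show ?case
  proof (cases "k2 = \<zero>")
    case True
    then have "k1 \<noteq> \<zero>" using lin k gc by auto
    then obtain j u where "unit u" "k1 = g [^] (j::nat) \<otimes> u" using lin(2) by blast
    then have "k1 \<otimes> g \<oplus> k2 = g [^] Suc j \<otimes> u" using True gc k unit_carrier by (simp add: m_ac)
    then show ?thesis using \<open>unit u\<close> by blast
  next
    case False
    then have "unit k2" using field_unit[OF assms(1,2)] lin by auto
    then have "unit (k2 \<oplus> k1 \<otimes> g)" using unit_add_place place_mult assms(3) k by auto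
    moreover have "k1 \<otimes> g \<oplus> k2 = g [^] (0::nat) \<otimes> (k2 \<oplus> k1 \<otimes> g)" using k gc by (simp add: a_comm)
    ultimately show ?thesis by blast
  qed
qed simp

text \<open>On the field generated by \<open>C\<close> and \<open>g\<close> every value is an
  integral multiple of that of \<open>g\<close>. The negative power is moved to the left so that
  natural exponents suffice.\<close>

lemma generated_in_place_element:
  assumes "subfield C R" "C \<subseteq> V" "g \<in> place_of R V" "g \<noteq> \<zero>"
    and "y \<in> generate_field R (insert g C)" "y \<noteq> \<zero>"
  shows "\<exists>i j u. unit u \<and> y \<otimes> g [^] (i::nat) = g [^] (j::nat) \<otimes> u"
proof -
  have gc: "g \<in> carrier R" "g \<in> V" using assms(3) place_carrier by auto
  have AV: "simple_extension C g \<subseteq> V" using simple_extension_subring_incl[OF V_subring assms(2) gc(2)] .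
  obtain a b where ab: "a \<in> simple_extension C g" "b \<in> simple_extension C g" "b \<noteq> \<zero>" "y = a \<otimes> inv b"
    using generate_field_insert_fraction[OF assms(1) gc(1) assms(5)] by auto
  have c: "a \<in> carrier R" "b \<in> carrier R" using ab AV V_carrier by auto
  have "a \<noteq> \<zero>" using ab assms(6) c by auto
  obtain j u where j: "unit u" "a = g [^] (j::nat) \<otimes> u"
    using polynomial_in_place_element[OF assms(1-4) ab(1) \<open>a \<noteq> \<zero>\<close>] by auto
  obtain i w where i: "unit w" "b = g [^] (i::nat) \<otimes> w"
    using polynomial_in_place_element[OF assms(1-4) ab(2,3)] by auto
  have wc: "w \<in> carrier R" "w \<noteq> \<zero>" "u \<in> carrier R" using i j unit_carrier by auto
  have gi: "g [^] i \<in> carrier R" "g [^] i \<noteq> \<zero>" using gc assms(4) by auto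
  have "inv b \<otimes> g [^] i = inv w"
    unfolding i(2) using gi wc by (simp add: inv_mult_nonzero m_ac)
  then have "y \<otimes> g [^] i = g [^] j \<otimes> (u \<otimes> inv w)"
    using ab c j wc gc by (simp add: m_assoc)
  then show ?thesis using unit_mult[OF j(1) unit_inv[OF i(1)]] by blast
qed

end

lemma valuation_ringD:
  assumes "field R" "valuation_ring R F (carrier R) V"
  shows "valued_ring R V" "F \<subseteq> V" "V \<noteq> carrier R"
  using assms by (auto simp: valuation_ring_def valued_ring_def valued_ring_axioms_def)

subsection \<open>Existence of valuation rings\<close>

text \<open>Polynomials in \<open>x\<close> of degree at most \<open>n\<close> with all coefficients
  in the ideal \<open>aV\<close>, used for \<open>x\<close> and for its inverse. The element of
  interest is 1: its membership is the obstruction to adjoining \<open>x\<close> to \<open>V\<close>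
  without also adjoining the inverse of \<open>a\<close>.\<close>

inductive_set (in ring) laurent_part :: "'a set \<Rightarrow> 'a \<Rightarrow> 'a \<Rightarrow> nat \<Rightarrow> 'a set" for V a x n where
  zero: "\<zero> \<in> laurent_part V a x n"
| add: "\<lbrakk>w \<in> laurent_part V a x n; c \<in> V; i \<le> n\<rbrakk> \<Longrightarrow> w \<oplus> a \<otimes> c \<otimes> x [^] i \<in> laurent_part V a x n"

text \<open>The situation after Zorn's lemma in Chevalley's extension theorem: \<open>V\<close> is
  maximal among the subrings that omit the inverse of \<open>a\<close>, and is to be recognised as a
  valuation ring.\<close>

locale subring_excluding = field R for R (structure) +
  fixes V a
  assumes V: "subring V R" and a: "a \<in> V" "a \<noteq> \<zero>" "inv a \<notin> V"
    and maximal: "\<And>V'. subring V' R \<Longrightarrow> V \<subseteq> V' \<Longrightarrow> inv a \<notin> V' \<Longrightarrow> V' = V"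
begin

lemmas V_ring = subringE[OF V]

lemma V_carrier: "x \<in> V \<Longrightarrow> x \<in> carrier R" using V_ring(1) by auto

lemma extension_contains:
  assumes "x \<in> carrier R" "x \<notin> V"
  shows "inv a \<in> simple_extension V x"
proof (rule ccontr)
  assume "inv a \<notin> simple_extension V x"
  then have "simple_extension V x = V"
    using maximal[OF simple_extension_is_subring[OF V assms(1)]] simple_extension_incl[OF V_ring(1) assms(1)] by simp
  then show False using simple_extension_mem[OF V assms(1)] assms(2) by simp
qed

lemma one_minus_nonzero:
  assumes "c \<in> V"
  shows "\<one> \<ominus> a \<otimes> c \<noteq> \<zero>"
proof
  assume z: "\<one> \<ominus> a \<otimes> c = \<zero>"
  then have "a \<otimes> c = \<one>" using V_carrier a assms by auto
  then have "inv a = c" using comm_inv_char[of a c] V_carrier a assms by simp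
  then show False using a assms by simp
qed

text \<open>Maximality makes \<open>aV\<close> behave as if inside the maximal ideal of a local
  ring. Were the inverse of \<open>d = 1 - ac\<close> outside \<open>V\<close>, adjoining it would
  produce \<open>inv a\<close>. Clearing denominators, \<open>inv a d^k\<close> lies in
  \<open>V\<close>; since \<open>d^k\<close> is again of the form \<open>1 - ac'\<close>, so would
  \<open>inv a\<close> itself.\<close>

lemma inv_one_minus:
  assumes c: "c \<in> V"
  shows "inv (\<one> \<ominus> a \<otimes> c) \<in> V"
proof (rule ccontr)
  let ?d = "\<one> \<ominus> a \<otimes> c"
  assume n: "inv ?d \<notin> V"
  have ac: "a \<in> carrier R" "c \<in> carrier R" using a assms V_carrier by auto
  have d: "?d \<in> carrier R" "?d \<noteq> \<zero>" using ac one_minus_nonzero[OF c] by auto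
  have dV: "?d \<in> V" using a(1) c V_ring by (simp add: minus_eq)
  have "\<exists>k::nat. y \<otimes> ?d [^] k \<in> V \<and> y \<in> carrier R" if "y \<in> simple_extension V (inv ?d)" for y
    using that
  proof (induct y rule: simple_extension.induct)
    case zero
    then show ?case using V_ring(2) d by simp
  next
    case (lin k1 k2)
    then obtain k :: nat where k: "k1 \<otimes> ?d [^] k \<in> V" "k1 \<in> carrier R" by auto
    have k2: "k2 \<in> carrier R" using lin V_carrier by auto
    have pw: "?d [^] j \<in> V" for j :: nat using dV V_ring(3,6) by (induct j) auto
    have "(k1 \<otimes> inv ?d \<oplus> k2) \<otimes> ?d [^] Suc k = k1 \<otimes> ?d [^] k \<oplus> k2 \<otimes> ?d [^] Suc k"
    proof -
      have "(k1 \<otimes> i \<oplus> k2) \<otimes> (P \<otimes> D) = k1 \<otimes> P \<otimes> (D \<otimes> i) \<oplus> k2 \<otimes> (P \<otimes> D)"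
        if "i \<in> carrier R" "P \<in> carrier R" "D \<in> carrier R" for i P D using that k k2 by algebra
      from this[of "inv ?d" "?d [^] k" ?d] show ?thesis using d k by simp
    qed
    moreover have "k1 \<otimes> ?d [^] k \<oplus> k2 \<otimes> ?d [^] Suc k \<in> V" using k lin pw[of "Suc k"] by (auto intro!: V_ring(6,7))
    ultimately show ?case using k k2 d by (metis m_closed a_closed inv_nonzero(1))
  qed
  from this[OF extension_contains[OF inv_nonzero(1)[OF d] n]]
  obtain k :: nat where k: "inv a \<otimes> ?d [^] k \<in> V" by auto
  have "\<exists>c'\<in>V. ?d [^] k = \<one> \<ominus> a \<otimes> c'" for k :: nat
  proof (induct k)
    case 0
    then show ?case using V_ring(2) ac by (intro bexI[of _ \<zero>]) (auto simp: minus_eq)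
  next
    case (Suc k)
    then obtain c' where c': "c' \<in> V" "?d [^] k = \<one> \<ominus> a \<otimes> c'" by auto
    have c'c: "c' \<in> carrier R" using c' V_carrier by auto
    have "(\<one> \<ominus> a \<otimes> c') \<otimes> (\<one> \<ominus> a \<otimes> c) = \<one> \<ominus> a \<otimes> (c \<oplus> c' \<oplus> \<ominus> (a \<otimes> c' \<otimes> c))"
      using ac c'c by algebra
    moreover have "c \<oplus> c' \<oplus> \<ominus> (a \<otimes> c' \<otimes> c) \<in> V" using c c' a by (auto intro!: V_ring(5-7))
    ultimately show ?case using c' by auto
  qed
  then obtain c' where c': "c' \<in> V" "?d [^] k = \<one> \<ominus> a \<otimes> c'" by blast
  have c'c: "c' \<in> carrier R" using c' V_carrier by auto
  have eq: "inv a = inv a \<otimes> ?d [^] k \<oplus> c'"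
  proof -
    have "i \<otimes> (\<one> \<ominus> a \<otimes> c') \<oplus> c' = i \<oplus> (c' \<ominus> (i \<otimes> a) \<otimes> c')" if "i \<in> carrier R" for i
      using that ac c'c by algebra
    from this[of "inv a"] show ?thesis using ac a c' c'c by (simp add: minus_eq r_neg)
  qed
  show False using V_ring(7)[OF k c'(1)] a(3) eq[symmetric] by simp
qed

lemma lp_closed: "w \<in> laurent_part V a x n \<Longrightarrow> x \<in> carrier R \<Longrightarrow> w \<in> carrier R"
  by (induct w rule: laurent_part.induct) (use a V_carrier in auto)

lemma lp_mono: "w \<in> laurent_part V a x n \<Longrightarrow> n \<le> n' \<Longrightarrow> w \<in> laurent_part V a x n'"
  by (induct w rule: laurent_part.induct) (auto intro: laurent_part.intros)

lemma lp_plus: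
  assumes "x \<in> carrier R" "w \<in> laurent_part V a x n" "w' \<in> laurent_part V a x n"
  shows "w \<oplus> w' \<in> laurent_part V a x n"
  using assms(3)
proof (induct w' rule: laurent_part.induct)
  case zero
  then show ?case using lp_closed assms by simp
next
  case (add w' c i)
  have "w \<oplus> (w' \<oplus> a \<otimes> c \<otimes> x [^] i) = (w \<oplus> w') \<oplus> a \<otimes> c \<otimes> x [^] i"
    using lp_closed assms add a V_carrier by (simp add: a_assoc)
  then show ?case using add by (auto intro: laurent_part.add)
qed

lemma lp_scale_shift:
  assumes "x \<in> carrier R" "w \<in> laurent_part V a x n" "b \<in> V"
  shows "b \<otimes> x [^] l \<otimes> w \<in> laurent_part V a x (n + l)"
  using assms(2)
proof (induct w rule: laurent_part.induct)
  case zero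
  then show ?case using assms V_carrier by (simp add: laurent_part.zero)
next
  case (add w c i)
  have bc: "b \<in> carrier R" "c \<in> carrier R" "a \<in> carrier R" "b \<otimes> c \<in> V"
    using assms add a V_carrier V_ring(6) by auto
  have wc: "w \<in> carrier R" using add lp_closed assms by auto
  have "b \<otimes> xx \<otimes> (w \<oplus> a \<otimes> c \<otimes> yy) = b \<otimes> xx \<otimes> w \<oplus> a \<otimes> (b \<otimes> c) \<otimes> (yy \<otimes> xx)"
    if "xx \<in> carrier R" "yy \<in> carrier R" for xx yy using that bc wc by algebra
  from this[of "x [^] l" "x [^] i"]
  have "b \<otimes> x [^] l \<otimes> (w \<oplus> a \<otimes> c \<otimes> x [^] i) = b \<otimes> x [^] l \<otimes> w \<oplus> a \<otimes> (b \<otimes> c) \<otimes> x [^] (i + l)"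
    using assms by (simp add: nat_pow_mult)
  then show ?case using add bc laurent_part.add by auto
qed

lemma lp_top:
  assumes "x \<in> carrier R" "w \<in> laurent_part V a x (Suc n)"
  shows "\<exists>w0\<in>laurent_part V a x n. \<exists>c\<in>V. w = w0 \<oplus> a \<otimes> c \<otimes> x [^] Suc n"
  using assms(2)
proof (induct w rule: laurent_part.induct)
  case zero
  then show ?case using V_ring(2) a V_carrier assms laurent_part.zero[of V a x n]
    by (intro bexI[of _ \<zero>]) auto
next
  case (add w c i)
  then obtain w0 c0 where w0: "w0 \<in> laurent_part V a x n" "c0 \<in> V" "w = w0 \<oplus> a \<otimes> c0 \<otimes> x [^] Suc n" by auto
  have cc: "w0 \<in> carrier R" "c0 \<in> carrier R" "c \<in> carrier R" "a \<in> carrier R"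
    using w0 add a V_carrier lp_closed assms by auto
  show ?case
  proof (cases "i = Suc n")
    case True
    have "w0 \<oplus> a \<otimes> c0 \<otimes> xx \<oplus> a \<otimes> c \<otimes> xx = w0 \<oplus> a \<otimes> (c0 \<oplus> c) \<otimes> xx" if "xx \<in> carrier R" for xx
      using that cc by algebra
    then show ?thesis using w0 add True V_ring(7) assms by (metis nat_pow_closed)
  next
    case False
    then have i: "i \<le> n" using add by auto
    have "w0 \<oplus> a \<otimes> c0 \<otimes> xx \<oplus> a \<otimes> c \<otimes> yy = (w0 \<oplus> a \<otimes> c \<otimes> yy) \<oplus> a \<otimes> c0 \<otimes> xx"
      if "xx \<in> carrier R" "yy \<in> carrier R" for xx yy
      using that cc by algebra
    then have "w \<oplus> a \<otimes> c \<otimes> x [^] i = (w0 \<oplus> a \<otimes> c \<otimes> x [^] i) \<oplus> a \<otimes> c0 \<otimes> x [^] Suc n"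
      using w0 assms by (metis nat_pow_closed)
    then show ?thesis using w0 laurent_part.add[OF w0(1) _ i] add by blast
  qed
qed

text \<open>Multiplying by the full power of \<open>x\<close> turns a polynomial in the inverse of
  \<open>x\<close> into one in \<open>x\<close>. Only the constant term \<open>ac\<close> would
  reach the top degree, and it is subtracted beforehand.\<close>

lemma lp_reverse:
  assumes "x \<in> carrier R" "x \<noteq> \<zero>" "w \<in> laurent_part V a (inv x) (Suc m)"
  shows "\<exists>c\<in>V. x [^] Suc m \<otimes> (w \<ominus> a \<otimes> c) \<in> laurent_part V a x m"
  using assms(3)
proof (induct w rule: laurent_part.induct)
  case zero
  show ?case using V_ring(2) a V_carrier assms laurent_part.zero[of V a x m]
    by (intro bexI[of _ \<zero>]) (auto simp: minus_eq)
next
  case (add w c i)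
  then obtain c0 where c0: "c0 \<in> V" "x [^] Suc m \<otimes> (w \<ominus> a \<otimes> c0) \<in> laurent_part V a x m" by auto
  have cc: "w \<in> carrier R" "c0 \<in> carrier R" "c \<in> carrier R" "a \<in> carrier R" "inv x \<in> carrier R"
    using c0 add a V_carrier lp_closed assms by auto
  show ?case
  proof (cases i)
    case 0
    have "w \<oplus> a \<otimes> c \<otimes> \<one> \<ominus> a \<otimes> (c0 \<oplus> c) = w \<ominus> a \<otimes> c0" using cc by algebra
    then show ?thesis using 0 c0 V_ring(7)[of c0 c] add by (intro bexI[of _ "c0 \<oplus> c"]) auto
  next
    case (Suc k)
    have k: "m - k \<le> m" "k \<le> m" using add Suc by auto
    have xi: "x [^] Suc m \<otimes> inv x [^] i = x [^] (m - k)"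
    proof -
      have "Suc m = (m - k) + i" using k Suc by auto
      then have "x [^] Suc m = x [^] (m - k) \<otimes> x [^] i" using assms by (metis nat_pow_mult)
      moreover have "x [^] i \<otimes> inv x [^] i = \<one>" using assms cc by (simp flip: pow_mult_distrib[OF m_comm])
      ultimately show ?thesis using assms cc by (simp add: m_assoc)
    qed
    have "xx \<otimes> (w \<oplus> a \<otimes> c \<otimes> yy \<ominus> a \<otimes> c0) = xx \<otimes> (w \<ominus> a \<otimes> c0) \<oplus> a \<otimes> c \<otimes> (xx \<otimes> yy)"
      if "xx \<in> carrier R" "yy \<in> carrier R" for xx yy using that cc by algebra
    from this[of "x [^] Suc m" "inv x [^] i"]
    have "x [^] Suc m \<otimes> (w \<oplus> a \<otimes> c \<otimes> inv x [^] i \<ominus> a \<otimes> c0)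
        = x [^] Suc m \<otimes> (w \<ominus> a \<otimes> c0) \<oplus> a \<otimes> c \<otimes> x [^] (m - k)"
      using assms cc xi by simp
    then show ?thesis using c0 laurent_part.add[OF c0(2) add(3) k(1)] by (intro bexI[of _ c0]) auto
  qed
qed

lemma lp_one:
  assumes "x \<in> carrier R" "x \<notin> V"
  shows "\<exists>n. \<one> \<in> laurent_part V a x (Suc n)"
proof -
  have ac: "a \<in> carrier R" using a V_carrier by auto
  have "\<exists>n. a \<otimes> y \<in> laurent_part V a x n \<and> y \<in> carrier R" if "y \<in> simple_extension V x" for y
    using that
  proof (induct y rule: simple_extension.induct)
    case zero
    then show ?case using laurent_part.zero ac by auto
  next
    case (lin k1 k2)
    then obtain n where n: "a \<otimes> k1 \<in> laurent_part V a x n" "k1 \<in> carrier R" by auto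
    have k2: "k2 \<in> carrier R" using lin V_carrier by auto
    have "\<one> \<otimes> x [^] (1::nat) \<otimes> (a \<otimes> k1) \<in> laurent_part V a x (n + 1)"
      using lp_scale_shift[OF assms(1) n(1) V_ring(3)] .
    then have "\<one> \<otimes> x [^] (1::nat) \<otimes> (a \<otimes> k1) \<oplus> a \<otimes> k2 \<otimes> x [^] (0::nat) \<in> laurent_part V a x (n + 1)"
      using lin by (intro laurent_part.add) auto
    moreover have "\<one> \<otimes> x [^] (1::nat) \<otimes> (a \<otimes> k1) \<oplus> a \<otimes> k2 \<otimes> x [^] (0::nat) = a \<otimes> (k1 \<otimes> x \<oplus> k2)"
      using assms n k2 ac by (simp add: r_distr m_ac)
    ultimately show ?case using n k2 assms by (intro exI[of _ "n + 1"]) auto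
  qed
  from this[OF extension_contains[OF assms]] obtain n where "\<one> \<in> laurent_part V a x n" using a ac by auto
  then show ?thesis using lp_mono[of _ _ n "Suc n"] by auto
qed

text \<open>The relation for the inverse expresses \<open>x^(m+1)\<close> through lower powers with
  coefficients in \<open>aV\<close>, because \<open>1 - ac\<close> is invertible in
  \<open>V\<close>. Shifted by \<open>n - m\<close>, it replaces the top term of the relation for
  \<open>x\<close>.\<close>

lemma lp_reduce:
  assumes "x \<in> carrier R" "x \<noteq> \<zero>" "\<one> \<in> laurent_part V a x (Suc n)" "\<one> \<in> laurent_part V a (inv x) (Suc m)" "m \<le> n"
  shows "\<one> \<in> laurent_part V a x n"
proof -
  obtain c where c: "c \<in> V" "x [^] Suc m \<otimes> (\<one> \<ominus> a \<otimes> c) \<in> laurent_part V a x m"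
    using lp_reverse[OF assms(1,2,4)] by auto
  let ?d = "\<one> \<ominus> a \<otimes> c"
  have d: "?d \<in> carrier R" "?d \<noteq> \<zero>" "inv ?d \<in> V" using c a V_carrier one_minus_nonzero inv_one_minus by auto
  obtain w0 c0 where w0: "w0 \<in> laurent_part V a x n" "c0 \<in> V" "\<one> = w0 \<oplus> a \<otimes> c0 \<otimes> x [^] Suc n"
    using lp_top[OF assms(1,3)] by auto
  have cc: "c0 \<in> carrier R" "a \<in> carrier R" using w0 a V_carrier by auto
  have "inv ?d \<otimes> (a \<otimes> c0) \<in> V" using d w0 a V_ring(6) by auto
  from lp_scale_shift[OF assms(1) c(2) this, of "n - m"]
  have "inv ?d \<otimes> (a \<otimes> c0) \<otimes> x [^] (n - m) \<otimes> (x [^] Suc m \<otimes> ?d) \<in> laurent_part V a x n" using assms(5) by simp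
  moreover have "inv ?d \<otimes> (a \<otimes> c0) \<otimes> x [^] (n - m) \<otimes> (x [^] Suc m \<otimes> ?d) = a \<otimes> c0 \<otimes> x [^] Suc n"
  proof -
    have "I \<otimes> (a \<otimes> c0) \<otimes> xx \<otimes> (yy \<otimes> D) = (a \<otimes> c0) \<otimes> (xx \<otimes> yy) \<otimes> (I \<otimes> D)"
      if "I \<in> carrier R" "xx \<in> carrier R" "yy \<in> carrier R" "D \<in> carrier R" for I xx yy D
      using that cc by algebra
    from this[of "inv ?d" "x [^] (n - m)" "x [^] Suc m" ?d]
    have "inv ?d \<otimes> (a \<otimes> c0) \<otimes> x [^] (n - m) \<otimes> (x [^] Suc m \<otimes> ?d) = a \<otimes> c0 \<otimes> (x [^] (n - m) \<otimes> x [^] Suc m)"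
      using d assms cc by simp
    also have "x [^] (n - m) \<otimes> x [^] Suc m = x [^] Suc n" using assms by (subst nat_pow_mult) auto
    finally show ?thesis .
  qed
  ultimately show ?thesis using lp_plus[OF assms(1) w0(1)] w0(3) by simp
qed

text \<open>If neither \<open>x\<close> nor its inverse lay in \<open>V\<close>, each would satisfy
  a relation expressing 1. When both relations have minimal degree, the longer one can still be
  shortened, a contradiction; degree 0 is excluded because it would make \<open>a\<close> invertible
  in \<open>V\<close>.\<close>

lemma is_valuation:
  assumes "x \<in> carrier R" "x \<noteq> \<zero>"
  shows "x \<in> V \<or> inv x \<in> V"
proof (rule ccontr)
  assume "\<not> ?thesis"
  then have n: "x \<notin> V" "inv x \<notin> V" by auto
  have ix: "inv x \<in> carrier R" "inv x \<noteq> \<zero>" "inv (inv x) = x" using assms by auto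
  have lp0: "\<one> \<notin> laurent_part V a y 0" if y: "y \<in> carrier R" for y
  proof
    assume "\<one> \<in> laurent_part V a y 0"
    moreover have "\<exists>c\<in>V. w = a \<otimes> c" if "w \<in> laurent_part V a y 0" for w
      using that
    proof (induct w rule: laurent_part.induct)
      case zero
      then show ?case using V_ring(2) a V_carrier by (intro bexI[of _ \<zero>]) auto
    next
      case (add w c i)
      then obtain c0 where "c0 \<in> V" "w = a \<otimes> c0" by auto
      then show ?case using add V_carrier a V_ring(7) y by (intro bexI[of _ "c0 \<oplus> c"]) (auto simp: r_distr)
    qed
    ultimately obtain c where "c \<in> V" "a \<otimes> c = \<one>" by force
    then show False using comm_inv_char[of a c] V_carrier a by auto
  qed
  define N where "N = (LEAST k. \<one> \<in> laurent_part V a x (Suc k))"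
  define M where "M = (LEAST k. \<one> \<in> laurent_part V a (inv x) (Suc k))"
  have N: "\<one> \<in> laurent_part V a x (Suc N)" unfolding N_def using lp_one[OF assms(1) n(1)] by (rule LeastI_ex)
  have M: "\<one> \<in> laurent_part V a (inv x) (Suc M)" unfolding M_def using lp_one[OF ix(1) n(2)] by (rule LeastI_ex)
  show False
  proof (cases "M \<le> N")
    case True
    then have *: "\<one> \<in> laurent_part V a x N" using lp_reduce[OF assms N M] by simp
    then obtain k where "N = Suc k" using lp0[OF assms(1)] by (cases N) auto
    then show False using * not_less_Least[of k "\<lambda>k. \<one> \<in> laurent_part V a x (Suc k)"] by (simp add: N_def)
  next
    case False
    then have *: "\<one> \<in> laurent_part V a (inv x) M" using lp_reduce[OF ix(1,2) M] N ix by simp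
    then obtain k where "M = Suc k" using lp0[OF ix(1)] by (cases M) auto
    then show False using * not_less_Least[of k "\<lambda>k. \<one> \<in> laurent_part V a (inv x) (Suc k)"] by (simp add: M_def)
  qed
qed

end

text \<open>Chevalley's theorem. Zorn's lemma is applied to the subrings above \<open>A\<close> that
  omit \<open>inv a\<close>, rather than to pairs of a ring and a prime ideal; the omitted inverse
  is what places \<open>a\<close> in the maximal ideal.\<close>

theorem (in field) exists_valuation_ring:
  assumes "subfield F R" "subring A R" "F \<subseteq> A" "a \<in> A" "a \<noteq> \<zero>" "inv a \<notin> A"
  shows "\<exists>V. valuation_ring R F (carrier R) V \<and> A \<subseteq> V \<and> a \<in> place_of R V"
proof -
  let ?S = "{V. subring V R \<and> A \<subseteq> V \<and> inv a \<notin> V}"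
  have "\<exists>M\<in>?S. \<forall>xx\<in>?S. M \<subseteq> xx \<longrightarrow> xx = M"
  proof (rule subset_Zorn_nonempty)
    show "?S \<noteq> {}" using assms by auto
    fix C assume C: "C \<noteq> {}" "subset.chain ?S C"
    then have CS: "C \<subseteq> ?S" by (simp add: subset.chain_def)
    have dir: "\<exists>Z\<in>C. x \<in> Z \<and> y \<in> Z" if xy: "x \<in> \<Union>C" "y \<in> \<Union>C" for x y
    proof -
      obtain xx yy where "xx \<in> C" "x \<in> xx" "yy \<in> C" "y \<in> yy" using xy by auto
      moreover have "xx \<subseteq> yy \<or> yy \<subseteq> xx" using C calculation by (auto simp: subset_chain_def)
      ultimately show ?thesis by auto
    qed
    have "subring (\<Union>C) R"
    proof (rule subringI)
      show "\<Union>C \<subseteq> carrier R" using CS subringE(1) by blast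
      show "\<one> \<in> \<Union>C" using CS C(1) subringE(3) by blast
      fix h1 h2 assume h: "h1 \<in> \<Union>C" "h2 \<in> \<Union>C"
      obtain Z where Z: "Z \<in> C" "h1 \<in> Z" "h2 \<in> Z" using dir[OF h] by auto
      have "subring Z R" using Z CS by auto
      then have "\<ominus> h1 \<in> Z" "h1 \<otimes> h2 \<in> Z" "h1 \<oplus> h2 \<in> Z" using Z by (simp_all add: subringE(5-7))
      then show "\<ominus> h1 \<in> \<Union>C" "h1 \<otimes> h2 \<in> \<Union>C" "h1 \<oplus> h2 \<in> \<Union>C" using Z by auto
    qed
    then show "\<Union>C \<in> ?S" using CS C(1) by auto
  qed
  then obtain V where V: "V \<in> ?S" "\<And>xx. xx \<in> ?S \<Longrightarrow> V \<subseteq> xx \<Longrightarrow> xx = V" by auto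
  have V1: "subring V R" "A \<subseteq> V" "inv a \<notin> V" using V(1) by auto
  interpret subring_excluding R V a
  proof (intro subring_excluding.intro subring_excluding_axioms.intro field_axioms)
    show "subring V R" "a \<in> V" "a \<noteq> \<zero>" "inv a \<notin> V" using V1 assms(4,5) by auto
    show "V' = V" if "subring V' R" "V \<subseteq> V'" "inv a \<notin> V'" for V'
      using that V1(2) by (intro V(2)) auto
  qed
  have "a \<notin> F" using subfield_m_inv(1)[OF assms(1), of a] assms by auto
  then have "F \<subset> V" using V1(2) assms(3,4) by auto
  moreover have "V \<subset> carrier R"
    using V1 assms(4,5) subringE(1)[OF V1(1)] subringE(1)[OF assms(2)] inv_nonzero(1)[of a] by auto
  ultimately show ?thesis
    using V1 is_valuation assms(4) by (intro exI[of _ V]) (auto simp: valuation_ring_def place_of_def)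
qed

subsection \<open>Valuation rings of function fields are discrete\<close>

context valued_ring
begin

text \<open>Equality of values before values exist. The classes of nonzero elements form the value
  group, which is first shown to be torsion modulo the powers of one element.\<close>

definition eqv where "eqv x y \<longleftrightarrow> (\<exists>u. unit u \<and> x = u \<otimes> y)"

lemma eqv_refl: "x \<in> carrier R \<Longrightarrow> eqv x x"
  unfolding eqv_def by (intro exI[of _ \<one>]) auto

lemma eqv_sym: "y \<in> carrier R \<Longrightarrow> eqv x y \<Longrightarrow> eqv y x"
proof -
  assume y: "y \<in> carrier R" and "eqv x y"
  then obtain u where u: "unit u" "x = u \<otimes> y" by (auto simp: eqv_def)
  then have "y = inv u \<otimes> x" using y unit_carrier[OF u(1)] by (simp add: m_assoc[symmetric])
  then show ?thesis using unit_inv[OF u(1)] by (auto simp: eqv_def)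
qed

lemma eqv_trans: "z \<in> carrier R \<Longrightarrow> eqv x y \<Longrightarrow> eqv y z \<Longrightarrow> eqv x z"
  unfolding eqv_def using unit_mult unit_carrier(1) m_assoc by metis

lemma eqv_mult:
  assumes "y \<in> carrier R" "y' \<in> carrier R" "eqv x y" "eqv x' y'"
  shows "eqv (x \<otimes> x') (y \<otimes> y')"
proof -
  obtain u u' where u: "unit u" "x = u \<otimes> y" "unit u'" "x' = u' \<otimes> y'" using assms by (auto simp: eqv_def)
  then have "x \<otimes> x' = (u \<otimes> u') \<otimes> (y \<otimes> y')" using assms unit_carrier by (simp add: m_ac)
  then show ?thesis using unit_mult u by (auto simp: eqv_def)
qed

lemma eqv_pow: "y \<in> carrier R \<Longrightarrow> eqv x y \<Longrightarrow> eqv (x [^] (n::nat)) (y [^] n)"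
  by (induct n) (auto intro: eqv_refl eqv_mult)

lemma eqv_cancel:
  assumes "x \<in> carrier R" "y \<in> carrier R" "z \<in> carrier R" "z \<noteq> \<zero>" "eqv (x \<otimes> z) (y \<otimes> z)"
  shows "eqv x y"
proof -
  obtain u where u: "unit u" "x \<otimes> z = u \<otimes> (y \<otimes> z)" using assms by (auto simp: eqv_def)
  then have "x \<otimes> z = (u \<otimes> y) \<otimes> z" using assms unit_carrier by (simp add: m_assoc)
  then have "x = u \<otimes> y" using m_rcancel[OF assms(4,3)] assms unit_carrier[OF u(1)] by auto
  then show ?thesis using u by (auto simp: eqv_def)
qed

lemma eqv_sum:
  assumes "x \<in> carrier R" "x \<noteq> \<zero>" "y \<in> carrier R" "y \<noteq> \<zero>"
  shows "eqv x y \<or> x \<oplus> y \<noteq> \<zero> \<and> (eqv (x \<oplus> y) x \<or> eqv (x \<oplus> y) y)"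
proof -
  have *: "eqv x y \<or> x \<oplus> y \<noteq> \<zero> \<and> eqv (x \<oplus> y) y"
    if q: "x \<otimes> inv y \<in> V" and xy: "x \<in> carrier R" "x \<noteq> \<zero>" "y \<in> carrier R" "y \<noteq> \<zero>" for x y
  proof (cases "unit (x \<otimes> inv y)")
    case True
    moreover have "x = x \<otimes> inv y \<otimes> y" using xy by (simp add: m_assoc)
    ultimately show ?thesis by (auto simp: eqv_def)
  next
    case False
    then have "unit (\<one> \<oplus> x \<otimes> inv y)" using place_or_unit[OF q] unit_add_place[OF unit_one] by blast
    moreover have "x \<oplus> y = (\<one> \<oplus> x \<otimes> inv y) \<otimes> y" using xy by (simp add: l_distr m_assoc a_comm)
    moreover from calculation have "x \<oplus> y \<noteq> \<zero>"
      using unit_carrier[OF calculation(1)] xy by simp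
    ultimately show ?thesis by (auto simp: eqv_def)
  qed
  have "x \<otimes> inv y \<in> V \<or> y \<otimes> inv x \<in> V"
    using V_val[of "x \<otimes> inv y"] assms by (auto simp: inv_mult_nonzero m_comm)
  then show ?thesis using *[of x y] *[of y x] assms eqv_sym[of x y] by (auto simp: a_comm)
qed

text \<open>In a vanishing sum, two nonzero terms must have the same value.\<close>

lemma combine_collision:
  assumes "length Ks = length Us" "set Ks \<subseteq> carrier R" "set Us \<subseteq> carrier R"
  shows "(\<exists>i j. i < j \<and> j < length Us \<and> Ks!i \<otimes> Us!i \<noteq> \<zero> \<and> Ks!j \<otimes> Us!j \<noteq> \<zero> \<and> eqv (Ks!i \<otimes> Us!i) (Ks!j \<otimes> Us!j))
    \<or> (\<forall>i<length Us. Ks!i \<otimes> Us!i = \<zero>) \<and> combine Ks Us = \<zero>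
    \<or> combine Ks Us \<noteq> \<zero> \<and> (\<exists>i<length Us. Ks!i \<otimes> Us!i \<noteq> \<zero> \<and> eqv (combine Ks Us) (Ks!i \<otimes> Us!i))"
  using assms
proof (induct Ks Us rule: list_induct2)
  case (Cons k Ks u Us)
  let ?z = "k \<otimes> u" and ?S = "combine Ks Us"
  have c: "k \<in> carrier R" "u \<in> carrier R" "?S \<in> carrier R" using Cons by auto
  have zc: "?z \<in> carrier R" using c by simp
  have tc: "Ks!i \<otimes> Us!i \<in> carrier R" if "i < length Us" for i using that Cons by (auto simp: subset_iff)
  have IH: "(\<exists>i j. i < j \<and> j < length Us \<and> Ks!i \<otimes> Us!i \<noteq> \<zero> \<and> Ks!j \<otimes> Us!j \<noteq> \<zero> \<and> eqv (Ks!i \<otimes> Us!i) (Ks!j \<otimes> Us!j))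
    \<or> (\<forall>i<length Us. Ks!i \<otimes> Us!i = \<zero>) \<and> combine Ks Us = \<zero>
    \<or> combine Ks Us \<noteq> \<zero> \<and> (\<exists>i<length Us. Ks!i \<otimes> Us!i \<noteq> \<zero> \<and> eqv (combine Ks Us) (Ks!i \<otimes> Us!i))"
    using Cons by auto
  let ?t = "\<lambda>i. (k#Ks)!i \<otimes> (u#Us)!i"
  have t0: "?t 0 = ?z" and tS: "\<And>i. ?t (Suc i) = Ks!i \<otimes> Us!i" by auto
  consider (a) i j where "i < j" "j < length Us" "Ks!i \<otimes> Us!i \<noteq> \<zero>" "Ks!j \<otimes> Us!j \<noteq> \<zero>" "eqv (Ks!i \<otimes> Us!i) (Ks!j \<otimes> Us!j)"
    | (b) "\<forall>i<length Us. Ks!i \<otimes> Us!i = \<zero>" "?S = \<zero>"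
    | (c) i where "?S \<noteq> \<zero>" "i < length Us" "Ks!i \<otimes> Us!i \<noteq> \<zero>" "eqv ?S (Ks!i \<otimes> Us!i)"
    using IH by blast
  then have "(\<exists>i j. i < j \<and> j < length (u#Us) \<and> ?t i \<noteq> \<zero> \<and> ?t j \<noteq> \<zero> \<and> eqv (?t i) (?t j))
    \<or> (\<forall>i<length (u#Us). ?t i = \<zero>) \<and> ?z \<oplus> ?S = \<zero>
    \<or> ?z \<oplus> ?S \<noteq> \<zero> \<and> (\<exists>i<length (u#Us). ?t i \<noteq> \<zero> \<and> eqv (?z \<oplus> ?S) (?t i))"
  proof cases
    case a
    then have "Suc i < Suc j \<and> Suc j < length (u#Us) \<and> ?t (Suc i) \<noteq> \<zero> \<and> ?t (Suc j) \<noteq> \<zero> \<and> eqv (?t (Suc i)) (?t (Suc j))"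
      by auto
    then show ?thesis by blast
  next
    case b
    show ?thesis
    proof (cases "?z = \<zero>")
      case True
      then have "\<forall>i<length (u#Us). ?t i = \<zero>" using b by (auto simp: less_Suc_eq_0_disj)
      then show ?thesis using b True by simp
    next
      case False
      then have "?z \<oplus> ?S \<noteq> \<zero> \<and> 0 < length (u#Us) \<and> ?t 0 \<noteq> \<zero> \<and> eqv (?z \<oplus> ?S) (?t 0)"
        using b eqv_refl zc by simp
      then show ?thesis by blast
    qed
  next
    case c
    note cc = c
    show ?thesis
    proof (cases "?z = \<zero>")
      case True
      then have "?z \<oplus> ?S \<noteq> \<zero> \<and> Suc i < length (u#Us) \<and> ?t (Suc i) \<noteq> \<zero> \<and> eqv (?z \<oplus> ?S) (?t (Suc i))"
        using cc \<open>?S \<in> carrier R\<close> by simp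
      then show ?thesis by blast
    next
      case False
      consider "eqv ?z ?S" | "?z \<oplus> ?S \<noteq> \<zero>" "eqv (?z \<oplus> ?S) ?z" | "?z \<oplus> ?S \<noteq> \<zero>" "eqv (?z \<oplus> ?S) ?S"
        using eqv_sum[OF zc False \<open>?S \<in> carrier R\<close> cc(1)] by blast
      then show ?thesis
      proof cases
        case 1
        then have "eqv (?t 0) (?t (Suc i))" using eqv_trans[OF tc[OF cc(2)] 1 cc(4)] by simp
        then have "0 < Suc i \<and> Suc i < length (u#Us) \<and> ?t 0 \<noteq> \<zero> \<and> ?t (Suc i) \<noteq> \<zero> \<and> eqv (?t 0) (?t (Suc i))"
          using cc False by simp
        then show ?thesis by blast
      next
        case 2
        then have "0 < length (u#Us) \<and> ?t 0 \<noteq> \<zero> \<and> eqv (?z \<oplus> ?S) (?t 0)" using False by simp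
        then show ?thesis using 2 by blast
      next
        case 3
        then have "Suc i < length (u#Us) \<and> ?t (Suc i) \<noteq> \<zero> \<and> eqv (?z \<oplus> ?S) (?t (Suc i))"
          using eqv_trans[OF tc[OF cc(2)] 3(2) cc(4)] cc by simp
        then show ?thesis using 3 by blast
      qed
    qed
  qed
  then show ?case by simp
qed simp

text \<open>The powers 1, x, ..., x^n are dependent over the field generated by \<open>F\<close> and
  \<open>g\<close>. In the vanishing combination two nonzero terms have equal value, and their
  coefficients have values of powers of \<open>g\<close>; hence so does the power of
  \<open>x\<close> whose exponent is the difference of the two positions.\<close>

lemma value_torsion:
  assumes F: "subfield F R" "F \<subseteq> V" and g: "g \<in> place_of R V" "g \<noteq> \<zero>"
    and dim: "dimension n (generate_field R (insert g F)) (carrier R)"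
    and x: "x \<in> carrier R" "x \<noteq> \<zero>"
  shows "\<exists>d a b. 0 < d \<and> d \<le> n \<and> eqv (x [^] (d::nat) \<otimes> g [^] (a::nat)) (g [^] (b::nat))"
proof -
  let ?E = "generate_field R (insert g F)"
  have gc: "g \<in> carrier R" using g place_carrier by auto
  have E: "subfield ?E R" using generate_field_is_subfield gc subfieldE(3)[OF F(1)] by auto
  \<comment> \<open>\<open>exp_base\<close> lists the powers in descending order, so position
    \<open>i\<close> holds exponent \<open>n - i\<close>.\<close>
  let ?U = "exp_base x (Suc n)"
  have U: "length ?U = Suc n" "\<And>i. i \<le> n \<Longrightarrow> ?U ! i = x [^] (n - i)"
    by (auto simp: exp_base_def rev_nth simp del: upt_Suc)
  have Uc: "set ?U \<subseteq> carrier R" using x by (auto simp: exp_base_def)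
  have "dependent ?E ?U" using independent_length_le_dimension[OF E dim, of ?U] U Uc by auto
  then obtain Ks where K: "length Ks = length ?U" "combine Ks ?U = \<zero>" "set Ks \<subseteq> ?E" "set Ks \<noteq> {\<zero>}"
    using dependent_imp_non_trivial_combine[OF E Uc] by auto
  have Kc: "set Ks \<subseteq> carrier R" using K(3) subfieldE(3)[OF E] by auto
  have "Ks \<noteq> []" using K U by auto
  then have "set Ks \<noteq> {}" by simp
  then obtain k where k: "k \<in> set Ks" "k \<noteq> \<zero>" using K(4) by (metis insertI1 singletonI subsetI subset_singleton_iff)
  then obtain i0 where i0: "i0 < length Ks" "Ks ! i0 \<noteq> \<zero>" by (metis in_set_conv_nth)
  have "Ks!i0 \<in> carrier R" using Kc nth_mem[OF i0(1)] by blast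
  then have nz: "Ks!i0 \<otimes> ?U!i0 \<noteq> \<zero>" using i0 U K(1) x by auto
  obtain i j where ij: "i < j" "j < length ?U" "Ks!i \<otimes> ?U!i \<noteq> \<zero>" "Ks!j \<otimes> ?U!j \<noteq> \<zero>" "eqv (Ks!i \<otimes> ?U!i) (Ks!j \<otimes> ?U!j)"
    using combine_collision[OF K(1) Kc Uc] K(1,2) nz i0 by metis
  have len: "i \<le> n" "j \<le> n" using ij U by auto
  let ?k = "Ks!i" and ?l = "Ks!j"
  have kl: "?k \<in> ?E" "?l \<in> ?E" using K ij U len by (auto simp: subset_iff)
  have klc: "?k \<in> carrier R" "?l \<in> carrier R" using kl subfieldE(3)[OF E] by auto
  have klz: "?k \<noteq> \<zero>" "?l \<noteq> \<zero>" using ij klc U len x by auto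
  obtain a b u where 1: "unit u" "?k \<otimes> g [^] (a::nat) = g [^] (b::nat) \<otimes> u"
    using generated_in_place_element[OF F g kl(1) klz(1)] by auto
  obtain a' b' u' where 2: "unit u'" "?l \<otimes> g [^] (a'::nat) = g [^] (b'::nat) \<otimes> u'"
    using generated_in_place_element[OF F g kl(2) klz(2)] by auto
  have e1: "eqv (g [^] b) (?k \<otimes> g [^] a)"
    using 1 gc klc unit_carrier eqv_sym[of "g [^] b" "?k \<otimes> g [^] a"] by (auto simp: eqv_def m_comm)
  have e2: "eqv (?l \<otimes> g [^] a') (g [^] b')" using 2 gc klc unit_carrier by (auto simp: eqv_def m_comm)
  let ?d = "j - i"
  have "x [^] (n - i) = x [^] ?d \<otimes> x [^] (n - j)" using x ij len by (subst nat_pow_mult) auto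
  then have "eqv (?k \<otimes> x [^] ?d \<otimes> x [^] (n - j)) (?l \<otimes> x [^] (n - j))"
    using ij U len x klc by (simp add: m_assoc)
  then have e3: "eqv (?k \<otimes> x [^] ?d) ?l" using eqv_cancel[of "?k \<otimes> x [^] ?d" ?l "x [^] (n - j)"] x klc by simp
  have gp: "g [^] (c::nat) \<in> carrier R" for c using gc by simp
  have "eqv (x [^] ?d \<otimes> g [^] a' \<otimes> g [^] b) (x [^] ?d \<otimes> g [^] a' \<otimes> (?k \<otimes> g [^] a))"
    using e1 eqv_mult eqv_refl gp x klc by simp
  moreover have "x [^] ?d \<otimes> g [^] a' \<otimes> (?k \<otimes> g [^] a) = (?k \<otimes> x [^] ?d) \<otimes> (g [^] a' \<otimes> g [^] a)"
    using gp x klc by (simp add: m_ac)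
  moreover have "eqv ((?k \<otimes> x [^] ?d) \<otimes> (g [^] a' \<otimes> g [^] a)) (?l \<otimes> (g [^] a' \<otimes> g [^] a))"
    using e3 eqv_mult eqv_refl gp x klc by simp
  moreover have "?l \<otimes> (g [^] a' \<otimes> g [^] a) = (?l \<otimes> g [^] a') \<otimes> g [^] a" using gp klc by (simp add: m_assoc)
  moreover have "eqv ((?l \<otimes> g [^] a') \<otimes> g [^] a) (g [^] b' \<otimes> g [^] a)"
    using e2 eqv_mult eqv_refl gp by simp
  ultimately have "eqv (x [^] ?d \<otimes> g [^] a' \<otimes> g [^] b) (g [^] b' \<otimes> g [^] a)"
    using eqv_trans gp klc by (metis m_closed)
  then have "eqv (x [^] ?d \<otimes> g [^] (a' + b)) (g [^] (b' + a))"
    using gp x gc by (simp add: m_assoc nat_pow_mult)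
  then show ?thesis using ij len by (intro exI[of _ ?d] exI[of _ "a' + b"] exI[of _ "b' + a"]) auto
qed

lemma place_pow_inj:
  assumes "g \<in> place_of R V" "g \<noteq> \<zero>" "eqv (g [^] (a::nat)) (g [^] (b::nat))"
  shows "a = b"
proof -
  have gc: "g \<in> carrier R" using assms place_carrier by auto
  have *: False if ab: "a < b" "eqv (g [^] (a::nat)) (g [^] (b::nat))" for a b
  proof -
    obtain u where u: "unit u" "g [^] a = u \<otimes> g [^] b" using ab by (auto simp: eqv_def)
    have "g [^] b = g [^] (b - a) \<otimes> g [^] a" using gc ab by (subst nat_pow_mult) auto
    then have "\<one> \<otimes> g [^] a = (u \<otimes> g [^] (b - a)) \<otimes> g [^] a" using u gc unit_carrier by (simp add: m_assoc)
    then have "\<one> = u \<otimes> g [^] (b - a)"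
      using m_rcancel[of "g [^] a" \<one> "u \<otimes> g [^] (b - a)"] gc assms(2) unit_carrier[OF u(1)]
      by (metis m_closed nat_pow_closed one_closed pow_nonzero)
    moreover have "u \<otimes> g [^] (b - a) \<in> place_of R V"
      using place_mult place_pow[OF assms(1)] ab u by (auto simp: unit_def)
    ultimately show False using place_not_unit unit_one by metis
  qed
  show ?thesis using *[of a b] *[of b a] assms gc eqv_sym by (meson linorder_neqE_nat nat_pow_closed)
qed

text \<open>With all torsion cleared by one exponent \<open>N\<close>, the exponent of
  \<open>g\<close> that matches \<open>x^N\<close> is an integer-valued homomorphism
  \<open>nu\<close>. Its sign decides membership in \<open>V\<close>, and dividing by its least
  positive value normalises it.\<close>

theorem discrete_valuation_exists:
  assumes F: "subfield F R" "F \<subseteq> V" and g: "g \<in> place_of R V" "g \<noteq> \<zero>"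
    and dim: "finite_dimension (generate_field R (insert g F)) (carrier R)"
  shows "\<exists>v. discretely_valued_field R v \<and> V = {x \<in> carrier R. x = \<zero> \<or> 0 \<le> v x}"
proof -
  obtain n where n: "dimension n (generate_field R (insert g F)) (carrier R)" using dim by auto
  have gc: "g \<in> carrier R" using g place_carrier by auto
  have gp: "g [^] (c::nat) \<in> carrier R" "g [^] (c::nat) \<noteq> \<zero>" for c using gc g by auto
  \<comment> \<open>A common multiple of all exponents \<open>d\<close> from 1 to \<open>n\<close>
    that \<open>value_torsion\<close> may return.\<close>
  define N where "N = (fact n :: nat)"
  have "\<exists>a b. eqv (x [^] N \<otimes> g [^] (a::nat)) (g [^] (b::nat))" if x: "x \<in> carrier R" "x \<noteq> \<zero>" for x
  proof -
    obtain d a b where d: "0 < d" "d \<le> n" "eqv (x [^] (d::nat) \<otimes> g [^] (a::nat)) (g [^] (b::nat))"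
      using value_torsion[OF F g n x] by auto
    have "d dvd N" unfolding N_def using d by (simp add: dvd_fact)
    then obtain q where q: "N = d * q" by auto
    have "eqv ((x [^] d \<otimes> g [^] a) [^] q) ((g [^] b) [^] q)" using eqv_pow d gp by simp
    moreover have "(x [^] d \<otimes> g [^] a) [^] q = x [^] N \<otimes> g [^] (a * q)"
      using x gc q by (simp add: pow_mult_distrib[OF m_comm] nat_pow_pow)
    ultimately show ?thesis using gc by (metis nat_pow_pow)
  qed
  then have "\<exists>a b. \<forall>x. x \<in> carrier R \<and> x \<noteq> \<zero> \<longrightarrow> eqv (x [^] N \<otimes> g [^] (a x::nat)) (g [^] (b x::nat))" by metis
  then obtain A B where AB: "\<And>x. x \<in> carrier R \<Longrightarrow> x \<noteq> \<zero> \<Longrightarrow> eqv (x [^] N \<otimes> g [^] (A x::nat)) (g [^] (B x::nat))" by blast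
  define nu where "nu = (\<lambda>x. int (B x) - int (A x))"
  \<comment> \<open>The exponents \<open>A x\<close> and \<open>B x\<close> were picked arbitrarily;
    their difference does not depend on the choice, since distinct powers of \<open>g\<close> have
    distinct values.\<close>
  have nu: "nu x = int b - int a" if x: "x \<in> carrier R" "x \<noteq> \<zero>" and e: "eqv (x [^] N \<otimes> g [^] (a::nat)) (g [^] (b::nat))" for x a b
  proof -
    have 1: "eqv ((x [^] N \<otimes> g [^] A x) \<otimes> g [^] a) (g [^] B x \<otimes> g [^] a)"
      using AB[OF x] eqv_mult eqv_refl gp by simp
    have 2: "eqv ((x [^] N \<otimes> g [^] a) \<otimes> g [^] A x) (g [^] b \<otimes> g [^] A x)"
      using e eqv_mult eqv_refl gp by simp
    have "(x [^] N \<otimes> g [^] A x) \<otimes> g [^] a = (x [^] N \<otimes> g [^] a) \<otimes> g [^] A x" using x gp by (simp add: m_ac)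
    then have "eqv (g [^] B x \<otimes> g [^] a) (g [^] b \<otimes> g [^] A x)"
      using 1 2 eqv_sym eqv_trans gp by (metis m_closed)
    then have "eqv (g [^] (B x + a)) (g [^] (b + A x))" using gc by (simp add: nat_pow_mult)
    then have "B x + a = b + A x" using place_pow_inj[OF g] by blast
    then show ?thesis by (simp add: nu_def)
  qed
  have nu_mult: "nu (x \<otimes> y) = nu x + nu y" if "x \<in> carrier R" "x \<noteq> \<zero>" "y \<in> carrier R" "y \<noteq> \<zero>" for x y
  proof -
    have "eqv ((x [^] N \<otimes> g [^] A x) \<otimes> (y [^] N \<otimes> g [^] A y)) (g [^] B x \<otimes> g [^] B y)"
      using AB eqv_mult gp that by simp
    moreover have "(x [^] N \<otimes> g [^] A x) \<otimes> (y [^] N \<otimes> g [^] A y) = (x \<otimes> y) [^] N \<otimes> g [^] (A x + A y)"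
    proof -
      have "(x [^] N \<otimes> g [^] A x) \<otimes> (y [^] N \<otimes> g [^] A y) = (x [^] N \<otimes> y [^] N) \<otimes> (g [^] A x \<otimes> g [^] A y)"
        using that gp by (simp add: m_ac)
      then show ?thesis using that gc by (simp add: nat_pow_mult pow_mult_distrib[OF m_comm])
    qed
    ultimately have "eqv ((x \<otimes> y) [^] N \<otimes> g [^] (A x + A y)) (g [^] (B x + B y))" using gc by (simp add: nat_pow_mult)
    then show ?thesis using nu[of "x \<otimes> y"] that by (simp add: nu_def)
  qed
  have Npos: "N > 0" by (simp add: N_def)
  have nu_g: "nu g = int N"
    using nu[of g 0 N] eqv_refl gp gc g by simp
  have nu_one: "nu \<one> = 0" using nu_mult[of \<one> \<one>] by simp
  have nu_inv: "nu (inv x) = - nu x" if "x \<in> carrier R" "x \<noteq> \<zero>" for x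
    using nu_mult[of x "inv x"] that nu_one by simp
  have nu_neg: "x \<notin> V" if x: "x \<in> carrier R" "x \<noteq> \<zero>" and neg: "nu x < 0" for x
  proof
    assume xV: "x \<in> V"
    have "B x < A x" using neg by (simp add: nu_def)
    then have "g [^] A x = g [^] (A x - B x) \<otimes> g [^] B x" using gc by (subst nat_pow_mult) auto
    then have "eqv ((x [^] N \<otimes> g [^] (A x - B x)) \<otimes> g [^] B x) (\<one> \<otimes> g [^] B x)"
      using AB[OF x] x gp by (simp add: m_assoc)
    then have "eqv (x [^] N \<otimes> g [^] (A x - B x)) \<one>" using eqv_cancel gp x by (meson m_closed nat_pow_closed one_closed)
    then have "unit (x [^] N \<otimes> g [^] (A x - B x))" using unit_carrier by (auto simp: eqv_def)
    moreover have "x [^] N \<in> V" using xV V_ring(3,6) by (induct N) auto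
    then have "x [^] N \<otimes> g [^] (A x - B x) \<in> place_of R V"
      using place_mult place_pow[OF g(1), of "A x - B x"] \<open>B x < A x\<close> by auto
    ultimately show False using place_not_unit by auto
  qed
  have V_iff: "x \<in> V \<longleftrightarrow> 0 \<le> nu x" if x: "x \<in> carrier R" "x \<noteq> \<zero>" for x
  proof
    show "x \<in> V \<Longrightarrow> 0 \<le> nu x" using nu_neg[OF x] by force
    assume nn: "0 \<le> nu x"
    show "x \<in> V"
    proof (cases "0 < nu x")
      case True
      then have "inv x \<notin> V" using nu_neg[of "inv x"] x nu_inv by auto
      then show ?thesis using V_val x by auto
    next
      case False
      then have "A x = B x" using nn by (simp add: nu_def)
      then have "eqv (x [^] N) \<one>" using AB[OF x] eqv_cancel[of "x [^] N" \<one> "g [^] A x"] x gp by simp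
      then have u: "unit (x [^] N)" using unit_carrier by (auto simp: eqv_def)
      show "x \<in> V"
      proof (rule ccontr)
        assume "x \<notin> V"
        then have "inv x [^] N \<in> place_of R V" using not_V_inv place_pow Npos x by auto
        then have "x [^] N \<otimes> inv x [^] N \<in> place_of R V" using u place_mult by (auto simp: unit_def)
        moreover have "x [^] N \<otimes> inv x [^] N = \<one>" using x by (simp flip: pow_mult_distrib[OF m_comm])
        ultimately show False using place_not_unit unit_one by metis
      qed
    qed
  qed
  \<comment> \<open>The values form a nonzero subgroup of the integers; its least positive member
    \<open>d\<close> divides every value by division with remainder.\<close>
  define P where "P = (\<lambda>k. 0 < k \<and> (\<exists>x\<in>carrier R. x \<noteq> \<zero> \<and> nu x = int k))"
  define d where "d = (LEAST k. P k)"
  have "P N" unfolding P_def using nu_g gc g Npos by auto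
  then have Pd: "P d" unfolding d_def by (rule LeastI)
  then obtain p where p: "p \<in> carrier R" "p \<noteq> \<zero>" "nu p = int d" and d0: "0 < d" by (auto simp: P_def)
  have nu_pow: "nu (x [^] (k::nat)) = int k * nu x" if "x \<in> carrier R" "x \<noteq> \<zero>" for x k
    using that nu_one nu_mult by (induct k) (auto simp: algebra_simps)
  have dvd: "int d dvd nu x" if x: "x \<in> carrier R" "x \<noteq> \<zero>" for x
  proof -
    let ?r = "nu x mod int d" and ?q = "nu x div int d"
    obtain q1 q2 :: nat where q: "?q = int q1 - int q2" by (metis int_diff_cases)
    let ?y = "x \<otimes> p [^] q2 \<otimes> inv (p [^] q1)"
    have y: "?y \<in> carrier R" "?y \<noteq> \<zero>" using x p by auto
    have "nu ?y = nu x + int q2 * int d - int q1 * int d" using x p by (simp add: nu_mult nu_inv nu_pow)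
    also have "\<dots> = nu x - ?q * int d" by (simp add: q algebra_simps)
    also have "\<dots> = ?r" by (simp add: minus_div_mult_eq_mod)
    finally have yr: "nu ?y = ?r" .
    have r: "0 \<le> ?r" "?r < int d" using d0 by auto
    have "?r = 0"
    proof (rule ccontr)
      assume "?r \<noteq> 0"
      then have "P (nat ?r)" unfolding P_def using r y yr by (intro conjI bexI[of _ ?y]) auto
      then have "d \<le> nat ?r" unfolding d_def by (rule Least_le)
      then show False using r by simp
    qed
    then show ?thesis by (simp add: dvd_eq_mod_eq_0)
  qed
  define v where "v = (\<lambda>x. nu x div int d)"
  have v: "nu x = v x * int d" if "x \<in> carrier R" "x \<noteq> \<zero>" for x using dvd[OF that] by (simp add: v_def)
  have v_nn: "x \<in> V \<longleftrightarrow> 0 \<le> v x" if "x \<in> carrier R" "x \<noteq> \<zero>" for x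
    using V_iff[OF that] v[OF that] d0 by (simp add: zero_le_mult_iff)
  have v_mult: "v (x \<otimes> y) = v x + v y" if "x \<in> carrier R" "y \<in> carrier R" "x \<noteq> \<zero>" "y \<noteq> \<zero>" for x y
  proof -
    have "v (x \<otimes> y) * int d = (v x + v y) * int d"
      using nu_mult[of x y] v[of x] v[of y] v[of "x \<otimes> y"] that by (simp add: algebra_simps)
    then show ?thesis using d0 by simp
  qed
  have v_add: "min (v x) (v y) \<le> v (x \<oplus> y)"
    if "x \<in> carrier R" "y \<in> carrier R" "x \<noteq> \<zero>" "y \<noteq> \<zero>" "x \<oplus> y \<noteq> \<zero>" for x y
  proof -
    have *: "v b \<le> v (a \<oplus> b)" if q: "a \<otimes> inv b \<in> V" and ab: "a \<in> carrier R" "b \<in> carrier R" "b \<noteq> \<zero>" "a \<oplus> b \<noteq> \<zero>" for a b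
    proof -
      have "a \<otimes> inv b \<oplus> \<one> \<in> V" using q V_ring(3,7) by auto
      moreover have eq: "a \<oplus> b = (a \<otimes> inv b \<oplus> \<one>) \<otimes> b" using ab by (simp add: l_distr m_assoc)
      moreover have "a \<otimes> inv b \<oplus> \<one> \<noteq> \<zero>" using eq ab by auto
      ultimately show ?thesis using v_nn[of "a \<otimes> inv b \<oplus> \<one>"] v_mult[of "a \<otimes> inv b \<oplus> \<one>" b] ab by simp
    qed
    have "x \<otimes> inv y \<in> V \<or> y \<otimes> inv x \<in> V"
      using V_val[of "x \<otimes> inv y"] that by (auto simp: inv_mult_nonzero m_comm)
    then show ?thesis using *[of x y] *[of y x] that by (auto simp: a_comm)
  qed
  have "v p = 1" using v[of p] p d0 by simp
  then have "discretely_valued_field R v"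
    using v_mult v_add p by unfold_locales auto
  moreover have "V = {x \<in> carrier R. x = \<zero> \<or> 0 \<le> v x}" using v_nn V_carrier V_ring(2) by auto
  ultimately show ?thesis by blast
qed

end

section \<open>Function fields: a parameter with a zero at a given place\<close>

lemma (in field) generate_field_inv:
  assumes "subfield F R" "t \<in> carrier R" "t \<noteq> \<zero>"
  shows "generate_field R (insert (inv t) F) = generate_field R (insert t F)"
proof -
  have F: "F \<subseteq> carrier R" using subfieldE(3)[OF assms(1)] .
  have *: "generate_field R (insert (inv s) F) \<subseteq> generate_field R (insert s F)"
    if s: "s \<in> carrier R" "s \<noteq> \<zero>" for s
  proof (rule generate_field_min_subfield1)
    show "insert (inv s) F \<subseteq> carrier R" using F s by auto
    show "subfield (generate_field R (insert s F)) R" using F s by (intro generate_field_is_subfield) auto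
    show "insert (inv s) F \<subseteq> generate_field R (insert s F)"
      using s by (auto intro: generate_field.m_inv generate_field.incl)
  qed
  show ?thesis using *[OF assms(2,3)] *[of "inv t"] assms by auto
qed

text \<open>Some nonzero \<open>g\<close> in \<open>F[t]\<close> must be a non-unit: otherwise
  \<open>V\<close> contains the field \<open>F(t)\<close> and, being integrally closed, everything
  algebraic over it. As \<open>g\<close> is a polynomial in \<open>t\<close>, conversely
  \<open>t\<close> is algebraic over \<open>F(g)\<close>, and finite dimension over
  \<open>F(t)\<close> becomes finite dimension over \<open>F(g)\<close>.\<close>

lemma (in field) function_field_place_element:
  assumes F: "subfield F R" and t: "t \<in> carrier R" "t \<in> V"
    and dim: "finite_dimension (generate_field R (insert t F)) (carrier R)"
    and V: "valuation_ring R F (carrier R) V"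
  shows "\<exists>g\<in>place_of R V. g \<noteq> \<zero> \<and> finite_dimension (generate_field R (insert g F)) (carrier R)"
proof -
  interpret valued_ring R V using valuation_ringD[OF _ V] field_axioms by auto
  have FV: "F \<subseteq> V" "V \<noteq> carrier R" using valuation_ringD[OF _ V] field_axioms by auto
  have Fc: "F \<subseteq> carrier R" "subring F R" using subfieldE[OF F] by auto
  let ?E = "generate_field R (insert t F)" and ?A = "simple_extension F t"
  have E: "subfield ?E R" using generate_field_is_subfield Fc t by auto
  have AV: "?A \<subseteq> V" using simple_extension_subring_incl[OF V_subring FV(1) t(2)] .
  have AE: "?A \<subseteq> ?E"
    using simple_extension_subring_incl[OF subfieldE(1)[OF E], of F t] generate_field.incl[of _ "insert t F" R] by auto
  have "\<exists>g\<in>?A. g \<noteq> \<zero> \<and> \<not> unit g"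
  proof (rule ccontr)
    assume "\<not> ?thesis"
    then have u: "\<And>g. g \<in> ?A \<Longrightarrow> g \<noteq> \<zero> \<Longrightarrow> unit g" by auto
    have "?E \<subseteq> V"
    proof
      fix y assume "y \<in> ?E"
      then obtain a b where "a \<in> ?A" "b \<in> ?A" "b \<noteq> \<zero>" "y = a \<otimes> inv b"
        using generate_field_insert_fraction[OF F t(1)] by blast
      then show "y \<in> V" using u[of b] AV V_ring(6) by (auto simp: unit_def)
    qed
    moreover have "algebraic ?E x" if "x \<in> carrier R" for x
      using finite_dimension_imp_algebraic[OF E carrier_is_subring dim that] by (simp add: over_def)
    ultimately have "carrier R \<subseteq> V" using algebraic_in_V[OF E] by auto
    then show False using FV(2) V_ring(1) by auto
  qed
  then obtain g where g: "g \<in> ?A" "g \<noteq> \<zero>" "\<not> unit g" by auto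
  have gV: "g \<in> V" "g \<in> carrier R" using g AV V_carrier by auto
  have gp: "g \<in> place_of R V" using place_or_unit gV g by auto
  have gF: "g \<notin> F" using field_unit[OF F FV(1)] g by auto
  let ?E1 = "generate_field R (insert g F)"
  have E1: "subfield ?E1 R" using generate_field_is_subfield Fc gV by auto
  have E1E: "?E1 \<subseteq> ?E"
    using generate_field_min_subfield1[OF _ E, of "insert g F"] Fc gV g AE generate_field.incl[of _ "insert t F" R] by auto
  obtain P where P: "P \<in> carrier (F[X])" "eval P t = g"
    using g simple_extension_as_eval_img[OF Fc(1) t(1)] by auto
  interpret UP: domain "?E1[X]" using univ_poly_is_domain[OF subfieldE(1)[OF E1]] .
  have P1: "P \<in> carrier (?E1[X])"
  proof -
    have "F \<subseteq> ?E1" using generate_field.incl[of _ "insert g F" R] by auto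
    then show ?thesis using P(1) by (auto simp: univ_poly_def polynomial_def)
  qed
  have gE1: "g \<in> ?E1" using generate_field.incl[of g "insert g F" R] by auto
  have c1: "[g] \<in> carrier (?E1[X])" using gE1 g by (auto simp: univ_poly_def polynomial_def)
  \<comment> \<open>Vanishes at \<open>t\<close>, and is not the zero polynomial: if
    \<open>P\<close> were the constant \<open>g\<close>, then \<open>g\<close> would lie in
    \<open>F\<close>, whose nonzero elements are units.\<close>
  let ?Q = "P \<ominus>\<^bsub>?E1[X]\<^esub> [g]"
  have Q: "?Q \<in> carrier (?E1[X])" using P1 c1 by auto
  interpret ev: ring_hom_cring "?E1[X]" R "\<lambda>p. eval p t"
    using eval_cring_hom[OF subfieldE(1)[OF E1] t(1)] .
  have "eval ?Q t = \<zero>"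
    using P1 c1 P(2) gV t(1) ev.hom_add[of P "\<ominus>\<^bsub>?E1[X]\<^esub> [g]"] ev.hom_a_inv[of "[g]"]
    by (simp add: a_minus_def r_neg)
  moreover have "?Q \<noteq> []"
  proof
    assume "?Q = []"
    then have "P = [g]" using UP.r_right_minus_eq[OF P1 c1] by (simp add: univ_poly_zero)
    then show False using P(1) gF by (auto simp: univ_poly_def polynomial_def)
  qed
  ultimately have alg: "(algebraic over ?E1) t" using algebraicI[OF Q] by auto
  have sf: "subfield (simple_extension ?E1 t) R" using simple_extension_is_subfield[OF E1 t(1)] alg by simp
  have "simple_extension ?E1 t = ?E"
  proof
    show "simple_extension ?E1 t \<subseteq> ?E"
      using simple_extension_subring_incl[OF subfieldE(1)[OF E] E1E] generate_field.incl[of t "insert t F" R] by auto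
    have "insert t F \<subseteq> simple_extension ?E1 t"
      using simple_extension_mem[OF subfieldE(1)[OF E1] t(1)] simple_extension_incl[OF subfieldE(3)[OF E1] t(1)]
        generate_field.incl[of _ "insert g F" R] by auto
    then show "?E \<subseteq> simple_extension ?E1 t" using generate_field_min_subfield1[OF _ sf] Fc t by auto
  qed
  then have "finite_dimension ?E1 ?E"
    using finite_dimensionI[OF dimension_simple_extension[OF E1 t(1) alg]] by simp
  then have "finite_dimension ?E1 (carrier R)" using telescopic_base_dim(1)[OF E1 E _ dim] by simp
  then show ?thesis using gp g by auto
qed

theorem (in field) function_field_valuation:
  assumes F: "subfield F R" and t: "t \<in> carrier R"
    and dim: "finite_dimension (generate_field R (insert t F)) (carrier R)"
    and V: "valuation_ring R F (carrier R) V"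
  shows "\<exists>v. discretely_valued_field R v \<and> V = {x \<in> carrier R. x = \<zero> \<or> 0 \<le> v x}"
proof -
  interpret valued_ring R V using valuation_ringD[OF _ V] field_axioms by auto
  have "\<exists>s\<in>V. finite_dimension (generate_field R (insert s F)) (carrier R)"
  proof (cases "t \<in> V")
    case False
    then have "t \<noteq> \<zero>" "inv t \<in> V" using V_ring(2) V_val[OF t] by auto
    then show ?thesis using generate_field_inv[OF F t] dim by (intro bexI[of _ "inv t"]) auto
  qed (use dim in auto)
  then obtain s where s: "s \<in> V" "finite_dimension (generate_field R (insert s F)) (carrier R)" by auto
  obtain g where "g \<in> place_of R V" "g \<noteq> \<zero>" "finite_dimension (generate_field R (insert g F)) (carrier R)"
    using function_field_place_element[OF F V_carrier[OF s(1)] s V] by auto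
  then show ?thesis using discrete_valuation_exists[OF F] valuation_ringD(2)[OF field_axioms V] by blast
qed

subsection \<open>Extension of automorphisms\<close>

lemma (in field) card_roots_le:
  assumes "p \<in> carrier (poly_ring R)" "p \<noteq> []"
  shows "finite {x \<in> carrier R. eval p x = \<zero>}" "card {x \<in> carrier R. eval p x = \<zero>} \<le> degree p"
proof -
  have eq: "{x \<in> carrier R. eval p x = \<zero>} = set_mset (roots p)"
    using roots_mem_iff_is_root[OF assms(1)] assms(2) by (auto simp: is_root_def)
  then show "finite {x \<in> carrier R. eval p x = \<zero>}" by simp
  have "card (set_mset (roots p)) \<le> size (roots p)"
    by (metis mset_set_set_mset_msubset size_mset_mono size_mset_set)
  then show "card {x \<in> carrier R. eval p x = \<zero>} \<le> degree p"
    using eq size_roots_le_degree[OF assms(1)] by simp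
qed

lemma (in field) eval_map_hom:
  assumes E: "subfield E R" and s: "s \<in> ring_hom (R\<lparr>carrier := E\<rparr>) R" and b: "b \<in> carrier R"
  shows "(\<lambda>p. eval (map s p) b) \<in> ring_hom (E[X]) R"
proof -
  interpret h: ring_hom_ring "R\<lparr>carrier := E\<rparr>" R s
    using s field.is_ring[OF subfield_iff(2)[OF E]] ring_axioms by (intro ring_hom_ringI2) auto
  have Er: "subring E R" using subfieldE(1)[OF E] .
  have sc: "set (map s p) \<subseteq> carrier R" if "p \<in> carrier (E[X])" for p
  proof -
    have "set p \<subseteq> E" using that by (auto simp: univ_poly_def polynomial_def)
    then show ?thesis using h.hom_closed by auto
  qed
  have sE: "set p \<subseteq> carrier (R\<lparr>carrier := E\<rparr>)" if "p \<in> carrier (E[X])" for p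
    using that by (auto simp: univ_poly_def polynomial_def)
  show ?thesis
  proof (rule ring_hom_memI)
    show "eval (map s p) b \<in> carrier R" if "p \<in> carrier (E[X])" for p
      using eval_in_carrier[OF sc[OF that] b] .
    show "eval (map s \<one>\<^bsub>E[X]\<^esub>) b = \<one>"
      using h.hom_one b by (simp add: univ_poly_one)
    fix p q assume p: "p \<in> carrier (E[X])" and q: "q \<in> carrier (E[X])"
    have cl: "p \<oplus>\<^bsub>E[X]\<^esub> q \<in> carrier (E[X])" "p \<otimes>\<^bsub>E[X]\<^esub> q \<in> carrier (E[X])"
      using p q univ_poly_is_ring[OF Er] ring.ring_simprules(1,5) by (metis, metis)
    have "eval (map s (p \<oplus>\<^bsub>E[X]\<^esub> q)) b = eval (normalize (map s (poly_add p q))) b"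
      using eval_normalize[OF sc[OF cl(1)] b] by (simp add: univ_poly_add)
    also have "\<dots> = eval (poly_add (map s p) (map s q)) b"
      using h.poly_add_hom'[OF sE[OF p] sE[OF q]] poly_add_consistent[OF Er] by simp
    finally show "eval (map s (p \<oplus>\<^bsub>E[X]\<^esub> q)) b = eval (map s p) b \<oplus> eval (map s q) b"
      using eval_poly_add[OF sc[OF p] sc[OF q] b] by simp
    have "eval (map s (p \<otimes>\<^bsub>E[X]\<^esub> q)) b = eval (normalize (map s (poly_mult p q))) b"
      using eval_normalize[OF sc[OF cl(2)] b] by (simp add: univ_poly_mult)
    also have "\<dots> = eval (poly_mult (map s p) (map s q)) b"
      using h.poly_mult_hom'[OF sE[OF p] sE[OF q]] poly_mult_consistent[OF Er] by simp
    finally show "eval (map s (p \<otimes>\<^bsub>E[X]\<^esub> q)) b = eval (map s p) b \<otimes> eval (map s q) b"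
      using eval_poly_mult[OF sc[OF p] sc[OF q] b] by simp
  qed
qed

text \<open>The image of \<open>p(a)\<close> is forced to be the transported polynomial evaluated at
  \<open>b\<close>. It is well defined because two polynomials agreeing at \<open>a\<close> differ
  by a multiple of the minimal polynomial, whose transport kills \<open>b\<close>.\<close>

lemma (in field) extend_hom_simple:
  assumes E: "subfield E R" and s: "s \<in> ring_hom (R\<lparr>carrier := E\<rparr>) R"
    and a: "a \<in> carrier R" "(algebraic over E) a"
    and b: "b \<in> carrier R" "eval (map s (Irr E a)) b = \<zero>"
  shows "\<exists>\<tau>\<in>ring_hom (R\<lparr>carrier := simple_extension E a\<rparr>) R.
           \<forall>p\<in>carrier (E[X]). \<tau> (eval p a) = eval (map s p) b"
proof -
  have Er: "subring E R" and Ec: "E \<subseteq> carrier R" using subfieldE[OF E] by auto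
  interpret UP: domain "E[X]" using univ_poly_is_domain[OF Er] .
  let ?\<Phi> = "\<lambda>p. eval (map s p) b"
  have \<Phi>: "?\<Phi> \<in> ring_hom (E[X]) R" using eval_map_hom[OF E s b(1)] .
  interpret f: ring_hom_ring "E[X]" R ?\<Phi> using \<Phi> UP.ring_axioms ring_axioms by (intro ring_hom_ringI2) auto
  interpret e: ring_hom_ring "E[X]" R "\<lambda>p. eval p a" using eval_ring_hom[OF Er a(1)] .
  have well: "?\<Phi> p = ?\<Phi> q" if p: "p \<in> carrier (E[X])" and q: "q \<in> carrier (E[X])" and eq: "eval p a = eval q a" for p q
  proof -
    let ?d = "p \<ominus>\<^bsub>E[X]\<^esub> q"
    have d: "?d \<in> carrier (E[X])" using p q by auto
    have "eval ?d a = \<zero>" using p q eq e.hom_add[of p "\<ominus>\<^bsub>E[X]\<^esub> q"] e.hom_a_inv[of q] by (simp add: a_minus_def r_neg)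
    then have "(Irr E a) pdivides ?d" using Irr_minimal[OF E a d] by simp
    then have "(Irr E a) divides\<^bsub>E[X]\<^esub> ?d" using pdivides_iff_shell[OF E IrrE(1)[OF E a] d] by simp
    then obtain r where r: "r \<in> carrier (E[X])" "?d = Irr E a \<otimes>\<^bsub>E[X]\<^esub> r" by (auto simp: factor_def)
    have "?\<Phi> ?d = \<zero>" using r f.hom_mult[OF IrrE(1)[OF E a] r(1)] b f.hom_closed[OF r(1)] by simp
    moreover have "?\<Phi> ?d = ?\<Phi> p \<ominus> ?\<Phi> q" using p q f.hom_add[of p "\<ominus>\<^bsub>E[X]\<^esub> q"] f.hom_a_inv[of q] by (simp add: a_minus_def)
    ultimately show ?thesis using f.hom_closed[OF p] f.hom_closed[OF q] by simp
  qed
  define \<tau> where "\<tau> = (\<lambda>x. ?\<Phi> (SOME p. p \<in> carrier (E[X]) \<and> eval p a = x))"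
  have \<tau>: "\<tau> (eval p a) = ?\<Phi> p" if p: "p \<in> carrier (E[X])" for p
  proof -
    have "\<exists>q. q \<in> carrier (E[X]) \<and> eval q a = eval p a" using p by auto
    from someI_ex[OF this] show ?thesis unfolding \<tau>_def using well[OF _ p] by blast
  qed
  have img: "\<exists>p\<in>carrier (E[X]). x = eval p a" if "x \<in> simple_extension E a" for x
    using that simple_extension_as_eval_img[OF Ec a(1)] by auto
  have "\<tau> \<in> ring_hom (R\<lparr>carrier := simple_extension E a\<rparr>) R"
  proof (rule ring_hom_memI)
    fix x y assume "x \<in> carrier (R\<lparr>carrier := simple_extension E a\<rparr>)" "y \<in> carrier (R\<lparr>carrier := simple_extension E a\<rparr>)"
    then obtain p q where pq: "p \<in> carrier (E[X])" "x = eval p a" "q \<in> carrier (E[X])" "y = eval q a"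
      using img[of x] img[of y] by auto
    show "\<tau> x \<in> carrier R" using \<tau> pq f.hom_closed by auto
    have "x \<otimes> y = eval (p \<otimes>\<^bsub>E[X]\<^esub> q) a" "x \<oplus> y = eval (p \<oplus>\<^bsub>E[X]\<^esub> q) a" using pq by auto
    then show "\<tau> (x \<otimes>\<^bsub>R\<lparr>carrier := simple_extension E a\<rparr>\<^esub> y) = \<tau> x \<otimes> \<tau> y"
      "\<tau> (x \<oplus>\<^bsub>R\<lparr>carrier := simple_extension E a\<rparr>\<^esub> y) = \<tau> x \<oplus> \<tau> y"
      using \<tau>[OF UP.m_closed[OF pq(1,3)]] \<tau>[OF UP.a_closed[OF pq(1,3)]] \<tau>[OF pq(1)] \<tau>[OF pq(3)]
        f.hom_mult[OF pq(1,3)] f.hom_add[OF pq(1,3)] pq(2,4) by simp_all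
  next
    show "\<tau> \<one>\<^bsub>R\<lparr>carrier := simple_extension E a\<rparr>\<^esub> = \<one>"
      using \<tau>[of "\<one>\<^bsub>E[X]\<^esub>"] f.hom_one e.hom_one by simp
  qed
  then show ?thesis using \<tau> by blast
qed

text \<open>Separability and normality together, by counting: a polynomial with as many distinct
  roots in \<open>R\<close> as its degree splits there without multiplicity. No derivatives
  enter.\<close>

definition (in field) splits_separably :: "'a set \<Rightarrow> 'a \<Rightarrow> bool" where
  "splits_separably E a \<longleftrightarrow> (\<exists>h\<in>carrier (E[X]). h \<noteq> [] \<and> eval h a = \<zero> \<and>
     card {x \<in> carrier R. eval h x = \<zero>} = degree h)"

lemma (in field) splits_separably_algebraic:
  assumes "splits_separably E0 a" "E0 \<subseteq> E"
  shows "(algebraic over E) a"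
proof -
  obtain h where h: "h \<in> carrier (E0[X])" "h \<noteq> []" "eval h a = \<zero>" using assms by (auto simp: splits_separably_def)
  then have "h \<in> carrier (E[X])" using assms(2) by (auto simp: univ_poly_def polynomial_def)
  then show ?thesis using h algebraicI by auto
qed

text \<open>Over the larger field the minimal polynomial of \<open>a\<close> divides
  \<open>h\<close>, and \<open>s\<close> fixes \<open>h\<close>. The roots of \<open>h\<close> are
  shared between the transports of the two factors; neither can have more roots than its degree, so
  both attain it.\<close>

lemma (in field) conjugates_count:
  assumes E0: "subfield E0 R" and E: "subfield E R" "E0 \<subseteq> E"
    and s: "s \<in> ring_hom (R\<lparr>carrier := E\<rparr>) R" "\<And>x. x \<in> E0 \<Longrightarrow> s x = x"
    and a: "a \<in> carrier R" "splits_separably E0 a"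
  shows "card {x \<in> carrier R. eval (map s (Irr E a)) x = \<zero>} = degree (Irr E a)"
proof -
  have Er: "subring E R" and Ec: "E \<subseteq> carrier R" using subfieldE[OF E(1)] by auto
  interpret UP: domain "E[X]" using univ_poly_is_domain[OF Er] .
  obtain h where h: "h \<in> carrier (E0[X])" "h \<noteq> []" "eval h a = \<zero>" "card {x \<in> carrier R. eval h x = \<zero>} = degree h"
    using a by (auto simp: splits_separably_def)
  have hE: "h \<in> carrier (E[X])" using h E(2) by (auto simp: univ_poly_def polynomial_def)
  have alg: "(algebraic over E) a" using splits_separably_algebraic[OF a(2) E(2)] .
  let ?m = "Irr E a"
  note I = IrrE[OF E(1) a(1) alg]
  have "?m divides\<^bsub>E[X]\<^esub> h"
    using Irr_minimal[OF E(1) a(1) alg hE h(3)] pdivides_iff_shell[OF E(1) I(1) hE] by simp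
  then obtain n where n: "n \<in> carrier (E[X])" "h = ?m \<otimes>\<^bsub>E[X]\<^esub> n" by (auto simp: factor_def)
  have nz: "?m \<noteq> []" "n \<noteq> []"
    using n h(2) I(1) UP.integral_iff[OF I(1) n(1)] by (auto simp: univ_poly_zero)
  have deg: "degree h = degree ?m + degree n"
    using n nz I(1) poly_mult_degree_eq[OF Er, of ?m n] by (auto simp: univ_poly_carrier univ_poly_mult)
  have fE: "field (R\<lparr>carrier := E\<rparr>)" using subfield_iff(2)[OF E(1)] .
  have mapc: "map s p \<in> carrier (poly_ring R)" if "p \<in> carrier (E[X])" for p
    using polynomial_hom[OF s(1) fE field_axioms, of p] that univ_poly_consistent[OF Er] by simp
  have hfix: "map s h = h" using h(1) s(2) by (intro map_idI) (auto simp: univ_poly_def polynomial_def)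
  let ?S = "\<lambda>p. {x \<in> carrier R. eval p x = \<zero>}"
  have "?S h \<subseteq> ?S (map s ?m) \<union> ?S (map s n)"
  proof
    fix x assume x: "x \<in> ?S h"
    then have xc: "x \<in> carrier R" by auto
    note \<Phi> = ring_hom_memE[OF eval_map_hom[OF E(1) s(1) xc]]
    have "eval (map s ?m) x \<otimes> eval (map s n) x = \<zero>" using \<Phi>(2)[OF I(1) n(1)] n(2) hfix x by simp
    then show "x \<in> ?S (map s ?m) \<union> ?S (map s n)" using \<Phi>(1)[OF I(1)] \<Phi>(1)[OF n(1)] xc by auto
  qed
  moreover have f: "finite (?S (map s ?m))" "finite (?S (map s n))"
    using card_roots_le(1)[OF mapc[OF I(1)]] card_roots_le(1)[OF mapc[OF n(1)]] nz by auto
  ultimately have "degree h \<le> card (?S (map s ?m) \<union> ?S (map s n))" using h(4) card_mono by (metis (lifting) finite_UnI)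
  also have "\<dots> \<le> card (?S (map s ?m)) + card (?S (map s n))" by (rule card_Un_le)
  finally have "degree ?m + degree n \<le> card (?S (map s ?m)) + card (?S (map s n))" using deg by simp
  moreover have "card (?S (map s ?m)) \<le> degree ?m" "card (?S (map s n)) \<le> degree n"
    using card_roots_le(2)[OF mapc[OF I(1)]] card_roots_le(2)[OF mapc[OF n(1)]] nz by auto
  ultimately show ?thesis by simp
qed

text \<open>Induction on the adjoined elements. If \<open>x\<close> already lies in the smaller
  field, a homomorphism moving it is extended. Otherwise \<open>x = p(a)\<close> with
  \<open>p\<close> nonconstant and of degree below that of the minimal polynomial of
  \<open>a\<close>; if every conjugate of \<open>a\<close> gave the value \<open>x\<close>, then
  \<open>p - x\<close> would have too many roots.\<close>

lemma (in field) moved_by_hom: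
  assumes E0: "subfield E0 R" and xs: "set xs \<subseteq> carrier R" "\<And>a. a \<in> set xs \<Longrightarrow> splits_separably E0 a"
    and x: "x \<in> finite_extension E0 xs" "x \<notin> E0"
  shows "\<exists>\<tau>\<in>ring_hom (R\<lparr>carrier := finite_extension E0 xs\<rparr>) R. (\<forall>y\<in>E0. \<tau> y = y) \<and> \<tau> x \<noteq> x"
  using xs x
proof (induct xs)
  case (Cons a xs)
  let ?E = "finite_extension E0 xs"
  have ext: "finite_extension E0 (a # xs) = simple_extension ?E a" by simp
  note finite_extension.simps [simp del]
  have E0c: "E0 \<subseteq> carrier R" using subfieldE[OF E0] by auto
  have alg0: "\<And>y. y \<in> set xs \<Longrightarrow> (algebraic over E0) y" using Cons splits_separably_algebraic[of E0 _ E0] by auto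
  have E: "subfield ?E R" using finite_extension_is_subfield[OF E0 _ alg0] Cons by auto
  have E0E: "E0 \<subseteq> ?E" using finite_extension_incl[OF E0c] Cons by auto
  have Er: "subring ?E R" and Ec: "?E \<subseteq> carrier R" using subfieldE[OF E] by auto
  have a: "a \<in> carrier R" "splits_separably E0 a" using Cons by auto
  have alg: "(algebraic over ?E) a" using splits_separably_algebraic[OF a(2) E0E] .
  note I = IrrE[OF E a(1) alg]
  have deg: "degree (Irr ?E a) \<ge> 1" using pirreducible_degree[OF E I(1,2)] .
  have const: "[k] \<in> carrier (?E[X])" if "k \<in> ?E" "k \<noteq> \<zero>" for k using that by (auto simp: univ_poly_def polynomial_def)
  have agree: "\<tau> y = s y" if t: "\<forall>p\<in>carrier (?E[X]). \<tau> (eval p a) = eval (map s p) b"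
      and s: "s \<in> ring_hom (R\<lparr>carrier := ?E\<rparr>) R" "y \<in> ?E" "b \<in> carrier R" "s \<zero> = \<zero>" for \<tau> s b y
  proof (cases "y = \<zero>")
    case True
    then show ?thesis using bspec[OF t, of "[]"] s by (simp add: univ_poly_def polynomial_def)
  next
    case False
    have yc: "y \<in> carrier R" "s y \<in> carrier R" using s Ec by (auto simp: ring_hom_def)
    then show ?thesis using bspec[OF t const[OF s(2) False]] s a by simp
  qed
  have s0: "s \<zero> = \<zero>" if "s \<in> ring_hom (R\<lparr>carrier := ?E\<rparr>) R" for s
  proof -
    interpret h: ring_hom_ring "R\<lparr>carrier := ?E\<rparr>" R s
      using that field.is_ring[OF subfield_iff(2)[OF E]] ring_axioms by (intro ring_hom_ringI2) auto
    show ?thesis using h.hom_zero by simp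
  qed
  show ?case
  proof (cases "x \<in> ?E")
    case True
    then obtain s where s: "s \<in> ring_hom (R\<lparr>carrier := ?E\<rparr>) R" "\<forall>y\<in>E0. s y = y" "s x \<noteq> x"
      using Cons by auto
    have "card {y \<in> carrier R. eval (map s (Irr ?E a)) y = \<zero>} \<noteq> 0"
      using conjugates_count[OF E0 E E0E s(1) _ a] s(2) deg by auto
    then have "{y \<in> carrier R. eval (map s (Irr ?E a)) y = \<zero>} \<noteq> {}" by (metis card.empty)
    then obtain b where b: "b \<in> carrier R" "eval (map s (Irr ?E a)) b = \<zero>" by auto
    obtain \<tau> where t: "\<tau> \<in> ring_hom (R\<lparr>carrier := simple_extension ?E a\<rparr>) R"
      "\<forall>p\<in>carrier (?E[X]). \<tau> (eval p a) = eval (map s p) b"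
      using extend_hom_simple[OF E s(1) a(1) alg b] by auto
    have "\<tau> y = s y" if "y \<in> ?E" for y using agree[OF t(2) s(1) that b(1) s0[OF s(1)]] .
    then show ?thesis using t(1) s True E0E unfolding ext by (intro bexI[of _ \<tau>]) auto
  next
    case False
    have id: "id \<in> ring_hom (R\<lparr>carrier := ?E\<rparr>) R" using Ec by (auto simp: ring_hom_def)
    have x: "x \<in> simple_extension ?E a" using Cons(4) ext by simp
    have "x \<in> (\<lambda>p. eval p a) ` {p \<in> carrier (?E[X]). length p \<le> degree (Irr ?E a)}"
      using x unfolding Span_eq_eval_img[OF E a(1), symmetric] Span_exp_base[OF E a(1) alg] .
    then obtain p where p: "p \<in> carrier (?E[X])" "length p \<le> degree (Irr ?E a)" "x = eval p a" by blast
    have xc: "x \<in> carrier R" using Cons(4) finite_extension_in_carrier[OF E0c Cons(2)] by blast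
    have "\<exists>b\<in>carrier R. eval (Irr ?E a) b = \<zero> \<and> eval p b \<noteq> x"
    proof (rule ccontr)
      assume "\<not> ?thesis"
      then have all: "\<And>b. b \<in> carrier R \<Longrightarrow> eval (Irr ?E a) b = \<zero> \<Longrightarrow> eval p b = x" by auto
      interpret P: domain "poly_ring R" using univ_poly_is_domain[OF carrier_is_subring] .
      have "x \<noteq> \<zero>" using False Er subringE(2) by auto
      have pc: "p \<in> carrier (poly_ring R)" "[x] \<in> carrier (poly_ring R)"
        using carrier_polynomial_shell[OF Er p(1)] xc \<open>x \<noteq> \<zero>\<close> by (auto simp: univ_poly_def polynomial_def)
      let ?q = "p \<ominus>\<^bsub>poly_ring R\<^esub> [x]"
      have q: "?q \<in> carrier (poly_ring R)" using pc by auto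
      have qz: "?q \<noteq> []"
      proof
        assume "?q = []"
        then have "p = [x]" using P.r_right_minus_eq[OF pc] by (simp add: univ_poly_zero)
        then show False using p(1) False by (auto simp: univ_poly_def polynomial_def)
      qed
      have evq: "eval ?q b = eval p b \<ominus> x" if b: "b \<in> carrier R" for b
      proof -
        interpret e: ring_hom_ring "poly_ring R" R "\<lambda>p. eval p b" using eval_ring_hom[OF carrier_is_subring b] .
        show ?thesis using pc e.hom_add[of p "\<ominus>\<^bsub>poly_ring R\<^esub> [x]"] e.hom_a_inv[of "[x]"] b xc by (simp add: a_minus_def)
      qed
      have "{y \<in> carrier R. eval (map id (Irr ?E a)) y = \<zero>} \<subseteq> {y \<in> carrier R. eval ?q y = \<zero>}"
        using all evq xc by auto
      then have "degree (Irr ?E a) \<le> card {y \<in> carrier R. eval ?q y = \<zero>}"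
        using conjugates_count[OF E0 E E0E id _ a] card_roots_le(1)[OF q qz] card_mono by (metis (lifting) id_apply)
      also have "\<dots> \<le> degree ?q" using card_roots_le(2)[OF q qz] .
      also have "degree ?q < degree (Irr ?E a)"
      proof -
        have pz: "p \<noteq> []" using p(3) \<open>x \<noteq> \<zero>\<close> by auto
        have m: "\<ominus>\<^bsub>poly_ring R\<^esub> [x] = [\<ominus> x]" using univ_poly_a_inv_def'[OF carrier_is_subring pc(2)] by simp
        have "length ?q \<le> max (length p) (length [\<ominus> x])"
          unfolding a_minus_def m univ_poly_add by (rule poly_add_length_le)
        then have "length ?q \<le> length p" using pz by (cases p) auto
        moreover have "length ?q > 0" using qz by simp
        ultimately show ?thesis using p(2) by linarith
      qed
      finally show False by simp
    qed
    then obtain b where b: "b \<in> carrier R" "eval (Irr ?E a) b = \<zero>" "eval p b \<noteq> x" by auto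
    obtain \<tau> where t: "\<tau> \<in> ring_hom (R\<lparr>carrier := simple_extension ?E a\<rparr>) R"
      "\<forall>p\<in>carrier (?E[X]). \<tau> (eval p a) = eval (map id p) b"
      using extend_hom_simple[OF E id a(1) alg b(1)] b by auto
    have "\<tau> y = y" if "y \<in> ?E" for y using agree[OF t(2) id that b(1)] by simp
    moreover have "\<tau> x \<noteq> x" using bspec[OF t(2) p(1)] b p(3) by simp
    ultimately show ?thesis using t(1) E0E unfolding ext by (intro bexI[of _ \<tau>]) auto
  qed
qed simp

theorem (in field) galois_fixed_field:
  assumes E0: "subfield E0 R" and xs: "set xs \<subseteq> carrier R" "\<And>a. a \<in> set xs \<Longrightarrow> splits_separably E0 a"
    and gen: "carrier R = finite_extension E0 xs"
    and x: "x \<in> carrier R" "\<forall>\<gamma>\<in>carrier (Gal R E0). \<gamma> x = x"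
  shows "x \<in> E0"
proof (rule ccontr)
  assume "x \<notin> E0"
  then obtain \<tau> where t: "\<tau> \<in> ring_hom R R" "\<forall>y\<in>E0. \<tau> y = y" "\<tau> x \<noteq> x"
    using moved_by_hom[OF E0 xs] x(1) unfolding gen[symmetric] by auto
  have E0c: "E0 \<subseteq> carrier R" using subfieldE[OF E0] by auto
  interpret h: ring_hom_ring R R \<tau> using t(1) ring_axioms by (intro ring_hom_ringI2) auto
  have inj: "inj_on \<tau> (carrier R)" using non_trivial_field_hom_is_inj[OF t(1)] field_axioms by auto
  have fd: "finite_dimension E0 (carrier R)"
    using finite_extension_finite_dimension(1)[OF E0 xs(1)] splits_separably_algebraic[OF xs(2)] gen by auto
  have "y \<in> \<tau> ` carrier R" if y: "y \<in> carrier R" for y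
  proof -
    obtain f where f: "f \<in> carrier (E0[X])" "f \<noteq> []" "eval f y = \<zero>"
      using algebraicE[OF subfieldE(1)[OF E0] y finite_dimension_imp_algebraic[OF E0 carrier_is_subring fd y]] by auto
    \<comment> \<open>Surjectivity of \<open>\<tau>\<close>: it fixes the coefficients of
      \<open>f\<close>, so it permutes this finite root set, and \<open>y\<close> is among the
      images.\<close>
    let ?S = "{y \<in> carrier R. eval f y = \<zero>}"
    have "finite ?S" using card_roots_le(1)[OF carrier_polynomial_shell[OF subfieldE(1)[OF E0] f(1)] f(2)] .
    moreover have "\<tau> ` ?S \<subseteq> ?S"
    proof
      fix z assume "z \<in> \<tau> ` ?S"
      then obtain w where w: "w \<in> carrier R" "eval f w = \<zero>" "z = \<tau> w" by auto
      have "map \<tau> f = f" using f(1) t(2) by (intro map_idI) (auto simp: univ_poly_def polynomial_def)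
      then show "z \<in> ?S" using h.eval_hom[OF subfieldE(1)[OF E0] w(1) f(1)] w by simp
    qed
    moreover have "inj_on \<tau> ?S" using inj by (rule inj_on_subset) auto
    ultimately have "\<tau> ` ?S = ?S" by (rule endo_inj_surj)
    then show ?thesis using y f by blast
  qed
  then have b: "bij_betw \<tau> (carrier R) (carrier R)" using inj h.hom_closed by (auto simp: bij_betw_def)
  have "bij_betw (restrict \<tau> (carrier R)) (carrier R) (carrier R)"
    using b by (subst bij_betw_cong[where g = \<tau>]) auto
  moreover have "restrict \<tau> (carrier R) \<in> ring_hom R R" by (intro ring_hom_memI) auto
  moreover have "\<forall>y\<in>E0. restrict \<tau> (carrier R) y = y" using t(2) E0c by auto
  ultimately have "restrict \<tau> (carrier R) \<in> carrier (Gal R E0)" by (auto simp: Gal_def ring_iso_def)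
  then show False using x t(3) by auto
qed

subsection \<open>The covering \<open>x \<mapsto> x\<^sup>m + c x\<^sup>3 + x\<^sup>2\<close>\<close>

text \<open>In characteristic \<open>p\<close> with \<open>m\<close> a power of \<open>p\<close>, this polynomial has \<open>0\<close> as its only critical
  point if \<open>c = 0\<close>, \<open>p > 2\<close> (derivative \<open>2x\<close>) or \<open>c = 1\<close>, \<open>p = 2\<close> (derivative \<open>x\<^sup>2\<close>). The derivative is
  written \<open>k x\<^sup>e\<close>.\<close>

locale trinomial = field R for R (structure) +
  fixes m e :: nat and c k :: 'a
  assumes m_gt: "m > 3" and k_nonzero: "k \<in> carrier R" "k \<noteq> \<zero>"
    and c_e: "(c = \<zero> \<and> e = 1) \<or> (c = \<one> \<and> e = 2)"
    and coprime_e: "coprime (m - 1) e"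
    and taylor: "\<And>a d. a \<in> carrier R \<Longrightarrow> d \<in> carrier R \<Longrightarrow>
      (a \<oplus> d) [^] m \<oplus> c \<otimes> (a \<oplus> d) [^] (3::nat) \<oplus> (a \<oplus> d) [^] (2::nat) =
      (a [^] m \<oplus> c \<otimes> a [^] (3::nat) \<oplus> a [^] (2::nat)) \<oplus>
      d \<otimes> (k \<otimes> a [^] e \<oplus> d \<otimes> (\<one> \<oplus> c \<otimes> (a \<oplus> d) \<oplus> d [^] (m - 2)))"
begin

definition tri :: "'a \<Rightarrow> 'a" where
  "tri x = x [^] m \<oplus> c \<otimes> x [^] (3::nat) \<oplus> x [^] (2::nat)"

lemma c_carrier [simp]: "c \<in> carrier R" using c_e by auto

lemma tri_closed: "x \<in> carrier R \<Longrightarrow> tri x \<in> carrier R" by (simp add: tri_def)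

lemma tri_auto:
  assumes "\<gamma> \<in> carrier (Gal R E)" "x \<in> carrier R"
  shows "\<gamma> (tri x) = tri (\<gamma> x)"
proof -
  have "\<gamma> c = c" using c_e auto_zero[OF assms(1)] auto_one[OF assms(1)] by auto
  then show ?thesis unfolding tri_def using auto_simps[OF assms(1)] assms(2) by simp
qed

text \<open>The Taylor expansion of \<open>tri\<close> at \<open>a\<close>, divided by
  \<open>b - a\<close>. All information on how two roots of the same equation approach each other
  comes from this identity.\<close>

lemma tri_same:
  assumes "a \<in> carrier R" "b \<in> carrier R" "tri a = tri b" "a \<noteq> b"
  shows "k \<otimes> a [^] e \<oplus> (b \<ominus> a) \<otimes> (\<one> \<oplus> c \<otimes> b \<oplus> (b \<ominus> a) [^] (m - 2)) = \<zero>"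
proof -
  let ?d = "b \<ominus> a"
  let ?T = "k \<otimes> a [^] e \<oplus> ?d \<otimes> (\<one> \<oplus> c \<otimes> b \<oplus> ?d [^] (m - 2))"
  have d: "?d \<in> carrier R" "?d \<noteq> \<zero>" using assms by auto
  have ab: "a \<oplus> ?d = b" using assms(1,2) by algebra
  have T: "?T \<in> carrier R" using assms d k_nonzero by auto
  have "tri a = tri a \<oplus> ?d \<otimes> ?T"
    using taylor[OF assms(1) d(1)] assms(3) unfolding ab tri_def by simp
  then have "?d \<otimes> ?T = \<zero>" using tri_closed[OF assms(1)] d T
    by (metis add.l_cancel_one' m_closed)
  then show ?thesis using d T by simp
qed

end

locale valued_trinomial = discretely_valued_field R v + trinomial R m e c k
  for R (structure) and v m e c k +
  assumes v_k: "v k = 0"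
begin

lemma c_fil: "c \<in> fil 0" using c_e by auto

text \<open>At a pole of \<open>a\<close> the term \<open>a^m\<close> would dominate, as
  \<open>m\<close> exceeds 3, and \<open>tri a\<close> would have a pole too.\<close>

lemma root_integral:
  assumes a: "a \<in> carrier R" and u: "tri a \<in> fil 0"
  shows "a \<in> fil 0"
proof (rule ccontr)
  assume n: "a \<notin> fil 0"
  then have nz: "a \<noteq> \<zero>" and neg: "v a < 0" using a by (auto simp: fil_def)
  have a1: "a \<in> fil (v a)" using in_fil_v a by auto
  have "c \<otimes> a [^] (3::nat) \<in> fil (3 * v a)" using fil_mult0(1)[OF c_fil] fil_pow[OF a1, of 3] by simp
  moreover have "a [^] (2::nat) \<in> fil (3 * v a)" using fil_mono[OF fil_pow[OF a1, of 2], of "3 * v a"] neg by simp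
  moreover have "tri a \<in> fil (3 * v a)" using fil_mono[OF u, of "3 * v a"] neg by simp
  ultimately have "tri a \<ominus> (c \<otimes> a [^] (3::nat) \<oplus> a [^] (2::nat)) \<in> fil (3 * v a)"
    using fil_diff fil_add by auto
  moreover have "P \<oplus> D \<ominus> D = P" if "P \<in> carrier R" "D \<in> carrier R" for P D
    using that by (simp add: minus_eq a_assoc r_neg)
  then have "tri a \<ominus> (c \<otimes> a [^] (3::nat) \<oplus> a [^] (2::nat)) = a [^] m" unfolding tri_def using a by (simp add: a_assoc)
  ultimately have "3 * v a \<le> int m * v a" using a nz by (simp add: fil_iff v_pow)
  then show False using neg m_gt by (simp add: mult_le_cancel_right)
qed

lemma root_unit:
  assumes "a \<in> carrier R" "tri a \<noteq> \<zero>" "v (tri a) = 0"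
  shows "a \<noteq> \<zero>" "v a = 0"
proof -
  have a0: "a \<in> fil 0" using root_integral assms tri_closed by (simp add: fil_def)
  have "a \<notin> fil 1"
  proof
    assume a1: "a \<in> fil 1"
    have "a [^] (n::nat) \<in> fil 1" if "n > 0" for n
      using fil_mono[OF fil_pow[OF a1, of n], of 1] that by simp
    then have "tri a \<in> fil 1" unfolding tri_def using m_gt fil_mult0(1)[OF c_fil] fil_add by simp
    then show False using assms by (simp add: fil_def)
  qed
  with a0 show "a \<noteq> \<zero>" "v a = 0" by (auto simp: fil_def)
qed

text \<open>If \<open>a\<close> were a unit, \<open>k a^e\<close> would be a unit that the multiple
  of \<open>b - a\<close> in \<open>tri_same\<close> cannot cancel. So distinct roots can coincide
  modulo the place only at the critical point 0.\<close>

lemma roots_separated: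
  assumes "a \<in> fil 0" "b \<in> fil 0" "tri a = tri b" "b \<ominus> a \<in> fil 1" "a \<noteq> b"
  shows "a \<in> fil 1"
proof (rule ccontr)
  assume n: "a \<notin> fil 1"
  have cc: "a \<in> carrier R" "b \<in> carrier R" using assms fil_carrier by auto
  have nz: "a \<noteq> \<zero>" "v a = 0" using n assms(1) by (auto simp: fil_def)
  let ?d = "b \<ominus> a"
  let ?w = "\<one> \<oplus> c \<otimes> b \<oplus> ?d [^] (m - 2)"
  have d0: "?d \<in> fil 0" using fil_mono[OF assms(4), of 0] by simp
  have w: "?w \<in> fil 0" using fil_add fil_one fil_mult0(1)[OF c_fil assms(2)] fil_pow0[OF d0] by simp
  have dw: "?d \<otimes> ?w \<in> fil 1" using fil_mult0(2)[OF assms(4) w] .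
  have "v (k \<otimes> a [^] e) = 0" using cc nz k_nonzero by (simp add: v_mult v_k v_pow)
  then have "k \<otimes> a [^] e \<oplus> ?d \<otimes> ?w \<noteq> \<zero>"
    using v_add_dominant(1)[of "k \<otimes> a [^] e" "?d \<otimes> ?w"] dw cc nz k_nonzero by simp
  then show False using tri_same[OF cc assms(3,5)] by simp
qed

text \<open>Near 0 the polynomial is \<open>x^2\<close> times a unit. This is the origin of
  ramification index 2, and so of the transpositions.\<close>

lemma root_at_zero:
  assumes "a \<in> fil 1" "tri a \<noteq> \<zero>"
  shows "a \<noteq> \<zero>" "2 * v a = v (tri a)"
proof -
  have a: "a \<in> carrier R" using assms fil_carrier by auto
  show nz: "a \<noteq> \<zero>" using assms m_gt by (auto simp: tri_def nat_pow_zero)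
  have m: "m = (m - 2) + 2" using m_gt by simp
  have "a [^] (3::nat) = a [^] (2::nat) \<otimes> a" using a by (simp add: numeral_3_eq_3 numeral_2_eq_2)
  moreover have "a [^] m = a [^] (m - 2) \<otimes> a [^] (2::nat)" using a m by (metis nat_pow_mult)
  moreover have "P \<otimes> Q \<oplus> c \<otimes> (Q \<otimes> a) \<oplus> Q = Q \<otimes> (\<one> \<oplus> (c \<otimes> a \<oplus> P))" if "P \<in> carrier R" "Q \<in> carrier R" for P Q
    using that a c_carrier by (simp add: r_distr m_ac a_ac)
  ultimately have eq: "tri a = a [^] (2::nat) \<otimes> (\<one> \<oplus> (c \<otimes> a \<oplus> a [^] (m - 2)))" unfolding tri_def using a by simp
  have "int (m - 2) * 1 \<ge> 1" using m_gt by simp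
  then have "a [^] (m - 2) \<in> fil 1" using fil_mono[OF fil_pow[OF assms(1), of "m - 2"]] by simp
  then have "c \<otimes> a \<oplus> a [^] (m - 2) \<in> fil (v \<one> + 1)" using fil_add fil_mult0(1)[OF c_fil assms(1)] by simp
  then have "v (\<one> \<oplus> (c \<otimes> a \<oplus> a [^] (m - 2))) = 0" "\<one> \<oplus> (c \<otimes> a \<oplus> a [^] (m - 2)) \<noteq> \<zero>"
    using v_add_dominant[of \<one>] by auto
  then show "2 * v a = v (tri a)" using eq a nz by (simp add: v_mult v_pow)
qed

lemma root_at_pole:
  assumes "a \<in> carrier R" "tri a \<noteq> \<zero>" "v (tri a) < 0"
  shows "a \<noteq> \<zero>" "v a < 0" "int m * v a = v (tri a)"
proof -
  have "a \<notin> fil 0"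
  proof
    assume "a \<in> fil 0"
    then have "tri a \<in> fil 0" unfolding tri_def using fil_add fil_pow0 fil_mult0(1)[OF c_fil] by simp
    then show False using assms by (simp add: fil_def)
  qed
  then show nz: "a \<noteq> \<zero>" and neg: "v a < 0" using assms by (auto simp: fil_def)
  have a1: "a \<in> fil (v a)" using in_fil_v assms by auto
  have am: "v (a [^] m) = int m * v a" using assms nz by (simp add: v_pow)
  have less: "int m * v a + 1 \<le> 3 * v a"
  proof -
    have "int m * v a \<le> 4 * v a" using neg m_gt by (intro mult_right_mono_neg) auto
    then show ?thesis using neg by linarith
  qed
  have "c \<otimes> a [^] (3::nat) \<in> fil (3 * v a)" using fil_mult0(1)[OF c_fil] fil_pow[OF a1, of 3] by simp
  moreover have "a [^] (2::nat) \<in> fil (3 * v a)" using fil_mono[OF fil_pow[OF a1, of 2], of "3 * v a"] neg by simp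
  ultimately have "c \<otimes> a [^] (3::nat) \<oplus> a [^] (2::nat) \<in> fil (3 * v a)" using fil_add by auto
  then have "c \<otimes> a [^] (3::nat) \<oplus> a [^] (2::nat) \<in> fil (v (a [^] m) + 1)" using fil_mono less am by auto
  then have "v (a [^] m \<oplus> (c \<otimes> a [^] (3::nat) \<oplus> a [^] (2::nat))) = v (a [^] m)"
    using v_add_dominant(2)[of "a [^] m"] assms nz by simp
  then show "int m * v a = v (tri a)" using am assms by (simp add: tri_def a_assoc)
qed

text \<open>A Newton polygon argument for the equation
  \<open>k a^e + d + c b d + d^(m-1) = 0\<close> in the difference \<open>d\<close>. If
  \<open>d\<close> has larger value than \<open>a\<close>, the middle terms are negligible against
  \<open>k a^e\<close>, which must balance \<open>d^(m-1)\<close>. Otherwise \<open>d^(m-1)\<close>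
  alone has the smallest value and nothing can cancel it.\<close>

lemma root_difference_at_pole:
  assumes "a \<in> carrier R" "b \<in> carrier R" "tri a = tri b" "a \<noteq> b" "tri a \<noteq> \<zero>" "v (tri a) < 0"
  shows "int (m - 1) * v (b \<ominus> a) = int e * v a"
proof -
  let ?d = "b \<ominus> a"
  have a: "a \<noteq> \<zero>" "v a < 0" using root_at_pole[OF assms(1,5,6)] by auto
  have d: "?d \<in> carrier R" "?d \<noteq> \<zero>" using assms by auto
  have ab: "b = a \<oplus> ?d" using assms(1,2) by algebra
  have T: "k \<otimes> a [^] e \<oplus> ?d \<otimes> (\<one> \<oplus> c \<otimes> b \<oplus> ?d [^] (m - 2)) = \<zero>" using tri_same[OF assms(1-4)] .
  let ?r = "?d \<oplus> c \<otimes> (b \<otimes> ?d)"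
  let ?D = "?d [^] (m - 1)"
  have "Suc (m - 2) = m - 1" using m_gt by simp
  then have D: "?d [^] (m - 2) \<otimes> ?d = ?D" using nat_pow_Suc by metis
  have "K \<oplus> d \<otimes> (\<one> \<oplus> c \<otimes> b \<oplus> P) = K \<oplus> (d \<oplus> c \<otimes> (b \<otimes> d)) \<oplus> P \<otimes> d" if "K \<in> carrier R" "P \<in> carrier R" "d \<in> carrier R" for K P d
    using that assms(2) c_carrier by (simp add: r_distr m_ac a_ac)
  from this[of "k \<otimes> a [^] e" "?d [^] (m - 2)" ?d]
  have sum: "k \<otimes> a [^] e \<oplus> ?r \<oplus> ?D = \<zero>" using T D d assms k_nonzero by simp
  have ka: "k \<otimes> a [^] e \<in> carrier R" "k \<otimes> a [^] e \<noteq> \<zero>" "v (k \<otimes> a [^] e) = int e * v a"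
    using assms a k_nonzero by (auto simp: v_mult v_pow v_k)
  have rc: "?r \<in> carrier R" using assms d by auto
  have Dc: "?D \<in> carrier R" "?D \<noteq> \<zero>" "v ?D = int (m - 1) * v ?d" using d by (auto simp: v_pow)
  have b1: "b \<in> fil (min (v a) (v ?d))"
  proof -
    have "a \<in> fil (min (v a) (v ?d))" "?d \<in> fil (min (v a) (v ?d))" using assms(1) d by (auto simp: fil_def)
    then have "a \<oplus> ?d \<in> fil (min (v a) (v ?d))" by (rule fil_add)
    then show ?thesis using ab[symmetric] by simp
  qed
  show ?thesis
  proof (cases "v a < v ?d")
    case True
    have "?r \<in> fil (int e * v a + 1)"
    proof (cases "c = \<zero>")
      case c0: True
      then have "e = 1" using c_e by auto
      then show ?thesis using c0 True d assms by (simp add: fil_def)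
    next
      case False
      then have e2: "c = \<one>" "e = 2" using c_e by auto
      have "b \<in> fil (v a)" using b1 True by simp
      moreover have "?d \<in> fil (v a + 1)" using True d by (simp add: fil_def)
      ultimately have "b \<otimes> ?d \<in> fil (v a + (v a + 1))" by (rule fil_mult)
      then have "b \<otimes> ?d \<in> fil (2 * v a + 1)" by (simp add: algebra_simps)
      moreover have "?d \<in> fil (2 * v a + 1)" using True a d by (simp add: fil_def)
      ultimately show ?thesis using fil_add e2 assms d by simp
    qed
    then have "v (k \<otimes> a [^] e \<oplus> ?r) = int e * v a" "k \<otimes> a [^] e \<oplus> ?r \<noteq> \<zero>"
      using v_add_dominant[of "k \<otimes> a [^] e" ?r] ka by auto
    moreover have "?D = \<ominus> (k \<otimes> a [^] e \<oplus> ?r)"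
      using sum ka rc Dc by (metis a_closed add.inv_comm minus_equality minus_minus)
    ultimately show ?thesis using Dc ka rc v_uminus by auto
  next
    case False
    let ?l = "v ?d"
    have l: "?l \<le> v a" "?l < 0" using False a by auto
    have three: "int (m - 1) * ?l + 1 \<le> 2 * ?l"
    proof -
      have "int (m - 1) * ?l \<le> 3 * ?l" using l m_gt by (intro mult_right_mono_neg) auto
      then show ?thesis using l by linarith
    qed
    have dl: "?d \<in> fil ?l" using d in_fil_v by auto
    have "b \<in> fil ?l" using b1 l by (simp add: min_def split: if_splits)
    then have "b \<otimes> ?d \<in> fil (?l + ?l)" using dl by (rule fil_mult)
    then have "c \<otimes> (b \<otimes> ?d) \<in> fil (2 * ?l)" using fil_mult0(1)[OF c_fil] by simp
    moreover have "?d \<in> fil (2 * ?l)" using fil_mono[OF dl] l by simp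
    ultimately have "?r \<in> fil (2 * ?l)" using fil_add by simp
    moreover have "k \<otimes> a [^] e \<in> fil (2 * ?l)"
    proof -
      have "2 * ?l \<le> int e * v a" using c_e l a by auto
      then show ?thesis using ka by (simp add: fil_def)
    qed
    ultimately have "k \<otimes> a [^] e \<oplus> ?r \<in> fil (2 * ?l)" by (simp add: fil_add)
    then have "k \<otimes> a [^] e \<oplus> ?r \<in> fil (v ?D + 1)" using fil_mono three Dc(3) by simp
    then have "?D \<oplus> (k \<otimes> a [^] e \<oplus> ?r) \<noteq> \<zero>" using v_add_dominant(1)[of ?D] Dc by simp
    then show ?thesis using sum ka rc Dc by (simp add: a_comm)
  qed
qed

end

subsection \<open>A pair of coverings with disjoint ramification\<close>

definition (in field) trivial_on :: "'a set \<Rightarrow> ('a \<Rightarrow> int) \<Rightarrow> bool" where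
  "trivial_on F v \<longleftrightarrow> (\<forall>x\<in>F. x \<noteq> \<zero> \<longrightarrow> v x = 0)"

text \<open>The product clause is Vieta's formula for the constant term. Both valuations live on the
  big field \<open>R\<close>: that \<open>v u\<close> divides all values on \<open>E0\<close> says
  that \<open>u\<close>, or its inverse at the pole, is a uniformizer of the place below, without
  speaking of a restricted valuation.\<close>

definition (in trinomial) root_family :: "'a set \<Rightarrow> 'a set \<Rightarrow> 'a \<Rightarrow> (nat \<Rightarrow> 'a) \<Rightarrow> bool" where
  "root_family F E0 u \<alpha> \<longleftrightarrow> u \<in> E0 \<and> u \<noteq> \<zero> \<and> inj_on \<alpha> {1..m}
     \<and> {x \<in> carrier R. tri x = u} = \<alpha> ` {1..m} \<and> (\<Otimes>i\<in>{1..m}. \<ominus> \<alpha> i) = \<ominus> u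
     \<and> (\<exists>v. discretely_valued_field R v \<and> trivial_on F v \<and> v u > 0 \<and> (\<forall>y\<in>E0. y \<noteq> \<zero> \<longrightarrow> v u dvd v y))
     \<and> (\<exists>v. discretely_valued_field R v \<and> trivial_on F v \<and> v u < 0 \<and> (\<forall>y\<in>E0. y \<noteq> \<zero> \<longrightarrow> v u dvd v y))"

lemma (in discretely_valued_field) valued_ring_fil: "valued_ring R (fil 0)"
proof (intro valued_ring.intro valued_ring_axioms.intro field_axioms)
  show "subring (fil 0) R"
    using fil_mult0 fil_carrier by (intro subringI) (auto simp: fil_uminus fil_add fil_mult0)
  show "x \<in> fil 0 \<or> inv x \<in> fil 0" if "x \<in> carrier R" "x \<noteq> \<zero>" for x
    using that by (auto simp: fil_def v_inv)
qed

lemma (in discretely_valued_field) algebraic_value_zero: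
  assumes "subfield F R" "trivial_on F v" "x \<in> carrier R" "algebraic F x" "x \<noteq> \<zero>"
  shows "v x = 0"
proof -
  interpret valued_ring R "fil 0" using valued_ring_fil .
  have "F \<subseteq> fil 0" using assms(2) subfieldE(3)[OF assms(1)] by (auto simp: fil_def trivial_on_def)
  then have "unit x" using algebraic_unit[OF assms(1) _ assms(3-5)] by simp
  then have "x \<in> fil 0" "inv x \<in> fil 0" by (simp_all add: unit_def)
  then show ?thesis using assms(3,5) by (auto simp: fil_def v_inv)
qed

text \<open>The data are symmetric in the two families, so each statement proved for \<alpha>
  transfers to \<beta> through \<open>swap\<close>. \<open>fixed\<close> and
  \<open>determined\<close> extract what is used of \<open>R\<close> being Galois over
  \<open>E0\<close> and generated by the roots; \<open>disjoint\<close> says that \<open>u\<close>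
  and \<open>w\<close> have no common zero or pole.\<close>

locale double_cover = trinomial R m e c k for R (structure) and m e c k +
  fixes F E0 :: "'a set" and \<alpha> \<beta> :: "nat \<Rightarrow> 'a" and u w :: 'a
  assumes F: "subfield F R" "F \<subseteq> E0" "k \<in> F" and E0: "subfield E0 R"
    and fixed: "\<lbrakk>x \<in> carrier R; \<forall>\<gamma>\<in>carrier (Gal R E0). \<gamma> x = x\<rbrakk> \<Longrightarrow> x \<in> E0"
    and determined: "\<lbrakk>\<gamma> \<in> carrier (Gal R E0); \<tau> \<in> carrier (Gal R E0);
      \<And>i. i \<in> {1..m} \<Longrightarrow> \<gamma> (\<alpha> i) = \<tau> (\<alpha> i) \<and> \<gamma> (\<beta> i) = \<tau> (\<beta> i)\<rbrakk> \<Longrightarrow> \<gamma> = \<tau>"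
    and disjoint: "\<lbrakk>discretely_valued_field R v; trivial_on F v\<rbrakk> \<Longrightarrow> v u = 0 \<or> v w = 0"
    and families: "root_family F E0 u \<alpha>" "root_family F E0 w \<beta>"
begin

abbreviation "G \<equiv> carrier (Gal R E0)"

lemma swap: "double_cover R m e c k F E0 \<beta> \<alpha> w u"
proof (intro double_cover.intro double_cover_axioms.intro trinomial_axioms F E0 families)
  show "x \<in> E0" if "x \<in> carrier R" "\<forall>\<gamma>\<in>carrier (Gal R E0). \<gamma> x = x" for x
    using fixed that by simp
  show "\<gamma> = \<tau>" if "\<gamma> \<in> carrier (Gal R E0)" "\<tau> \<in> carrier (Gal R E0)"
      "\<And>i. i \<in> {1..m} \<Longrightarrow> \<gamma> (\<beta> i) = \<tau> (\<beta> i) \<and> \<gamma> (\<alpha> i) = \<tau> (\<alpha> i)" for \<gamma> \<tau>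
    using determined[OF that(1,2)] that(3) by simp
  show "v w = 0 \<or> v u = 0" if "discretely_valued_field R v" "trivial_on F v" for v
    using disjoint[OF that] by auto
qed

lemma E0_carrier: "E0 \<subseteq> carrier R" using subfieldE(3)[OF E0] .

lemma \<alpha>_props:
  shows u_E0: "u \<in> E0" and u_nonzero: "u \<noteq> \<zero>" and \<alpha>_inj: "inj_on \<alpha> {1..m}"
    and \<alpha>_closed: "i \<in> {1..m} \<Longrightarrow> \<alpha> i \<in> carrier R" and \<alpha>_root: "i \<in> {1..m} \<Longrightarrow> tri (\<alpha> i) = u"
    and \<alpha>_all: "x \<in> carrier R \<Longrightarrow> tri x = u \<Longrightarrow> x \<in> \<alpha> ` {1..m}"
    and \<alpha>_prod: "(\<Otimes>i\<in>{1..m}. \<ominus> \<alpha> i) = \<ominus> u"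
  using families(1) unfolding root_family_def by blast+

lemma u_carrier: "u \<in> carrier R" using u_E0 E0_carrier by auto

lemma G_fix: "\<gamma> \<in> G \<Longrightarrow> x \<in> E0 \<Longrightarrow> \<gamma> x = x" by (simp add: Gal_def)

lemma G_root:
  assumes "\<gamma> \<in> G" "i \<in> {1..m}"
  shows "\<gamma> (\<alpha> i) \<in> \<alpha> ` {1..m}"
proof (rule \<alpha>_all)
  show "\<gamma> (\<alpha> i) \<in> carrier R" using auto_closed[OF assms(1)] \<alpha>_closed assms by auto
  show "tri (\<gamma> (\<alpha> i)) = u"
    using tri_auto[OF assms(1), of "\<alpha> i"] \<alpha>_root[OF assms(2)] \<alpha>_closed[OF assms(2)] G_fix[OF assms(1) u_E0] by simp
qed

lemma \<alpha>_nonzero: "i \<in> {1..m} \<Longrightarrow> \<alpha> i \<noteq> \<zero>"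
  using \<alpha>_root[of i] u_nonzero m_gt by (auto simp: tri_def nat_pow_zero)

lemma finite_group: "finite_automorphism_group R G"
proof (intro finite_automorphism_group.intro finite_automorphism_group_axioms.intro field_axioms)
  interpret s: double_cover R m e c k F E0 \<beta> \<alpha> w u by (rule swap)
  let ?f = "\<lambda>\<gamma>. restrict (\<lambda>i. (\<gamma> (\<alpha> i), \<gamma> (\<beta> i))) {1..m}"
  have "inj_on ?f G"
  proof (rule inj_onI)
    fix \<gamma> \<tau> assume g: "\<gamma> \<in> G" "\<tau> \<in> G" "?f \<gamma> = ?f \<tau>"
    show "\<gamma> = \<tau>"
    proof (rule determined[OF g(1,2)])
      fix i assume "i \<in> {1..m}"
      then show "\<gamma> (\<alpha> i) = \<tau> (\<alpha> i) \<and> \<gamma> (\<beta> i) = \<tau> (\<beta> i)" using fun_cong[OF g(3), of i] by simp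
    qed
  qed
  moreover have "?f ` G \<subseteq> {1..m} \<rightarrow>\<^sub>E (\<alpha> ` {1..m} \<times> \<beta> ` {1..m})"
    using G_root s.G_root by auto
  moreover have "finite ({1..m} \<rightarrow>\<^sub>E (\<alpha> ` {1..m} \<times> \<beta> ` {1..m}))" by (intro finite_PiE) auto
  ultimately show "finite G" by (meson finite_imageD finite_subset)
  show "G \<subseteq> carrier (Gal R {})" by (rule Gal_mono) simp
  show "restrict id (carrier R) \<in> G" using Gal_id[OF E0_carrier] .
  show "restrict (\<gamma> \<circ> \<tau>) (carrier R) \<in> G" if "\<gamma> \<in> G" "\<tau> \<in> G" for \<gamma> \<tau> using Gal_comp[OF that] .
qed

text \<open>Automorphisms trivial on the constants. The inertia elements found below lie here and
  their conjugates generate all pairs of permutations of the roots, which leaves no room for new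
  constants.\<close>

definition Gc :: "('a \<Rightarrow> 'a) set" where
  "Gc = {\<gamma> \<in> G. \<forall>x\<in>carrier R. algebraic F x \<longrightarrow> \<gamma> x = x}"

lemma algebraic_auto:
  assumes "\<gamma> \<in> G" "x \<in> carrier R" "algebraic F x"
  shows "algebraic F (\<gamma> x)"
proof -
  have "\<gamma> ` F = F" using G_fix[OF assms(1)] F(2) by force
  then show ?thesis
    using algebraic_hom[OF auto_hom(1)[OF assms(1)] field_axioms field_axioms F(1) assms(2)] assms(3)
    by (simp add: over_def)
qed

text \<open>Ramification at a simple zero of \<open>u\<close>, where \<open>w\<close> is a unit, comes from an inertia element, and
  this can only exchange the two roots that meet there.\<close>

lemma exists_transposition:
  "\<exists>\<gamma>\<in>Gc. \<exists>i\<in>{1..m}. \<exists>j\<in>{1..m}. i \<noteq> j \<and> \<gamma> (\<alpha> i) = \<alpha> j \<and> \<gamma> (\<alpha> j) = \<alpha> i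
     \<and> (\<forall>l\<in>{1..m} - {i, j}. \<gamma> (\<alpha> l) = \<alpha> l) \<and> (\<forall>l\<in>{1..m}. \<gamma> (\<beta> l) = \<beta> l)"
proof -
  interpret s: double_cover R m e c k F E0 \<beta> \<alpha> w u by (rule swap)
  obtain v where v: "discretely_valued_field R v" "trivial_on F v" "v u > 0" "\<forall>y\<in>E0. y \<noteq> \<zero> \<longrightarrow> v u dvd v y"
    using families(1) unfolding root_family_def by blast
  interpret V: valued_trinomial R v m e c k
    using v(1,2) F(3) k_nonzero trinomial_axioms
    by (intro valued_trinomial.intro valued_trinomial_axioms.intro) (auto simp: trivial_on_def)
  interpret A: finite_automorphism_group R G by (rule finite_group)
  interpret VA: valued_automorphism_group R v G by unfold_locales
  have w0: "v w = 0" using disjoint[OF v(1,2)] v(3) by auto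
  have u1: "u \<in> V.fil 1" using v(3) u_carrier by (simp add: V.fil_def)
  have \<alpha>0: "\<alpha> i \<in> V.fil 0" if "i \<in> {1..m}" for i
    using V.root_integral[OF \<alpha>_closed[OF that]] \<alpha>_root[OF that] V.fil_mono[OF u1, of 0] by simp
  have \<beta>0: "\<beta> i \<in> V.fil 0" "\<beta> i \<notin> V.fil 1" if "i \<in> {1..m}" for i
    using V.root_unit[OF s.\<alpha>_closed[OF that]] s.\<alpha>_root[OF that] s.u_nonzero w0 s.\<alpha>_closed[OF that]
    by (auto simp: V.fil_def)
  define Z where "Z = {i \<in> {1..m}. \<alpha> i \<in> V.fil 1}"
  have vZ: "2 * v (\<alpha> i) = v u" if "i \<in> Z" for i
    using V.root_at_zero[of "\<alpha> i"] that \<alpha>_root[of i] u_nonzero by (auto simp: Z_def)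
  \<comment> \<open>By the product formula the values of all roots add up to \<open>v u\<close>.
    Roots outside \<open>Z\<close> contribute 0, those in \<open>Z\<close> contribute half of
    \<open>v u\<close> each.\<close>
  have cZ: "card Z = 2"
  proof -
    have "\<alpha> i \<in> carrier R \<and> \<alpha> i \<noteq> \<zero> \<and> v (\<ominus> \<alpha> i) = v (\<alpha> i)" if "i \<in> {1..m}" for i
      using \<alpha>_closed[OF that] \<alpha>_nonzero[OF that] V.v_uminus by auto
    then have "v (\<Otimes>i\<in>{1..m}. \<ominus> \<alpha> i) = (\<Sum>i\<in>{1..m}. v (\<alpha> i))"
      using V.v_finprod[of "{1..m}" "\<lambda>i. \<ominus> \<alpha> i"] by simp
    moreover have "v (\<ominus> u) = v u" using V.v_uminus u_carrier u_nonzero by simp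
    ultimately have "v u = (\<Sum>i\<in>{1..m}. v (\<alpha> i))" using \<alpha>_prod by simp
    also have "\<dots> = (\<Sum>i\<in>Z. v (\<alpha> i)) + (\<Sum>i\<in>{1..m} - Z. v (\<alpha> i))"
      by (rule sum.subset_diff[of Z, simplified add.commute]) (auto simp: Z_def)
    also have "(\<Sum>i\<in>{1..m} - Z. v (\<alpha> i)) = 0"
      using \<alpha>0 \<alpha>_nonzero \<alpha>_closed by (intro sum.neutral) (force simp: Z_def V.fil_def)
    finally have "2 * v u = (\<Sum>i\<in>Z. 2 * v (\<alpha> i))" by (simp add: sum_distrib_left)
    also have "\<dots> = int (card Z) * v u" using vZ by simp
    finally show ?thesis using v(3) by simp
  qed
  \<comment> \<open>Contrapositive of \<open>invariant_uniformizer\<close>: without such an inertia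
    element there is \<open>y\<close> in \<open>E0\<close> of value 1, hence \<open>v u\<close> = 1,
    although \<open>v u\<close> is twice the value of a root in \<open>Z\<close>.\<close>
  have "\<exists>\<gamma>\<in>G. \<gamma> \<noteq> restrict id (carrier R) \<and> (\<forall>x\<in>carrier R. x \<noteq> \<zero> \<longrightarrow> v (\<gamma> x) = v x)
      \<and> (\<forall>x\<in>carrier R. (\<forall>\<tau>\<in>G. \<tau> x \<in> V.fil 0) \<longrightarrow> x \<ominus> \<gamma> x \<in> V.fil 1)"
  proof (rule ccontr)
    assume n: "\<not> ?thesis"
    have "\<exists>y\<in>carrier R. (\<forall>\<gamma>\<in>G. \<gamma> y = y) \<and> y \<noteq> \<zero> \<and> v y = 1"
    proof (rule VA.invariant_uniformizer)
      fix \<gamma> assume "\<gamma> \<in> G" "\<gamma> \<noteq> restrict id (carrier R)" "\<And>x. x \<in> carrier R \<Longrightarrow> x \<noteq> \<zero> \<Longrightarrow> v (\<gamma> x) = v x"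
      then show "\<exists>x\<in>carrier R. (\<forall>\<tau>\<in>G. \<tau> x \<in> V.fil 0) \<and> x \<ominus> \<gamma> x \<notin> V.fil 1" using n by blast
    qed
    then obtain y where y: "y \<in> carrier R" "\<forall>\<gamma>\<in>G. \<gamma> y = y" "y \<noteq> \<zero>" "v y = 1" by auto
    then have "v u dvd 1" using v(4) fixed by fastforce
    then have "v u = 1" using v(3) by (simp add: zdvd1_eq)
    moreover obtain i where "i \<in> Z" using cZ by fastforce
    ultimately have "2 * v (\<alpha> i) = 1" using vZ by simp
    then show False by presburger
  qed
  then obtain \<gamma> where g: "\<gamma> \<in> G" "\<gamma> \<noteq> restrict id (carrier R)"
    and inert: "\<And>x. x \<in> carrier R \<Longrightarrow> (\<forall>\<tau>\<in>G. \<tau> x \<in> V.fil 0) \<Longrightarrow> x \<ominus> \<gamma> x \<in> V.fil 1" by blast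
  have ra: "\<alpha> i \<ominus> \<gamma> (\<alpha> i) \<in> V.fil 1" if "i \<in> {1..m}" for i
    using inert[OF \<alpha>_closed[OF that]] G_root[OF _ that] \<alpha>0 by fastforce
  have rb: "\<beta> i \<ominus> \<gamma> (\<beta> i) \<in> V.fil 1" if "i \<in> {1..m}" for i
    using inert[OF s.\<alpha>_closed[OF that]] s.G_root[OF _ that] \<beta>0 by fastforce
  \<comment> \<open>Since \<open>w\<close> is a unit at this place, the roots \<beta> are pairwise
    incongruent, and inertia cannot move any of them.\<close>
  have fixb: "\<gamma> (\<beta> i) = \<beta> i" if i: "i \<in> {1..m}" for i
  proof (rule ccontr)
    assume ne: "\<gamma> (\<beta> i) \<noteq> \<beta> i"
    obtain j where j: "j \<in> {1..m}" "\<gamma> (\<beta> i) = \<beta> j" using s.G_root[OF g(1) i] by auto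
    have "\<beta> j \<in> V.fil 1"
      using V.roots_separated[OF \<beta>0(1)[OF j(1)] \<beta>0(1)[OF i]] s.\<alpha>_root[OF i] s.\<alpha>_root[OF j(1)] rb[OF i] ne j by simp
    then show False using \<beta>0(2)[OF j(1)] by simp
  qed
  have mv: "\<gamma> (\<alpha> i) = \<alpha> i \<or> (i \<in> Z \<and> \<gamma> (\<alpha> i) \<in> \<alpha> ` Z)" if i: "i \<in> {1..m}" for i
  proof (rule ccontr)
    assume ne: "\<not> ?thesis"
    obtain j where j: "j \<in> {1..m}" "\<gamma> (\<alpha> i) = \<alpha> j" using G_root[OF g(1) i] by auto
    have j1: "\<alpha> j \<in> V.fil 1"
      using V.roots_separated[OF \<alpha>0[OF j(1)] \<alpha>0[OF i]] \<alpha>_root[OF i] \<alpha>_root[OF j(1)] ra[OF i] ne j by simp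
    have "\<alpha> i \<ominus> \<alpha> j \<oplus> \<alpha> j \<in> V.fil 1" using V.fil_add ra[OF i] j(2) j1 by simp
    moreover have "\<alpha> i \<ominus> \<alpha> j \<oplus> \<alpha> j = \<alpha> i" using \<alpha>_closed[OF i] \<alpha>_closed[OF j(1)] by (simp add: minus_eq a_assoc l_neg)
    ultimately have "i \<in> Z" "j \<in> Z" using i j j1 by (auto simp: Z_def)
    then show False using ne j by auto
  qed
  obtain i where i: "i \<in> {1..m}" "\<gamma> (\<alpha> i) \<noteq> \<alpha> i"
  proof -
    have "\<not> (\<forall>i\<in>{1..m}. \<gamma> (\<alpha> i) = \<alpha> i)"
    proof
      assume a: "\<forall>i\<in>{1..m}. \<gamma> (\<alpha> i) = \<alpha> i"
      have "\<gamma> = restrict id (carrier R)"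
        using a fixb \<alpha>_closed s.\<alpha>_closed by (intro determined[OF g(1) A.G_id]) auto
      then show False using g(2) by simp
    qed
    then show ?thesis using that by blast
  qed
  then have iZ: "i \<in> Z" "\<gamma> (\<alpha> i) \<in> \<alpha> ` Z" using mv by blast+
  then obtain j where j: "j \<in> Z" "\<gamma> (\<alpha> i) = \<alpha> j" by auto
  have ij: "i \<noteq> j" using i j by auto
  have fZ: "finite Z" by (simp add: Z_def)
  have Zeq: "Z = {i, j}"
    using cZ iZ(1) j(1) ij fZ by (intro card_seteq[symmetric]) auto
  have jm: "j \<in> {1..m}" using j by (auto simp: Z_def)
  have "\<gamma> (\<alpha> j) \<noteq> \<alpha> j"
    using auto_hom(3)[OF g(1)] \<alpha>_closed[OF i(1)] \<alpha>_closed[OF jm] \<alpha>_inj i(1) jm ij j(2) by (metis inj_onD)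
  then have "\<gamma> (\<alpha> j) = \<alpha> i" using mv[OF jm] Zeq by auto
  moreover have "\<gamma> (\<alpha> l) = \<alpha> l" if "l \<in> {1..m} - {i, j}" for l using mv[of l] that Zeq by auto
  moreover have "\<gamma> \<in> Gc"
  proof -
    \<comment> \<open>The difference of \<open>x\<close> and \<open>\<gamma> x\<close> is algebraic
      over \<open>F\<close>, so it has value 0 unless it vanishes, whereas inertia puts it into the
      maximal ideal.\<close>
    have "\<gamma> x = x" if x: "x \<in> carrier R" "algebraic F x" for x
    proof (rule ccontr)
      assume ne: "\<gamma> x \<noteq> x"
      have c0: "\<tau> x \<in> V.fil 0" if "\<tau> \<in> G" for \<tau>
        using V.algebraic_value_zero[OF F(1) v(2) auto_closed[OF that x(1)] algebraic_auto[OF that x]]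
          auto_closed[OF that x(1)] by (cases "\<tau> x = \<zero>") (auto simp: V.fil_def)
      have gx: "\<gamma> x \<in> carrier R" using auto_closed[OF g(1) x(1)] .
      let ?C = "{x \<in> carrier R. algebraic F x}"
      have C: "subring ?C R" using subfieldE(1)[OF subfield_of_algebraics[OF F(1)]] by (simp add: over_def)
      have "x \<in> ?C" "\<gamma> x \<in> ?C" using x gx algebraic_auto[OF g(1) x] by auto
      then have "x \<ominus> \<gamma> x \<in> ?C" using subringE(7)[OF C _ subringE(5)[OF C]] by (simp only: minus_eq)
      then have "v (x \<ominus> \<gamma> x) = 0" using V.algebraic_value_zero[OF F(1) v(2)] ne x gx by (auto simp: over_def)
      then show False using inert[OF x(1)] c0 ne x gx by (auto simp: V.fil_def)
    qed
    then show ?thesis using g by (simp add: Gc_def)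
  qed
  ultimately show ?thesis using ij i(1) jm j(2) fixb by blast
qed

text \<open>An automorphism permutes the orbit. The product runs over the orbit and not over the
  group, so that its valuation counts orbit elements.\<close>

lemma orbit_product_invariant:
  assumes Ob: "Ob = (\<lambda>\<gamma>. (\<gamma> a, \<gamma> b)) ` G" "a \<in> carrier R" "b \<in> carrier R"
    and f: "\<And>\<gamma> x y. \<gamma> \<in> G \<Longrightarrow> x \<in> carrier R \<Longrightarrow> y \<in> carrier R \<Longrightarrow> \<gamma> (f (x, y)) = f (\<gamma> x, \<gamma> y)"
    and fc: "\<And>x y. x \<in> carrier R \<Longrightarrow> y \<in> carrier R \<Longrightarrow> f (x, y) \<in> carrier R"
  shows "finprod R f Ob \<in> E0"
proof (rule fixed)
  interpret A: finite_automorphism_group R G by (rule finite_group)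
  have Oc: "p \<in> carrier R \<times> carrier R" if "p \<in> Ob" for p using that Ob auto_closed by auto
  have fO: "f \<in> Ob \<rightarrow> carrier R" using Oc fc by auto
  then show "finprod R f Ob \<in> carrier R" by (rule finprod_closed)
  show "\<forall>\<gamma>\<in>G. \<gamma> (finprod R f Ob) = finprod R f Ob"
  proof
    fix \<gamma> assume g: "\<gamma> \<in> G"
    have hc: "ring_hom_cring R R \<gamma>"
      by (intro ring_hom_cring.intro ring_hom_cring_axioms.intro is_cring auto_hom(1)[OF g])
    let ?m = "\<lambda>p. (\<gamma> (fst p), \<gamma> (snd p))"
    have inj: "inj_on ?m Ob"
      using Oc auto_hom(3)[OF g] by (intro inj_onI) (auto simp: inj_on_def prod_eq_iff)
    have img: "?m ` Ob \<subseteq> Ob"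
    proof
      fix p assume "p \<in> ?m ` Ob"
      then obtain \<tau> where t: "\<tau> \<in> G" "p = (\<gamma> (\<tau> a), \<gamma> (\<tau> b))" using Ob by auto
      then have "p = (restrict (\<gamma> \<circ> \<tau>) (carrier R) a, restrict (\<gamma> \<circ> \<tau>) (carrier R) b)" using Ob by simp
      then show "p \<in> Ob" using A.G_comp[OF g t(1)] Ob by blast
    qed
    have fin: "finite Ob" using Ob A.G_finite by simp
    have eq: "?m ` Ob = Ob" using endo_inj_surj[OF fin img inj] .
    have "\<gamma> (finprod R f Ob) = finprod R (\<gamma> \<circ> f) Ob" using ring_hom_cring.hom_finprod[OF hc fO] by (simp add: comp_def)
    also have "\<dots> = finprod R (\<lambda>p. f (?m p)) Ob"
    proof (rule finprod_cong')
      show "(\<lambda>p. f (?m p)) \<in> Ob \<rightarrow> carrier R" using Oc fc auto_closed[OF g] by fastforce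
      fix p assume "p \<in> Ob"
      then show "(\<gamma> \<circ> f) p = f (?m p)" using f[OF g, of "fst p" "snd p"] Oc[of p] by auto
    qed simp
    also have "\<dots> = finprod R f (?m ` Ob)" using inj fO eq by (subst finprod_reindex) auto
    finally show "\<gamma> (finprod R f Ob) = finprod R f Ob" using eq by simp
  qed
qed

text \<open>At a simple pole of \<open>u\<close> all \<open>m(m-1)\<close> differences of roots have the same valuation, whose
  denominator is \<open>m(m-1)\<close> up to a factor \<open>e\<close>; hence the orbit of a pair has \<open>m(m-1)\<close> elements.\<close>

lemma doubly_transitive:
  assumes ij: "i \<in> {1..m}" "j \<in> {1..m}" "i \<noteq> j" and ij': "i' \<in> {1..m}" "j' \<in> {1..m}" "i' \<noteq> j'"
  shows "\<exists>\<gamma>\<in>G. \<gamma> (\<alpha> i) = \<alpha> i' \<and> \<gamma> (\<alpha> j) = \<alpha> j'"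
proof -
  obtain v where v: "discretely_valued_field R v" "trivial_on F v" "v u < 0" "\<forall>y\<in>E0. y \<noteq> \<zero> \<longrightarrow> v u dvd v y"
    using families(1) unfolding root_family_def by blast
  interpret V: valued_trinomial R v m e c k
    using v(1,2) F(3) k_nonzero trinomial_axioms
    by (intro valued_trinomial.intro valued_trinomial_axioms.intro) (auto simp: trivial_on_def)
  interpret A: finite_automorphism_group R G by (rule finite_group)
  define Ob where "Ob = (\<lambda>\<gamma>. (\<gamma> (\<alpha> i), \<gamma> (\<alpha> j))) ` G"
  define P where "P = {(x, y). x \<in> \<alpha> ` {1..m} \<and> y \<in> \<alpha> ` {1..m} \<and> x \<noteq> y}"
  have OP: "Ob \<subseteq> P"
  proof
    fix p assume "p \<in> Ob"
    then obtain \<gamma> where g: "\<gamma> \<in> G" "p = (\<gamma> (\<alpha> i), \<gamma> (\<alpha> j))" by (auto simp: Ob_def)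
    have "\<gamma> (\<alpha> i) \<noteq> \<gamma> (\<alpha> j)"
      using auto_hom(3)[OF g(1)] \<alpha>_closed[OF ij(1)] \<alpha>_closed[OF ij(2)] \<alpha>_inj ij by (metis inj_onD)
    then show "p \<in> P" using G_root[OF g(1)] ij g(2) by (auto simp: P_def)
  qed
  have cA: "card (\<alpha> ` {1..m}) = m" using card_image[OF \<alpha>_inj] by simp
  have fA: "finite (\<alpha> ` {1..m})" by simp
  have "P = (\<alpha> ` {1..m} \<times> \<alpha> ` {1..m}) - (\<lambda>x. (x, x)) ` (\<alpha> ` {1..m})" by (auto simp: P_def)
  moreover have "card ((\<lambda>x. (x, x)) ` (\<alpha> ` {1..m})) = m" using cA by (subst card_image) (auto intro: inj_onI)
  moreover have "card ((\<alpha> ` {1..m} \<times> \<alpha> ` {1..m}) - (\<lambda>x. (x, x)) ` (\<alpha> ` {1..m}))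
      = card (\<alpha> ` {1..m} \<times> \<alpha> ` {1..m}) - card ((\<lambda>x. (x, x)) ` (\<alpha> ` {1..m}))"
    by (rule card_Diff_subset) auto
  ultimately have cP: "card P = m * (m - 1)" using cA by (simp add: card_cartesian_product diff_mult_distrib2)
  have fP: "finite P" by (rule finite_subset[of _ "\<alpha> ` {1..m} \<times> \<alpha> ` {1..m}"]) (auto simp: P_def)
  have fO: "finite Ob" using OP fP finite_subset by auto
  have "restrict id (carrier R) \<in> G" by (rule A.G_id)
  then have One: "Ob \<noteq> {}" by (auto simp: Ob_def)
  have pr: "x \<in> carrier R" "y \<in> carrier R" "x \<noteq> y" "x \<noteq> \<zero>" "tri x = u" "tri y = u" if xy: "(x, y) \<in> Ob" for x y
  proof -
    have "(x, y) \<in> P" using OP xy by blast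
    then obtain a b where "a \<in> {1..m}" "x = \<alpha> a" "b \<in> {1..m}" "y = \<alpha> b" "x \<noteq> y" unfolding P_def by blast
    then show "x \<in> carrier R" "y \<in> carrier R" "x \<noteq> y" "x \<noteq> \<zero>" "tri x = u" "tri y = u"
      using \<alpha>_closed \<alpha>_root \<alpha>_nonzero by simp_all
  qed
  \<comment> \<open>Two invariants: the product of the first roots has value
    \<open>|Ob| v u / m\<close>, and the product of the differences has \<open>e / (m - 1)\<close>
    times that value. Both lie in \<open>E0\<close>, so both values are integral multiples of
    \<open>v u\<close>.\<close>
  define Z where "Z = finprod R fst Ob"
  define Y where "Y = finprod R (\<lambda>p. snd p \<ominus> fst p) Ob"
  have ZE: "Z \<in> E0" unfolding Z_def
    by (rule orbit_product_invariant[OF Ob_def]) (use ij \<alpha>_closed in auto)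
  have YE: "Y \<in> E0" unfolding Y_def
    by (rule orbit_product_invariant[OF Ob_def]) (use ij \<alpha>_closed in \<open>auto simp: auto_diff\<close>)
  have Zv: "Z \<noteq> \<zero>" "v Z = (\<Sum>p\<in>Ob. v (fst p))"
    using V.v_finprod[OF fO, of fst] pr unfolding Z_def by auto
  have "snd p \<ominus> fst p \<in> carrier R \<and> snd p \<ominus> fst p \<noteq> \<zero>" if "p \<in> Ob" for p
    using pr[of "fst p" "snd p"] that by auto
  then have Yv: "Y \<noteq> \<zero>" "v Y = (\<Sum>p\<in>Ob. v (snd p \<ominus> fst p))"
    using V.v_finprod[OF fO, of "\<lambda>p. snd p \<ominus> fst p"] unfolding Y_def by simp_all
  have mv: "int m * v (fst p) = v u" if "p \<in> Ob" for p
    using V.root_at_pole(3)[of "fst p"] pr[of "fst p" "snd p"] that u_nonzero v(3) by auto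
  have dv: "int (m - 1) * v (snd p \<ominus> fst p) = int e * v (fst p)" if "p \<in> Ob" for p
    using V.root_difference_at_pole[of "fst p" "snd p"] pr[of "fst p" "snd p"] that u_nonzero v(3) by auto
  have mZ: "int m * v Z = int (card Ob) * v u" using Zv mv by (simp add: sum_distrib_left)
  have dY: "int (m - 1) * v Y = int e * v Z" using Yv Zv dv by (simp add: sum_distrib_left)
  obtain z where z: "v Z = v u * z" using v(4) ZE Zv by (meson dvdE)
  obtain y where y: "v Y = v u * y" using v(4) YE Yv by (meson dvdE)
  have 1: "int m * z = int (card Ob)" using mZ z v(3) by (simp add: mult.commute mult.left_commute)
  have "int (m - 1) * y = int e * z" using dY y z v(3) by (simp add: mult.commute mult.left_commute)
  then have "int (m - 1) dvd int e * z" by (metis dvd_triv_left)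
  moreover have "coprime (int (m - 1)) (int e)" using coprime_e by simp
  \<comment> \<open>Since \<open>card Ob\<close> equals \<open>m z\<close>, this makes the orbit as
    large as the set of all ordered pairs of distinct roots.\<close>
  ultimately have "int (m - 1) dvd z" using coprime_dvd_mult_right_iff by blast
  then have "int m * int (m - 1) dvd int (card Ob)" using 1 by (metis mult_dvd_mono dvd_refl)
  then have "m * (m - 1) dvd card Ob" by (metis int_dvd_int_iff of_nat_mult)
  then have "card P \<le> card Ob" using cP fO One by (intro dvd_imp_le) (auto simp: card_gt_0_iff)
  then have "Ob = P" using OP fP by (intro card_seteq) auto
  moreover have "\<alpha> i' \<noteq> \<alpha> j'" using ij' \<alpha>_inj by (meson inj_onD)
  then have "(\<alpha> i', \<alpha> j') \<in> P" using ij' unfolding P_def by blast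
  ultimately have "(\<alpha> i', \<alpha> j') \<in> Ob" by simp
  then show ?thesis unfolding Ob_def by force
qed

end

section \<open>The Galois group as a full product of two symmetric groups, and its diagonal\<close>

context double_cover
begin

interpretation A: finite_automorphism_group R G by (rule finite_group)

interpretation s: double_cover R m e c k F E0 \<beta> \<alpha> w u by (rule swap)

lemma G_inverse:
  assumes "\<delta> \<in> G"
  obtains \<delta>' where "\<delta>' \<in> G" "\<And>x. x \<in> carrier R \<Longrightarrow> \<delta> (\<delta>' x) = x"
proof -
  have "restrict id (carrier R) \<in> (\<lambda>\<tau>. restrict (\<delta> \<circ> \<tau>) (carrier R)) ` G"
    using A.G_left_bij[OF assms] A.G_id by (simp add: bij_betw_def)
  then obtain \<delta>' where d: "\<delta>' \<in> G" "restrict id (carrier R) = restrict (\<delta> \<circ> \<delta>') (carrier R)" by blast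
  have "\<delta> (\<delta>' x) = x" if "x \<in> carrier R" for x using fun_cong[OF d(2), of x] that by simp
  then show thesis using d(1) that by blast
qed

lemma Gc_comp:
  assumes "\<gamma> \<in> Gc" "\<tau> \<in> Gc"
  shows "restrict (\<gamma> \<circ> \<tau>) (carrier R) \<in> Gc"
  using assms A.G_comp unfolding Gc_def by auto

text \<open>Conjugation of the one known transposition by an automorphism carrying its two roots to
  the prescribed ones. The conjugate stays trivial on the roots \<beta>, which the conjugating
  element merely permutes, and on the constants, which it maps to constants.\<close>

lemma all_transpositions:
  assumes ij: "i \<in> {1..m}" "j \<in> {1..m}" "i \<noteq> j"
  shows "\<exists>\<gamma>\<in>Gc. \<forall>l\<in>{1..m}. \<gamma> (\<alpha> l) = \<alpha> (Transposition.transpose i j l) \<and> \<gamma> (\<beta> l) = \<beta> l"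
proof -
  obtain \<tau> a b where t: "\<tau> \<in> Gc" "a \<in> {1..m}" "b \<in> {1..m}" "a \<noteq> b" "\<tau> (\<alpha> a) = \<alpha> b" "\<tau> (\<alpha> b) = \<alpha> a"
    "\<And>l. l \<in> {1..m} - {a, b} \<Longrightarrow> \<tau> (\<alpha> l) = \<alpha> l" "\<And>l. l \<in> {1..m} \<Longrightarrow> \<tau> (\<beta> l) = \<beta> l"
    using exists_transposition by blast
  have tG: "\<tau> \<in> G" using t(1) by (simp add: Gc_def)
  obtain \<delta> where d: "\<delta> \<in> G" "\<delta> (\<alpha> a) = \<alpha> i" "\<delta> (\<alpha> b) = \<alpha> j" using doubly_transitive[OF t(2-4) ij] by auto
  obtain \<delta>' where d': "\<delta>' \<in> G" "\<And>x. x \<in> carrier R \<Longrightarrow> \<delta> (\<delta>' x) = x" by (rule G_inverse[OF d(1)]) blast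
  let ?g = "restrict (\<delta> \<circ> restrict (\<tau> \<circ> \<delta>') (carrier R)) (carrier R)"
  have gG: "?g \<in> G" using A.G_comp[OF d(1) A.G_comp[OF tG d'(1)]] .
  have gx: "?g x = \<delta> (\<tau> (\<delta>' x))" if "x \<in> carrier R" for x using that by simp
  have "?g x = x" if x: "x \<in> carrier R" "algebraic F x" for x
  proof -
    have "\<tau> (\<delta>' x) = \<delta>' x" using t(1) algebraic_auto[OF d'(1) x] auto_closed[OF d'(1) x(1)] by (simp add: Gc_def)
    then show ?thesis using gx[OF x(1)] d'(2)[OF x(1)] by simp
  qed
  then have "?g \<in> Gc" using gG unfolding Gc_def by blast
  moreover have "?g (\<alpha> l) = \<alpha> (Transposition.transpose i j l) \<and> ?g (\<beta> l) = \<beta> l" if l: "l \<in> {1..m}" for l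
  proof
    obtain l' where l': "l' \<in> {1..m}" "\<delta>' (\<beta> l) = \<beta> l'" using s.G_root[OF d'(1) l] by auto
    have "\<delta> (\<beta> l') = \<beta> l" using d'(2)[OF s.\<alpha>_closed[OF l]] l' by simp
    then show "?g (\<beta> l) = \<beta> l" using gx[OF s.\<alpha>_closed[OF l]] l' t(8) by simp
    obtain r where r: "r \<in> {1..m}" "\<delta>' (\<alpha> l) = \<alpha> r" using G_root[OF d'(1) l] by auto
    have dr: "\<delta> (\<alpha> r) = \<alpha> l" using d'(2)[OF \<alpha>_closed[OF l]] r by simp
    have iff: "\<delta> (\<alpha> x) = \<delta> (\<alpha> y) \<longleftrightarrow> x = y" if "x \<in> {1..m}" "y \<in> {1..m}" for x y
      using auto_hom(3)[OF d(1)] \<alpha>_closed that \<alpha>_inj by (metis inj_onD)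
    have iff': "\<alpha> x = \<alpha> y \<longleftrightarrow> x = y" if "x \<in> {1..m}" "y \<in> {1..m}" for x y
      using that \<alpha>_inj by (metis inj_onD)
    have li: "l = i \<longleftrightarrow> r = a" using iff[OF r(1) t(2)] iff'[OF l ij(1)] dr d(2) by simp
    have lj: "l = j \<longleftrightarrow> r = b" using iff[OF r(1) t(3)] iff'[OF l ij(2)] dr d(3) by simp
    show "?g (\<alpha> l) = \<alpha> (Transposition.transpose i j l)"
    proof (cases "r = a \<or> r = b")
      case True
      then show ?thesis using li lj gx[OF \<alpha>_closed[OF l]] r(2) t(5,6) d(2,3) ij by auto
    next
      case False
      then have "\<tau> (\<alpha> r) = \<alpha> r" using t(7) r by auto
      then show ?thesis using False li lj gx[OF \<alpha>_closed[OF l]] r(2) dr by (simp add: transpose_def)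
    qed
  qed
  ultimately show ?thesis by blast
qed

lemma all_permutations:
  assumes "\<pi> permutes {1..m}"
  shows "\<exists>\<gamma>\<in>Gc. \<forall>l\<in>{1..m}. \<gamma> (\<alpha> l) = \<alpha> (\<pi> l) \<and> \<gamma> (\<beta> l) = \<beta> l"
  using assms finite_atLeastAtMost
proof (induct \<pi> rule: permutes_induct)
  case id
  have "restrict id (carrier R) \<in> Gc" using A.G_id by (simp add: Gc_def)
  then show ?case using \<alpha>_closed s.\<alpha>_closed by (intro bexI[of _ "restrict id (carrier R)"]) auto
next
  case (swap a b p)
  obtain \<gamma> where g: "\<gamma> \<in> Gc" "\<And>l. l \<in> {1..m} \<Longrightarrow> \<gamma> (\<alpha> l) = \<alpha> (p l) \<and> \<gamma> (\<beta> l) = \<beta> l" using swap(4) by blast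
  obtain \<tau> where t: "\<tau> \<in> Gc" "\<And>l. l \<in> {1..m} \<Longrightarrow> \<tau> (\<alpha> l) = \<alpha> (Transposition.transpose a b l) \<and> \<tau> (\<beta> l) = \<beta> l"
    using all_transpositions[OF swap(1-3)] by blast
  have "p l \<in> {1..m}" if "l \<in> {1..m}" for l using swap(5) that permutes_in_image by metis
  then have "restrict (\<tau> \<circ> \<gamma>) (carrier R) (\<alpha> l) = \<alpha> ((Transposition.transpose a b \<circ> p) l)
      \<and> restrict (\<tau> \<circ> \<gamma>) (carrier R) (\<beta> l) = \<beta> l" if "l \<in> {1..m}" for l
    using g(2)[OF that] t(2) that \<alpha>_closed[OF that] s.\<alpha>_closed[OF that] by simp
  then show ?case using Gc_comp[OF t(1) g(1)] by blast
qed

lemma all_pairs_of_permutations: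
  assumes "\<pi> permutes {1..m}" "\<rho> permutes {1..m}"
  shows "\<exists>\<gamma>\<in>Gc. \<forall>l\<in>{1..m}. \<gamma> (\<alpha> l) = \<alpha> (\<pi> l) \<and> \<gamma> (\<beta> l) = \<beta> (\<rho> l)"
proof -
  obtain \<gamma> where g: "\<gamma> \<in> Gc" "\<And>l. l \<in> {1..m} \<Longrightarrow> \<gamma> (\<alpha> l) = \<alpha> (\<pi> l) \<and> \<gamma> (\<beta> l) = \<beta> l"
    using all_permutations[OF assms(1)] by blast
  have "\<exists>\<tau>\<in>s.Gc. \<forall>l\<in>{1..m}. \<tau> (\<beta> l) = \<beta> (\<rho> l) \<and> \<tau> (\<alpha> l) = \<alpha> l"
    by (rule double_cover.all_permutations[OF swap assms(2)])
  then obtain \<tau> where t: "\<tau> \<in> Gc" "\<And>l. l \<in> {1..m} \<Longrightarrow> \<tau> (\<beta> l) = \<beta> (\<rho> l) \<and> \<tau> (\<alpha> l) = \<alpha> l"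
    unfolding Gc_def s.Gc_def by blast
  have "\<pi> l \<in> {1..m}" if "l \<in> {1..m}" for l using assms(1) that permutes_in_image by metis
  then have "restrict (\<tau> \<circ> \<gamma>) (carrier R) (\<alpha> l) = \<alpha> (\<pi> l) \<and> restrict (\<tau> \<circ> \<gamma>) (carrier R) (\<beta> l) = \<beta> (\<rho> l)"
    if "l \<in> {1..m}" for l
    using g(2)[OF that] t(2) that \<alpha>_closed[OF that] s.\<alpha>_closed[OF that] by simp
  then show ?thesis using Gc_comp[OF t(1) g(1)] by blast
qed

lemma G_permutation:
  assumes "\<gamma> \<in> G"
  shows "\<exists>\<pi>. \<pi> permutes {1..m} \<and> (\<forall>l\<in>{1..m}. \<gamma> (\<alpha> l) = \<alpha> (\<pi> l))"
proof -
  define \<pi> where "\<pi> = (\<lambda>l. if l \<in> {1..m} then inv_into {1..m} \<alpha> (\<gamma> (\<alpha> l)) else l)"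
  have p: "\<pi> l \<in> {1..m}" "\<alpha> (\<pi> l) = \<gamma> (\<alpha> l)" if "l \<in> {1..m}" for l
    using G_root[OF assms that] that inv_into_into[of "\<gamma> (\<alpha> l)" \<alpha> "{1..m}"] f_inv_into_f[of "\<gamma> (\<alpha> l)" \<alpha> "{1..m}"]
    by (simp_all add: \<pi>_def)
  have "inj_on \<pi> {1..m}"
  proof (rule inj_onI)
    fix x y assume xy: "x \<in> {1..m}" "y \<in> {1..m}" "\<pi> x = \<pi> y"
    then have "\<gamma> (\<alpha> x) = \<gamma> (\<alpha> y)" using p(2) by metis
    then show "x = y" using auto_hom(3)[OF assms] \<alpha>_closed \<alpha>_inj xy by (metis inj_onD)
  qed
  moreover have "\<pi> ` {1..m} \<subseteq> {1..m}" using p(1) by blast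
  ultimately have "bij_betw \<pi> {1..m} {1..m}" using endo_inj_surj[of "{1..m}" \<pi>] by (simp add: bij_betw_def)
  then have "\<pi> permutes {1..m}" by (rule bij_imp_permutes) (unfold \<pi>_def, argo)
  then show ?thesis using p(2) by metis
qed

text \<open>Every member of \<open>G\<close> acts on the roots like some member of
  \<open>Gc\<close>, and this action determines it. Hence all of \<open>G\<close> fixes the
  constants.\<close>

lemma algebraic_in_E0:
  assumes "x \<in> carrier R" "algebraic F x"
  shows "x \<in> E0"
proof (rule fixed[OF assms(1)], rule ballI)
  fix \<gamma> assume g: "\<gamma> \<in> G"
  obtain \<pi> where p: "\<pi> permutes {1..m}" "\<forall>l\<in>{1..m}. \<gamma> (\<alpha> l) = \<alpha> (\<pi> l)" using G_permutation[OF g] by blast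
  obtain \<rho> where r: "\<rho> permutes {1..m}" "\<forall>l\<in>{1..m}. \<gamma> (\<beta> l) = \<beta> (\<rho> l)"
    using double_cover.G_permutation[OF swap g] by blast
  obtain \<tau> where t: "\<tau> \<in> Gc" "\<forall>l\<in>{1..m}. \<tau> (\<alpha> l) = \<alpha> (\<pi> l) \<and> \<tau> (\<beta> l) = \<beta> (\<rho> l)"
    using all_pairs_of_permutations[OF p(1) r(1)] by blast
  have "\<gamma> = \<tau>" using t p r by (intro determined[OF g]) (auto simp: Gc_def)
  then show "\<gamma> x = x" using t(1) assms by (simp add: Gc_def)
qed

text \<open>At every place one of the two families has distinct residues, so the diagonal subgroup has
  trivial inertia everywhere.\<close>

lemma distinct_residues:
  assumes v: "discretely_valued_field R v" "trivial_on F v" and u0: "v u = 0"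
    and l: "l \<in> {1..m}" "l' \<in> {1..m}" "l \<noteq> l'"
  shows "\<alpha> l \<ominus> \<alpha> l' \<notin> discretely_valued_field.fil R v 1" "\<alpha> l \<in> discretely_valued_field.fil R v 0"
proof -
  interpret V: valued_trinomial R v m e c k
    using v F(3) k_nonzero trinomial_axioms
    by (intro valued_trinomial.intro valued_trinomial_axioms.intro) (auto simp: trivial_on_def)
  have a0: "\<alpha> i \<in> V.fil 0" "\<alpha> i \<notin> V.fil 1" if "i \<in> {1..m}" for i
    using V.root_unit[OF \<alpha>_closed[OF that]] \<alpha>_root[OF that] u_nonzero u0 \<alpha>_closed[OF that]
    by (auto simp: V.fil_def)
  show "\<alpha> l \<in> V.fil 0" using a0 l by blast
  have "\<alpha> l \<noteq> \<alpha> l'" using l \<alpha>_inj by (meson inj_onD)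
  then show "\<alpha> l \<ominus> \<alpha> l' \<notin> V.fil 1"
    using V.roots_separated[OF a0(1)[OF l(2)] a0(1)[OF l(1)]] \<alpha>_root[OF l(1)] \<alpha>_root[OF l(2)] a0(2)[OF l(2)] by auto
qed

text \<open>The permutations of the first \<open>n\<close> indices act simultaneously on both
  families, and \<open>K\<close> is the field of invariants. The last clause expresses
  unramifiedness without places of \<open>K\<close>: an element of \<open>K\<close> with value 1 is
  a uniformizer above and below at once.\<close>

theorem diagonal_symmetric_group:
  assumes n: "n \<le> m"
  shows "\<exists>K. subfield K R \<and> E0 \<subseteq> K \<and> {x \<in> carrier R. \<forall>\<gamma>\<in>carrier (Gal R K). \<gamma> x = x} = K
    \<and> Gal R K \<cong> sym_group n
    \<and> (\<forall>v. discretely_valued_field R v \<and> trivial_on F v \<longrightarrow> (\<exists>y\<in>K. y \<noteq> \<zero> \<and> v y = 1))"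
proof -
  define act where "act = (\<lambda>\<pi> \<gamma>. \<forall>l\<in>{1..m}. \<gamma> (\<alpha> l) = \<alpha> (\<pi> l) \<and> \<gamma> (\<beta> l) = \<beta> (\<pi> l))"
  have pm: "\<pi> permutes {1..m}" if "\<pi> permutes {1..n}" for \<pi> using permutes_subset[OF that, of "{1..m}"] n by auto
  have "\<exists>\<gamma>\<in>G. act \<pi> \<gamma>" if "\<pi> permutes {1..n}" for \<pi>
    using all_pairs_of_permutations[OF pm[OF that] pm[OF that]] unfolding act_def Gc_def by blast
  then obtain \<Phi> where \<Phi>: "\<And>\<pi>. \<pi> permutes {1..n} \<Longrightarrow> \<Phi> \<pi> \<in> G \<and> act \<pi> (\<Phi> \<pi>)" by metis
  have uniq: "\<gamma> = \<tau>" if "\<gamma> \<in> G" "\<tau> \<in> G" "act \<pi> \<gamma>" "act \<pi> \<tau>" for \<gamma> \<tau> \<pi>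
    using that by (intro determined) (auto simp: act_def)
  define H where "H = \<Phi> ` {\<pi>. \<pi> permutes {1..n}}"
  have HG: "H \<subseteq> G" using \<Phi> by (auto simp: H_def)
  have comp_act: "act (\<pi> \<circ> \<rho>) (restrict (\<gamma> \<circ> \<tau>) (carrier R))"
    if "act \<pi> \<gamma>" "act \<rho> \<tau>" "\<rho> permutes {1..n}" for \<pi> \<rho> \<gamma> \<tau>
  proof -
    have "\<rho> l \<in> {1..m}" if "l \<in> {1..m}" for l using permutes_in_image[OF pm[OF \<open>\<rho> permutes {1..n}\<close>]] that by blast
    then show ?thesis using that(1,2) \<alpha>_closed s.\<alpha>_closed by (simp add: act_def)
  qed
  have \<Phi>_comp: "restrict (\<Phi> \<pi> \<circ> \<Phi> \<rho>) (carrier R) = \<Phi> (\<pi> \<circ> \<rho>)" if pr: "\<pi> permutes {1..n}" "\<rho> permutes {1..n}" for \<pi> \<rho>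
    using uniq[OF A.G_comp] \<Phi>[OF pr(1)] \<Phi>[OF pr(2)] \<Phi>[OF permutes_compose[OF pr(2,1)]] comp_act pr by blast
  have \<Phi>_id: "\<Phi> id = restrict id (carrier R)"
    using uniq[OF _ A.G_id, of "\<Phi> id" id] \<Phi>[OF permutes_id] \<alpha>_closed s.\<alpha>_closed by (simp add: act_def)
  have \<Phi>_inj: "\<pi> = \<rho>" if pr: "\<pi> permutes {1..n}" "\<rho> permutes {1..n}" and eq: "\<Phi> \<pi> = \<Phi> \<rho>" for \<pi> \<rho>
  proof
    fix l
    show "\<pi> l = \<rho> l"
    proof (cases "l \<in> {1..m}")
      case True
      then have "\<alpha> (\<pi> l) = \<alpha> (\<rho> l)" using \<Phi>[OF pr(1)] \<Phi>[OF pr(2)] eq unfolding act_def by metis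
      moreover have "\<pi> l \<in> {1..m}" "\<rho> l \<in> {1..m}"
        using True permutes_in_image[OF pm[OF pr(1)]] permutes_in_image[OF pm[OF pr(2)]] by blast+
      ultimately show ?thesis using \<alpha>_inj by (meson inj_onD)
    next
      case False
      then show ?thesis using permutes_not_in[OF pm[OF pr(1)]] permutes_not_in[OF pm[OF pr(2)]] by metis
    qed
  qed
  have H: "finite_automorphism_group R H"
  proof (intro finite_automorphism_group.intro finite_automorphism_group_axioms.intro field_axioms)
    show "finite H" using HG A.G_finite finite_subset by auto
    show "H \<subseteq> carrier (Gal R {})" using HG A.G_auto by auto
    show "restrict id (carrier R) \<in> H" using \<Phi>_id permutes_id unfolding H_def by (metis imageI mem_Collect_eq)
    fix \<gamma> \<tau> assume "\<gamma> \<in> H" "\<tau> \<in> H"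
    then obtain \<pi> \<rho> where "\<gamma> = \<Phi> \<pi>" "\<pi> permutes {1..n}" "\<tau> = \<Phi> \<rho>" "\<rho> permutes {1..n}" by (auto simp: H_def)
    then show "restrict (\<gamma> \<circ> \<tau>) (carrier R) \<in> H"
      using \<Phi>_comp[of \<pi> \<rho>] permutes_compose[of \<rho> "{1..n}" \<pi>] unfolding H_def by blast
  qed
  interpret H: finite_automorphism_group R H by (rule H)
  define K where "K = {x \<in> carrier R. \<forall>\<gamma>\<in>H. \<gamma> x = x}"
  have hg: "\<gamma> \<in> carrier (Gal R E0)" if "\<gamma> \<in> H" for \<gamma> using that HG by auto
  have Kc: "x \<in> K \<Longrightarrow> x \<in> carrier R" and Kf: "x \<in> K \<Longrightarrow> \<gamma> \<in> H \<Longrightarrow> \<gamma> x = x" for x \<gamma>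
    by (auto simp: K_def)
  have KI: "x \<in> carrier R \<Longrightarrow> (\<And>\<gamma>. \<gamma> \<in> H \<Longrightarrow> \<gamma> x = x) \<Longrightarrow> x \<in> K" for x by (simp add: K_def)
  have "subring K R"
  proof (rule subringI)
    show "K \<subseteq> carrier R" "\<one> \<in> K" using Kc KI auto_one[OF hg] by auto
    fix x y assume x: "x \<in> K" and y: "y \<in> K"
    have "\<gamma> (\<ominus> x) = \<ominus> x" "\<gamma> (x \<otimes> y) = x \<otimes> y" "\<gamma> (x \<oplus> y) = x \<oplus> y" if g: "\<gamma> \<in> H" for \<gamma>
      using Kc[OF x] Kc[OF y] Kf[OF x g] Kf[OF y g] auto_simps[OF hg[OF g]] by simp_all
    then show "\<ominus> x \<in> K" "x \<otimes> y \<in> K" "x \<oplus> y \<in> K" using Kc[OF x] Kc[OF y] by (auto intro!: KI)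
  qed
  then have K: "subfield K R"
  proof (rule subfieldI')
    fix x assume x: "x \<in> K - {\<zero>}"
    then have "\<gamma> (inv x) = inv x" if g: "\<gamma> \<in> H" for \<gamma>
      using Kc[of x] Kf[OF _ g, of x] auto_inv[OF hg[OF g]] by simp
    then show "inv x \<in> K" using Kc[of x] x by (auto intro!: KI)
  qed
  have EK: "E0 \<subseteq> K" using E0_carrier G_fix HG by (auto simp: K_def)
  have GalK: "carrier (Gal R K) = H"
  proof
    show "carrier (Gal R K) \<subseteq> H"
    proof
      fix \<gamma> assume g: "\<gamma> \<in> carrier (Gal R K)"
      show "\<gamma> \<in> H"
      proof (rule H.auto_fixing_invariants)
        show "\<gamma> \<in> carrier (Gal R {})" using g Gal_mono[of "{}" K] by auto
        show "\<gamma> x = x" if "x \<in> carrier R" "\<forall>\<tau>\<in>H. \<tau> x = x" for x using g that by (simp add: Gal_def K_def)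
      qed
    qed
    show "H \<subseteq> carrier (Gal R K)"
    proof
      fix \<gamma> assume "\<gamma> \<in> H"
      then show "\<gamma> \<in> carrier (Gal R K)" using H.G_auto by (auto simp: Gal_def K_def)
    qed
  qed
  have "\<Phi> \<in> iso (sym_group n) (Gal R K)"
  proof (rule isoI)
    show "\<Phi> \<in> hom (sym_group n) (Gal R K)"
      using \<Phi>_comp GalK by (intro homI) (auto simp: sym_group_def H_def, simp add: Gal_def)
    show "bij_betw \<Phi> (carrier (sym_group n)) (carrier (Gal R K))"
      using \<Phi>_inj GalK by (auto simp: bij_betw_def sym_group_def H_def inj_on_def)
  qed
  then have "sym_group n \<cong> Gal R K" by (auto simp: is_iso_def)
  then have iso: "Gal R K \<cong> sym_group n" using group.iso_sym[OF sym_group_is_group] by blast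
  have unif: "\<exists>y\<in>K. y \<noteq> \<zero> \<and> v y = 1" if v: "discretely_valued_field R v" "trivial_on F v" for v
  proof -
    interpret V: discretely_valued_field R v by (rule v(1))
    interpret VA: valued_automorphism_group R v H by unfold_locales
    have "\<exists>y\<in>carrier R. (\<forall>\<gamma>\<in>H. \<gamma> y = y) \<and> y \<noteq> \<zero> \<and> v y = 1"
    proof (rule VA.invariant_uniformizer)
      fix \<gamma> assume g: "\<gamma> \<in> H" "\<gamma> \<noteq> restrict id (carrier R)"
      then obtain \<pi> where p: "\<pi> permutes {1..n}" "\<gamma> = \<Phi> \<pi>" by (auto simp: H_def)
      then have "\<pi> \<noteq> id" using g \<Phi>_id by auto
      then obtain l where l: "\<pi> l \<noteq> l" by fastforce
      have lm: "l \<in> {1..m}" "\<pi> l \<in> {1..m}"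
        using l permutes_not_in[OF pm[OF p(1)]] permutes_in_image[OF pm[OF p(1)]] by metis+
      have ac: "\<gamma> (\<alpha> l) = \<alpha> (\<pi> l)" "\<gamma> (\<beta> l) = \<beta> (\<pi> l)" using \<Phi>[OF p(1)] lm p(2) by (auto simp: act_def)
      \<comment> \<open>\<open>distinct_residues\<close> speaks of two different indices, so
        integrality of a single root needs a second index as a partner.\<close>
      have int: "\<exists>i\<in>{1..m}. i \<noteq> l'" for l' :: nat using m_gt by (intro bexI[of _ "if l' = 1 then 2 else 1"]) auto
      \<comment> \<open>The index \<open>l\<close> is moved in both families. Whichever of the two
        has pairwise incongruent roots at this place shows that \<open>\<gamma>\<close> is not
        inertia.\<close>
      consider "v u = 0" | "v w = 0" using disjoint[OF v] by auto
      then show "\<exists>x\<in>carrier R. (\<forall>\<tau>\<in>H. \<tau> x \<in> V.fil 0) \<and> x \<ominus> \<gamma> x \<notin> V.fil 1"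
      proof cases
        case 1
        have "\<alpha> i \<in> V.fil 0" if "i \<in> {1..m}" for i using distinct_residues(2)[OF v 1 that] int[of i] by metis
        then have "\<tau> (\<alpha> l) \<in> V.fil 0" if "\<tau> \<in> H" for \<tau> using G_root[OF hg[OF that] lm(1)] by auto
        moreover have "\<alpha> l \<ominus> \<gamma> (\<alpha> l) \<notin> V.fil 1" using distinct_residues(1)[OF v 1 lm] l ac(1) by metis
        ultimately show ?thesis using \<alpha>_closed[OF lm(1)] by blast
      next
        case 2
        have "\<beta> i \<in> V.fil 0" if "i \<in> {1..m}" for i
          using double_cover.distinct_residues(2)[OF swap v 2 that] int[of i] by metis
        then have "\<tau> (\<beta> l) \<in> V.fil 0" if "\<tau> \<in> H" for \<tau> using s.G_root[OF hg[OF that] lm(1)] by auto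
        moreover have "\<beta> l \<ominus> \<gamma> (\<beta> l) \<notin> V.fil 1"
          using double_cover.distinct_residues(1)[OF swap v 2 lm] l ac(2) by metis
        ultimately show ?thesis using s.\<alpha>_closed[OF lm(1)] by blast
      qed
    qed
    then show ?thesis by (auto simp: K_def)
  qed
  show ?thesis using K EK iso unif GalK by (intro exI[of _ K]) (auto simp: K_def)
qed

end

subsection \<open>A countable algebraically closed field with a transcendental element\<close>

lemma (in domain) transcendentalI:
  assumes "subring K R" "x \<in> carrier R" "\<And>p. p \<in> carrier (K[X]) \<Longrightarrow> eval p x = \<zero> \<Longrightarrow> p = []"
  shows "transcendental K x"
proof -
  have "a_kernel (K[X]) R (\<lambda>p. eval p x) = {[]}"
    using assms(3) univ_poly_zero_closed[of R K] by (auto simp: a_kernel_def')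
  then show ?thesis using trivial_ker_imp_transcendental[OF assms(1,2)] by (simp add: over_def)
qed

lemma preimage_polynomial:
  assumes R: "field R" and S: "field S" and h: "h \<in> ring_hom R S" and K: "K \<subseteq> carrier R"
    and p: "p \<in> carrier (univ_poly S (h ` K))"
  shows "\<exists>q\<in>carrier (univ_poly R K). p = map h q"
proof -
  interpret h: ring_hom_ring R S h
    using h R S by (intro ring_hom_ringI2) (auto simp: field.is_ring)
  have pK: "set p \<subseteq> h ` K" and plc: "p \<noteq> [] \<Longrightarrow> lead_coeff p \<noteq> \<zero>\<^bsub>S\<^esub>"
    using p by (auto simp: univ_poly_def polynomial_def)
  define q where "q = map (inv_into K h) p"
  have q: "p = map h q" "set q \<subseteq> K"
    using pK by (auto simp: q_def f_inv_into_f inv_into_into subset_iff intro!: map_idI[symmetric])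
  have "q \<noteq> [] \<Longrightarrow> lead_coeff q \<noteq> \<zero>\<^bsub>R\<^esub>"
  proof
    assume ne: "q \<noteq> []" and z: "lead_coeff q = \<zero>\<^bsub>R\<^esub>"
    then have "lead_coeff p = h \<zero>\<^bsub>R\<^esub>" using q by (cases q) auto
    then show False using plc ne q h.hom_zero by simp
  qed
  then show ?thesis using q by (intro bexI[of _ q]) (auto simp: univ_poly_def polynomial_def)
qed

lemma transcendental_hom:
  assumes R: "field R" and S: "field S" and h: "h \<in> ring_hom R S" and K: "subfield K R"
    and t: "t \<in> carrier R" "ring.transcendental R K t"
  shows "ring.transcendental S (h ` K) (h t)"
proof -
  interpret S: field S by fact
  interpret R: field R by fact
  interpret h: ring_hom_ring R S h using h by (intro ring_hom_ringI2) (auto simp: R.ring_axioms S.ring_axioms)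
  have hK: "subfield (h ` K) S" using h.img_is_subfield(2)[OF K] by simp
  have inj: "inj_on h (carrier R)" using non_trivial_field_hom_is_inj[OF h R S] .
  show ?thesis
  proof (rule S.transcendentalI)
    show "subring (h ` K) S" using subfieldE(1)[OF hK] .
    show "h t \<in> carrier S" using t by simp
    fix p assume p: "p \<in> carrier (univ_poly S (h ` K))" "S.eval p (h t) = \<zero>\<^bsub>S\<^esub>"
    obtain q where q: "q \<in> carrier (univ_poly R K)" "p = map h q"
      using preimage_polynomial[OF R S h subfieldE(3)[OF K] p(1)] by auto
    have "h (R.eval q t) = \<zero>\<^bsub>S\<^esub>" using h.eval_hom[OF subfieldE(1)[OF K] t(1) q(1)] p q by simp
    moreover have "R.eval q t \<in> carrier R"
      using q(1) R.carrier_polynomial_shell[OF subfieldE(1)[OF K]] R.eval_poly_in_carrier[OF R.carrier_is_subring _ t(1)]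
      by (auto simp: univ_poly_carrier)
    ultimately have "R.eval q t = \<zero>\<^bsub>R\<^esub>" using inj by (metis R.zero_closed h.hom_zero inj_onD)
    then have "q = []" using R.eval_transcendental[of K t q] t q by (simp add: over_def)
    then show "p = []" using q by simp
  qed
qed

definition seq_ring :: "('a, 'b) ring_scheme \<Rightarrow> (nat \<Rightarrow> 'a) ring" where
  "seq_ring R = \<lparr>carrier = {f. \<forall>n. f n \<in> carrier R}, Group.monoid.mult = (\<lambda>f g n. f n \<otimes>\<^bsub>R\<^esub> g n), Group.monoid.one = (\<lambda>n. \<one>\<^bsub>R\<^esub>),
     Ring.ring.zero = (\<lambda>n. \<zero>\<^bsub>R\<^esub>), Ring.ring.add = (\<lambda>f g n. f n \<oplus>\<^bsub>R\<^esub> g n)\<rparr>"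

lemma (in cring) seq_ring_cring: "cring (seq_ring R)"
proof (rule cringI)
  show "abelian_group (seq_ring R)"
  proof (rule abelian_groupI)
    fix x assume "x \<in> carrier (seq_ring R)"
    then show "\<exists>y\<in>carrier (seq_ring R). y \<oplus>\<^bsub>seq_ring R\<^esub> x = \<zero>\<^bsub>seq_ring R\<^esub>"
      by (intro bexI[of _ "\<lambda>n. \<ominus> x n"]) (auto simp: seq_ring_def l_neg)
  qed (auto simp: seq_ring_def a_ac)
  show "comm_monoid (seq_ring R)"
    by (rule comm_monoidI) (auto simp: seq_ring_def m_ac)
qed (auto simp: seq_ring_def l_distr)

lemma FactRing_zero: "\<zero>\<^bsub>R Quot I\<^esub> = I"
  by (simp add: FactRing_def)

text \<open>The field is an ultrapower: a quotient of the ring of sequences by a maximal ideal containing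
  all sequences of finite support. The class of an injective sequence is transcendental.\<close>

lemma (in field) transcendental_extension_exists:
  assumes "infinite (carrier R)"
  shows "\<exists>(L :: (nat \<Rightarrow> 'a) set ring) h t. field L \<and> h \<in> ring_hom R L \<and> t \<in> carrier L
    \<and> ring.transcendental L (h ` carrier R) t"
proof -
  let ?S = "seq_ring R"
  interpret S: cring ?S by (rule seq_ring_cring)
  have Sc: "f \<in> carrier ?S \<longleftrightarrow> (\<forall>n. f n \<in> carrier R)" for f by (simp add: seq_ring_def)
  define I0 where "I0 = {f \<in> carrier ?S. finite {n. f n \<noteq> \<zero>}}"
  let ?A = "{J. ideal J ?S \<and> I0 \<subseteq> J \<and> \<one>\<^bsub>?S\<^esub> \<notin> J}"
  have minus: "\<ominus>\<^bsub>?S\<^esub> f = (\<lambda>n. \<ominus> f n)" if "f \<in> carrier ?S" for f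
    using that by (intro S.minus_equality) (auto simp: seq_ring_def l_neg)
  have I0: "ideal I0 ?S"
  proof (rule idealI[OF S.ring_axioms])
    show "subgroup I0 (add_monoid ?S)"
    proof (rule S.add.subgroupI)
      show "I0 \<subseteq> carrier ?S" by (auto simp: I0_def)
      have "(\<lambda>n. \<zero>) \<in> I0" by (simp add: I0_def Sc)
      then show "I0 \<noteq> {}" by blast
      fix f g assume fg: "f \<in> I0" "g \<in> I0"
      then show "\<ominus>\<^bsub>?S\<^esub> f \<in> I0" by (auto simp: I0_def minus Sc)
      have "finite ({n. f n \<noteq> \<zero>} \<union> {n. g n \<noteq> \<zero>})" using fg by (auto simp: I0_def)
      then have "finite {n. f n \<oplus> g n \<noteq> \<zero>}" by (rule rev_finite_subset) auto
      then show "f \<oplus>\<^bsub>?S\<^esub> g \<in> I0" using fg by (auto simp: I0_def Sc seq_ring_def)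
    qed
    fix f x assume f: "f \<in> I0" and x: "x \<in> carrier ?S"
    have "finite {n. x n \<otimes> f n \<noteq> \<zero>}" "finite {n. f n \<otimes> x n \<noteq> \<zero>}"
      using f x by (auto simp: I0_def Sc elim!: rev_finite_subset)
    then show "x \<otimes>\<^bsub>?S\<^esub> f \<in> I0" "f \<otimes>\<^bsub>?S\<^esub> x \<in> I0" using f x by (auto simp: I0_def Sc seq_ring_def)
  qed
  have "\<exists>M\<in>?A. \<forall>J\<in>?A. M \<subseteq> J \<longrightarrow> J = M"
  proof (rule subset_Zorn_nonempty)
    have "\<one>\<^bsub>?S\<^esub> \<notin> I0" by (simp add: I0_def seq_ring_def)
    then show "?A \<noteq> {}" using I0 by blast
    fix C assume C: "C \<noteq> {}" "subset.chain ?A C"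
    then have CA: "C \<subseteq> ?A" by (simp add: subset.chain_def)
    have id: "ideal J ?S" if "J \<in> C" for J using CA that by auto
    have "ideal (\<Union>C) ?S"
    proof (rule idealI[OF S.ring_axioms])
      show "subgroup (\<Union>C) (add_monoid ?S)"
      proof (rule S.add.subgroupI)
        show "\<Union>C \<subseteq> carrier ?S" using id ideal.Icarr by fast
        obtain J where "J \<in> C" using C(1) by blast
        then have "\<zero>\<^bsub>?S\<^esub> \<in> J" using id additive_subgroup.zero_closed ideal.axioms(1) by blast
        then show "\<Union>C \<noteq> {}" using \<open>J \<in> C\<close> by blast
        fix f g assume fg: "f \<in> \<Union>C" "g \<in> \<Union>C"
        then obtain J J' where J: "J \<in> C" "f \<in> J" "J' \<in> C" "g \<in> J'" by blast
        have "J \<subseteq> J' \<or> J' \<subseteq> J" using C J by (auto simp: subset_chain_def)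
        then obtain Z where Z: "Z \<in> C" "f \<in> Z" "g \<in> Z" using J by blast
        interpret Z: ideal Z ?S using id[OF Z(1)] .
        show "\<ominus>\<^bsub>?S\<^esub> f \<in> \<Union>C" "f \<oplus>\<^bsub>?S\<^esub> g \<in> \<Union>C" using Z by auto
      qed
      fix f x assume "f \<in> \<Union>C" and x: "x \<in> carrier ?S"
      then obtain Z where Z: "Z \<in> C" "f \<in> Z" by blast
      then show "x \<otimes>\<^bsub>?S\<^esub> f \<in> \<Union>C" "f \<otimes>\<^bsub>?S\<^esub> x \<in> \<Union>C"
        using ideal.I_l_closed[OF id[OF Z(1)] Z(2) x] ideal.I_r_closed[OF id[OF Z(1)] Z(2) x] by blast+
    qed
    moreover have "I0 \<subseteq> \<Union>C" "\<one>\<^bsub>?S\<^esub> \<notin> \<Union>C" using CA C(1) by auto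
    ultimately show "\<Union>C \<in> ?A" by simp
  qed
  then obtain M where M: "ideal M ?S" "I0 \<subseteq> M" "\<one>\<^bsub>?S\<^esub> \<notin> M"
    and max: "\<And>J. ideal J ?S \<Longrightarrow> I0 \<subseteq> J \<Longrightarrow> \<one>\<^bsub>?S\<^esub> \<notin> J \<Longrightarrow> M \<subseteq> J \<Longrightarrow> J = M" by auto
  interpret M: ideal M ?S by (rule M(1))
  have "maximalideal M ?S"
  proof (rule maximalidealI[OF M(1)])
    show "carrier ?S \<noteq> M" using M(3) by auto
    fix J assume J: "ideal J ?S" "M \<subseteq> J" "J \<subseteq> carrier ?S"
    show "J = M \<or> J = carrier ?S"
    proof (cases "\<one>\<^bsub>?S\<^esub> \<in> J")
      case True
      then show ?thesis using ideal.one_imp_carrier[OF J(1)] by simp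
    next
      case False
      have "I0 \<subseteq> J" using M(2) J(2) by (rule subset_trans)
      then show ?thesis using max[OF J(1) _ False J(2)] by simp
    qed
  qed
  then have L: "field (?S Quot M)" using maximalideal.quotient_is_field S.is_cring by blast
  let ?L = "?S Quot M"
  interpret L: field ?L by (rule L)
  interpret pi: ring_hom_ring ?S ?L "(+>\<^bsub>?S\<^esub>) M" by (rule M.rcos_ring_hom_ring)
  define cst where "cst = (\<lambda>(a :: 'a) (n::nat). a)"
  have cst: "ring_hom_ring R ?S cst"
    by (intro ring_hom_ringI2 ring_axioms S.ring_axioms ring_hom_memI) (auto simp: cst_def seq_ring_def)
  interpret cst: ring_hom_ring R ?S cst by (rule cst)
  define h where "h = (\<lambda>a. M +>\<^bsub>?S\<^esub> cst a)"
  have h: "h \<in> ring_hom R ?L"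
    unfolding h_def by (rule ring_hom_memI) auto
  obtain s :: "nat \<Rightarrow> 'a" where s: "inj s" "range s \<subseteq> carrier R"
    using infinite_countable_subset[OF assms] by auto
  have sS: "s \<in> carrier ?S" using s(2) by (auto simp: Sc)
  have "ring.transcendental ?L (h ` carrier R) (M +>\<^bsub>?S\<^esub> s)"
  proof (rule L.transcendentalI)
    interpret h: ring_hom_ring R ?L h by (rule ring_hom_ringI2[OF ring_axioms L.ring_axioms h])
    show "subring (h ` carrier R) ?L" using h.img_is_subring[OF carrier_is_subring] .
    show "M +>\<^bsub>?S\<^esub> s \<in> carrier ?L" using sS by simp
    fix p assume p: "p \<in> carrier (univ_poly ?L (h ` carrier R))" "L.eval p (M +>\<^bsub>?S\<^esub> s) = \<zero>\<^bsub>?L\<^esub>"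
    obtain q where q: "q \<in> carrier (poly_ring R)" "p = map h q"
      using preimage_polynomial[OF field_axioms L h _ p(1)] by auto
    have qc: "set q \<subseteq> carrier R" using q(1) by (auto simp: univ_poly_def polynomial_def)
    have qS: "set (map cst q) \<subseteq> carrier ?S" using qc cst.hom_closed by auto
    let ?f = "\<lambda>n. eval q (s n)"
    have "S.eval (map cst q) s = ?f"
    proof
      fix n
      have "ring_hom_ring ?S R (\<lambda>f. f n)"
        by (intro ring_hom_ringI2 ring_axioms S.ring_axioms ring_hom_memI) (auto simp: seq_ring_def)
      then interpret pr: ring_hom_ring ?S R "\<lambda>f. f n" .
      have "map (\<lambda>f. f n) (map cst q) = q" by (simp add: cst_def comp_def)
      then show "S.eval (map cst q) s n = eval q (s n)" using pr.eval_hom'[OF sS qS] by simp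
    qed
    moreover have "p = map ((+>\<^bsub>?S\<^esub>) M) (map cst q)" using q(2) by (simp add: h_def comp_def)
    then have "L.eval p (M +>\<^bsub>?S\<^esub> s) = M +>\<^bsub>?S\<^esub> (S.eval (map cst q) s)" using pi.eval_hom'[OF sS qS] by simp
    ultimately have fz: "M +>\<^bsub>?S\<^esub> ?f = \<zero>\<^bsub>?L\<^esub>" using p(2) by simp
    have fS: "?f \<in> carrier ?S" using qc s(2) eval_in_carrier by (auto simp: Sc)
    have fM: "?f \<in> M" using fz unfolding FactRing_zero by (rule M.rcos_const_imp_mem[OF fS])
    show "p = []"
    proof (rule ccontr)
      assume "p \<noteq> []"
      then have qz: "q \<noteq> []" using q by auto
      have "{n. ?f n = \<zero>} \<subseteq> s -` {x \<in> carrier R. eval q x = \<zero>}" using s(2) by auto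
      then have fin: "finite {n. ?f n = \<zero>}"
        using card_roots_le(1)[OF q(1) qz] finite_vimageI[OF _ s(1)] finite_subset by metis
      \<comment> \<open>The sequence \<open>f\<close> vanishes at only finitely many indices,
        because a nonzero polynomial has finitely many roots and \<open>s\<close> is injective. So
        \<open>f\<close> times its pointwise inverse differs from 1 by a sequence \<open>e\<close>
        of finite support, which lies in \<open>M\<close>; with \<open>f\<close> in
        \<open>M\<close>, so would 1.\<close>
      define g where "g = (\<lambda>n. if ?f n = \<zero> then \<zero> else inv (?f n))"
      define e where "e = (\<lambda>n. if ?f n = \<zero> then \<one> else \<zero>)"
      have fc: "?f n \<in> carrier R" for n using fS by (simp add: Sc)
      have gS: "g \<in> carrier ?S" using fc by (auto simp: g_def Sc)
      have "e \<in> I0" using fin by (auto simp: e_def I0_def Sc elim!: rev_finite_subset)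
      then have eM: "e \<in> M" using M(2) by auto
      have "g \<otimes>\<^bsub>?S\<^esub> ?f \<oplus>\<^bsub>?S\<^esub> e = \<one>\<^bsub>?S\<^esub>"
        using fc by (auto simp: seq_ring_def g_def e_def fun_eq_iff)
      moreover have "g \<otimes>\<^bsub>?S\<^esub> ?f \<oplus>\<^bsub>?S\<^esub> e \<in> M" using M.I_l_closed[OF fM gS] eM by simp
      ultimately show False using M(3) by simp
    qed
  qed
  moreover have "M +>\<^bsub>?S\<^esub> s \<in> carrier ?L" using sS by simp
  ultimately show ?thesis using L h by blast
qed

text \<open>In a field with \<open>q\<close> elements every \<open>x\<close> satisfies
  \<open>x^q = x\<close>, so \<open>x^q - x + 1\<close> has no root.\<close>

lemma algebraically_closed_infinite:
  fixes R (structure)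
  assumes "algebraically_closed R"
  shows "infinite (carrier R)"
proof
  interpret algebraically_closed R by fact
  assume fin: "finite (carrier R)"
  let ?q = "card (carrier R)"
  have "{\<zero>, \<one>} \<subseteq> carrier R" by auto
  then have "card {\<zero>, \<one>} \<le> ?q" using fin card_mono by blast
  then have q2: "?q \<ge> 2" by simp
  let ?p = "\<one> # replicate (?q - 2) \<zero> @ [\<ominus> \<one>, \<one>]"
  have p: "?p \<in> carrier (poly_ring R)" by (auto simp: univ_poly_def polynomial_def)
  have deg: "degree ?p = ?q" using q2 by simp
  have "size (roots ?p) = ?q" using roots_over_carrier[OF p] deg by (simp add: splitted_def)
  then have "roots ?p \<noteq> {#}" using q2 by (metis size_empty not_numeral_le_zero)
  then obtain x where "x \<in># roots ?p" by blast
  then have x: "x \<in> carrier R" "eval ?p x = \<zero>" using roots_mem_iff_is_root[OF p] by (auto simp: is_root_def)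
  have "x [^] ?q = x"
  proof (cases "x = \<zero>")
    case True
    then show ?thesis using q2 by (simp add: nat_pow_zero)
  next
    case False
    interpret G: group "Multiplicative_Group.mult_of R" by (rule field_mult_group)
    have "x [^]\<^bsub>Multiplicative_Group.mult_of R\<^esub> order (Multiplicative_Group.mult_of R) = \<one>\<^bsub>Multiplicative_Group.mult_of R\<^esub>"
      using x False by (intro G.pow_order_eq_1) auto
    moreover have "order (Multiplicative_Group.mult_of R) = ?q - 1" using fin by (simp add: order_def card_Diff_singleton)
    ultimately have "x [^] (?q - 1) = \<one>" by (simp add: Multiplicative_Group.nat_pow_mult_of)
    moreover have "?q = Suc (?q - 1)" using q2 by simp
    ultimately show ?thesis using x by (metis l_one nat_pow_Suc)
  qed
  moreover have "eval ?p x = x [^] ?q \<oplus> (\<ominus> x \<oplus> \<one>)"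
  proof -
    have 1: "eval ?p x = x [^] degree ?p \<oplus> eval (replicate (?q - 2) \<zero> @ [\<ominus> \<one>, \<one>]) x" using x(1) by simp
    have 2: "eval (replicate (?q - 2) \<zero> @ [\<ominus> \<one>, \<one>]) x = eval [\<ominus> \<one>, \<one>] x"
      using x(1) by (intro eval_replicate) auto
    have 3: "eval [\<ominus> \<one>, \<one>] x = \<ominus> x \<oplus> \<one>" using x(1) by (simp add: l_minus)
    show ?thesis unfolding 1 2 3 deg ..
  qed
  ultimately have "x \<oplus> (\<ominus> x \<oplus> \<one>) = \<zero>" using x(2) by metis
  then have "\<one> = \<zero>" using x(1) r_neg2[of x \<one>] by simp
  then show False by simp
qed

section \<open>Countability, and closures carried by the natural numbers\<close>

lemma (in field) countable_algebraics:
  assumes "subfield K R" "countable K"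
  shows "countable {x \<in> carrier R. algebraic K x}"
proof (rule countable_subset)
  let ?P = "carrier (K[X]) - {[]}"
  show "{x \<in> carrier R. algebraic K x} \<subseteq> (\<Union>p\<in>?P. {x \<in> carrier R. eval p x = \<zero>})"
  proof
    fix x assume x: "x \<in> {x \<in> carrier R. algebraic K x}"
    then have "x \<in> carrier R" "(algebraic over K) x" by (simp_all add: over_def)
    then obtain p where "p \<in> carrier (K[X])" "p \<noteq> []" "eval p x = \<zero>"
      using algebraicE[OF subfieldE(1)[OF assms(1)]] by metis
    then show "x \<in> (\<Union>p\<in>?P. {x \<in> carrier R. eval p x = \<zero>})" using x by blast
  qed
  have "?P \<subseteq> lists K" by (auto simp: univ_poly_def polynomial_def)
  then have "countable ?P" by (rule countable_subset) (simp add: assms(2))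
  moreover have "finite {x \<in> carrier R. eval p x = \<zero>}" if "p \<in> ?P" for p
    using card_roots_le(1)[OF carrier_polynomial_shell[OF subfieldE(1)[OF assms(1)]]] that by auto
  ultimately show "countable (\<Union>p\<in>?P. {x \<in> carrier R. eval p x = \<zero>})"
    by (intro countable_UN) (auto intro: countable_finite)
qed

lemma (in field) countable_generate_field:
  assumes "subfield K R" "countable K" "t \<in> carrier R"
  shows "countable (generate_field R (insert t K))"
proof -
  have Kc: "K \<subseteq> carrier R" using subfieldE(3)[OF assms(1)] .
  have "carrier (K[X]) \<subseteq> lists K" by (auto simp: univ_poly_def polynomial_def)
  then have "countable (carrier (K[X]))" by (rule countable_subset) (simp add: assms(2))
  then have A: "countable (simple_extension K t)" using simple_extension_as_eval_img[OF Kc assms(3)] by simp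
  have "generate_field R (insert t K) \<subseteq> (\<lambda>(a, b). a \<otimes> inv b) ` (simple_extension K t \<times> simple_extension K t)"
    using generate_field_insert_fraction[OF assms(1,3)] by force
  then show ?thesis using A by (meson countable_SIGMA countable_image countable_subset)
qed

text \<open>The algebraic closure consists of the roots of countably many polynomials, so it is
  countable and can be transported along an injection into the natural numbers.\<close>

lemma (in field) algebraically_closed_extension_nat:
  assumes "countable (carrier R)"
  shows "\<exists>(W :: nat ring) h. algebraically_closed W \<and> h \<in> ring_hom R W"
proof -
  interpret C: algebraic_closure alg_closure "indexed_const ` carrier R" by (rule alg_closureE(1))
  let ?C = alg_closure
  have ic: "indexed_const \<in> ring_hom R ?C" by (rule alg_closureE(2))
  have "countable (carrier ?C)"
  proof -
    have sf: "subfield (indexed_const ` carrier R) ?C" using C.subfield_axioms .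
    have "carrier ?C = {x \<in> carrier ?C. C.algebraic (indexed_const ` carrier R) x}"
      using C.algebraic_extension by (auto simp: over_def)
    moreover have "countable {x \<in> carrier ?C. C.algebraic (indexed_const ` carrier R) x}"
      using C.countable_algebraics[OF sf] assms by simp
    ultimately show ?thesis by simp
  qed
  then obtain f :: "_ \<Rightarrow> nat" where f: "inj_on f (carrier ?C)" by (auto simp: countable_def)
  let ?W = "image_ring f ?C"
  have W: "field ?W" by (rule C.inj_imp_image_ring_is_field[OF f])
  have fi: "f \<in> ring_iso ?C ?W" by (rule inj_imp_image_ring_iso[OF f])
  then have fh: "f \<in> ring_hom ?C ?W" and fb: "f ` carrier ?C = carrier ?W" by (auto simp: ring_iso_def bij_betw_def)
  interpret W: field ?W by (rule W)
  interpret f: ring_hom_ring ?C ?W f by (rule ring_hom_ringI2[OF C.ring_axioms W.ring_axioms fh])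
  have "algebraically_closed ?W"
  proof (rule W.algebraically_closedI)
    fix p assume p: "p \<in> carrier (poly_ring ?W)" "degree p > 1"
    have "p \<in> carrier (univ_poly ?W (f ` carrier ?C))" using p fb by simp
    then obtain q where q: "q \<in> carrier (poly_ring ?C)" "p = map f q"
      using preimage_polynomial[OF C.field_axioms W fh _ , of "carrier ?C" p] by auto
    have "size (C.roots q) = degree q" using C.roots_over_carrier[OF q(1)] by (simp add: C.splitted_def)
    moreover have "degree q > 0" using p q by simp
    ultimately have "C.roots q \<noteq> {#}" by (metis size_empty less_irrefl)
    then obtain x where "x \<in># C.roots q" by blast
    then have x: "x \<in> carrier ?C" "C.eval q x = \<zero>\<^bsub>?C\<^esub>" using C.roots_mem_iff_is_root[OF q(1)] by (auto simp: C.is_root_def)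
    have "W.eval p (f x) = f (C.eval q x)" using f.eval_hom[OF C.carrier_is_subring x(1) q(1)] q(2) by simp
    then show "\<exists>y\<in>carrier ?W. W.eval p y = \<zero>\<^bsub>?W\<^esub>" using x by (intro bexI[of _ "f x"]) auto
  qed
  moreover have "f \<circ> indexed_const \<in> ring_hom R ?W" using ring_hom_trans[OF ic fh] .
  ultimately show ?thesis by blast
qed

text \<open>Algebraic closure is taken twice. The first makes the finite field infinite, as the
  ultrapower needs an injective sequence; the ultrapower supplies \<open>t\<close>, but on a larger
  type. The subfield generated by \<open>t\<close> over the image of \<open>F\<close> is countable
  again, so its closure returns to the natural numbers.\<close>

theorem exists_universal_domain:
  fixes F :: "('b, 'c) ring_scheme"
  assumes "field F" "finite (carrier F)"
  shows "\<exists>(W :: nat ring) \<phi> t. algebraically_closed W \<and> \<phi> \<in> ring_hom F W \<and> t \<in> carrier W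
    \<and> ring.transcendental W (\<phi> ` carrier F) t"
proof -
  interpret F: field F by fact
  obtain W1 :: "nat ring" and h1 where W1: "algebraically_closed W1" "h1 \<in> ring_hom F W1"
    using F.algebraically_closed_extension_nat assms(2) by (meson countable_finite)
  interpret W1: algebraically_closed W1 by (rule W1(1))
  interpret h1: ring_hom_ring F W1 h1 by (rule ring_hom_ringI2[OF F.ring_axioms W1.ring_axioms W1(2)])
  obtain L :: "(nat \<Rightarrow> nat) set ring" and h2 t where L: "field L" "h2 \<in> ring_hom W1 L" "t \<in> carrier L"
    "ring.transcendental L (h2 ` carrier W1) t"
    using W1.transcendental_extension_exists algebraically_closed_infinite[OF W1(1)] by blast
  interpret L: field L by (rule L(1))
  interpret h2: ring_hom_ring W1 L h2 by (rule ring_hom_ringI2[OF W1.ring_axioms L.ring_axioms L(2)])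
  let ?h = "h2 \<circ> h1"
  have h: "?h \<in> ring_hom F L" using ring_hom_trans[OF W1(2) L(2)] .
  interpret h: ring_hom_ring F L ?h by (rule ring_hom_ringI2[OF F.ring_axioms L.ring_axioms h])
  let ?K = "?h ` carrier F"
  have K: "subfield ?K L" using h.img_is_subfield(2)[OF F.carrier_is_subfield] by simp
  have "?K \<subseteq> h2 ` carrier W1" using h1.hom_closed by auto
  then have tK: "L.transcendental ?K t" using L.transcendental_mono[of ?K "h2 ` carrier W1" t] L(4) by (simp add: over_def)
  let ?E = "generate_field L (insert t ?K)"
  have Kc: "insert t ?K \<subseteq> carrier L" using L(3) subfieldE(3)[OF K] by auto
  have E: "subfield ?E L" using L.generate_field_is_subfield[OF Kc] .
  have inE: "insert t ?K \<subseteq> ?E" using generate_field.incl[of _ "insert t ?K" L] by blast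
  let ?L = "L\<lparr>carrier := ?E\<rparr>"
  interpret E: field ?L by (rule L.subfield_iff(2)[OF E])
  have "countable (carrier ?L)" using L.countable_generate_field[OF K _ L(3)] assms(2) by (simp add: countable_finite)
  then obtain W :: "nat ring" and h3 where W: "algebraically_closed W" "h3 \<in> ring_hom ?L W"
    using E.algebraically_closed_extension_nat by blast
  interpret W: algebraically_closed W by (rule W(1))
  have hE: "?h \<in> ring_hom F ?L"
  proof (rule ring_hom_memI)
    fix x y assume x: "x \<in> carrier F" "y \<in> carrier F"
    show "?h x \<in> carrier ?L" using inE x by auto
    show "?h (x \<otimes>\<^bsub>F\<^esub> y) = ?h x \<otimes>\<^bsub>?L\<^esub> ?h y" "?h (x \<oplus>\<^bsub>F\<^esub> y) = ?h x \<oplus>\<^bsub>?L\<^esub> ?h y"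
      using h.hom_mult[OF x] h.hom_add[OF x] by simp_all
  next
    show "?h \<one>\<^bsub>F\<^esub> = \<one>\<^bsub>?L\<^esub>" using h.hom_one by simp
  qed
  interpret hE: ring_hom_ring F ?L ?h by (rule ring_hom_ringI2[OF F.ring_axioms E.ring_axioms hE])
  have KE: "subfield ?K ?L" using hE.img_is_subfield(2)[OF F.carrier_is_subfield] by simp
  have "E.transcendental ?K t" using tK L.transcendental_consistent[OF subfieldE(1)[OF E]] by simp
  then have "ring.transcendental W (h3 ` ?K) (h3 t)"
    using transcendental_hom[OF E.field_axioms W.field_axioms W(2) KE] inE by simp
  moreover have "h3 t \<in> carrier W" using W(2) inE by (auto simp: ring_hom_def)
  moreover have "h3 \<circ> ?h \<in> ring_hom F W" using ring_hom_trans[OF hE W(2)] .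
  moreover have "(h3 \<circ> ?h) ` carrier F = h3 ` ?K" by (simp add: image_comp comp_assoc)
  ultimately show ?thesis using W(1) by metis
qed

subsection \<open>Frobenius and the trinomial over an algebraically closed field\<close>

lemma (in cring) binomial:
  assumes x: "x \<in> carrier R" and y: "y \<in> carrier R"
  shows "(x \<oplus> y) [^] (n::nat) = (\<Oplus>i\<in>{..n}. [(n choose i)] \<cdot> (x [^] i \<otimes> y [^] (n - i)))"
proof (induct n)
  case 0
  then show ?case using x y by simp
next
  case (Suc n)
  define b where "b = (\<lambda>n i. [(n choose i)] \<cdot> (x [^] i \<otimes> y [^] (n - i)))"
  have bc: "b n i \<in> carrier R" for n i using x y by (simp add: b_def)
  have ms: "([l] \<cdot> z) \<otimes> w = [l] \<cdot> (z \<otimes> w)" if "z \<in> carrier R" "w \<in> carrier R" for l :: nat and z w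
    using that by (simp add: add_pow_ldistr)
  have step: "b (Suc n) (Suc i) = b n i \<otimes> x \<oplus> b n (Suc i) \<otimes> y" if i: "i \<le> n" for i
  proof -
    have 1: "b n i \<otimes> x = [(n choose i)] \<cdot> (x [^] Suc i \<otimes> y [^] (n - i))"
    proof -
      have "(x [^] i \<otimes> y [^] (n - i)) \<otimes> x = x [^] Suc i \<otimes> y [^] (n - i)" using x y by (simp add: m_ac)
      then show ?thesis unfolding b_def using x y by (subst ms) auto
    qed
    have 2: "b n (Suc i) \<otimes> y = [(n choose Suc i)] \<cdot> (x [^] Suc i \<otimes> y [^] (n - i))"
    proof (cases "i = n")
      case True
      then show ?thesis using x y by (simp add: b_def binomial_eq_0)
    next
      case False
      then have "n - i = Suc (n - Suc i)" using i by simp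
      then have "y [^] (n - i) = y [^] (n - Suc i) \<otimes> y" by simp
      then show ?thesis using x y by (simp add: b_def ms m_assoc)
    qed
    show ?thesis unfolding 1 2 using x y by (simp add: b_def add.nat_pow_mult)
  qed
  have zero: "b (Suc n) 0 = b n 0 \<otimes> y" using x y by (simp add: b_def)
  have top: "b n (Suc n) \<otimes> y = \<zero>" using x y by (simp add: b_def binomial_eq_0)
  have "(x \<oplus> y) [^] Suc n = (\<Oplus>i\<in>{..n}. b n i) \<otimes> (x \<oplus> y)" using Suc by (simp add: b_def)
  also have "\<dots> = (\<Oplus>i\<in>{..n}. b n i \<otimes> x) \<oplus> (\<Oplus>i\<in>{..n}. b n i \<otimes> y)"
    using x y bc by (simp add: r_distr finsum_ldistr)
  also have "(\<Oplus>i\<in>{..n}. b n i \<otimes> y) = (\<Oplus>i\<in>{..Suc n}. b n i \<otimes> y)"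
    using bc y top by (subst finsum_Suc) auto
  also have "\<dots> = (\<Oplus>i\<in>{..n}. b n (Suc i) \<otimes> y) \<oplus> b n 0 \<otimes> y"
    using bc y by (subst finsum_Suc2) auto
  also have "(\<Oplus>i\<in>{..n}. b n i \<otimes> x) \<oplus> ((\<Oplus>i\<in>{..n}. b n (Suc i) \<otimes> y) \<oplus> b n 0 \<otimes> y)
      = ((\<Oplus>i\<in>{..n}. b n i \<otimes> x) \<oplus> (\<Oplus>i\<in>{..n}. b n (Suc i) \<otimes> y)) \<oplus> b n 0 \<otimes> y"
    using bc x y by (intro a_assoc[symmetric] finsum_closed) auto
  also have "(\<Oplus>i\<in>{..n}. b n i \<otimes> x) \<oplus> (\<Oplus>i\<in>{..n}. b n (Suc i) \<otimes> y) = (\<Oplus>i\<in>{..n}. b n i \<otimes> x \<oplus> b n (Suc i) \<otimes> y)"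
    using bc x y by (intro finsum_addf[symmetric]) auto
  also have "\<dots> = (\<Oplus>i\<in>{..n}. b (Suc n) (Suc i))" using bc step by (intro finsum_cong') auto
  also have "(\<Oplus>i\<in>{..n}. b (Suc n) (Suc i)) \<oplus> b n 0 \<otimes> y = (\<Oplus>i\<in>{..Suc n}. b (Suc n) i)"
    using bc zero by (subst finsum_Suc2) auto
  finally show ?case by (simp add: b_def)
qed

lemma (in cring) frobenius:
  assumes p: "Factorial_Ring.prime (p::nat)" "[p] \<cdot> \<one> = \<zero>" and x: "x \<in> carrier R" and y: "y \<in> carrier R"
  shows "(x \<oplus> y) [^] p = x [^] p \<oplus> y [^] p"
proof -
  define b where "b = (\<lambda>i. [(p choose i)] \<cdot> (x [^] i \<otimes> y [^] (p - i)))"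
  have bc: "b i \<in> carrier R" for i using x y by (simp add: b_def)
  have pz: "[p] \<cdot> z = \<zero>" if "z \<in> carrier R" for z
    using add_pow_ldistr[of \<one> z p] p(2) that by simp
  have bz: "b i = \<zero>" if "0 < i" "i < p" for i
  proof -
    have "p dvd (p choose i)" by (rule dvd_choose_prime) (use p(1) that in auto)
    then obtain q where "p choose i = p * q" by blast
    then have "b i = [q] \<cdot> ([p] \<cdot> (x [^] i \<otimes> y [^] (p - i)))" using x y by (simp add: b_def add.nat_pow_pow)
    then show ?thesis using pz x y by simp
  qed
  have p0: "p \<noteq> 0" using p(1) by auto
  have "(x \<oplus> y) [^] p = (\<Oplus>i\<in>{..p}. b i)" using binomial[OF x y, of p] by (simp add: b_def)
  also have "\<dots> = (\<Oplus>i\<in>{0, p}. b i)"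
    using bz bc by (intro add.finprod_mono_neutral_cong_left[symmetric]) (auto simp: le_less)
  also have "\<dots> = b 0 \<oplus> b p" using bc p0 by simp
  finally show ?thesis using x y by (simp add: b_def a_comm)
qed

lemma (in cring) frobenius_power:
  assumes p: "Factorial_Ring.prime (p::nat)" "[p] \<cdot> \<one> = \<zero>" and x: "x \<in> carrier R" and y: "y \<in> carrier R"
  shows "(x \<oplus> y) [^] (p ^ r) = x [^] (p ^ r) \<oplus> y [^] (p ^ r)"
proof (induct r)
  case (Suc r)
  have "z [^] (p ^ Suc r) = (z [^] (p ^ r)) [^] p" if "z \<in> carrier R" for z
    using that by (simp add: nat_pow_pow mult.commute)
  then show ?case using Suc frobenius[OF p] x y by simp
qed (use x y in simp)

lemma (in cring) square_sum:
  assumes "a \<in> carrier R" "d \<in> carrier R"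
  shows "(a \<oplus> d) [^] (2::nat) = a \<otimes> a \<oplus> d \<otimes> ((\<one> \<oplus> \<one>) \<otimes> a \<oplus> d)"
proof -
  have "(a \<oplus> d) \<otimes> (a \<oplus> d) = a \<otimes> a \<oplus> d \<otimes> ((\<one> \<oplus> \<one>) \<otimes> a \<oplus> d)"
    using assms by (simp add: l_distr r_distr a_ac m_ac)
  then show ?thesis using assms by (simp add: numeral_2_eq_2)
qed

text \<open>As the power map with exponent \<open>m\<close> is additive, only the square contributes
  a linear term, namely \<open>2 a d\<close>. This is the case \<open>c\<close> = 0,
  \<open>e\<close> = 1 and \<open>k\<close> = 2.\<close>

lemma (in cring) taylor_odd:
  assumes fr: "\<And>x y. x \<in> carrier R \<Longrightarrow> y \<in> carrier R \<Longrightarrow> (x \<oplus> y) [^] (m::nat) = x [^] m \<oplus> y [^] m"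
    and m: "(m::nat) > 3" and a: "a \<in> carrier R" and d: "d \<in> carrier R"
  shows "(a \<oplus> d) [^] m \<oplus> \<zero> \<otimes> (a \<oplus> d) [^] (3::nat) \<oplus> (a \<oplus> d) [^] (2::nat) =
      (a [^] m \<oplus> \<zero> \<otimes> a [^] (3::nat) \<oplus> a [^] (2::nat)) \<oplus>
      d \<otimes> ((\<one> \<oplus> \<one>) \<otimes> a [^] (1::nat) \<oplus> d \<otimes> (\<one> \<oplus> \<zero> \<otimes> (a \<oplus> d) \<oplus> d [^] (m - 2)))"
proof -
  have "d [^] m = d [^] (m - 2) \<otimes> d [^] (2::nat)" using nat_pow_mult[OF d, of "m - 2" 2] m by (metis add_diff_cancel_left' le_add_diff_inverse2 less_imp_le_nat numeral_2_eq_2 numeral_3_eq_3 Suc_lessD)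
  then have dm: "d [^] m = d [^] (m - 2) \<otimes> (d \<otimes> d)" using d by (simp add: numeral_2_eq_2)
  have a2: "a [^] (2::nat) = a \<otimes> a" using a by (simp add: numeral_2_eq_2)
  have "P \<oplus> D \<otimes> (d \<otimes> d) \<oplus> (a \<otimes> a \<oplus> d \<otimes> (B \<otimes> a \<oplus> d)) = P \<oplus> a \<otimes> a \<oplus> d \<otimes> (B \<otimes> a \<oplus> d \<otimes> (\<one> \<oplus> D))"
    if "P \<in> carrier R" "D \<in> carrier R" "B \<in> carrier R" for P D B
    using that a d by (simp add: r_distr a_ac m_ac)
  from this[of "a [^] m" "d [^] (m - 2)" "\<one> \<oplus> \<one>"] show ?thesis
    unfolding fr[OF a d] square_sum[OF a d] dm a2 using a d by simp
qed

text \<open>In characteristic 2 the square is additive as well, and the linear term comes from the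
  cube, as \<open>3 a^2 d = a^2 d\<close>. This is the case \<open>c\<close> = 1, \<open>e\<close> =
  2 and \<open>k\<close> = 1.\<close>

lemma (in cring) taylor_even:
  assumes two: "\<one> \<oplus> \<one> = \<zero>"
    and fr: "\<And>x y. x \<in> carrier R \<Longrightarrow> y \<in> carrier R \<Longrightarrow> (x \<oplus> y) [^] (m::nat) = x [^] m \<oplus> y [^] m"
    and m: "(m::nat) > 3" and a: "a \<in> carrier R" and d: "d \<in> carrier R"
  shows "(a \<oplus> d) [^] m \<oplus> \<one> \<otimes> (a \<oplus> d) [^] (3::nat) \<oplus> (a \<oplus> d) [^] (2::nat) =
      (a [^] m \<oplus> \<one> \<otimes> a [^] (3::nat) \<oplus> a [^] (2::nat)) \<oplus>
      d \<otimes> (\<one> \<otimes> a [^] (2::nat) \<oplus> d \<otimes> (\<one> \<oplus> \<one> \<otimes> (a \<oplus> d) \<oplus> d [^] (m - 2)))"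
proof -
  have "d [^] m = d [^] (m - 2) \<otimes> d [^] (2::nat)" using nat_pow_mult[OF d, of "m - 2" 2] m by (metis add_diff_cancel_left' le_add_diff_inverse2 less_imp_le_nat numeral_2_eq_2 numeral_3_eq_3 Suc_lessD)
  then have dm: "d [^] m = d [^] (m - 2) \<otimes> (d \<otimes> d)" using d by (simp add: numeral_2_eq_2)
  have p2: "x [^] (2::nat) = x \<otimes> x" if "x \<in> carrier R" for x using that by (simp add: numeral_2_eq_2)
  have p3: "x [^] (3::nat) = x [^] (2::nat) \<otimes> x" if "x \<in> carrier R" for x using that by (simp add: numeral_3_eq_3 numeral_2_eq_2)
  have sq: "(a \<oplus> d) [^] (2::nat) = a \<otimes> a \<oplus> d \<otimes> d" using square_sum[OF a d] two a d by simp
  have "P \<oplus> D \<otimes> (d \<otimes> d) \<oplus> (a \<otimes> a \<oplus> d \<otimes> d) \<otimes> (a \<oplus> d) \<oplus> (a \<otimes> a \<oplus> d \<otimes> d)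
      = (P \<oplus> a \<otimes> a \<otimes> a \<oplus> a \<otimes> a) \<oplus> d \<otimes> (a \<otimes> a \<oplus> d \<otimes> (\<one> \<oplus> (a \<oplus> d) \<oplus> D))"
    if "P \<in> carrier R" "D \<in> carrier R" for P D
    using that a d by (simp add: l_distr r_distr a_ac m_ac)
  from this[of "a [^] m" "d [^] (m - 2)"] show ?thesis
    unfolding fr[OF a d] p3[OF add.m_closed[OF a d]] sq dm p3[OF a] p2[OF a] using a d by simp
qed

section \<open>Simplicity of the roots of the trinomial\<close>

definition (in ring) linear_factors :: "'a list \<Rightarrow> 'a list" where
  "linear_factors as = foldr (\<lambda>a q. [\<one>, \<ominus> a] \<otimes>\<^bsub>poly_ring R\<^esub> q) as \<one>\<^bsub>poly_ring R\<^esub>"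

context algebraically_closed
begin

interpretation P: domain "poly_ring L" by (rule univ_poly_is_domain[OF carrier_is_subring])

lemma linear_closed: "a \<in> carrier L \<Longrightarrow> [\<one>, \<ominus> a] \<in> carrier (poly_ring L)"
  by (simp add: univ_poly_def polynomial_def)

lemma linear_factors_closed: "set as \<subseteq> carrier L \<Longrightarrow> linear_factors as \<in> carrier (poly_ring L)"
  by (induct as) (auto simp: linear_factors_def intro!: linear_closed)

lemma eval_linear_factors:
  assumes "set as \<subseteq> carrier L" "x \<in> carrier L"
  shows "eval (linear_factors as) x = foldr (\<lambda>a y. (x \<ominus> a) \<otimes> y) as \<one>"
  using assms(1)
proof (induct as)
  case Nil
  then show ?case using assms(2) by (simp add: linear_factors_def univ_poly_one)
next
  case (Cons a as)
  interpret e: ring_hom_ring "poly_ring L" L "\<lambda>p. eval p x" by (rule eval_ring_hom[OF carrier_is_subring assms(2)])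
  have "eval (linear_factors (a # as)) x = eval [\<one>, \<ominus> a] x \<otimes> eval (linear_factors as) x"
    using e.hom_mult[OF linear_closed linear_factors_closed] Cons by (simp add: linear_factors_def)
  moreover have "eval [\<one>, \<ominus> a] x = x \<ominus> a" using Cons assms(2) by (simp add: minus_eq)
  ultimately show ?case using Cons by simp
qed

lemma monic_factorization:
  assumes "p \<in> carrier (poly_ring L)" "p \<noteq> []" "lead_coeff p = \<one>"
  shows "\<exists>as. set as \<subseteq> carrier L \<and> length as = degree p \<and> p = linear_factors as"
  using assms
proof (induct "degree p" arbitrary: p)
  case 0
  then have "length p = 1" by (cases p) auto
  then obtain a where "p = [a]" by (metis One_nat_def length_0_conv length_Suc_conv)
  then have "p = [\<one>]" using 0 by simp
  then show ?case by (intro exI[of _ "[]"]) (auto simp: linear_factors_def univ_poly_one)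
next
  case (Suc n)
  have "size (roots p) = Suc n" using roots_over_carrier[OF Suc(3)] Suc(2) by (simp add: splitted_def)
  then have "roots p \<noteq> {#}" by (metis size_empty Zero_not_Suc)
  then obtain a where "a \<in># roots p" by blast
  then have r: "is_root p a" using roots_mem_iff_is_root[OF Suc(3)] by simp
  then have a: "a \<in> carrier L" by (simp add: is_root_def)
  have "[\<one>, \<ominus> a] pdivides p" using is_root_imp_pdivides[OF Suc(3) r] .
  then obtain q where q: "q \<in> carrier (poly_ring L)" "p = [\<one>, \<ominus> a] \<otimes>\<^bsub>poly_ring L\<^esub> q"
    by (auto simp: pdivides_def factor_def)
  have qz: "q \<noteq> []"
  proof
    assume "q = []"
    then have "p = \<zero>\<^bsub>poly_ring L\<^esub>" using q(2) P.r_null[OF linear_closed[OF a]] by (simp add: univ_poly_zero)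
    then show False using Suc(4) by (simp add: univ_poly_zero)
  qed
  have pm: "p = poly_mult [\<one>, \<ominus> a] q" using q(2) by (simp add: univ_poly_mult)
  have pp: "polynomial (carrier L) [\<one>, \<ominus> a]" "polynomial (carrier L) q"
    using linear_closed[OF a] q(1) by (simp_all add: univ_poly_carrier)
  have "degree p = Suc (degree q)" unfolding pm poly_mult_degree_eq[OF carrier_is_subring pp] using qz by simp
  then have n: "n = degree q" using Suc(2) by simp
  have "lead_coeff p = \<one> \<otimes> lead_coeff q" unfolding pm using poly_mult_lead_coeff[OF carrier_is_subring pp _ qz] by simp
  moreover have "lead_coeff q \<in> carrier L" using q(1) qz by (cases q) (auto simp: univ_poly_def polynomial_def)
  ultimately have "lead_coeff q = \<one>" using Suc(5) by simp
  then obtain as where as: "set as \<subseteq> carrier L" "length as = degree q" "q = linear_factors as"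
    using Suc(1)[OF n q(1) qz] by blast
  then show ?case using a q(2) n Suc(2) by (intro exI[of _ "a # as"]) (auto simp: linear_factors_def)
qed

end

locale closed_trinomial = algebraically_closed R + trinomial R m e c k for R (structure) and m e c k
begin

text \<open>The coefficients are recorded so that the same polynomial can later be read over a
  subfield containing \<open>u\<close>. In the witness, \<open>m - 4\<close> zeros fill the gap
  between \<open>x^m\<close> and \<open>x^3\<close>.\<close>

lemma tri_polynomial:
  assumes u: "u \<in> carrier R"
  shows "\<exists>h. h \<in> carrier (poly_ring R) \<and> set h \<subseteq> {\<zero>, \<one>, c, \<ominus> u} \<and> h \<noteq> [] \<and> lead_coeff h = \<one> \<and> degree h = m
    \<and> (\<forall>x\<in>carrier R. eval h x = tri x \<ominus> u)"
proof -
  let ?h = "\<one> # replicate (m - 4) \<zero> @ [c, \<one>, \<zero>, \<ominus> u]"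
  have h: "?h \<in> carrier (poly_ring R)" using u by (auto simp: univ_poly_def polynomial_def)
  have deg: "degree ?h = m" using m_gt by simp
  have "eval ?h x = tri x \<ominus> u" if x: "x \<in> carrier R" for x
  proof -
    have 1: "eval ?h x = x [^] degree ?h \<oplus> eval (replicate (m - 4) \<zero> @ [c, \<one>, \<zero>, \<ominus> u]) x" using x by simp
    have 2: "eval (replicate (m - 4) \<zero> @ [c, \<one>, \<zero>, \<ominus> u]) x = eval [c, \<one>, \<zero>, \<ominus> u] x"
      using x u by (intro eval_replicate) auto
    have 3: "eval [c, \<one>, \<zero>, \<ominus> u] x = c \<otimes> x [^] (3::nat) \<oplus> (x [^] (2::nat) \<oplus> \<ominus> u)"
      using x u by (simp add: numeral_3_eq_3 numeral_2_eq_2)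
    show ?thesis unfolding 1 2 3 deg tri_def using x u by (simp add: minus_eq a_assoc)
  qed
  then have "\<forall>x\<in>carrier R. eval ?h x = tri x \<ominus> u" by blast
  moreover have "set ?h \<subseteq> {\<zero>, \<one>, c, \<ominus> u}" by auto
  moreover have "lead_coeff ?h = \<one>" "?h \<noteq> []" by simp_all
  ultimately show ?thesis using h deg by blast
qed

text \<open>A derivative argument without derivatives. Away from \<open>a\<close>, the Taylor
  expansion writes \<open>tri x - u\<close> as \<open>x - a\<close> times the sum of
  \<open>k a^e\<close> and a multiple of \<open>x - a\<close>. Comparison with a double root gives a
  polynomial \<open>r\<close> with infinitely many zeros; being the zero polynomial, it also
  vanishes at \<open>a\<close>, where its value is \<open>k a^e\<close>. So \<open>a\<close> = 0 and
  \<open>u\<close> = 0.\<close>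

lemma no_double_root:
  assumes u: "u \<in> carrier R" "u \<noteq> \<zero>" and a: "a \<in> carrier R" and q: "q \<in> carrier (poly_ring R)"
    and eq: "\<And>x. x \<in> carrier R \<Longrightarrow> tri x \<ominus> u = (x \<ominus> a) \<otimes> ((x \<ominus> a) \<otimes> eval q x)"
  shows False
proof -
  interpret P: domain "poly_ring R" by (rule univ_poly_is_domain[OF carrier_is_subring])
  have "eval q a \<in> carrier R" using eval_poly_in_carrier[OF carrier_is_subring _ a] q by (auto simp: univ_poly_carrier)
  then have "tri a \<ominus> u = \<zero>" using eq[OF a] a by (simp add: minus_eq r_neg)
  then have ua: "tri a = u" using a u tri_closed[OF a] by simp
  let ?Y = "[\<one>, \<ominus> a]" and ?C = "\<lambda>b. poly_of_const b"
  let ?s = "k \<otimes> a [^] e"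
  have Y: "?Y \<in> carrier (poly_ring R)" using linear_closed[OF a] .
  have X: "X \<in> carrier (poly_ring R)" using var_closed(1)[OF carrier_is_subring] .
  have C: "?C b \<in> carrier (poly_ring R)" if "b \<in> carrier R" for b
    using that by (auto simp: poly_of_const_def univ_poly_def polynomial_def)
  have eC: "eval (?C b) x = b" if "b \<in> carrier R" "x \<in> carrier R" for b x using that by (simp add: poly_of_const_def)
  have s: "?s \<in> carrier R" using k_nonzero a by simp
  define r where "r = (?C ?s \<oplus>\<^bsub>poly_ring R\<^esub> ?Y \<otimes>\<^bsub>poly_ring R\<^esub> (\<one>\<^bsub>poly_ring R\<^esub> \<oplus>\<^bsub>poly_ring R\<^esub> ?C c \<otimes>\<^bsub>poly_ring R\<^esub> X
      \<oplus>\<^bsub>poly_ring R\<^esub> ?Y [^]\<^bsub>poly_ring R\<^esub> (m - 2))) \<ominus>\<^bsub>poly_ring R\<^esub> ?Y \<otimes>\<^bsub>poly_ring R\<^esub> q"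
  have r: "r \<in> carrier (poly_ring R)" unfolding r_def using C[OF s] C[OF c_carrier] X Y q by simp
  have er: "eval r x = (?s \<oplus> (x \<ominus> a) \<otimes> (\<one> \<oplus> c \<otimes> x \<oplus> (x \<ominus> a) [^] (m - 2))) \<ominus> (x \<ominus> a) \<otimes> eval q x"
    if x: "x \<in> carrier R" for x
  proof -
    interpret e: ring_hom_cring "poly_ring R" R "\<lambda>p. eval p x" by (rule eval_cring_hom[OF carrier_is_subring x])
    have eY: "eval ?Y x = x \<ominus> a" using a x by (simp add: minus_eq)
    have pw: "eval (?Y [^]\<^bsub>poly_ring R\<^esub> j) x = (x \<ominus> a) [^] j" for j :: nat
      using e.hom_mult[of "?Y [^]\<^bsub>poly_ring R\<^esub> _" ?Y] Y eY e.hom_one by (induct j) simp_all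
    show ?thesis
      unfolding r_def a_minus_def[of "poly_ring R"]
      using C[OF s] C[OF c_carrier] X Y q eC[OF s x] eC[OF c_carrier x] eval_var[OF x] eY pw
      by (simp del: eval.simps add: minus_eq)
  qed
  have "eval r x = \<zero>" if x: "x \<in> carrier R" "x \<noteq> a" for x
  proof -
    let ?d = "x \<ominus> a"
    have d: "?d \<in> carrier R" "?d \<noteq> \<zero>" using x a by auto
    have ad: "a \<oplus> ?d = x" using x(1) a by algebra
    let ?T = "?s \<oplus> ?d \<otimes> (\<one> \<oplus> c \<otimes> x \<oplus> ?d [^] (m - 2))"
    have Tc: "?T \<in> carrier R" using s d x by simp
    have qx: "eval q x \<in> carrier R" using eval_poly_in_carrier[OF carrier_is_subring _ x(1)] q by (auto simp: univ_poly_carrier)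
    have "tri x = tri a \<oplus> ?d \<otimes> ?T" using taylor[OF a d(1)] unfolding ad tri_def by simp
    then have "tri x \<ominus> u = ?d \<otimes> ?T" using ua u d Tc by (simp add: minus_eq a_ac r_neg2)
    then have "?d \<otimes> ?T = ?d \<otimes> (?d \<otimes> eval q x)" using eq[OF x(1)] by simp
    then have "?T = ?d \<otimes> eval q x" using m_lcancel[OF d(2) d(1) Tc] qx d by simp
    then show ?thesis unfolding er[OF x(1)] using d qx by simp
  qed
  then have "carrier R - {a} \<subseteq> {x \<in> carrier R. eval r x = \<zero>}" by auto
  moreover have "infinite (carrier R - {a})" using algebraically_closed_infinite[OF algebraically_closed_axioms] by simp
  ultimately have "infinite {x \<in> carrier R. eval r x = \<zero>}" using finite_subset by blast
  then have "r = []" using card_roots_le(1)[OF r] by blast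
  then have "eval r a = \<zero>" by simp
  moreover have "eval q a \<in> carrier R" using eval_poly_in_carrier[OF carrier_is_subring _ a] q by (auto simp: univ_poly_carrier)
  moreover have "a \<ominus> a = \<zero>" using a by simp
  ultimately have "?s = \<zero>" unfolding er[OF a] using s a by (simp add: minus_eq)
  then have "a [^] e = \<zero>" using integral[of k "a [^] e"] k_nonzero a by auto
  then have "a = \<zero>" using pow_nonzero a by blast
  then show False using ua u m_gt by (simp add: tri_def nat_pow_zero)
qed

lemma tri_roots:
  assumes u: "u \<in> carrier R" "u \<noteq> \<zero>"
  shows "\<exists>\<alpha>. inj_on \<alpha> {1..m} \<and> {x \<in> carrier R. tri x = u} = \<alpha> ` {1..m} \<and> (\<Otimes>i\<in>{1..m}. \<ominus> \<alpha> i) = \<ominus> u"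
proof -
  obtain h where h: "h \<in> carrier (poly_ring R)" "h \<noteq> []" "lead_coeff h = \<one>" "degree h = m"
    "\<And>x. x \<in> carrier R \<Longrightarrow> eval h x = tri x \<ominus> u" using tri_polynomial[OF u(1)] by blast
  interpret P: domain "poly_ring R" by (rule univ_poly_is_domain[OF carrier_is_subring])
  obtain as where as: "set as \<subseteq> carrier R" "length as = m" "h = linear_factors as"
    using monic_factorization[OF h(1-3)] h(4) by blast
  have ev: "tri x \<ominus> u = foldr (\<lambda>a y. (x \<ominus> a) \<otimes> y) as \<one>" if "x \<in> carrier R" for x
    using h(5)[OF that] eval_linear_factors[OF as(1) that] as(3) by simp
  have fc: "foldr (\<lambda>a y. (x \<ominus> a) \<otimes> y) bs \<one> \<in> carrier R" if "x \<in> carrier R" "set bs \<subseteq> carrier R" for x bs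
    using that by (induct bs) auto
  have "foldr (\<lambda>a y. (x \<ominus> a) \<otimes> y) bs \<one> = \<zero> \<longleftrightarrow> x \<in> set bs" if "x \<in> carrier R" "set bs \<subseteq> carrier R" for x bs
    using that fc by (induct bs) auto
  then have S: "{x \<in> carrier R. tri x = u} = set as"
    using ev as(1) tri_closed u(1) by (auto simp: subset_iff) (metis minus_eq_zero_iff)+
  have "distinct as"
  proof (rule ccontr)
    assume "\<not> distinct as"
    then obtain xs ys zs a where d: "as = xs @ [a] @ ys @ [a] @ zs" using not_distinct_decomp by blast
    have c: "set xs \<subseteq> carrier R" "set ys \<subseteq> carrier R" "set zs \<subseteq> carrier R" "a \<in> carrier R" using as(1) d by auto
    let ?q = "linear_factors (xs @ ys @ zs)"
    have q: "?q \<in> carrier (poly_ring R)" using c by (intro linear_factors_closed) auto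
    have "tri x \<ominus> u = (x \<ominus> a) \<otimes> ((x \<ominus> a) \<otimes> eval ?q x)" if x: "x \<in> carrier R" for x
    proof -
      have fa: "foldr (\<lambda>a y. (x \<ominus> a) \<otimes> y) (bs @ cs) \<one> = foldr (\<lambda>a y. (x \<ominus> a) \<otimes> y) bs \<one> \<otimes> foldr (\<lambda>a y. (x \<ominus> a) \<otimes> y) cs \<one>"
        if "set bs \<subseteq> carrier R" "set cs \<subseteq> carrier R" for bs cs
        using that
      proof (induct bs)
        case Nil
        then show ?case using fc[OF x] by simp
      next
        case (Cons b bs)
        have "x \<ominus> b \<in> carrier R" using Cons x by simp
        then show ?case using Cons m_assoc fc[OF x, of bs] fc[OF x, of cs] by simp
      qed
      let ?f = "\<lambda>bs. foldr (\<lambda>a y. (x \<ominus> a) \<otimes> y) bs \<one>"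
      have "?f as = ?f xs \<otimes> ((x \<ominus> a) \<otimes> (?f ys \<otimes> ((x \<ominus> a) \<otimes> ?f zs)))"
        using fa[of xs "[a] @ ys @ [a] @ zs"] fa[of ys "[a] @ zs"] c d by simp
      also have "\<dots> = (x \<ominus> a) \<otimes> ((x \<ominus> a) \<otimes> (?f xs \<otimes> (?f ys \<otimes> ?f zs)))"
        using fc[OF x c(1)] fc[OF x c(2)] fc[OF x c(3)] x c(4) by (simp add: m_ac)
      also have "?f xs \<otimes> (?f ys \<otimes> ?f zs) = ?f (xs @ ys @ zs)"
        using fa[of xs "ys @ zs"] fa[of ys zs] c by (metis le_sup_iff set_append)
      finally show ?thesis using ev[OF x] eval_linear_factors[OF _ x, of "xs @ ys @ zs"] c by simp
    qed
    then show False using no_double_root[OF u c(4) q] by blast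
  qed
  \<comment> \<open>The product of the negated roots is the linear factorisation evaluated at
    0.\<close>
  have "finprod R (\<lambda>a. \<ominus> a) (set bs) = foldr (\<lambda>a y. (\<zero> \<ominus> a) \<otimes> y) bs \<one>" if "distinct bs" "set bs \<subseteq> carrier R" for bs
    using that
  proof (induct bs)
    case (Cons b bs)
    have "(\<lambda>a. \<ominus> a) \<in> set bs \<rightarrow> carrier R" "\<ominus> b \<in> carrier R" using Cons by auto
    then show ?case using Cons by (simp add: finprod_insert minus_eq)
  qed simp
  then have "finprod R (\<lambda>a. \<ominus> a) (set as) = tri \<zero> \<ominus> u" using \<open>distinct as\<close> as(1) ev[of \<zero>] by simp
  also have "\<dots> = \<ominus> u" using m_gt u by (simp add: tri_def nat_pow_zero minus_eq)
  finally have prod: "finprod R (\<lambda>a. \<ominus> a) (set as) = \<ominus> u" .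
  have "card (set as) = m" using \<open>distinct as\<close> as(2) by (simp add: distinct_card)
  then obtain \<alpha> where al: "bij_betw \<alpha> {1..m} (set as)" using ex_bij_betw_nat_finite_1[of "set as"] by auto
  then have "inj_on \<alpha> {1..m}" "\<alpha> ` {1..m} = set as" by (auto simp: bij_betw_def)
  moreover have "(\<Otimes>i\<in>{1..m}. \<ominus> \<alpha> i) = finprod R (\<lambda>a. \<ominus> a) (\<alpha> ` {1..m})"
    using calculation as(1) by (subst finprod_reindex) auto
  ultimately show ?thesis using S prod by metis
qed

end

subsection \<open>Descent to the fixed field of the diagonal symmetric group\<close>

lemma (in field) algebraic_field:
  assumes "subfield F R"
  shows "\<And>x y. \<lbrakk>x \<in> carrier R; y \<in> carrier R; algebraic F x; algebraic F y\<rbrakk> \<Longrightarrow> algebraic F (x \<oplus> y)"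
    and "\<And>x y. \<lbrakk>x \<in> carrier R; y \<in> carrier R; algebraic F x; algebraic F y\<rbrakk> \<Longrightarrow> algebraic F (x \<otimes> y)"
    and "\<And>x. \<lbrakk>x \<in> carrier R; algebraic F x\<rbrakk> \<Longrightarrow> algebraic F (\<ominus> x)"
    and "\<And>x. \<lbrakk>x \<in> carrier R; x \<noteq> \<zero>; algebraic F x\<rbrakk> \<Longrightarrow> algebraic F (inv x)"
    and "\<And>x. x \<in> F \<Longrightarrow> algebraic F x"
proof -
  have S: "subfield {x \<in> carrier R. algebraic F x} R" using subfield_of_algebraics[OF assms] by (simp add: over_def)
  note r = subringE[OF subfieldE(1)[OF S]]
  show "algebraic F (x \<oplus> y)" "algebraic F (x \<otimes> y)"
    if "x \<in> carrier R" "y \<in> carrier R" "algebraic F x" "algebraic F y" for x y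
    using r(7)[of x y] r(6)[of x y] that by simp_all
  show "algebraic F (\<ominus> x)" if "x \<in> carrier R" "algebraic F x" for x using r(5)[of x] that by simp
  show "algebraic F (inv x)" if "x \<in> carrier R" "x \<noteq> \<zero>" "algebraic F x" for x
    using subfield_m_inv(1)[OF S, of x] that by simp
  show "algebraic F x" if "x \<in> F" for x using algebraic_self[OF subfieldE(1)[OF assms] that] by (simp add: over_def)
qed

text \<open>Write \<open>x b = a\<close> with polynomials in \<open>t\<close> and compare constant
  terms: \<open>x b0 - a0\<close> is an integral multiple of \<open>t\<close>, so it has positive
  value or vanishes; being algebraic over \<open>F\<close>, it vanishes. If \<open>b0\<close> is
  nonzero, \<open>x\<close> is a quotient of constants; otherwise a factor \<open>t\<close> cancels
  on both sides and \<open>b\<close> gets shorter.\<close>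

lemma (in discretely_valued_field) rational_constants:
  assumes F: "subfield F R" "trivial_on F v" and t: "t \<in> carrier R" "t \<noteq> \<zero>" "v t > 0"
    and x: "x \<in> generate_field R (insert t F)" "algebraic F x"
  shows "x \<in> F"
proof -
  let ?A = "simple_extension F t"
  note Fr = subringE[OF subfieldE(1)[OF F(1)]]
  have tf: "t \<in> fil 1" "t \<in> fil 0" using t by (auto simp: fil_def)
  have Fc: "F \<subseteq> carrier R" using Fr(1) .
  have F0: "F \<subseteq> fil 0" using F(2) Fc by (auto simp: fil_def trivial_on_def)
  interpret valued_ring R "fil 0" using valued_ring_fil .
  have AV: "?A \<subseteq> fil 0" using simple_extension_subring_incl[OF V_subring F0 tf(2)] .
  have xc: "x \<in> carrier R" using generate_field_in_carrier[OF _ x(1)] Fc t by auto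
  have xf: "x \<in> fil 0" using algebraic_in_V[OF F(1) F0 xc x(2)] .
  have small: "z = \<zero>" if "z \<in> fil 1" "algebraic F z" for z
  proof (rule ccontr)
    assume "z \<noteq> \<zero>"
    then have "v z = 0" using algebraic_value_zero[OF F fil_carrier[OF that(1)] that(2)] by simp
    then show False using that(1) \<open>z \<noteq> \<zero>\<close> by (simp add: fil_def)
  qed
  obtain a b where ab: "a \<in> ?A" "b \<in> ?A" "b \<noteq> \<zero>" "x = a \<otimes> inv b"
    using generate_field_insert_fraction[OF F(1) t(1) x(1)] by blast
  have "a \<in> carrier R" "b \<in> carrier R" using ab AV fil_carrier by auto
  then have "x \<otimes> b = a" using ab by (simp add: m_assoc)
  moreover have "\<And>a. \<lbrakk>a \<in> ?A; b \<noteq> \<zero>; x \<otimes> b = a\<rbrakk> \<Longrightarrow> x \<in> F" using ab(2)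
  proof (induct b rule: simple_extension.induct)
    case (lin b' b0)
    have b: "b' \<in> fil 0" "b' \<in> carrier R" "b0 \<in> carrier R" using lin AV Fc fil_carrier by auto
    from lin(4) show ?case
    proof (cases rule: simple_extension.cases)
      case zero
      then have "x = \<zero>" using lin(5,6) xc b t by simp
      then show ?thesis using Fr(2) by simp
    next
      case (lin a' a0)
      have a: "a' \<in> fil 0" "a' \<in> carrier R" "a0 \<in> carrier R" using lin AV Fc fil_carrier by auto
      let ?z = "a' \<ominus> x \<otimes> b'"
      have z: "?z \<in> fil 0" "?z \<in> carrier R" using a b xf xc fil_mult0 fil_diff by auto
      have "x \<otimes> b' \<otimes> t \<oplus> x \<otimes> b0 = a' \<otimes> t \<oplus> a0"
        using \<open>x \<otimes> (b' \<otimes> t \<oplus> b0) = a\<close> lin(1) xc b t by (simp add: r_distr m_assoc)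
      moreover have "Q \<ominus> T = S \<ominus> P" if eq: "P \<oplus> Q = S \<oplus> T"
        and c: "P \<in> carrier R" "Q \<in> carrier R" "S \<in> carrier R" "T \<in> carrier R" for P Q S T
      proof -
        have "Q = \<ominus> P \<oplus> (S \<oplus> T)" using r_neg1[OF c(1,2)] eq by simp
        then have "Q \<ominus> T = \<ominus> P \<oplus> (S \<oplus> (T \<oplus> \<ominus> T))" using c by (simp add: minus_eq a_assoc)
        then show ?thesis using c by (simp add: minus_eq r_neg a_comm)
      qed
      ultimately have "x \<otimes> b0 \<ominus> a0 = a' \<otimes> t \<ominus> x \<otimes> b' \<otimes> t" using xc b a t by simp
      then have eq: "x \<otimes> b0 \<ominus> a0 = ?z \<otimes> t" using xc b a t by (simp add: minus_eq l_distr l_minus)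
      then have "x \<otimes> b0 \<ominus> a0 \<in> fil 1" using fil_mult0(1)[OF z(1) tf(1)] by simp
      moreover have "algebraic F (x \<otimes> b0 \<ominus> a0)"
        unfolding minus_eq using algebraic_field[OF F(1)] xc x(2) b a lin(3) \<open>b0 \<in> F\<close> by auto
      ultimately have eq0: "x \<otimes> b0 \<ominus> a0 = \<zero>" by (rule small)
      then have xb: "x \<otimes> b0 = a0" using xc b a by simp
      show ?thesis
      proof (cases "b0 = \<zero>")
        case True
        then have "b' \<noteq> \<zero>" using \<open>b' \<otimes> t \<oplus> b0 \<noteq> \<zero>\<close> t by auto
        moreover have "?z = \<zero>" using integral[OF _ z(2) t(1)] eq eq0 t(2) by metis
        then have "x \<otimes> b' = a'" using a b xc by simp
        ultimately show ?thesis using \<open>\<And>a. \<lbrakk>a \<in> ?A; b' \<noteq> \<zero>; x \<otimes> b' = a\<rbrakk> \<Longrightarrow> x \<in> F\<close> lin(2) by blast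
      next
        case False
        have "x \<otimes> b0 \<otimes> inv b0 = x" using xc b False by (simp add: m_assoc)
        then have "x = a0 \<otimes> inv b0" using xb by simp
        then show ?thesis using Fr(6)[OF lin(3)] subfield_m_inv(1)[OF F(1)] False \<open>b0 \<in> F\<close> by auto
      qed
    qed
  qed simp
  ultimately show ?thesis using ab by blast
qed

lemma (in field) generated_extension:
  assumes E0: "subfield E0 R" and xs: "set xs \<subseteq> carrier R" "\<And>x. x \<in> set xs \<Longrightarrow> (algebraic over E0) x"
    and gen: "\<And>K. \<lbrakk>subfield K R; E0 \<subseteq> K; set xs \<subseteq> K\<rbrakk> \<Longrightarrow> carrier R \<subseteq> K"
  shows "carrier R = finite_extension E0 xs"
proof
  show "carrier R \<subseteq> finite_extension E0 xs"
    using finite_extension_is_subfield[OF E0 xs] finite_extension_incl[OF subfieldE(3)[OF E0] xs(1)]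
      finite_extension_mem[OF subfieldE(1)[OF E0] xs(1)] by (intro gen) auto
  show "finite_extension E0 xs \<subseteq> carrier R" using finite_extension_in_carrier[OF subfieldE(3)[OF E0] xs(1)] .
qed

lemma (in field) auto_eq_on_generators:
  assumes g: "\<gamma> \<in> carrier (Gal R E0)" "\<tau> \<in> carrier (Gal R E0)" and E0: "subfield E0 R"
    and gen: "\<And>K. \<lbrakk>subfield K R; E0 \<subseteq> K; S \<subseteq> K\<rbrakk> \<Longrightarrow> carrier R \<subseteq> K"
    and S: "S \<subseteq> carrier R" "\<And>x. x \<in> S \<Longrightarrow> \<gamma> x = \<tau> x"
  shows "\<gamma> = \<tau>"
proof -
  let ?K = "{x \<in> carrier R. \<gamma> x = \<tau> x}"
  have "subfield ?K R"
  proof (rule subfieldI')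
    show "subring ?K R" using auto_simps[OF g(1)] auto_simps[OF g(2)] by (intro subringI) auto
    show "inv x \<in> ?K" if "x \<in> ?K - {\<zero>}" for x using auto_simps[OF g(1)] auto_simps[OF g(2)] that by auto
  qed
  moreover have "E0 \<subseteq> ?K" using g subfieldE(3)[OF E0] by (auto simp: Gal_def)
  ultimately have "carrier R \<subseteq> ?K" using S by (intro gen) auto
  then show ?thesis by (intro auto_eqI[OF g]) auto
qed

theorem (in double_cover) unramified_symmetric_extension:
  assumes E0_eq: "E0 = generate_field R (insert u F)" and u: "transcendental F u"
    and xs: "set xs \<subseteq> carrier R" "\<And>x. x \<in> set xs \<Longrightarrow> (algebraic over E0) x" "carrier R = finite_extension E0 xs"
    and n: "n \<le> m"
  shows "\<exists>K. F \<subseteq> K \<and> function_field R F K \<and> galois_ext R K \<and> constant_field_is R F (carrier R)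
    \<and> unramified_ext R F K (carrier R) \<and> Gal R K \<cong> sym_group n"
proof -
  obtain K where K: "subfield K R" "E0 \<subseteq> K" "{x \<in> carrier R. \<forall>\<gamma>\<in>carrier (Gal R K). \<gamma> x = x} = K" "Gal R K \<cong> sym_group n"
    and unr: "\<And>v. \<lbrakk>discretely_valued_field R v; trivial_on F v\<rbrakk> \<Longrightarrow> \<exists>y\<in>K. y \<noteq> \<zero> \<and> v y = 1"
    using diagonal_symmetric_group[OF n] by blast
  have Kc: "K \<subseteq> carrier R" using subfieldE(3)[OF K(1)] .
  have uE: "u \<in> E0" "u \<noteq> \<zero>" using families(1) by (auto simp: root_family_def)
  then have uc: "u \<in> carrier R" using subfieldE(3)[OF E0] by auto
  have dim: "finite_dimension E0 (carrier R)" using finite_extension_finite_dimension(1)[OF E0 xs(1)] xs(2,3) by simp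
  have dimu: "finite_dimension (generate_field R (insert u F)) (carrier R)" using dim E0_eq by simp
  have FK: "F \<subseteq> K" using F(2) K(2) by blast
  \<comment> \<open>A constant is fixed by the whole group, so it lies in the rational function
    field \<open>F(u)\<close>, where \<open>F\<close> is algebraically closed.\<close>
  have const: "x \<in> F" if "x \<in> carrier R" "\<not> transcendental F x" for x
  proof -
    obtain v where v: "discretely_valued_field R v" "trivial_on F v" "v u > 0" using families(1) by (auto simp: root_family_def)
    have "x \<in> E0" using algebraic_in_E0 that by (simp add: over_def)
    then show ?thesis using discretely_valued_field.rational_constants[OF v(1) F(1) v(2) uc uE(2) v(3)] that E0_eq
      by (simp add: over_def)
  qed
  have "finite_dimension E0 K"
  proof (rule subalbegra_incl_imp_finite_dimension[OF E0 dim _ Kc])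
    show "subalgebra E0 K R"
      using subringE(6)[OF subfieldE(1)[OF K(1)]] K(2) subring.axioms(1)[OF subfieldE(1)[OF K(1)]]
      by (intro subalgebra.intro subalgebra_axioms.intro) auto
  qed
  moreover have "constant_field_is R F K" unfolding constant_field_is_def using const Kc by blast
  ultimately have ff: "function_field R F K"
    unfolding function_field_def using K(1,2) F(1) FK uE(1) u E0_eq by blast
  have "finite_extension E0 xs \<subseteq> finite_extension K xs" using mono_finite_extension[OF K(2)] .
  then have "carrier R = finite_extension K xs" using finite_extension_in_carrier[OF Kc xs(1)] xs(3) by blast
  then have "finite_dimension K (carrier R)"
    using finite_extension_finite_dimension(1)[OF K(1) xs(1)] algebraic_mono[OF K(2)] xs(2) by auto
  then have gal: "galois_ext R K" unfolding galois_ext_def using field_axioms K by auto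
  have "unramified_ext R F K (carrier R)"
    unfolding unramified_ext_def unramified_at_def
  proof (intro allI impI, elim conjE)
    fix V V' assume V: "valuation_ring R F K V" and V': "valuation_ring R F (carrier R) V'" and eq: "V' \<inter> K = V"
    obtain v where v: "discretely_valued_field R v" "V' = {x \<in> carrier R. x = \<zero> \<or> 0 \<le> v x}"
      using function_field_valuation[OF F(1) uc dimu V'] by blast
    interpret v: discretely_valued_field R v by (rule v(1))
    have FV: "F \<subseteq> V'" using V' by (auto simp: valuation_ring_def)
    have "trivial_on F v" unfolding trivial_on_def
    proof (intro ballI impI)
      fix x assume x: "x \<in> F" "x \<noteq> \<zero>"
      then have xc: "x \<in> carrier R" "inv x \<noteq> \<zero>" using FK Kc by auto
      have "inv x \<in> F" using subfield_m_inv(1)[OF F(1), of x] x by auto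
      then have "0 \<le> v x" "0 \<le> v (inv x)" using x xc FV v(2) by auto
      then show "v x = 0" using v.v_inv x xc by simp
    qed
    \<comment> \<open>Having value 1, \<open>y\<close> generates the maximal ideal of
      \<open>V'\<close>; since it lies in \<open>K\<close>, it generates that of \<open>V\<close> as
      well.\<close>
    then obtain y where y: "y \<in> K" "y \<noteq> \<zero>" "v y = 1" using unr[OF v(1)] by blast
    have yc: "y \<in> carrier R" using y Kc by auto
    have nV: "inv x \<notin> V' \<longleftrightarrow> 1 \<le> v x" if "x \<in> carrier R" "x \<noteq> \<zero>" for x
      using that v.v_inv[OF that] v(2) by auto
    have inK: "inv x \<in> K" if "x \<in> K" "x \<noteq> \<zero>" for x using subfield_m_inv(1)[OF K(1), of x] that by auto
    note Kr = subringE[OF subfieldE(1)[OF K(1)]]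
    have yV: "y \<in> V" using y yc v(2) eq by auto
    have mem: "x \<in> V' \<and> (x = \<zero> \<or> inv x \<notin> V') \<longleftrightarrow> x \<in> carrier R \<and> inv y \<otimes> x \<in> V'" for x
    proof (cases "x \<in> carrier R \<and> x \<noteq> \<zero>")
      case True
      then have "v (inv y \<otimes> x) = v x - 1" using v.v_mult[of "inv y" x] v.v_inv[OF yc y(2)] y yc by simp
      then show ?thesis using True nV[of x] v(2) y yc by auto
    qed (use v(2) yc y in auto)
    have cancel: "x = y \<otimes> (inv y \<otimes> x)" "inv y \<otimes> (y \<otimes> x) = x" if "x \<in> carrier R" for x
      using that y yc by (simp_all add: m_assoc[symmetric])
    have "place_of R V' = {y \<otimes> z | z. z \<in> V'}" (is "?L = ?M")
    proof
      show "?L \<subseteq> ?M" using mem cancel(1) by (force simp: place_of_def)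
      show "?M \<subseteq> ?L"
      proof
        fix x assume "x \<in> ?M"
        then obtain z where z: "z \<in> V'" "x = y \<otimes> z" by blast
        then have "z \<in> carrier R" using v(2) by auto
        then show "x \<in> ?L" using mem[of x] z cancel(2) yc by (simp add: place_of_def)
      qed
    qed
    moreover have "place_of R V = {y \<otimes> z | z. z \<in> V}" (is "?L = ?M")
    proof
      show "?L \<subseteq> ?M"
      proof
        fix x assume "x \<in> ?L"
        then have x: "x \<in> V'" "x \<in> K" "x = \<zero> \<or> inv x \<notin> V'" using eq inK by (auto simp: place_of_def)
        then have "inv y \<otimes> x \<in> V" using mem[of x] eq Kr(6)[OF inK[OF y(1,2)]] by auto
        moreover have "x = y \<otimes> (inv y \<otimes> x)" using cancel(1) x(2) Kc by blast
        ultimately show "x \<in> ?M" by blast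
      qed
      show "?M \<subseteq> ?L"
      proof
        fix x assume "x \<in> ?M"
        then obtain z where z: "z \<in> V" "x = y \<otimes> z" by blast
        then have zc: "z \<in> K" "z \<in> V'" "z \<in> carrier R" using v(2) eq by auto
        have xK: "x \<in> K" using Kr(6)[OF y(1) zc(1)] z by simp
        then show "x \<in> ?L" using mem[of x] z zc cancel(2) yc eq by (auto simp: place_of_def)
      qed
    qed
    ultimately show "\<exists>\<pi>\<in>V. place_of R V = {\<pi> \<otimes> y |y. y \<in> V} \<and> place_of R V' = {\<pi> \<otimes> y |y. y \<in> V'}"
      using yV by blast
  qed
  then show ?thesis using FK ff gal K(4) const by (intro exI[of _ K]) (auto simp: constant_field_is_def)
qed

subsection \<open>Places of a subfield of an algebraically closed field\<close>

lemma (in field) subfield_restrict: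
  assumes "subfield K R" "subfield F R" "F \<subseteq> K"
  shows "subfield F (R\<lparr>carrier := K\<rparr>)"
proof -
  interpret K: field "R\<lparr>carrier := K\<rparr>" by (rule subfield_iff(2)[OF assms(1)])
  show ?thesis using subfield_iff(2)[OF assms(2)] assms(3) by (intro K.subfield_iff(1)) auto
qed

lemma (in field) subfield_extend:
  assumes "subfield K R" "subfield F (R\<lparr>carrier := K\<rparr>)"
  shows "subfield F R"
proof -
  interpret K: field "R\<lparr>carrier := K\<rparr>" by (rule subfield_iff(2)[OF assms(1)])
  have "field (R\<lparr>carrier := F\<rparr>)" "F \<subseteq> K" using K.subfield_iff(2)[OF assms(2)] subfieldE(3)[OF assms(2)] by simp_all
  then show ?thesis using subfieldE(3)[OF assms(1)] by (intro subfield_iff(1)) auto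
qed

lemma (in field) inv_restrict:
  assumes "subfield K R" "x \<in> K" "x \<noteq> \<zero>"
  shows "inv\<^bsub>R\<lparr>carrier := K\<rparr>\<^esub> x = inv x" "inv x \<in> K"
proof -
  interpret K: field "R\<lparr>carrier := K\<rparr>" by (rule subfield_iff(2)[OF assms(1)])
  have xc: "x \<in> carrier R" using subsetD[OF subfieldE(3)[OF assms(1)] assms(2)] .
  show i: "inv x \<in> K" using subfield_m_inv(1)[OF assms(1), of x] assms by auto
  show "inv\<^bsub>R\<lparr>carrier := K\<rparr>\<^esub> x = inv x" using K.comm_inv_char[of x "inv x"] assms xc i by simp
qed

lemma (in field) transcendental_nonzero:
  assumes "subfield C R" "transcendental C g"
  shows "g \<noteq> \<zero>"
  using assms zero_is_algebraic[OF subfieldE(1)[OF assms(1)]] by (auto simp: over_def)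

lemma (in field) inv_transcendental_notin:
  assumes C: "subfield C R" and g: "g \<in> carrier R" "transcendental C g"
  shows "inv g \<notin> simple_extension C g"
proof
  assume "inv g \<in> simple_extension C g"
  then obtain p where p: "p \<in> carrier (C[X])" "inv g = eval p g"
    using simple_extension_as_eval_img[OF subfieldE(3)[OF C] g(1)] by auto
  have g0: "g \<noteq> \<zero>" using transcendental_nonzero[OF C g(2)] .
  then have pz: "p \<noteq> []" using p(2) g(1) by auto
  note Cr = subringE[OF subfieldE(1)[OF C]]
  have pc: "set p \<subseteq> C" "lead_coeff p \<noteq> \<zero>" using p(1) pz by (auto simp: univ_poly_def polynomial_def)
  have "\<ominus> \<one> \<in> C" using Cr(3,5) by simp
  \<comment> \<open>Coefficients stand in descending order, so appending -1 to \<open>p\<close>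
    gives the polynomial \<open>p X - 1\<close>, which would vanish at \<open>g\<close>.\<close>
  then have q: "p @ [\<ominus> \<one>] \<in> carrier (C[X])" using pc pz by (auto simp: univ_poly_def polynomial_def)
  have "set p \<subseteq> carrier R" using pc(1) Cr(1) by blast
  then have "eval (p @ [\<ominus> \<one>]) g = inv g \<otimes> g \<oplus> \<ominus> \<one>" using eval_append_aux[of p "\<ominus> \<one>" g] g(1) p(2) by simp
  then have "eval (p @ [\<ominus> \<one>]) g = \<zero>" using g(1) g0 by (simp add: r_neg)
  then show False using eval_transcendental[of C g, OF _ q] g(2) by (simp add: over_def)
qed

text \<open>If the difference were algebraic over the finite extension generated by \<rho>, then
  \<rho> and the difference, hence also \<open>t\<close>, would lie in a finite extension of
  \<open>F\<close>.\<close>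

lemma (in field) transcendental_shift:
  assumes F: "subfield F R" and t: "t \<in> carrier R" "transcendental F t" and r: "\<rho> \<in> carrier R" "algebraic F \<rho>"
  shows "transcendental (simple_extension F \<rho>) (t \<ominus> \<rho>)"
proof (rule ccontr)
  let ?C = "simple_extension F \<rho>" and ?g = "t \<ominus> \<rho>"
  assume "\<not> ?thesis"
  then have a: "(algebraic over ?C) ?g" by (simp add: over_def)
  have g: "?g \<in> carrier R" using t r by simp
  have ra: "(algebraic over F) \<rho>" using r(2) by (simp add: over_def)
  have C: "subfield ?C R" using simple_extension_is_subfield[OF F r(1)] ra by simp
  have d: "finite_dimension F (simple_extension ?C ?g)"
    using telescopic_base_dim(1)[OF F C] finite_dimension_simple_extension[OF F r(1)] ra
      finite_dimension_simple_extension[OF C g] a by blast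
  have s: "subring (simple_extension ?C ?g) R" using simple_extension_is_subring[OF subfieldE(1)[OF C] g] .
  have "\<rho> \<in> simple_extension ?C ?g"
    using simple_extension_incl[OF subfieldE(3)[OF C] g] simple_extension_mem[OF subfieldE(1)[OF F] r(1)] by auto
  moreover have "?g \<in> simple_extension ?C ?g" using simple_extension_mem[OF subfieldE(1)[OF C] g] .
  ultimately have "?g \<oplus> \<rho> \<in> simple_extension ?C ?g" using subringE(7)[OF s] by blast
  moreover have "?g \<oplus> \<rho> = t" using t r by (simp add: minus_eq a_assoc l_neg)
  ultimately have "(algebraic over F) t" using finite_dimension_imp_algebraic[OF F s d] by simp
  then show False using t(2) by (simp add: over_def)
qed

text \<open>A place of \<open>K\<close> at which \<open>u\<close> is a simple zero over
  \<open>E\<close>, obtained by restricting one of the ambient field. The ambient valuation ring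
  contains \<open>C\<close> and has \<open>g\<close> as a non-unit; it need not be discrete, but its
  intersection with the function field \<open>K\<close> is. Both \<open>C\<close> and
  \<open>g\<close> may lie outside \<open>K\<close>: the hypothesis \<open>loc\<close> trades
  \<open>g\<close> for \<open>u\<close> up to a unit, and on the field generated by \<open>C\<close>
  and \<open>g\<close> all values are multiples of that of \<open>g\<close>.\<close>

lemma (in field) place_with_parameter:
  assumes F: "subfield F R" and C: "subfield C R" "F \<subseteq> C" and g: "g \<in> carrier R" "transcendental C g"
    and K: "subfield K R" "F \<subseteq> K" and t: "t \<in> K"
    and dim: "ring.finite_dimension (R\<lparr>carrier := K\<rparr>) (generate_field (R\<lparr>carrier := K\<rparr>) (insert t F)) K"
    and u: "u \<in> K" "u \<noteq> \<zero>" and E: "E \<subseteq> K" "E \<subseteq> generate_field R (insert g C)"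
    and loc: "\<And>V. \<lbrakk>valued_ring R V; C \<subseteq> V; g \<in> place_of R V\<rbrakk> \<Longrightarrow> \<exists>w. valued_ring.unit R V w \<and> u = g \<otimes> w"
  shows "\<exists>v. discretely_valued_field (R\<lparr>carrier := K\<rparr>) v \<and> field.trivial_on (R\<lparr>carrier := K\<rparr>) F v
    \<and> 0 < v u \<and> (\<forall>y\<in>E. y \<noteq> \<zero> \<longrightarrow> v u dvd v y)"
proof -
  let ?K = "R\<lparr>carrier := K\<rparr>"
  interpret K: field ?K by (rule subfield_iff(2)[OF K(1)])
  have Kc: "K \<subseteq> carrier R" using subfieldE(3)[OF K(1)] .
  note Kr = subringE[OF subfieldE(1)[OF K(1)]]
  have g0: "g \<noteq> \<zero>" using transcendental_nonzero[OF C(1) g(2)] .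
  obtain V where V: "valuation_ring R C (carrier R) V" "simple_extension C g \<subseteq> V" "g \<in> place_of R V"
    using exists_valuation_ring[OF C(1) simple_extension_is_subring[OF subfieldE(1)[OF C(1)] g(1)]
        simple_extension_incl[OF subfieldE(3)[OF C(1)] g(1)] simple_extension_mem[OF subfieldE(1)[OF C(1)] g(1)] g0
        inv_transcendental_notin[OF C(1) g]] by blast
  interpret V: valued_ring R V using valuation_ringD(1)[OF field_axioms V(1)] .
  have CV: "C \<subseteq> V" using valuation_ringD(2)[OF field_axioms V(1)] .
  obtain w where w: "V.unit w" "u = g \<otimes> w" using loc[OF V.valued_ring_axioms CV V(3)] by blast
  have wc: "w \<in> carrier R" "w \<noteq> \<zero>" using V.unit_carrier[OF w(1)] by auto
  have uV: "u \<in> place_of R V" using V.place_mult(2)[OF _ V(3), of w] w by (simp add: V.unit_def)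
  then have iu: "u \<in> V" "inv u \<notin> V" using u(2) by (auto simp: place_of_def)
  have FV: "V.unit x" if "x \<in> F" "x \<noteq> \<zero>" for x using V.field_unit[OF F _ that] C(2) CV by auto
  have val: "valuation_ring ?K F (carrier ?K) (V \<inter> K)"
    unfolding valuation_ring_def
  proof (intro conjI ballI impI)
    show "subring (V \<inter> K) ?K"
    proof (rule K.ring_incl_imp_subring)
      have "subring (V \<inter> K) R"
        using V.V_ring Kr by (intro subringI) auto
      then show "ring (?K\<lparr>carrier := V \<inter> K\<rparr>)" using subring_is_ring by simp
    qed simp
    have "u \<notin> F" using FV[of u] V.place_not_unit[OF uV] u(2) by blast
    then show "F \<subset> V \<inter> K" using K(2) C(2) CV u(1) iu(1) by blast
    have "inv u \<in> K" using inv_restrict(2)[OF K(1) u] .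
    then show "V \<inter> K \<subset> carrier ?K" using iu(2) by auto
    fix x assume x: "x \<in> carrier ?K" "x \<noteq> \<zero>\<^bsub>?K\<^esub>"
    then have xK: "x \<in> K" "x \<noteq> \<zero>" by simp_all
    then show "x \<in> V \<inter> K \<or> inv\<^bsub>?K\<^esub> x \<in> V \<inter> K"
      using V.V_val[of x] inv_restrict[OF K(1) xK] Kc by auto
  qed
  have FK: "subfield F ?K" using subfield_restrict[OF K(1) F K(2)] .
  obtain v where v: "discretely_valued_field ?K v" and Vv: "V \<inter> K = {x \<in> carrier ?K. x = \<zero>\<^bsub>?K\<^esub> \<or> 0 \<le> v x}"
    using K.function_field_valuation[OF FK _ _ val, of t] t dim by auto
  interpret v: discretely_valued_field ?K v by (rule v)
  have mem: "x \<in> V \<longleftrightarrow> 0 \<le> v x" if "x \<in> K" "x \<noteq> \<zero>" for x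
  proof -
    have "x \<in> V \<inter> K \<longleftrightarrow> 0 \<le> v x" unfolding Vv using that by simp
    then show ?thesis using that by simp
  qed
  have vi: "v (inv x) = - v x" if "x \<in> K" "x \<noteq> \<zero>" for x using v.v_inv[of x] inv_restrict[OF K(1) that] that by simp
  have un: "v x = 0" if "x \<in> K" "V.unit x" for x
  proof -
    have x: "x \<noteq> \<zero>" "x \<in> V" "inv x \<in> V" using that(2) by (auto simp: V.unit_def)
    then have "inv x \<in> K" "inv x \<noteq> \<zero>" using inv_restrict(2)[OF K(1) that(1)] that(1) Kc by auto
    then have "0 \<le> v (inv x)" "0 \<le> v x" using mem[of x] mem[of "inv x"] x that by auto
    then show ?thesis using vi[OF that(1) x(1)] by simp
  qed
  have "K.trivial_on F v" unfolding K.trivial_on_def using un FV K(2) by auto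
  moreover have "0 < v u"
  proof -
    have "0 \<le> v u" using mem[OF u] iu(1) by simp
    moreover have "\<not> 0 \<le> v (inv u)" using mem[of "inv u"] iu(2) inv_restrict(2)[OF K(1) u] u Kc by auto
    ultimately show ?thesis using vi[OF u] by simp
  qed
  moreover have "v u dvd v y" if y: "y \<in> E" "y \<noteq> \<zero>" for y
  proof -
    obtain i j w' where w': "V.unit w'" "y \<otimes> g [^] (i::nat) = g [^] (j::nat) \<otimes> w'"
      using V.generated_in_place_element[OF C(1) CV V(3) g0] E(2) y by blast
    have w'c: "w' \<in> carrier R" using V.unit_carrier[OF w'(1)] by auto
    have yK: "y \<in> K" using E(1) y by auto
    have yc: "y \<in> carrier R" and uc: "u \<in> carrier R" using yK u Kc by auto
    have pK: "u [^] (l::nat) \<in> K" for l using u(1) Kr by (induct l) auto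
    \<comment> \<open>From \<open>y g^i = g^j w'\<close> and \<open>u = g w\<close> one gets
      \<open>y u^i = u^j z\<close>. This unit lies in \<open>K\<close>, although \<open>w\<close>
      and \<open>w'\<close> may not, so its value under \<open>v\<close> makes sense and is
      0.\<close>
    let ?z = "w' \<otimes> w [^] i \<otimes> inv (w [^] j)"
    have wj: "w [^] j \<in> carrier R" "w [^] j \<noteq> \<zero>" using wc by auto
    have z: "V.unit ?z" using w' w V.unit_mult V.unit_inv V.unit_pow by auto
    have zc: "?z \<in> carrier R" "?z \<noteq> \<zero>" using V.unit_carrier[OF z] by auto
    have up: "u [^] (l::nat) = g [^] l \<otimes> w [^] l" for l using w(2) wc g by (simp add: nat_pow_distrib)
    have "u [^] j \<otimes> ?z = g [^] j \<otimes> w' \<otimes> w [^] i \<otimes> (w [^] j \<otimes> inv (w [^] j))"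
      unfolding up using g wc w'c inv_nonzero(1)[OF wj] by (simp add: m_ac del: inv_nonzero)
    also have "\<dots> = y \<otimes> g [^] i \<otimes> w [^] i" using w'(2) g wc w'c wj yc by simp
    also have "\<dots> = y \<otimes> u [^] i" unfolding up using g wc yc by (simp add: m_assoc)
    finally have e: "u [^] j \<otimes> ?z = y \<otimes> u [^] i" .
    have uj: "u [^] (l::nat) \<noteq> \<zero>" for l using uc u(2) by simp
    have "inv (u [^] j) \<otimes> (y \<otimes> u [^] i) = ?z"
      using e[symmetric] uj[of j] uc zc by (simp add: m_assoc[symmetric] del: mult_nonzero_iff)
    then have zK: "?z \<in> K" using Kr(6)[OF inv_restrict(2)[OF K(1) pK uj] Kr(6)[OF yK pK]] by metis
    have vp: "v (u [^] (l::nat)) = int l * v u" for l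
      using v.v_pow[of u l] u by (simp add: nat_pow_consistent[symmetric])
    have "v (u [^] j \<otimes> ?z) = v (u [^] j) + v ?z" using v.v_mult[of "u [^] j" ?z] pK uj zK zc by simp
    moreover have "v (y \<otimes> u [^] i) = v y + v (u [^] i)" using v.v_mult[of y "u [^] i"] pK uj yK y(2) by simp
    ultimately have "v y + int i * v u = int j * v u" using e vp un[OF zK z] by simp
    then have "v y = (int j - int i) * v u" by (simp add: algebra_simps)
    then show ?thesis by simp
  qed
  ultimately show ?thesis using v by blast
qed

subsection \<open>The rational function with prescribed zeros and poles\<close>

text \<open>Taking \<open>b\<close> = 0 and \<open>b\<close> = 1 gives the numerator and the
  denominator of \<open>s\<close>. In characteristic \<open>p\<close>, with \<open>m\<close> a power
  of \<open>p\<close>, the derivative is 1, so all roots are simple.\<close>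

definition (in ring) quadrinomial :: "nat \<Rightarrow> nat \<Rightarrow> 'a \<Rightarrow> 'a \<Rightarrow> 'a" where
  "quadrinomial p m b x = \<one> \<oplus> x \<oplus> b \<otimes> x [^] p \<oplus> x [^] m"

lemma (in ring) quadrinomial_closed: "b \<in> carrier R \<Longrightarrow> x \<in> carrier R \<Longrightarrow> quadrinomial p m b x \<in> carrier R"
  by (simp add: quadrinomial_def)

lemma (in field) quadrinomial_polynomial:
  assumes F: "subfield F R" and b: "b \<in> F" and pm: "1 < p" "p < m"
  shows "\<exists>h\<in>carrier (F[X]). h \<noteq> [] \<and> degree h = m \<and> (\<forall>x\<in>carrier R. eval h x = quadrinomial p m b x)"
proof -
  note Fr = subringE[OF subfieldE(1)[OF F]]
  let ?q = "replicate (m - p - 1) \<zero> @ b # replicate (p - 2) \<zero> @ [\<one>, \<one>]"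
  let ?h = "\<one> # ?q"
  have bc: "b \<in> carrier R" using b Fr(1) by auto
  have h: "?h \<in> carrier (F[X])" using b Fr(2,3) by (auto simp: univ_poly_def polynomial_def)
  have deg: "degree ?h = m" using pm by simp
  have "eval ?h x = quadrinomial p m b x" if x: "x \<in> carrier R" for x
  proof -
    have 1: "eval ?h x = x [^] degree ?h \<oplus> eval ?q x" using x by simp
    have 2: "eval ?q x = eval (b # replicate (p - 2) \<zero> @ [\<one>, \<one>]) x" using x bc by (intro eval_replicate) auto
    have 3: "eval (b # replicate (p - 2) \<zero> @ [\<one>, \<one>]) x
        = b \<otimes> x [^] degree (b # replicate (p - 2) \<zero> @ [\<one>, \<one>]) \<oplus> eval (replicate (p - 2) \<zero> @ [\<one>, \<one>]) x" by simp
    have d: "degree (b # replicate (p - 2) \<zero> @ [\<one>, \<one>]) = p" using pm by simp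
    have 4: "eval (replicate (p - 2) \<zero> @ [\<one>, \<one>]) x = eval [\<one>, \<one>] x" using x by (intro eval_replicate) auto
    have 5: "eval [\<one>, \<one>] x = x \<oplus> \<one>" using x by simp
    show ?thesis unfolding 1 2 3 4 5 d deg quadrinomial_def using x bc by (simp add: a_ac)
  qed
  then show ?thesis using h deg by (intro bexI[of _ ?h]) (blast, assumption)
qed

text \<open>Neither value involves \<open>b\<close>, so the quotient of two such quadrinomials is a
  unit wherever \<open>x\<close> has a zero or a pole. This is what keeps the branch points of the
  two covers apart.\<close>

lemma (in discretely_valued_field) quadrinomial_value:
  assumes x: "x \<in> carrier R" "x \<noteq> \<zero>" and b: "b \<in> fil 0" and pm: "1 < p" "p < m"
  shows "v x > 0 \<Longrightarrow> quadrinomial p m b x \<noteq> \<zero> \<and> v (quadrinomial p m b x) = 0"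
    and "v x < 0 \<Longrightarrow> quadrinomial p m b x \<noteq> \<zero> \<and> v (quadrinomial p m b x) = int m * v x"
proof -
  have bc: "b \<in> carrier R" using b fil_carrier by auto
  have pw: "x [^] (l::nat) \<in> fil k" if "k \<le> int l * v x" for l k using that x v_pow[OF x] by (simp add: fil_def)
  {
    assume v: "v x > 0"
    have "1 \<le> int l * v x" if "0 < l" for l :: nat using that v by (simp add: int_one_le_iff_zero_less)
    then have "x [^] (l::nat) \<in> fil 1" if "0 < l" for l using pw that by blast
    then have "x \<in> fil 1" "x [^] p \<in> fil 1" "x [^] m \<in> fil 1" using pm x v by (auto simp: fil_def[of 1] intro: less_trans)
    then have "x \<oplus> (b \<otimes> x [^] p \<oplus> x [^] m) \<in> fil (v \<one> + 1)" using b fil_mult0 fil_add by simp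
    from v_add_dominant[OF _ _ this] have "\<one> \<oplus> (x \<oplus> (b \<otimes> x [^] p \<oplus> x [^] m)) \<noteq> \<zero> \<and> v (\<one> \<oplus> (x \<oplus> (b \<otimes> x [^] p \<oplus> x [^] m))) = 0" by simp
    then show "quadrinomial p m b x \<noteq> \<zero> \<and> v (quadrinomial p m b x) = 0"
      unfolding quadrinomial_def using x bc by (simp add: a_assoc)
  next
    assume v: "v x < 0"
    have le: "int m * v x + 1 \<le> int l * v x" if "l < m" for l
    proof -
      have "int m * v x = int l * v x + int (m - l) * v x" using that by (simp add: algebra_simps of_nat_diff)
      moreover have "int (m - l) * v x \<le> 1 * v x" using that v by (intro mult_right_mono_neg) auto
      ultimately show ?thesis using v by linarith
    qed
    have "x [^] l \<in> fil (int m * v x + 1)" if "l < m" for l using pw le that by blast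
    from this[of 0] this[of 1] this[of p] have "\<one> \<in> fil (int m * v x + 1)" "x \<in> fil (int m * v x + 1)" "x [^] p \<in> fil (int m * v x + 1)"
      using pm x by simp_all
    then have "\<one> \<oplus> x \<oplus> b \<otimes> x [^] p \<in> fil (v (x [^] m) + 1)" using b fil_mult0 fil_add v_pow[OF x] by simp
    from v_add_dominant[OF _ _ this] have "x [^] m \<oplus> (\<one> \<oplus> x \<oplus> b \<otimes> x [^] p) \<noteq> \<zero> \<and> v (x [^] m \<oplus> (\<one> \<oplus> x \<oplus> b \<otimes> x [^] p)) = int m * v x"
      using x v_pow[OF x] by simp
    moreover have "x [^] m \<oplus> (\<one> \<oplus> x \<oplus> b \<otimes> x [^] p) = quadrinomial p m b x"
      unfolding quadrinomial_def using x bc by (simp add: a_comm)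
    ultimately show "quadrinomial p m b x \<noteq> \<zero> \<and> v (quadrinomial p m b x) = int m * v x" by simp
  }
qed

text \<open>Additivity of the two power maps gives
  \<open>Q(\<rho> + g) = g (1 + b g^(p-1) + g^(m-1))\<close> at a root \<rho>, a simple zero. The
  other quadrinomial differs from it by the \<open>p\<close>-th power of \<open>\<rho> + g\<close>
  up to sign, which is a unit because \<rho> is nonzero.\<close>

lemma (in valued_ring) quadrinomial_at_root:
  assumes C: "subfield C R" "C \<subseteq> V" and r: "\<rho> \<in> C" "quadrinomial p m b \<rho> = \<zero>" and g: "g \<in> place_of R V"
    and b: "(b, b') = (\<zero>, \<one>) \<or> (b, b') = (\<one>, \<zero>)" and pm: "1 < p" "p < m"
    and fr: "(\<rho> \<oplus> g) [^] p = \<rho> [^] p \<oplus> g [^] p" "(\<rho> \<oplus> g) [^] m = \<rho> [^] m \<oplus> g [^] m"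
  shows "\<exists>w. unit w \<and> quadrinomial p m b (\<rho> \<oplus> g) \<otimes> inv (quadrinomial p m b' (\<rho> \<oplus> g)) = g \<otimes> w"
proof -
  have rc: "\<rho> \<in> carrier R" and gc: "g \<in> carrier R" "g \<in> V" using r C V_carrier place_carrier[OF g] by auto
  have bV: "b \<in> V" "b \<in> carrier R" "b' \<in> carrier R" using b V_ring(2,3) by auto
  let ?t = "\<rho> \<oplus> g"
  let ?w = "\<one> \<oplus> (b \<otimes> g [^] (p - 1) \<oplus> g [^] (m - 1))"
  have "b \<otimes> g [^] (p - 1) \<oplus> g [^] (m - 1) \<in> place_of R V"
    using place_pow[OF g] pm place_mult(1)[OF bV(1)] by (intro place_add) auto
  then have w: "unit ?w" by (intro unit_add_place) auto
  have gp: "g [^] p = g \<otimes> g [^] (p - 1)" "g [^] m = g \<otimes> g [^] (m - 1)"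
    using gc pm nat_pow_Suc2[of g "p - 1"] nat_pow_Suc2[of g "m - 1"] by auto
  have "P1 \<oplus> (\<rho> \<oplus> g) \<oplus> b \<otimes> (P2 \<oplus> g \<otimes> G2) \<oplus> (P3 \<oplus> g \<otimes> G3)
      = (P1 \<oplus> \<rho> \<oplus> b \<otimes> P2 \<oplus> P3) \<oplus> g \<otimes> (\<one> \<oplus> (b \<otimes> G2 \<oplus> G3))"
    if "P1 \<in> carrier R" "P2 \<in> carrier R" "P3 \<in> carrier R" "G2 \<in> carrier R" "G3 \<in> carrier R" for P1 P2 P3 G2 G3
    using that rc gc bV by (simp add: r_distr a_ac m_ac)
  then have "quadrinomial p m b ?t = quadrinomial p m b \<rho> \<oplus> g \<otimes> ?w"
    unfolding quadrinomial_def fr gp using rc gc by simp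
  then have eq: "quadrinomial p m b ?t = g \<otimes> ?w" using r(2) gc unit_carrier[OF w] by simp
  have "\<rho> \<noteq> \<zero>" using r(2) pm bV by (auto simp: quadrinomial_def nat_pow_zero)
  then have "unit \<rho>" using field_unit[OF C r(1)] by simp
  then have t: "unit ?t" using unit_add_place[OF _ g] by simp
  then have tp: "unit (?t [^] p)" "unit (\<ominus> \<one> \<otimes> ?t [^] p)"
    using unit_pow unit_mult field_unit[OF C, of "\<ominus> \<one>"] subringE(3,5)[OF subfieldE(1)[OF C(1)]] by auto
  have tc: "?t \<in> carrier R" using rc gc by simp
  have pl: "quadrinomial p m b ?t \<in> place_of R V" unfolding eq using place_mult(2)[OF _ g] w by (simp add: unit_def)
  have "unit (quadrinomial p m b' ?t)" using b
  proof
    assume "(b, b') = (\<zero>, \<one>)"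
    then have "quadrinomial p m b' ?t = ?t [^] p \<oplus> quadrinomial p m b ?t" using tc by (simp add: quadrinomial_def a_ac del: fr)
    then show ?thesis using unit_add_place[OF tp(1) pl] by simp
  next
    assume bb: "(b, b') = (\<one>, \<zero>)"
    have "P \<oplus> Q = \<ominus> \<one> \<otimes> T \<oplus> (P \<oplus> T \<oplus> Q)" if "P \<in> carrier R" "Q \<in> carrier R" "T \<in> carrier R" for P Q T
    proof -
      have "\<ominus> \<one> \<otimes> T \<oplus> (P \<oplus> T \<oplus> Q) = (\<ominus> T \<oplus> T) \<oplus> (P \<oplus> Q)" using that by (simp only: l_minus one_closed l_one a_ac a_closed a_inv_closed)
      then show ?thesis using that by (simp add: l_neg)
    qed
    from this[of "\<one> \<oplus> ?t" "?t [^] m" "?t [^] p"]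
    have "quadrinomial p m b' ?t = \<ominus> \<one> \<otimes> ?t [^] p \<oplus> quadrinomial p m b ?t"
      unfolding quadrinomial_def using bb tc by simp
    then show ?thesis using unit_add_place[OF tp(2) pl] by simp
  qed
  then have "unit (?w \<otimes> inv (quadrinomial p m b' ?t))" using w unit_mult unit_inv by blast
  moreover have "quadrinomial p m b ?t \<otimes> inv (quadrinomial p m b' ?t) = g \<otimes> (?w \<otimes> inv (quadrinomial p m b' ?t))"
    unfolding eq using m_assoc[OF gc(1)] unit_carrier(1)[OF w] unit_carrier(1)[OF unit_inv[OF \<open>unit (quadrinomial p m b' ?t)\<close>]] by blast
  ultimately show ?thesis by blast
qed

section \<open>Assembly inside an algebraically closed field\<close>

lemma (in field) uminus_restrict:
  assumes "subfield K R" "x \<in> K"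
  shows "\<ominus>\<^bsub>R\<lparr>carrier := K\<rparr>\<^esub> x = \<ominus> x" "\<ominus> x \<in> K"
proof -
  interpret K: field "R\<lparr>carrier := K\<rparr>" by (rule subfield_iff(2)[OF assms(1)])
  have xc: "x \<in> carrier R" using subsetD[OF subfieldE(3)[OF assms(1)] assms(2)] .
  show i: "\<ominus> x \<in> K" using subringE(5)[OF subfieldE(1)[OF assms(1)] assms(2)] .
  show "\<ominus>\<^bsub>R\<lparr>carrier := K\<rparr>\<^esub> x = \<ominus> x" using K.minus_equality[of "\<ominus> x" x] assms xc i by (simp add: l_neg)
qed

lemma (in field) finprod_restrict:
  assumes "subfield K R" "finite I" "\<And>i. i \<in> I \<Longrightarrow> f i \<in> K"
  shows "finprod (R\<lparr>carrier := K\<rparr>) f I = finprod R f I"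
  using assms(2,3)
proof (induct I)
  case empty
  interpret K: field "R\<lparr>carrier := K\<rparr>" by (rule subfield_iff(2)[OF assms(1)])
  show ?case using K.finprod_empty[of f] by simp
next
  case (insert a I)
  interpret K: field "R\<lparr>carrier := K\<rparr>" by (rule subfield_iff(2)[OF assms(1)])
  have 1: "f \<in> I \<rightarrow> carrier R" "f a \<in> carrier R" using insert subfieldE(3)[OF assms(1)] by auto
  have 2: "f \<in> I \<rightarrow> carrier (R\<lparr>carrier := K\<rparr>)" "f a \<in> carrier (R\<lparr>carrier := K\<rparr>)" using insert by auto
  show ?case using finprod_insert[OF insert(1,2) 1] K.finprod_insert[OF insert(1,2) 2] insert by simp
qed

lemma (in algebraically_closed) root_exists:
  assumes "p \<in> carrier (poly_ring L)" "0 < degree p"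
  shows "\<exists>x\<in>carrier L. eval p x = \<zero>"
proof -
  have "size (roots p) = degree p" using roots_over_carrier[OF assms(1)] by (simp add: splitted_def)
  then have "roots p \<noteq> {#}" using assms(2) by (metis size_empty less_irrefl)
  then obtain x where "x \<in># roots p" by blast
  then show ?thesis using roots_mem_iff_is_root[OF assms(1)] by (auto simp: is_root_def)
qed

text \<open>A root \<rho> of the quadrinomial need not lie in \<open>F\<close>, so the constants are
  extended by \<rho> and \<open>t - \<rho>\<close> serves as parameter. Exchanging \<open>b\<close>
  and \<open>b'\<close> replaces \<open>u\<close> by its inverse, so the lemma serves for zeros and
  for poles.\<close>

lemma (in algebraically_closed) quadrinomial_place:
  assumes F: "subfield F L" and t: "t \<in> K" "transcendental F t" and K: "subfield K L" "F \<subseteq> K"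
    and dim: "ring.finite_dimension (L\<lparr>carrier := K\<rparr>) (generate_field (L\<lparr>carrier := K\<rparr>) (insert t F)) K"
    and b: "(b, b') = (\<zero>, \<one>) \<or> (b, b') = (\<one>, \<zero>)" and pm: "1 < p" "p < m"
    and fr: "\<And>x y. \<lbrakk>x \<in> carrier L; y \<in> carrier L\<rbrakk> \<Longrightarrow> (x \<oplus> y) [^] p = x [^] p \<oplus> y [^] p"
      "\<And>x y. \<lbrakk>x \<in> carrier L; y \<in> carrier L\<rbrakk> \<Longrightarrow> (x \<oplus> y) [^] m = x [^] m \<oplus> y [^] m"
    and u: "u = quadrinomial p m b t \<otimes> inv (quadrinomial p m b' t)" "u \<in> K" "u \<noteq> \<zero>"
  shows "\<exists>v. discretely_valued_field (L\<lparr>carrier := K\<rparr>) v \<and> field.trivial_on (L\<lparr>carrier := K\<rparr>) F v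
    \<and> 0 < v u \<and> (\<forall>y\<in>generate_field L (insert t F). y \<noteq> \<zero> \<longrightarrow> v u dvd v y)"
proof -
  note Fr = subringE[OF subfieldE(1)[OF F]]
  have tc: "t \<in> carrier L" using subsetD[OF subfieldE(3)[OF K(1)] t(1)] .
  have bF: "b \<in> F" using b Fr(2,3) by auto
  obtain h where h: "h \<in> carrier (F[X])" "h \<noteq> []" "degree h = m" "\<And>x. x \<in> carrier L \<Longrightarrow> eval h x = quadrinomial p m b x"
    using quadrinomial_polynomial[OF F bF pm] by blast
  have "h \<in> carrier (poly_ring L)" using h(1) Fr(1) by (auto simp: univ_poly_def polynomial_def)
  moreover have "0 < degree h" using h(3) pm by linarith
  ultimately obtain \<rho> where r: "\<rho> \<in> carrier L" "eval h \<rho> = \<zero>" using root_exists by blast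
  have ra: "(algebraic over F) \<rho>" using algebraicI[OF h(1,2) r(2)] .
  let ?C = "simple_extension F \<rho>" and ?g = "t \<ominus> \<rho>"
  have C: "subfield ?C L" "F \<subseteq> ?C" "\<rho> \<in> ?C"
    using simple_extension_is_subfield[OF F r(1)] ra simple_extension_incl[OF Fr(1) r(1)]
      simple_extension_mem[OF subfieldE(1)[OF F] r(1)] by auto
  have g: "?g \<in> carrier L" "transcendental ?C ?g" using transcendental_shift[OF F tc t(2) r(1)] ra r tc by (auto simp: over_def)
  have tg: "\<rho> \<oplus> ?g = t" using a_lcomm[of \<rho> t "\<ominus> \<rho>"] tc r(1) by (simp add: minus_eq r_neg)
  have gC: "insert ?g ?C \<subseteq> carrier L" using g(1) subfieldE(3)[OF C(1)] by auto
  have S: "subfield (generate_field L (insert ?g ?C)) L" using generate_field_is_subfield[OF gC] .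
  have incl: "insert ?g ?C \<subseteq> generate_field L (insert ?g ?C)" using generate_fieldE(2)[OF gC refl] .
  have "t \<in> generate_field L (insert ?g ?C)"
    using subringE(7)[OF subfieldE(1)[OF S], of \<rho> ?g] incl C(3) tg by auto
  then have E: "generate_field L (insert t F) \<subseteq> generate_field L (insert ?g ?C)"
    using S incl C(2) tc Fr(1) by (intro generate_field_min_subfield1) auto
  have E': "generate_field L (insert t F) \<subseteq> K"
    using K t(1) tc Fr(1) by (intro generate_field_min_subfield1) auto
  show ?thesis
  proof (rule place_with_parameter[OF F C(1,2) g K t(1) dim u(2,3) E' E])
    fix V assume V: "valued_ring L V" "?C \<subseteq> V" "?g \<in> place_of L V"
    have "quadrinomial p m b \<rho> = \<zero>" using h(4) r by simp
    from valued_ring.quadrinomial_at_root[OF V(1) C(1) V(2) C(3) this V(3) b pm fr(1)[OF r(1) g(1)] fr(2)[OF r(1) g(1)]]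
    show "\<exists>w. valued_ring.unit L V w \<and> u = ?g \<otimes> w" unfolding tg u(1) .
  qed
qed

theorem (in closed_trinomial) unramified_symmetric_extension_exists:
  assumes F: "subfield F R" "k \<in> F" and t: "t \<in> carrier R" "transcendental F t" and pm: "1 < p" "p < m"
    and fr: "\<And>x y. \<lbrakk>x \<in> carrier R; y \<in> carrier R\<rbrakk> \<Longrightarrow> (x \<oplus> y) [^] p = x [^] p \<oplus> y [^] p"
      "\<And>x y. \<lbrakk>x \<in> carrier R; y \<in> carrier R\<rbrakk> \<Longrightarrow> (x \<oplus> y) [^] m = x [^] m \<oplus> y [^] m"
    and n: "n \<le> m"
  shows "\<exists>K E. subfield K R \<and> F \<subseteq> K \<and> F \<subseteq> E \<and> function_field (R\<lparr>carrier := K\<rparr>) F E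
    \<and> galois_ext (R\<lparr>carrier := K\<rparr>) E \<and> constant_field_is (R\<lparr>carrier := K\<rparr>) F K
    \<and> unramified_ext (R\<lparr>carrier := K\<rparr>) F E K \<and> Gal (R\<lparr>carrier := K\<rparr>) E \<cong> sym_group n"
proof -
  note Fr = subringE[OF subfieldE(1)[OF F(1)]]
  let ?r = "\<lambda>b. quadrinomial p m b t"
  have t0: "t \<noteq> \<zero>" using transcendental_nonzero[OF F(1) t(2)] .
  have rc: "?r b \<in> carrier R" if "b \<in> F" for b using quadrinomial_closed that Fr(1) t(1) by auto
  have r0: "?r b \<noteq> \<zero>" if b: "b \<in> F" for b
  proof -
    obtain h where h: "h \<in> carrier (F[X])" "h \<noteq> []" "eval h t = ?r b" using quadrinomial_polynomial[OF F(1) b pm] t(1) by blast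
    then show ?thesis using eval_transcendental[of F t h] t(2) by (auto simp: over_def)
  qed
  define s where "s = ?r \<zero> \<otimes> inv (?r \<one>)"
  have s: "s \<in> carrier R" "s \<noteq> \<zero>" unfolding s_def using rc[OF Fr(2)] rc[OF Fr(3)] r0[OF Fr(2)] r0[OF Fr(3)] by auto
  have si: "inv s = ?r \<one> \<otimes> inv (?r \<zero>)"
    unfolding s_def using rc[OF Fr(2)] rc[OF Fr(3)] r0[OF Fr(2)] r0[OF Fr(3)] by (simp add: inv_mult_nonzero m_comm)
  obtain \<alpha> where al: "inj_on \<alpha> {1..m}" "{x \<in> carrier R. tri x = t} = \<alpha> ` {1..m}" "(\<Otimes>i\<in>{1..m}. \<ominus> \<alpha> i) = \<ominus> t"
    using tri_roots[OF t(1) t0] by blast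
  obtain \<beta> where be: "inj_on \<beta> {1..m}" "{x \<in> carrier R. tri x = s} = \<beta> ` {1..m}" "(\<Otimes>i\<in>{1..m}. \<ominus> \<beta> i) = \<ominus> s"
    using tri_roots[OF s] by blast
  let ?S = "insert t F \<union> (\<alpha> ` {1..m} \<union> \<beta> ` {1..m})"
  have tF: "insert t F \<subseteq> carrier R" using t(1) Fr(1) by auto
  have Sc: "?S \<subseteq> carrier R" using tF al(2) be(2) by blast
  \<comment> \<open>The splitting field, generated inside the ambient field by \<open>t\<close> and
    both families of roots. From here on the notions are restated in the ring with carrier
    \<open>K\<close>, where the Galois group lives.\<close>
  define K where "K = generate_field R ?S"
  have K: "subfield K R" unfolding K_def using generate_field_is_subfield[OF Sc] .
  have SK: "?S \<subseteq> K" using generate_fieldE(2)[OF Sc K_def] .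
  note Kr = subringE[OF subfieldE(1)[OF K]]
  let ?L = "R\<lparr>carrier := K\<rparr>"
  have cK: "c \<in> K" using c_e Kr(2,3) by auto
  have kK: "k \<in> K" using F(2) SK by auto
  interpret L0: field ?L by (rule subfield_iff(2)[OF K])
  interpret L: trinomial ?L m e c k
  proof (intro trinomial.intro trinomial_axioms.intro L0.field_axioms)
    fix a d assume "a \<in> carrier ?L" "d \<in> carrier ?L"
    then have "a \<in> carrier R" "d \<in> carrier R" using Kr(1) by auto
    from taylor[OF this] show "(a \<oplus>\<^bsub>?L\<^esub> d) [^]\<^bsub>?L\<^esub> m \<oplus>\<^bsub>?L\<^esub> c \<otimes>\<^bsub>?L\<^esub> (a \<oplus>\<^bsub>?L\<^esub> d) [^]\<^bsub>?L\<^esub> (3::nat) \<oplus>\<^bsub>?L\<^esub> (a \<oplus>\<^bsub>?L\<^esub> d) [^]\<^bsub>?L\<^esub> (2::nat) =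
      (a [^]\<^bsub>?L\<^esub> m \<oplus>\<^bsub>?L\<^esub> c \<otimes>\<^bsub>?L\<^esub> a [^]\<^bsub>?L\<^esub> (3::nat) \<oplus>\<^bsub>?L\<^esub> a [^]\<^bsub>?L\<^esub> (2::nat)) \<oplus>\<^bsub>?L\<^esub>
      d \<otimes>\<^bsub>?L\<^esub> (k \<otimes>\<^bsub>?L\<^esub> a [^]\<^bsub>?L\<^esub> e \<oplus>\<^bsub>?L\<^esub> d \<otimes>\<^bsub>?L\<^esub> (\<one>\<^bsub>?L\<^esub> \<oplus>\<^bsub>?L\<^esub> c \<otimes>\<^bsub>?L\<^esub> (a \<oplus>\<^bsub>?L\<^esub> d) \<oplus>\<^bsub>?L\<^esub> d [^]\<^bsub>?L\<^esub> (m - 2)))"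
      unfolding nat_pow_consistent[symmetric] by simp
  qed (use m_gt k_nonzero kK c_e coprime_e in auto)
  have tri_eq: "L.tri = tri" unfolding L.tri_def tri_def nat_pow_consistent[symmetric] by simp
  have q_eq: "L0.quadrinomial = quadrinomial" unfolding L0.quadrinomial_def quadrinomial_def nat_pow_consistent[symmetric] by simp
  have ev: "L0.eval = eval" using eval_consistent[OF subfieldE(1)[OF K]] by auto
  define E where "E = generate_field R (insert t F)"
  have E_L: "generate_field ?L (insert t F) = E" unfolding E_def using subfield_gen_equality[OF K, of "insert t F"] SK by auto
  have E: "subfield E R" unfolding E_def using generate_field_is_subfield[OF tF] .
  have tFE: "insert t F \<subseteq> E" using generate_fieldE(2)[OF tF E_def] .
  have EK: "E \<subseteq> K" unfolding E_def using generate_field_min_subfield1[OF tF K] SK by blast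
  note Er = subringE[OF subfieldE(1)[OF E]]
  have EL: "subfield E ?L" using subfield_restrict[OF K E EK] .
  have FL: "subfield F ?L" using subfield_restrict[OF K F(1)] SK by auto
  have pE: "t [^] (l::nat) \<in> E" for l using tFE Er(3,6) by (induct l) auto
  have rE: "?r b \<in> E" if "b \<in> F" for b unfolding quadrinomial_def using that tFE pE Er by auto
  have sE: "s \<in> E" unfolding s_def
    using Er(6)[OF rE[OF Fr(2)] inv_restrict(2)[OF E rE[OF Fr(3)] r0[OF Fr(3)]]] .
  have rootE: "\<gamma> i \<in> K \<and> L0.splits_separably E (\<gamma> i)"
    if w: "w \<in> E" "w \<noteq> \<zero>" and g: "inj_on \<gamma> {1..m}" "{x \<in> carrier R. tri x = w} = \<gamma> ` {1..m}" "\<gamma> ` {1..m} \<subseteq> K" and i: "i \<in> {1..m}"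
    for w \<gamma> i
  proof -
    have wc: "w \<in> carrier R" using w(1) Er(1) by auto
    obtain h where h: "h \<in> carrier (poly_ring R)" "set h \<subseteq> {\<zero>, \<one>, c, \<ominus> w}" "h \<noteq> []" "lead_coeff h = \<one>" "degree h = m"
      "\<And>x. x \<in> carrier R \<Longrightarrow> eval h x = tri x \<ominus> w" using tri_polynomial[OF wc] by blast
    have "c \<in> E" using c_e Er(2,3) by auto
    then have "set h \<subseteq> E" using h(2) Er(2,3,5) w(1) by auto
    then have hE: "h \<in> carrier (univ_poly ?L E)" using h(3,4) by (simp add: univ_poly_def polynomial_def)
    have z: "eval h x = \<zero> \<longleftrightarrow> tri x = w" if "x \<in> carrier R" for x using h(6)[OF that] tri_closed[OF that] wc by simp
    have "x \<in> K" if "x \<in> carrier R" "tri x = w" for x using that g(2,3) by blast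
    then have "{x \<in> carrier ?L. L0.eval h x = \<zero>\<^bsub>?L\<^esub>} = {x \<in> carrier R. tri x = w}" unfolding ev using z Kr(1) by auto
    then have "card {x \<in> carrier ?L. L0.eval h x = \<zero>\<^bsub>?L\<^esub>} = degree h" using g h(5) by (simp add: card_image)
    moreover have "\<gamma> i \<in> carrier R" "tri (\<gamma> i) = w" using g(2) i by auto
    then have "L0.eval h (\<gamma> i) = \<zero>\<^bsub>?L\<^esub>" unfolding ev using z by simp
    ultimately show ?thesis unfolding L0.splits_separably_def using hE h(3) g(3) i by blast
  qed
  have alK: "\<alpha> ` {1..m} \<subseteq> K" and beK: "\<beta> ` {1..m} \<subseteq> K" using SK by auto
  have tE: "t \<in> E" using tFE by auto
  let ?xs = "map \<alpha> [1..<Suc m] @ map \<beta> [1..<Suc m]"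
  have set_xs: "set ?xs = \<alpha> ` {1..m} \<union> \<beta> ` {1..m}" by (simp only: set_append set_map set_upt atLeastLessThanSuc_atLeastAtMost)
  have xsK: "set ?xs \<subseteq> carrier ?L" unfolding set_xs using alK beK by simp
  have sep: "L0.splits_separably E x" if "x \<in> set ?xs" for x
    using that rootE[OF tE t0 al(1,2) alK] rootE[OF sE s(2) be(1,2) beK] unfolding set_xs by blast
  have algE: "(L0.algebraic over E) x" if "x \<in> set ?xs" for x using L0.splits_separably_algebraic[OF sep[OF that]] by simp
  have gen: "carrier ?L \<subseteq> M" if "subfield M ?L" "E \<subseteq> M" "set ?xs \<subseteq> M" for M
  proof -
    have "subfield M R" using subfield_extend[OF K that(1)] .
    moreover have "?S \<subseteq> M" using that(2,3) tFE unfolding set_xs by blast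
    ultimately show ?thesis unfolding K_def using generate_field_min_subfield1[OF Sc] by simp
  qed
  have fin: "carrier ?L = L0.finite_extension E ?xs" using L0.generated_extension[OF EL xsK algE gen] .
  have "L0.finite_dimension E (carrier ?L)" using L0.finite_extension_finite_dimension(1)[OF EL xsK algE] fin by simp
  then have dim: "L0.finite_dimension (generate_field ?L (insert t F)) K" using E_L by simp
  have FK: "F \<subseteq> K" and tK: "t \<in> K" and sK: "s \<in> K" using SK sE EK by auto
  have vinv: "v (inv x) = - v x" if "discretely_valued_field ?L v" "x \<in> K" "x \<noteq> \<zero>" for v x
    using discretely_valued_field.v_inv[OF that(1), of x] inv_restrict[OF K that(2,3)] that by simp
  have family: "L.root_family F E w \<gamma>"
    if w: "w \<in> E" "w \<noteq> \<zero>" and g: "inj_on \<gamma> {1..m}" "{x \<in> carrier R. tri x = w} = \<gamma> ` {1..m}" "(\<Otimes>i\<in>{1..m}. \<ominus> \<gamma> i) = \<ominus> w" "\<gamma> ` {1..m} \<subseteq> K"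
      and v1: "\<exists>v. discretely_valued_field ?L v \<and> L0.trivial_on F v \<and> 0 < v w \<and> (\<forall>y\<in>E. y \<noteq> \<zero> \<longrightarrow> v w dvd v y)"
      and v2: "\<exists>v. discretely_valued_field ?L v \<and> L0.trivial_on F v \<and> 0 < v (inv w) \<and> (\<forall>y\<in>E. y \<noteq> \<zero> \<longrightarrow> v (inv w) dvd v y)"
    for w \<gamma>
  proof -
    have wK: "w \<in> K" using w(1) EK by auto
    have "{x \<in> carrier ?L. L.tri x = w} = \<gamma> ` {1..m}" unfolding tri_eq using g(2,4) Kr(1) by auto
    moreover have "finprod ?L (\<lambda>i. \<ominus>\<^bsub>?L\<^esub> \<gamma> i) {1..m} = \<ominus>\<^bsub>?L\<^esub> w"
    proof -
      have m': "\<ominus>\<^bsub>?L\<^esub> \<gamma> i = \<ominus> \<gamma> i" "\<ominus> \<gamma> i \<in> K" if "i \<in> {1..m}" for i using uminus_restrict[OF K subsetD[OF g(4) imageI[OF that]]] by simp_all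
      have "finprod ?L (\<lambda>i. \<ominus>\<^bsub>?L\<^esub> \<gamma> i) {1..m} = finprod ?L (\<lambda>i. \<ominus> \<gamma> i) {1..m}"
        using m' by (intro L0.finprod_cong') auto
      also have "\<dots> = (\<Otimes>i\<in>{1..m}. \<ominus> \<gamma> i)" using m'(2) by (intro finprod_restrict[OF K]) auto
      finally show ?thesis using g(3) uminus_restrict(1)[OF K wK] by simp
    qed
    moreover have "\<exists>v. discretely_valued_field ?L v \<and> L0.trivial_on F v \<and> v w < 0 \<and> (\<forall>y\<in>E. y \<noteq> \<zero> \<longrightarrow> v w dvd v y)"
    proof -
      obtain v where v: "discretely_valued_field ?L v" "L0.trivial_on F v" "0 < v (inv w)" "\<forall>y\<in>E. y \<noteq> \<zero> \<longrightarrow> v (inv w) dvd v y"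
        using v2 by blast
      then show ?thesis using vinv[OF v(1) wK w(2)] by (intro exI[of _ v]) auto
    qed
    ultimately show ?thesis unfolding L.root_family_def using w g(1) v1 by simp
  qed
  have famt: "L.root_family F E t \<alpha>"
  proof (rule family[OF tE t0 al alK])
    show "\<exists>v. discretely_valued_field ?L v \<and> L0.trivial_on F v \<and> 0 < v t \<and> (\<forall>y\<in>E. y \<noteq> \<zero> \<longrightarrow> v t dvd v y)"
    \<comment> \<open>At the zero of \<open>t\<close> and, further down, at its pole,
      \<open>t\<close> and its inverse are themselves the parameters, with unit factor 1 and no
      extension of constants.\<close>
    proof (rule place_with_parameter[OF F(1) F(1) subset_refl t K FK tK dim tK t0 EK])
      show "E \<subseteq> generate_field R (insert t F)" by (simp add: E_def)
      fix V assume V: "valued_ring R V" "F \<subseteq> V" "t \<in> place_of R V"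
      then show "\<exists>w. valued_ring.unit R V w \<and> t = t \<otimes> w"
        using valued_ring.unit_one[OF V(1)] t(1) by (intro exI[of _ \<one>]) simp
    qed
    have it: "inv t \<in> carrier R" "inv t \<noteq> \<zero>" "inv t \<in> K" using t(1) t0 inv_restrict(2)[OF K tK t0] by auto
    have tr: "transcendental F (inv t)"
    proof (rule ccontr)
      assume "\<not> ?thesis"
      then have "algebraic F (inv (inv t))" using algebraic_field(4)[OF F(1) it(1,2)] by (simp add: over_def)
      then show False using t t0 by (simp add: over_def)
    qed
    show "\<exists>v. discretely_valued_field ?L v \<and> L0.trivial_on F v \<and> 0 < v (inv t) \<and> (\<forall>y\<in>E. y \<noteq> \<zero> \<longrightarrow> v (inv t) dvd v y)"
    proof (rule place_with_parameter[OF F(1) F(1) subset_refl it(1) tr K FK tK dim it(3,2) EK])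
      show "E \<subseteq> generate_field R (insert (inv t) F)" using generate_field_inv[OF F(1) t(1) t0] by (simp add: E_def)
      fix V assume V: "valued_ring R V" "F \<subseteq> V" "inv t \<in> place_of R V"
      then show "\<exists>w. valued_ring.unit R V w \<and> inv t = inv t \<otimes> w"
        using valued_ring.unit_one[OF V(1)] it(1) by (intro exI[of _ \<one>]) simp
    qed
  qed
  have isK: "inv s \<in> K" "inv s \<noteq> \<zero>" using inv_restrict(2)[OF K sK s(2)] s by auto
  have fams: "L.root_family F E s \<beta>"
  proof (rule family[OF sE s(2) be beK])
    show "\<exists>v. discretely_valued_field ?L v \<and> L0.trivial_on F v \<and> 0 < v s \<and> (\<forall>y\<in>E. y \<noteq> \<zero> \<longrightarrow> v s dvd v y)"
      unfolding E_def using quadrinomial_place[OF F(1) tK t(2) K FK dim _ pm fr s_def sK s(2)] by simp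
    show "\<exists>v. discretely_valued_field ?L v \<and> L0.trivial_on F v \<and> 0 < v (inv s) \<and> (\<forall>y\<in>E. y \<noteq> \<zero> \<longrightarrow> v (inv s) dvd v y)"
      unfolding E_def using quadrinomial_place[OF F(1) tK t(2) K FK dim _ pm fr si isK] by simp
  qed
  interpret D: double_cover ?L m e c k F E \<alpha> \<beta> t s
  proof (intro double_cover.intro double_cover_axioms.intro L.trinomial_axioms FL EL F(2) famt fams)
    show "F \<subseteq> E" using tFE by auto
    show "x \<in> E" if "x \<in> carrier ?L" "\<forall>\<gamma>\<in>carrier (Gal ?L E). \<gamma> x = x" for x
      using L0.galois_fixed_field[OF EL xsK sep fin that] .
    show "\<gamma> = \<tau>" if "\<gamma> \<in> carrier (Gal ?L E)" "\<tau> \<in> carrier (Gal ?L E)"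
      "\<And>i. i \<in> {1..m} \<Longrightarrow> \<gamma> (\<alpha> i) = \<tau> (\<alpha> i) \<and> \<gamma> (\<beta> i) = \<tau> (\<beta> i)" for \<gamma> \<tau>
    proof (rule L0.auto_eq_on_generators[OF that(1,2) EL gen xsK])
      show "\<gamma> x = \<tau> x" if "x \<in> set ?xs" for x using that \<open>\<And>i. i \<in> {1..m} \<Longrightarrow> _\<close> unfolding set_xs by blast
    qed
    show "v t = 0 \<or> v s = 0" if v: "discretely_valued_field ?L v" "L0.trivial_on F v" for v
    proof (cases "v t = 0")
      case False
      interpret v: discretely_valued_field ?L v by (rule v(1))
      have b: "\<zero> \<in> v.fil 0" "\<one> \<in> v.fil 0" using v.fil_zero[of 0] v.fil_one by simp_all
      note q0 = v.quadrinomial_value[OF _ _ b(1) pm, of t] and q1 = v.quadrinomial_value[OF _ _ b(2) pm, of t]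
      \<comment> \<open>Where \<open>t\<close> has a zero both values are 0, where it has a pole
        both are \<open>m v t\<close>; so \<open>s\<close> has value 0.\<close>
      have "v (?r \<zero>) = v (?r \<one>)"
        using q0 q1 False t0 tK unfolding q_eq by (cases "v t > 0") auto
      moreover have rK: "?r \<zero> \<in> K" "?r \<one> \<in> K" using rE[OF Fr(2)] rE[OF Fr(3)] EK by auto
      moreover have "v s = v (?r \<zero>) + v (inv (?r \<one>))"
        using v.v_mult[of "?r \<zero>" "inv (?r \<one>)"] rK r0[OF Fr(2)] r0[OF Fr(3)] rc[OF Fr(3)] inv_restrict(2)[OF K rK(2) r0[OF Fr(3)]] by (simp add: s_def)
      ultimately show ?thesis using vinv[OF v(1) rK(2) r0[OF Fr(3)]] by simp
    qed simp
  qed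
  have "L0.transcendental F t" using t(2) transcendental_consistent[OF subfieldE(1)[OF K]] by simp
  from D.unramified_symmetric_extension[OF E_L[symmetric] this xsK algE fin n]
  show ?thesis using K FK by auto
qed

theorem theorem3:
  fixes F :: "('b, 'c) ring_scheme" and p n :: nat
  assumes "Factorial_Ring.prime p" and "field F" and "finite (carrier F)" and "has_characteristic F p"
    and "n \<ge> 5"
  shows "\<exists>(R :: nat ring) F0 k.
           F0 \<subseteq> k \<and> subfield F0 R \<and> (\<exists>h. h \<in> ring_iso F (R\<lparr>carrier := F0\<rparr>))
         \<and> function_field R F0 k
         \<and> galois_ext R k
         \<and> constant_field_is R F0 (carrier R)
         \<and> unramified_ext R F0 k (carrier R)
         \<and> Gal R k \<cong> sym_group n"
proof -
  interpret F: field F by fact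
  obtain W :: "nat ring" and \<phi> t where W: "algebraically_closed W" and hom: "\<phi> \<in> ring_hom F W"
    and t: "t \<in> carrier W" "ring.transcendental W (\<phi> ` carrier F) t"
    using exists_universal_domain[OF assms(2,3)] by blast
  interpret W: algebraically_closed W by (rule W)
  interpret h: ring_hom_ring F W \<phi> by (rule ring_hom_ringI2[OF F.ring_axioms W.ring_axioms hom])
  let ?F = "\<phi> ` carrier F"
  have F: "subfield ?F W" and inj: "inj_on \<phi> (carrier F)" using h.img_is_subfield[OF F.carrier_is_subfield] by simp_all
  note Fr = subringE[OF subfieldE(1)[OF F]]
  have int: "\<phi> (add_pow F l \<one>\<^bsub>F\<^esub>) = add_pow W l \<one>\<^bsub>W\<^esub>" for l :: nat by (induct l) simp_all
  have p: "Factorial_Ring.prime p" "add_pow W p \<one>\<^bsub>W\<^esub> = \<zero>\<^bsub>W\<^esub>"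
    using assms(1,4) int[of p] by (simp_all add: has_characteristic_def)
  have p1: "1 < p" using prime_gt_1_nat[OF assms(1)] .
  \<comment> \<open>A power of \<open>p\<close> exceeding \<open>n\<close>, \<open>p\<close> and 3
    is wanted. The exponent \<open>n + 2\<close> gives \<open>n + 2 < 2^(n+2) \<le> m\<close>
    whatever the prime.\<close>
  define m where "m = p ^ (n + 2)"
  have "n + 2 < 2 ^ (n + 2)" by (rule less_exp)
  also have "(2::nat) ^ (n + 2) \<le> m" unfolding m_def using p1 by (intro power_mono) auto
  finally have mn: "n + 2 < m" .
  have pm: "p < m" unfolding m_def using p1 power_strict_increasing[of 1 "n + 2" p] by simp
  have fp: "(x \<oplus>\<^bsub>W\<^esub> y) [^]\<^bsub>W\<^esub> p = x [^]\<^bsub>W\<^esub> p \<oplus>\<^bsub>W\<^esub> y [^]\<^bsub>W\<^esub> p"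
    and fm: "(x \<oplus>\<^bsub>W\<^esub> y) [^]\<^bsub>W\<^esub> m = x [^]\<^bsub>W\<^esub> m \<oplus>\<^bsub>W\<^esub> y [^]\<^bsub>W\<^esub> m"
    if "x \<in> carrier W" "y \<in> carrier W" for x y
    unfolding m_def by (rule W.frobenius[OF p that], rule W.frobenius_power[OF p that])
  have two: "add_pow W (2::nat) \<one>\<^bsub>W\<^esub> = \<one>\<^bsub>W\<^esub> \<oplus>\<^bsub>W\<^esub> \<one>\<^bsub>W\<^esub>" by (simp add: numeral_2_eq_2)
  have m3: "3 < m" using mn assms(5) by simp
  have "\<exists>e c k. closed_trinomial W m e c k \<and> k \<in> ?F"
  proof (cases "p = 2")
    case True
    \<comment> \<open>Supplies the coprimality of \<open>m - 1\<close> with \<open>e\<close> =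
      2.\<close>
    have "odd (m - 1)" using m3 True by (simp add: m_def)
    moreover have "\<one>\<^bsub>W\<^esub> \<oplus>\<^bsub>W\<^esub> \<one>\<^bsub>W\<^esub> = \<zero>\<^bsub>W\<^esub>" using p(2) two True by simp
    ultimately have "closed_trinomial W m 2 \<one>\<^bsub>W\<^esub> \<one>\<^bsub>W\<^esub>"
      using W.taylor_even[OF _ fm m3] m3
      by (intro closed_trinomial.intro W trinomial.intro trinomial_axioms.intro W.field_axioms) auto
    then show ?thesis using Fr(3) by blast
  next
    case False
    \<comment> \<open>As 2 is smaller than the characteristic, the derivative factor
      \<open>k\<close> = 2 is nonzero, and injectivity of \<open>\<phi>\<close> carries this over to
      \<open>W\<close>.\<close>
    then have "add_pow F (2::nat) \<one>\<^bsub>F\<^esub> \<noteq> \<zero>\<^bsub>F\<^esub>" using assms(4) p1 by (auto simp: has_characteristic_def)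
    then have "\<phi> (add_pow F (2::nat) \<one>\<^bsub>F\<^esub>) \<noteq> \<phi> \<zero>\<^bsub>F\<^esub>" using inj_onD[OF inj] by blast
    then have "\<one>\<^bsub>W\<^esub> \<oplus>\<^bsub>W\<^esub> \<one>\<^bsub>W\<^esub> \<noteq> \<zero>\<^bsub>W\<^esub>" using int[of 2] two by simp
    then have "closed_trinomial W m 1 \<zero>\<^bsub>W\<^esub> (\<one>\<^bsub>W\<^esub> \<oplus>\<^bsub>W\<^esub> \<one>\<^bsub>W\<^esub>)"
      using W.taylor_odd[OF fm m3] m3
      by (intro closed_trinomial.intro W trinomial.intro trinomial_axioms.intro W.field_axioms) auto
    then show ?thesis using Fr(7)[OF Fr(3) Fr(3)] by blast
  qed
  then obtain e c k where "closed_trinomial W m e c k" "k \<in> ?F" by blast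
  then obtain K E where KE: "subfield K W" "?F \<subseteq> K" "?F \<subseteq> E" "function_field (W\<lparr>carrier := K\<rparr>) ?F E"
    "galois_ext (W\<lparr>carrier := K\<rparr>) E" "constant_field_is (W\<lparr>carrier := K\<rparr>) ?F K"
    "unramified_ext (W\<lparr>carrier := K\<rparr>) ?F E K" "Gal (W\<lparr>carrier := K\<rparr>) E \<cong> sym_group n"
    using closed_trinomial.unramified_symmetric_extension_exists[OF _ F _ t p1 pm fp fm, of e c k n] mn by auto
  have "\<phi> \<in> ring_iso F (W\<lparr>carrier := K\<rparr>\<lparr>carrier := ?F\<rparr>)"
    using inj by (auto simp: ring_iso_def ring_hom_def bij_betw_def)
  then show ?thesis
    using KE W.subfield_restrict[OF KE(1) F KE(2)] by (intro exI[of _ "W\<lparr>carrier := K\<rparr>"] exI[of _ ?F] exI[of _ E]) auto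
qed

end
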